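(* Let $0<p\le q<\infty$, $0<r<1$, $\omega\in\mathcal{D}$, let $\varphi,\psi$ be holomorphic self-maps of $\mathbb{B}_n$, let $u,v$ be weights (Borel functions on $\mathbb{B}_n$) and let $\mu$ be a positive Borel measure on $\mathbb{B}_n$. Then $uC_\varphi-vC_\psi:A^p_\omega\to L^q_\mu$ is bounded (respectively compact) if and only if $\eta+\sigma_r$ is a $q$-Carleson measure (respectively a vanishing $q$-Carleson measure) for $A^p_\omega$, where $$\eta=(|\rho u|^q\,d\mu)\circ\varphi^{-1}+(|\rho v|^q\,d\mu)\circ\psi^{-1},\qquad \sigma_r=(\chi_{G_r}|u-v|^q\,d\mu)\circ\varphi^{-1}+(\chi_{G_r}|u-v|^q\,d\mu)\circ\psi^{-1},$$ $\rho(z)=\rho(\varphi(z),\psi(z))$ and $G_r=\{z\in\mathbb{B}_n:\rho(z)<r\}$.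
   Context: $\mathbb{B}_n$ is the open unit ball of $\mathbb{C}^n$ and $dV$ the normalized volume measure. A radial weight is a positive, measurable, integrable function $\omega$ on $\mathbb{B}_n$ with $\omega(z)=\omega(|z|)$; put $\hat\omega(r)=\int_r^1\omega(s)\,ds$ for $r\in[0,1)$. $\omega\in\hat{\mathcal D}$ if there is $C\ge1$ with $\hat\omega(r)\le C\hat\omega(\frac{1+r}{2})$ for all $r\in[0,1)$; $\omega\in\check{\mathcal D}$ if there are $C,K>1$ with $\hat\omega(r)\ge C\hat\omega(1-\frac{1-r}{K})$ for all $r\in[0,1)$; $\mathcal D=\hat{\mathcal D}\cap\check{\mathcal D}$. For $0<p<\infty$, $A^p_\omega$ is the space of holomorphic $f$ on $\mathbb{B}_n$ with $\|f\|^p_{A^p_\omega}=\int_{\mathbb{B}_n}|f|^p\omega\,dV<\infty$. $L^q_\mu$ is the space of measurable $g$ with $\int|g|^q d\mu<\infty$. The weighted composition operator is $(uC_\varphi f)(z)=u(z)f(\varphi(z))$. The pseudohyperbolic distance is $\rho(a,z)=|\varphi_a(z)|$, where $\varphi_a$ is the involutive automorphism of $\mathbb{B}_n$ exchanging $a$ and $0$. For a positive Borel measure $\nu$ and a map $\varphi$, $(\nu\circ\varphi^{-1})(E)=\nu(\varphi^{-1}(E))$; $\chi_{G_r}$ is the characteristic function of $G_r$. A positive Borel measure $\nu$ is a $q$-Carleson measure for $A^p_\omega$ if the identity $A^p_\omega\to L^q_\nu$ is bounded, and a vanishing $q$-Carleson measure if this identity is compact. A linear map $T$ between topological vector spaces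 is compact if the image of every bounded sequence has a convergent subsequence. *)

theory Defs
  imports "HOL-Analysis.Analysis"
begin

definition unit_ball :: "(complex ^ 'n) set" where
  "unit_ball = ball 0 1"

definition dV :: "(complex ^ 'n) measure" where
  "dV = scale_measure (1 / emeasure lborel (unit_ball :: (complex ^ 'n) set))
          (restrict_space lborel unit_ball)"

definition holo_on :: "(complex ^ 'n) set \<Rightarrow> (complex ^ 'n \<Rightarrow> complex) \<Rightarrow> bool" where
  "holo_on S f \<longleftrightarrow> open S \<and> (\<forall>z\<in>S. \<exists>f'. (f has_derivative f') (at z) \<and>
       (\<forall>c v. f' (c *s v) = c * f' v))"

definition holo_self_map :: "(complex ^ 'n \<Rightarrow> complex ^ 'n) \<Rightarrow> bool" where
  "holo_self_map F \<longleftrightarrow> (\<forall>i. holo_on unit_ball (\<lambda>z. F z $ i)) \<and> F ` unit_ball \<subseteq> unit_ball"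

text \<open>Hermitian inner product and the involutive automorphism exchanging a and 0
  (Rudin's formula).\<close>
definition herm :: "complex ^ 'n \<Rightarrow> complex ^ 'n \<Rightarrow> complex" where
  "herm z w = (\<Sum>i\<in>UNIV. z $ i * cnj (w $ i))"

definition ball_aut :: "complex ^ 'n \<Rightarrow> complex ^ 'n \<Rightarrow> complex ^ 'n" where
  "ball_aut a z =
     (let P = (if a = 0 then 0 else (herm z a / of_real ((norm a)\<^sup>2)) *s a);
          Q = z - P;
          s = of_real (sqrt (1 - (norm a)\<^sup>2))
      in (1 / (1 - herm z a)) *s (a - P - s *s Q))"

definition pseudohyp :: "complex ^ 'n \<Rightarrow> complex ^ 'n \<Rightarrow> real" where
  "pseudohyp a z = norm (ball_aut a z)"

text \<open>Radial weights, given by their profile on [0,1): omega(z) = w(norm z).\<close>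
definition radial_weight :: "('n::finite) itself \<Rightarrow> (real \<Rightarrow> real) \<Rightarrow> bool" where
  "radial_weight _ w \<longleftrightarrow> (\<forall>s\<in>{0..<1}. w s > 0) \<and> set_borel_measurable borel {0..<1} w \<and>
     (\<integral>\<^sup>+ z\<in>(unit_ball :: (complex ^ 'n) set). ennreal (w (norm z)) \<partial>dV) < \<infinity>"

definition omega_hat :: "(real \<Rightarrow> real) \<Rightarrow> real \<Rightarrow> ennreal" where
  "omega_hat w r = (\<integral>\<^sup>+ s\<in>{r..<1}. ennreal (w s) \<partial>lborel)"

definition D_hat :: "(real \<Rightarrow> real) \<Rightarrow> bool" where
  "D_hat w \<longleftrightarrow> (\<exists>C::real. C \<ge> 1 \<and> (\<forall>r\<in>{0..<1}. omega_hat w r \<le> ennreal C * omega_hat w ((1 + r) / 2)))"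

definition D_check :: "(real \<Rightarrow> real) \<Rightarrow> bool" where
  "D_check w \<longleftrightarrow> (\<exists>C K::real. C > 1 \<and> K > 1 \<and>
     (\<forall>r\<in>{0..<1}. omega_hat w r \<ge> ennreal C * omega_hat w (1 - (1 - r) / K)))"

definition class_D :: "('n::finite) itself \<Rightarrow> (real \<Rightarrow> real) \<Rightarrow> bool" where
  "class_D n w \<longleftrightarrow> radial_weight n w \<and> D_hat w \<and> D_check w"

definition Apw_int :: "real \<Rightarrow> (real \<Rightarrow> real) \<Rightarrow> (complex ^ 'n \<Rightarrow> complex) \<Rightarrow> ennreal" where
  "Apw_int p w f = (\<integral>\<^sup>+ z\<in>unit_ball. ennreal (cmod (f z) powr p * w (norm z)) \<partial>dV)"

definition in_Apw :: "real \<Rightarrow> (real \<Rightarrow> real) \<Rightarrow> (complex ^ 'n \<Rightarrow> complex) \<Rightarrow> bool" where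
  "in_Apw p w f \<longleftrightarrow> holo_on unit_ball f \<and> Apw_int p w f < \<infinity>"

definition Apw_norm :: "real \<Rightarrow> (real \<Rightarrow> real) \<Rightarrow> (complex ^ 'n \<Rightarrow> complex) \<Rightarrow> real" where
  "Apw_norm p w f = enn2real (Apw_int p w f) powr (1 / p)"

definition Lq_int :: "'a measure \<Rightarrow> real \<Rightarrow> ('a \<Rightarrow> complex) \<Rightarrow> ennreal" where
  "Lq_int M q g = (\<integral>\<^sup>+ z. ennreal (cmod (g z) powr q) \<partial>M)"

definition in_Lq :: "'a measure \<Rightarrow> real \<Rightarrow> ('a \<Rightarrow> complex) \<Rightarrow> bool" where
  "in_Lq M q g \<longleftrightarrow> g \<in> borel_measurable M \<and> Lq_int M q g < \<infinity>"

definition Lq_norm :: "'a measure \<Rightarrow> real \<Rightarrow> ('a \<Rightarrow> complex) \<Rightarrow> real" where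
  "Lq_norm M q g = enn2real (Lq_int M q g) powr (1 / q)"

definition bounded_op :: "real \<Rightarrow> (real \<Rightarrow> real) \<Rightarrow> 'a measure \<Rightarrow> real \<Rightarrow>
    ((complex ^ 'n \<Rightarrow> complex) \<Rightarrow> ('a \<Rightarrow> complex)) \<Rightarrow> bool" where
  "bounded_op p w M q T \<longleftrightarrow>
     (\<forall>f. in_Apw p w f \<longrightarrow> in_Lq M q (T f)) \<and>
     (\<exists>C. \<forall>f. in_Apw p w f \<longrightarrow> Lq_norm M q (T f) \<le> C * Apw_norm p w f)"

definition compact_op :: "real \<Rightarrow> (real \<Rightarrow> real) \<Rightarrow> 'a measure \<Rightarrow> real \<Rightarrow>
    ((complex ^ 'n \<Rightarrow> complex) \<Rightarrow> ('a \<Rightarrow> complex)) \<Rightarrow> bool" where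
  "compact_op p w M q T \<longleftrightarrow>
     (\<forall>f. in_Apw p w f \<longrightarrow> in_Lq M q (T f)) \<and>
     (\<forall>fs :: nat \<Rightarrow> (complex ^ 'n \<Rightarrow> complex).
        (\<forall>k. in_Apw p w (fs k)) \<and> (\<exists>B. \<forall>k. Apw_norm p w (fs k) \<le> B) \<longrightarrow>
        (\<exists>r g. strict_mono r \<and> in_Lq M q g \<and>
               (\<lambda>k. Lq_norm M q (\<lambda>z. T (fs (r k)) z - g z)) \<longlonglongrightarrow> 0))"

definition carleson :: "real \<Rightarrow> (real \<Rightarrow> real) \<Rightarrow> real \<Rightarrow> (complex ^ 'n) measure \<Rightarrow> bool" where
  "carleson p w q \<nu> \<longleftrightarrow> bounded_op p w \<nu> q (\<lambda>f. f)"

definition vanishing_carleson :: "real \<Rightarrow> (real \<Rightarrow> real) \<Rightarrow> real \<Rightarrow> (complex ^ 'n) measure \<Rightarrow> bool" where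
  "vanishing_carleson p w q \<nu> \<longleftrightarrow> compact_op p w \<nu> q (\<lambda>f. f)"

definition measure_add :: "'a measure \<Rightarrow> 'a measure \<Rightarrow> 'a measure" where
  "measure_add M N = measure_of (space M) (sets M) (\<lambda>A. emeasure M A + emeasure N A)"

definition ball_borel :: "(complex ^ 'n) measure" where
  "ball_borel = restrict_space borel unit_ball"

definition pushforward :: "(complex ^ 'n) measure \<Rightarrow> (complex ^ 'n \<Rightarrow> real) \<Rightarrow>
    (complex ^ 'n \<Rightarrow> complex ^ 'n) \<Rightarrow> (complex ^ 'n) measure" where
  "pushforward \<mu> g F = distr (density \<mu> (\<lambda>z. ennreal (g z))) ball_borel F"

definition wcomp_diff :: "(complex ^ 'n \<Rightarrow> complex) \<Rightarrow> (complex ^ 'n \<Rightarrow> complex ^ 'n) \<Rightarrow>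
    (complex ^ 'n \<Rightarrow> complex) \<Rightarrow> (complex ^ 'n \<Rightarrow> complex ^ 'n) \<Rightarrow>
    (complex ^ 'n \<Rightarrow> complex) \<Rightarrow> (complex ^ 'n \<Rightarrow> complex)" where
  "wcomp_diff u \<phi> v \<psi> f = (\<lambda>z. u z * f (\<phi> z) - v z * f (\<psi> z))"

definition rho_pair :: "(complex ^ 'n \<Rightarrow> complex ^ 'n) \<Rightarrow> (complex ^ 'n \<Rightarrow> complex ^ 'n) \<Rightarrow> complex ^ 'n \<Rightarrow> real" where
  "rho_pair \<phi> \<psi> z = pseudohyp (\<phi> z) (\<psi> z)"

definition G_set :: "(complex ^ 'n \<Rightarrow> complex ^ 'n) \<Rightarrow> (complex ^ 'n \<Rightarrow> complex ^ 'n) \<Rightarrow> real \<Rightarrow> (complex ^ 'n) set" where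
  "G_set \<phi> \<psi> r = {z \<in> unit_ball. rho_pair \<phi> \<psi> z < r}"

end

theory Submission
  imports Defs "HOL-Complex_Analysis.Complex_Analysis"
begin

unbundle no fps_syntax

text \<open>
  Both sides of the equivalence reduce to the size of a measure on Bergman balls.  A measure \<open>\<nu>\<close>
  is \<open>q\<close>-Carleson for \<open>A\<^sup>p\<^sub>\<omega>\<close> iff \<open>\<nu>(D(a)) \<lesssim> M(a)\<^sup>q\<^sup>/\<^sup>p\<close> for all Bergman balls \<open>D(a)\<close>, where
  \<open>M(a) = (1 - |a|)\<^sup>n \<omega>^(|a|)\<close> (with \<open>\<omega>^\<close> the tail integral of \<open>\<omega>\<close>), and vanishing \<open>q\<close>-Carleson iff in addition the
  implied constant tends to \<open>0\<close> as \<open>|a| \<rightarrow> 1\<close>.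

  Sufficiency: the sub-mean value property and the Schwarz lemma bound \<open>|f(z)|\<^sup>p\<close>, and
  \<open>|f(z) - f(y)|\<^sup>p\<close> by \<open>\<rho>(z, y)\<^sup>p\<close> times, a mean of \<open>|f|\<^sup>p\<close> over a Bergman ball.  Writing
  \<open>u f(\<phi>) - v f(\<psi>) = (u - v) f(\<phi>) + v (f(\<phi>) - f(\<psi>))\<close> where \<open>\<rho> < r\<close> then dominates the operator by
  the integral of such local means against \<open>\<eta> + \<sigma>\<close>, which is estimated by Fubini after replacing
  \<open>\<omega>\<close> by the regular weight \<open>\<omega>^(s)/(1 - s)\<close>; that replacement costs a constant because integral
  means increase with the radius.  Compactness follows from Montel's theorem.

  Necessity: apply the operator to \<open>g = ((1 - |a|\<^sup>2)/(1 - \<langle>z, a\<rangle>))\<^sup>N\<close> and to the products of \<open>g\<close> with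
  the coordinates of the automorphism \<open>\<phi>\<^sub>a\<close>.  The combination
  \<open>u g(\<phi>) (\<phi>\<^sub>a(\<phi>) - \<phi>\<^sub>a(\<psi>))\<close> is controlled by these images and has size at least \<open>\<rho> |u|\<close> where
  \<open>\<phi> \<in> D(a)\<close>, and \<open>(u - v) g(\<phi>)\<close> differs from the image of \<open>g\<close> by at most \<open>\<rho> |v|\<close>.
\<close>

section \<open>Isometry invariance and integration of homogeneous weights\<close>

text \<open>The hypotheses control only tail integrals of \<omega>; the weight may be tiny on a
  whole Bergman ball, so a local mean of |f|^p is not bounded by the \<omega>-integral over that
  ball. This forces the regular weight. The two halves of the hypothesis do different work.
  \<open>D_check\<close> puts a fixed share of the tail beyond r into the annulus up to 1 - (1 -
  r)/K; that mass lies outside radius r, the direction in which integral means grow.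
  \<open>D_hat\<close> makes tails comparable at comparable distances from the sphere and limits
  their decay to a power of 1 - |a|, which decides how large N must be. M(a) is the volume (1 -
  |a|)^(n+1) of a Bergman ball times the regular weight \<omega>^(|a|)/(1 - |a|). The automorphism
  at a carries D(a) to a fixed ball about 0, where \<rho> is comparable to Euclidean distance; hence
  differences of its coordinates detect \<rho> uniformly in a. Where \<rho> \<ge> r, the bounds |u|
  \<le> \<rho>|u|/r and |v| \<le> \<rho>|v|/r replace the splitting. The embedding into L^q_\<nu> is
  itself the operator with u = 1, v = 0 and identity maps, so one set of lemmas serves both sides of
  the equivalence.\<close>

lemma nn_integral_lborel_affine:
  fixes g :: "'a::euclidean_space \<Rightarrow> ennreal"
  assumes [measurable]: "g \<in> borel_measurable borel" and c: "c \<noteq> 0"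
  shows "(\<integral>\<^sup>+x. g x \<partial>lborel) = ennreal (\<bar>c\<bar> ^ DIM('a)) * (\<integral>\<^sup>+x. g (t + c *\<^sub>R x) \<partial>lborel)"
  by (subst lborel_affine[OF c, of t])
     (simp add: nn_integral_density nn_integral_distr nn_integral_cmult)

lemma nn_integral_lborel_translate:
  fixes g :: "'a::euclidean_space \<Rightarrow> ennreal"
  assumes [measurable]: "g \<in> borel_measurable borel"
  shows "(\<integral>\<^sup>+x. g (t + x) \<partial>lborel) = (\<integral>\<^sup>+x. g x \<partial>lborel)"
  using nn_integral_lborel_affine[of g 1 t] by simp

text \<open>Uniqueness of Haar measure, in the form \<open>\<lambda>(T\<^sup>-\<^sup>1 A) \<lambda>(B) = \<lambda>(T\<^sup>-\<^sup>1 B) \<lambda>(A)\<close>,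
  gives invariance once \<open>B\<close> is the unit ball.\<close>
lemma nn_integral_lborel_isometry:
  fixes T :: "'a::euclidean_space \<Rightarrow> 'a" and g :: "'a \<Rightarrow> ennreal"
  assumes T: "linear T" "\<And>x. norm (T x) = norm x" and g: "g \<in> borel_measurable borel"
  shows "(\<integral>\<^sup>+x. g (T x) \<partial>lborel) = (\<integral>\<^sup>+x. g x \<partial>lborel)"
proof -
  have [measurable]: "T \<in> borel_measurable borel"
    using T(1) by (intro borel_measurable_continuous_onI linear_continuous_on linear_linear[THEN iffD2])
  have inj: "inj T"
    using T by (metis linear_injective_0 norm_eq_zero)
  then have "surj T"
    using T(1) by (simp add: linear_injective_imp_surjective)
  then obtain S where S: "\<And>y. T (S y) = y" by (metis surj_def)
  have T_add: "T (x + y) = T x + T y" for x y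
    using T(1) by (rule linear_add)
  have key: "(\<integral>\<^sup>+x. a (T x) \<partial>lborel) * (\<integral>\<^sup>+y. b y \<partial>lborel) =
             (\<integral>\<^sup>+x. b (T x) \<partial>lborel) * (\<integral>\<^sup>+y. a y \<partial>lborel)"
    if [measurable]: "a \<in> borel_measurable borel" "b \<in> borel_measurable borel" for a b :: "'a \<Rightarrow> ennreal"
  proof -
    have "(\<integral>\<^sup>+x. a (T x) \<partial>lborel) * (\<integral>\<^sup>+y. b y \<partial>lborel) =
          (\<integral>\<^sup>+x. a (T x) * (\<integral>\<^sup>+y. b (T x + y) \<partial>lborel) \<partial>lborel)"
      by (simp add: nn_integral_lborel_translate nn_integral_multc)
    also have "\<dots> = (\<integral>\<^sup>+x. (\<integral>\<^sup>+y. a (T x) * b (T x + y) \<partial>lborel) \<partial>lborel)"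
      by (simp add: nn_integral_cmult)
    also have "\<dots> = (\<integral>\<^sup>+y. (\<integral>\<^sup>+x. a (T x) * b (T x + y) \<partial>lborel) \<partial>lborel)"
      by (rule lborel_pair.Fubini') measurable
    \<comment> \<open>Translating x by a preimage of -y under T moves the shift from the argument of
      \<open>b\<close> to that of \<open>a\<close>; the integral over y can then be evaluated
      without reference to T.\<close>
    also have "\<dots> = (\<integral>\<^sup>+y. (\<integral>\<^sup>+x. a (T x + -y) * b (T x) \<partial>lborel) \<partial>lborel)"
    proof (rule nn_integral_cong)
      fix y :: 'a
      have "(\<integral>\<^sup>+x. a (T x) * b (T x + y) \<partial>lborel) =
            (\<integral>\<^sup>+x. a (T (S (-y) + x)) * b (T (S (-y) + x) + y) \<partial>lborel)"
        by (rule nn_integral_lborel_translate[symmetric]) measurable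
      then show "(\<integral>\<^sup>+x. a (T x) * b (T x + y) \<partial>lborel) = (\<integral>\<^sup>+x. a (T x + -y) * b (T x) \<partial>lborel)"
        by (simp add: T_add S algebra_simps)
    qed
    also have "\<dots> = (\<integral>\<^sup>+x. (\<integral>\<^sup>+y. a (T x + -y) * b (T x) \<partial>lborel) \<partial>lborel)"
      by (rule lborel_pair.Fubini') measurable
    also have "\<dots> = (\<integral>\<^sup>+x. (\<integral>\<^sup>+y. a y \<partial>lborel) * b (T x) \<partial>lborel)"
    proof (rule nn_integral_cong)
      fix x :: 'a
      have "(\<integral>\<^sup>+y. a (T x + -y) \<partial>lborel) = (\<integral>\<^sup>+y. a y \<partial>lborel)"
        using nn_integral_lborel_affine[of a "-1" "T x"] by simp
      then show "(\<integral>\<^sup>+y. a (T x + -y) * b (T x) \<partial>lborel) = (\<integral>\<^sup>+y. a y \<partial>lborel) * b (T x)"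
        by (simp add: nn_integral_multc)
    qed
    also have "\<dots> = (\<integral>\<^sup>+x. b (T x) \<partial>lborel) * (\<integral>\<^sup>+y. a y \<partial>lborel)"
      by (simp add: nn_integral_cmult mult.commute)
    finally show ?thesis .
  qed
  define V where "V = emeasure lborel (ball (0::'a) 1)"
  have V: "V \<noteq> 0" "V \<noteq> \<infinity>"
    using emeasure_bounded_finite[of "ball (0::'a) 1"] less_imp_neq[OF unit_ball_vol_pos[of "real DIM('a)"]]
    by (auto simp: V_def emeasure_ball)
  have "(\<integral>\<^sup>+x. indicator (ball (0::'a) 1) x \<partial>lborel) = V"
    by (simp add: V_def)
  moreover have "(\<integral>\<^sup>+x. indicator (ball (0::'a) 1) (T x) \<partial>lborel) = V"
  proof -
    have "(\<lambda>x. indicator (ball (0::'a) 1) (T x)) = (indicator (ball (0::'a) 1) :: 'a \<Rightarrow> ennreal)"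
      by (auto simp: fun_eq_iff T(2) split: split_indicator)
    then show ?thesis by (simp add: V_def)
  qed
  ultimately have "(\<integral>\<^sup>+x. g (T x) \<partial>lborel) * V = (\<integral>\<^sup>+x. g x \<partial>lborel) * V"
    using key[OF g borel_measurable_indicator[of "ball 0 1"]] by (simp add: mult.commute)
  with V show ?thesis
    by (simp add: ennreal_mult_cancel_left mult.commute[of _ V])
qed

text \<open>Polar coordinates by scaling alone: 1 is written as 1/|z| times the length of the
  interval from |z| to 2|z|, Fubini is applied, and z = \<tau> y leaves \<theta> unchanged while
  turning the interval condition into the annulus 1/2 \<le> |y| < 1. A second scaling, of \<tau> by
  |y|, separates the variables.\<close>

lemma nn_integral_homogeneous_norm:
  fixes \<theta> :: "'a::euclidean_space \<Rightarrow> ennreal" and h :: "real \<Rightarrow> ennreal"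
  assumes [measurable]: "\<theta> \<in> borel_measurable borel" "h \<in> borel_measurable borel"
    and hom: "\<And>c y. c > 0 \<Longrightarrow> \<theta> (c *\<^sub>R y) = \<theta> y"
  shows "(\<integral>\<^sup>+z. \<theta> z * h (norm z) \<partial>lborel) =
    (\<integral>\<^sup>+s. h s * ennreal (s ^ (DIM('a) - 1)) * indicator {0<..} s \<partial>lborel) *
    (\<integral>\<^sup>+y. \<theta> y * ennreal (1 / norm y ^ (DIM('a) + 1)) * indicator {y. 1/2 \<le> norm y \<and> norm y < 1} y \<partial>lborel)"
proof -
  let ?D = "DIM('a)"
  define A where "A = {y::'a. 1/2 \<le> norm y \<and> norm y < 1}"
  have [measurable]: "A \<in> sets borel" unfolding A_def by measurable
  define H where "H = (\<integral>\<^sup>+s. h s * ennreal (s ^ (?D - 1)) * indicator {0<..} s \<partial>lborel)"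
  have D: "x ^ ?D = x * x ^ (?D - 1)" for x :: real
    using DIM_positive[where 'a='a] by (cases ?D) auto
  have "(\<integral>\<^sup>+z. \<theta> z * h (norm z) \<partial>lborel) =
        (\<integral>\<^sup>+z. (\<integral>\<^sup>+\<tau>. \<theta> z * h (norm z) * ennreal (1 / norm z) * indicator {norm z<..2 * norm z} \<tau> \<partial>lborel) \<partial>lborel)"
  proof (rule nn_integral_cong_AE)
    have "\<theta> z * h (norm z) =
      (\<integral>\<^sup>+\<tau>. \<theta> z * h (norm z) * ennreal (1 / norm z) * indicator {norm z<..2 * norm z} \<tau> \<partial>lborel)" if "z \<noteq> 0" for z
    proof -
      have "(\<integral>\<^sup>+\<tau>. \<theta> z * h (norm z) * ennreal (1 / norm z) * indicator {norm z<..2 * norm z} \<tau> \<partial>lborel)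
         = \<theta> z * h (norm z) * ennreal (1 / norm z) * ennreal (norm z)"
        by (subst nn_integral_cmult_indicator) auto
      also have "\<dots> = \<theta> z * h (norm z)"
        using that by (simp add: mult.assoc ennreal_mult[symmetric] del: ennreal_mult')
      finally show ?thesis by simp
    qed
    then show "AE z in lborel. \<theta> z * h (norm z) = 
      (\<integral>\<^sup>+\<tau>. \<theta> z * h (norm z) * ennreal (1 / norm z) * indicator {norm z<..2 * norm z} \<tau> \<partial>lborel)"
      using AE_lborel_singleton[of "0::'a"] by auto
  qed
  also have "\<dots> = (\<integral>\<^sup>+\<tau>. (\<integral>\<^sup>+z. \<theta> z * h (norm z) * ennreal (1 / norm z) * indicator {norm z<..2 * norm z} \<tau> \<partial>lborel) \<partial>lborel)"
    by (rule lborel_pair.Fubini'[symmetric]) (simp add: indicator_def, measurable)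
  \<comment> \<open>For \<tau> > 0 this substitutes z = \<tau> y; of the Jacobian \<tau>^D one power
    is absorbed by 1/|z| = 1/(\<tau> |y|).\<close>
  also have "\<dots> = (\<integral>\<^sup>+\<tau>. (\<integral>\<^sup>+y. \<theta> y * ennreal (1 / norm y) * indicator A y *
      (h (\<tau> * norm y) * ennreal (\<tau> ^ (?D - 1)) * indicator {0<..} \<tau>) \<partial>lborel) \<partial>lborel)"
  proof (rule nn_integral_cong)
    fix \<tau> :: real
    show "(\<integral>\<^sup>+z. \<theta> z * h (norm z) * ennreal (1 / norm z) * indicator {norm z<..2 * norm z} \<tau> \<partial>lborel) =
      (\<integral>\<^sup>+y. \<theta> y * ennreal (1 / norm y) * indicator A y *
      (h (\<tau> * norm y) * ennreal (\<tau> ^ (?D - 1)) * indicator {0<..} \<tau>) \<partial>lborel)"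
    proof (cases "\<tau> > 0")
      case False
      then have "indicator {norm z<..2 * norm z} \<tau> = (0::ennreal)" for z :: 'a
        by (auto simp: indicator_def)
      with False show ?thesis by simp
    next
      case True
      have "(\<integral>\<^sup>+z. \<theta> z * h (norm z) * ennreal (1 / norm z) * indicator {norm z<..2 * norm z} \<tau> \<partial>lborel) =
        ennreal (\<bar>\<tau>\<bar> ^ ?D) * (\<integral>\<^sup>+y. \<theta> (0 + \<tau> *\<^sub>R y) * h (norm (0 + \<tau> *\<^sub>R y)) * ennreal (1 / norm (0 + \<tau> *\<^sub>R y)) *
           indicator {norm (0 + \<tau> *\<^sub>R y)<..2 * norm (0 + \<tau> *\<^sub>R y)} \<tau> \<partial>lborel)"
        using True by (intro nn_integral_lborel_affine) (simp_all add: indicator_def)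
      also have "\<dots> = (\<integral>\<^sup>+y. ennreal (\<tau> ^ ?D) * (\<theta> y * h (\<tau> * norm y) * ennreal (1 / (\<tau> * norm y)) * indicator A y) \<partial>lborel)"
        using True
        by (subst nn_integral_cmult[symmetric], simp add: indicator_def)
           (auto intro!: nn_integral_cong simp: hom A_def indicator_def)
      also have "\<dots> = (\<integral>\<^sup>+y. \<theta> y * ennreal (1 / norm y) * indicator A y *
         (h (\<tau> * norm y) * ennreal (\<tau> ^ (?D - 1)) * indicator {0<..} \<tau>) \<partial>lborel)"
      proof (rule nn_integral_cong)
        fix y :: 'a
        have "ennreal (\<tau> ^ ?D) * ennreal (1 / (\<tau> * norm y)) = ennreal (1 / norm y) * ennreal (\<tau> ^ (?D - 1))"
        proof -
          show ?thesis using True D[of \<tau>] by (simp add: ennreal_mult[symmetric])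
        qed
        then have "ennreal (\<tau> ^ ?D) * ennreal (1 / (\<tau> * norm y)) * (\<theta> y * h (\<tau> * norm y) * indicator A y) =
           ennreal (1 / norm y) * ennreal (\<tau> ^ (?D - 1)) * (\<theta> y * h (\<tau> * norm y) * indicator A y)" by simp
        then show "ennreal (\<tau> ^ ?D) * (\<theta> y * h (\<tau> * norm y) * ennreal (1 / (\<tau> * norm y)) * indicator A y) =
            \<theta> y * ennreal (1 / norm y) * indicator A y *
         (h (\<tau> * norm y) * ennreal (\<tau> ^ (?D - 1)) * indicator {0<..} \<tau>)"
          using True by (simp add: mult_ac)
      qed
      finally show ?thesis .
    qed
  qed
  also have "\<dots> = (\<integral>\<^sup>+y. (\<integral>\<^sup>+\<tau>. \<theta> y * ennreal (1 / norm y) * indicator A y *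
      (h (\<tau> * norm y) * ennreal (\<tau> ^ (?D - 1)) * indicator {0<..} \<tau>) \<partial>lborel) \<partial>lborel)"
    by (rule lborel_pair.Fubini') measurable
  also have "\<dots> = (\<integral>\<^sup>+y. H * (\<theta> y * ennreal (1 / norm y ^ (?D + 1)) * indicator A y) \<partial>lborel)"
  proof (rule nn_integral_cong)
    fix y :: 'a
    show "(\<integral>\<^sup>+\<tau>. \<theta> y * ennreal (1 / norm y) * indicator A y *
      (h (\<tau> * norm y) * ennreal (\<tau> ^ (?D - 1)) * indicator {0<..} \<tau>) \<partial>lborel) =
      H * (\<theta> y * ennreal (1 / norm y ^ (?D + 1)) * indicator A y)"
    proof (cases "y \<in> A")
      case True
      then have ny: "norm y > 0" by (auto simp: A_def)
      \<comment> \<open>Substituting s = |y| \<tau> in H produces |y|^D, which together with the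
        factor 1/|y| explains the exponent D + 1.\<close>
      have "H = ennreal (norm y) * (\<integral>\<^sup>+\<tau>. h (norm y * \<tau>) * ennreal ((norm y * \<tau>) ^ (?D - 1)) * indicator {0<..} (norm y * \<tau>) \<partial>lborel)"
        unfolding H_def using ny by (subst nn_integral_lborel_affine[of _ "norm y" 0]) auto
      also have "\<dots> = ennreal (norm y) * (\<integral>\<^sup>+\<tau>. ennreal (norm y ^ (?D - 1)) * (h (\<tau> * norm y) * ennreal (\<tau> ^ (?D - 1)) * indicator {0<..} \<tau>) \<partial>lborel)"
      proof (rule arg_cong2[where f="(*)"], rule refl, rule nn_integral_cong)
        fix x :: real
        show "h (norm y * x) * ennreal ((norm y * x) ^ (?D - 1)) * indicator {0<..} (norm y * x) =
          ennreal (norm y ^ (?D - 1)) * (h (x * norm y) * ennreal (x ^ (?D - 1)) * indicator {0<..} x)"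
        proof (cases "x > 0")
          case True
          then show ?thesis using ny
            by (simp add: power_mult_distrib ennreal_mult mult_ac)
        next
          case False
          then have "\<not> 0 < norm y * x" using ny by (simp add: zero_less_mult_iff)
          with False show ?thesis by simp
        qed
      qed
      also have "\<dots> = ennreal (norm y) * ennreal (norm y ^ (?D - 1)) * (\<integral>\<^sup>+\<tau>. (h (\<tau> * norm y) * ennreal (\<tau> ^ (?D - 1)) * indicator {0<..} \<tau>) \<partial>lborel)"
        by (simp add: nn_integral_cmult mult.assoc)
      also have "ennreal (norm y) * ennreal (norm y ^ (?D - 1)) = ennreal (norm y ^ ?D)"
        by (simp only: D[of "norm y"] ennreal_mult norm_ge_zero zero_le_power)
      finally have H: "H = ennreal (norm y ^ ?D) * (\<integral>\<^sup>+\<tau>. (h (\<tau> * norm y) * ennreal (\<tau> ^ (?D - 1)) * indicator {0<..} \<tau>) \<partial>lborel)" .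
      have "ennreal (norm y ^ ?D) * ennreal (1 / norm y ^ (?D + 1)) = ennreal (1 / norm y)"
        using ny by (simp add: ennreal_mult[symmetric] field_simps)
      moreover have "H * ennreal (1 / norm y ^ (?D + 1)) = (ennreal (norm y ^ ?D) * ennreal (1 / norm y ^ (?D + 1))) *
          (\<integral>\<^sup>+\<tau>. (h (\<tau> * norm y) * ennreal (\<tau> ^ (?D - 1)) * indicator {0<..} \<tau>) \<partial>lborel)"
        by (subst H) (simp only: mult_ac)
      ultimately have HJ: "H * ennreal (1 / norm y ^ (?D + 1)) = ennreal (1 / norm y) *
          (\<integral>\<^sup>+\<tau>. (h (\<tau> * norm y) * ennreal (\<tau> ^ (?D - 1)) * indicator {0<..} \<tau>) \<partial>lborel)"
        by simp
      have "(\<integral>\<^sup>+\<tau>. \<theta> y * ennreal (1 / norm y) * indicator A y *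
          (h (\<tau> * norm y) * ennreal (\<tau> ^ (?D - 1)) * indicator {0<..} \<tau>) \<partial>lborel) =
        \<theta> y * ennreal (1 / norm y) * indicator A y *
          (\<integral>\<^sup>+\<tau>. (h (\<tau> * norm y) * ennreal (\<tau> ^ (?D - 1)) * indicator {0<..} \<tau>) \<partial>lborel)"
        by (rule nn_integral_cmult) measurable
      also have "\<dots> = \<theta> y * indicator A y * (H * ennreal (1 / norm y ^ (?D + 1)))"
        unfolding HJ by (simp only: mult_ac)
      finally show ?thesis by (simp only: mult_ac)
    qed simp
  qed
  also have "\<dots> = H * (\<integral>\<^sup>+y. \<theta> y * ennreal (1 / norm y ^ (?D + 1)) * indicator A y \<partial>lborel)"
    by (rule nn_integral_cmult) measurable
  finally show ?thesis unfolding H_def A_def .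
qed

section \<open>Integral means of powers of holomorphic functions\<close>

lemma continuous_on_circlepath_compose:
  assumes "continuous_on A f" "\<And>t. t \<in> {0..1} \<Longrightarrow> circlepath a r t \<in> A"
  shows "continuous_on {0..1} (\<lambda>t. f (circlepath a r t))"
  by (rule continuous_on_compose2[OF assms(1)])
     (use assms(2) in \<open>auto simp: circlepath intro!: continuous_intros\<close>)

lemma norm_circlepath_diff: "0 \<le> r \<Longrightarrow> cmod (circlepath a r t - a) = r"
  by (simp add: circlepath norm_mult)

lemma circlepath_mean_value:
  assumes f: "f holomorphic_on cball a r" and r: "0 \<le> r"
  shows "((\<lambda>t. f (circlepath a r t)) has_integral f a) {0..1}"
proof (cases "r = 0")
  case True
  then have "(\<lambda>t. f (circlepath a r t)) = (\<lambda>t. f a)" by (simp add: circlepath)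
  then show ?thesis using has_integral_const_real[of "f a" 0 1] by simp
next
  case False
  then have r: "r > 0" using assms by simp
  have "((\<lambda>u. f u/(u-a)) has_contour_integral (2 * of_real pi * \<i> * f a)) (circlepath a r)"
    using Cauchy_integral_circlepath_simple[OF f, of a] r by simp
  then have "((\<lambda>x. f (circlepath a r x) / (circlepath a r x - a) * vector_derivative (circlepath a r) (at x within {0..1}))
       has_integral (2 * of_real pi * \<i> * f a)) {0..1}"
    by (simp add: has_contour_integral_def)
  then have "((\<lambda>x. 2 * of_real pi * \<i> * f (circlepath a r x)) has_integral (2 * of_real pi * \<i> * f a)) {0..1}"
    by (rule has_integral_eq[rotated])
       (use r in \<open>simp add: vector_derivative_circlepath01, simp add: circlepath\<close>)
  then have "((\<lambda>x. (2 * of_real pi * \<i> * f (circlepath a r x)) / (2 * of_real pi * \<i>)) has_integral (2 * of_real pi * \<i> * f a) / (2 * of_real pi * \<i>)) {0..1}"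
    by (rule has_integral_divide)
  then show ?thesis by simp
qed

text \<open>Near a zero the inequality is trivial, and away from the zeros a branch of \<open>k\<^sup>p\<close> is holomorphic.\<close>
lemma powr_cmod_local_submean:
  assumes k: "k holomorphic_on U" and U: "open U" "a \<in> U" and p: "p > 0"
  shows "\<exists>\<epsilon>>0. \<forall>r. 0 < r \<and> r < \<epsilon> \<longrightarrow>
           cmod (k a) powr p \<le> integral {0..1} (\<lambda>t. cmod (k (circlepath a r t)) powr p)"
proof (cases "k a = 0")
  case True
  have "0 \<le> integral {0..1} (\<lambda>t. cmod (k (circlepath a r t)) powr p)" for r
    by (cases "(\<lambda>t. cmod (k (circlepath a r t)) powr p) integrable_on {0..1}")
       (auto simp: not_integrable_integral intro: Henstock_Kurzweil_Integration.integral_nonneg)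
  with True show ?thesis by (intro exI[of _ 1]) auto
next
  case False
  have "isCont k a"
    using holomorphic_on_imp_continuous_on[OF k] U by (simp add: continuous_on_eq_continuous_at)
  then obtain e1 where e1: "e1 > 0" "\<And>z. dist z a < e1 \<Longrightarrow> dist (k z) (k a) < cmod (k a)"
    using False by (metis continuous_at_eps_delta zero_less_norm_iff continuous_at dist_commute)
  obtain e2 where e2: "e2 > 0" "ball a e2 \<subseteq> U"
    using U openE by blast
  define \<epsilon> where "\<epsilon> = min e1 e2"
  have \<epsilon>: "\<epsilon> > 0" "ball a \<epsilon> \<subseteq> U" using e1 e2 by (auto simp: \<epsilon>_def)
  have pos: "Re (k z / k a) > 0" if "z \<in> ball a \<epsilon>" for z
  proof -
    have "cmod (k z - k a) < cmod (k a)"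
      using e1(2)[of z] that by (simp add: \<epsilon>_def dist_norm norm_minus_commute)
    then have "cmod (k z / k a - 1) < 1"
      using False by (simp add: field_simps norm_divide flip: diff_divide_distrib)
    then have "\<bar>Re (k z / k a - 1)\<bar> < 1" using abs_Re_le_cmod order_le_less_trans by blast
    then show ?thesis by simp
  qed
  define h where "h z = exp (of_real p * Ln (k z / k a))" for z
  have hol: "h holomorphic_on ball a \<epsilon>"
    unfolding h_def using False pos k \<epsilon>
    by (intro holomorphic_intros) (auto intro: holomorphic_on_subset simp: complex_nonpos_Reals_iff not_le)
  have normh: "cmod (h z) = (cmod (k z) / cmod (k a)) powr p" if "z \<in> ball a \<epsilon>" for z
  proof -
    have "k z / k a \<noteq> 0" using pos[OF that] by auto
    then show ?thesis
      by (simp add: h_def powr_def norm_divide flip: norm_divide)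
  qed
  have "cmod (k a) powr p \<le> integral {0..1} (\<lambda>t. cmod (k (circlepath a r t)) powr p)"
    if r: "0 < r" "r < \<epsilon>" for r
  proof -
    have circ: "circlepath a r t \<in> ball a \<epsilon>" for t
      using norm_circlepath_diff[of r a t] r by (simp add: dist_norm norm_minus_commute)
    have I: "((\<lambda>t. h (circlepath a r t)) has_integral h a) {0..1}"
      using r by (intro circlepath_mean_value holomorphic_on_subset[OF hol]) auto
    have "h a = 1" using False by (simp add: h_def)
    then have "1 = cmod (integral {0..1} (\<lambda>t. h (circlepath a r t)))"
      using integral_unique[OF I] by simp
    also have "\<dots> \<le> integral {0..1} (\<lambda>t. cmod (h (circlepath a r t)))"
    proof (rule integral_norm_bound_integral)
      show "(\<lambda>t. h (circlepath a r t)) integrable_on {0..1}" using I by blast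
      show "(\<lambda>t. cmod (h (circlepath a r t))) integrable_on {0..1}"
        using circ by (intro integrable_continuous_real continuous_on_norm
          continuous_on_circlepath_compose[OF holomorphic_on_imp_continuous_on[OF hol]])
    qed auto
    also have "\<dots> = integral {0..1} (\<lambda>t. cmod (k (circlepath a r t)) powr p / cmod (k a) powr p)"
      using circ by (simp add: normh powr_divide)
    also have "\<dots> = integral {0..1} (\<lambda>t. cmod (k (circlepath a r t)) powr p) / cmod (k a) powr p"
      by simp
    finally show ?thesis
      using False by (simp add: field_simps)
  qed
  with \<epsilon>(1) show ?thesis by blast
qed

text \<open>Among the points where U attains a positive maximum, one of largest modulus is taken.
  The sub-mean inequality forces U to be maximal on a whole small circle about it, and that circle
  contains a point further from 0.\<close>

lemma local_submean_max_principle: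
  fixes U :: "complex \<Rightarrow> real"
  assumes cont: "continuous_on (cball 0 1) U"
    and sub: "\<And>a. cmod a < 1 \<Longrightarrow> \<exists>\<epsilon>>0. \<forall>r. 0 < r \<and> r < \<epsilon> \<longrightarrow> U a \<le> integral {0..1} (\<lambda>t. U (circlepath a r t))"
    and bdry: "\<And>x. cmod x = 1 \<Longrightarrow> U x \<le> 0" and x: "cmod x \<le> 1"
  shows "U x \<le> 0"
proof (rule ccontr)
  assume nx: "\<not> U x \<le> 0"
  obtain x0 where x0: "x0 \<in> cball 0 1" "\<And>y. y \<in> cball 0 1 \<Longrightarrow> U y \<le> U x0"
    using continuous_attains_sup[OF compact_cball _ cont] by (metis cball_eq_empty not_one_less_zero)
  define M where "M = U x0"
  have M: "M > 0" using x0(2)[of x] x nx by (simp add: M_def)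
  define K where "K = {y \<in> cball 0 1. U y = M}"
  have "closed K" 
    unfolding K_def using continuous_closed_preimage_constant[OF cont] by blast
  then have "compact K" unfolding K_def
    by (metis (no_types, lifting) bounded_cball bounded_subset compact_eq_bounded_closed mem_Collect_eq subsetI)
  moreover have "K \<noteq> {}" using x0 by (auto simp: K_def M_def)
  ultimately obtain y where y: "y \<in> K" "\<And>z. z \<in> K \<Longrightarrow> cmod z \<le> cmod y"
    using continuous_attains_sup[of K norm] by (metis continuous_on_norm_id)
  have "cmod y \<le> 1" "U y = M" using y by (auto simp: K_def)
  with bdry[of y] M have y1: "cmod y < 1" by force
  obtain \<epsilon> where \<epsilon>: "\<epsilon> > 0" "\<And>r. 0 < r \<and> r < \<epsilon> \<Longrightarrow> U y \<le> integral {0..1} (\<lambda>t. U (circlepath y r t))"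
    using sub[OF y1] by blast
  define r where "r = min \<epsilon> (1 - cmod y) / 2"
  have r: "0 < r" "r < \<epsilon>" "r \<le> 1 - cmod y" using \<epsilon> y1 by (auto simp: r_def min_def)
  have circ: "circlepath y r t \<in> cball 0 1" for t
    using norm_circlepath_diff[of r y t] r norm_triangle_sub[of "circlepath y r t" y] by simp
  have c1: "continuous_on {0..1} (\<lambda>t. U (circlepath y r t))"
    using continuous_on_circlepath_compose[OF cont circ] by blast
  then have c2: "continuous_on {0..1} (\<lambda>t. M - U (circlepath y r t))"
    by (intro continuous_intros)
  have "integral {0..1} (\<lambda>t. M - U (circlepath y r t)) = M - integral {0..1} (\<lambda>t. U (circlepath y r t))"
    using c1 by (subst Henstock_Kurzweil_Integration.integral_diff) (auto intro: integrable_continuous_real)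
  also have "\<dots> \<le> 0" using \<epsilon>(2)[of r] r \<open>U y = M\<close> by simp
  finally have "integral (cbox 0 1) (\<lambda>t. M - U (circlepath y r t)) = 0"
    using integral_nonneg[OF integrable_continuous_real[OF c2]] x0(2)[OF circ] by (force simp: M_def)
  then have eq: "M - U (circlepath y r t) = 0" if "t \<in> {0..1}" for t
    using integral_cbox_eq_0_iff[of 0 1 "\<lambda>t. M - U (circlepath y r t)"] c2 x0(2)[OF circ] that
    by (auto simp: M_def)
  \<comment> \<open>The outward radial direction at y; any direction serves when y = 0.\<close>
  obtain c where c: "cmod c = 1" "cmod (y + of_real r * c) = cmod y + r"
  proof (cases "y = 0")
    case True
    then show ?thesis using r by (intro that[of 1]) auto
  next
    case False
    have "y + of_real r * sgn y = of_real (1 + r / cmod y) * y"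
      using False by (simp add: sgn_eq field_simps)
    then have "cmod (y + of_real r * sgn y) = (1 + r / cmod y) * cmod y"
      using r by (simp add: norm_mult del: of_real_add)
    also have "\<dots> = cmod y + r" using False by (simp add: distrib_right)
    finally show ?thesis using False by (intro that[of "sgn y"]) (auto simp: norm_sgn)
  qed
  have "y + of_real r * c \<in> path_image (circlepath y r)"
    using r c by (simp add: dist_norm norm_mult)
  then obtain t where t: "t \<in> {0..1}" "circlepath y r t = y + of_real r * c"
    by (auto simp: path_image_def)
  then have "y + of_real r * c \<in> K"
    using eq[OF t(1)] circ[of t] by (auto simp: K_def)
  from y(2)[OF this] c r show False by simp
qed

text \<open>Stone-Weierstrass for real parts of polynomials. On the circle they form an algebra,
  because x^k times the conjugate of x^l is x^(k-l) or the conjugate of x^(l-k). The approximants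
  are harmonic in the disc, so they supply harmonic majorants with almost prescribed boundary
  values.\<close>

lemma real_trig_poly_approximation:
  fixes f :: "complex \<Rightarrow> real"
  assumes f: "continuous_on (sphere 0 1) f" and e: "e > 0"
  shows "\<exists>P. \<forall>x\<in>sphere 0 1. \<bar>f x - Re (poly P x)\<bar> < e"
proof -
  define R where "R g \<longleftrightarrow> (\<exists>P. \<forall>x\<in>sphere 0 1. g x = Re (poly P x))" for g :: "complex \<Rightarrow> real"
  have const: "R (\<lambda>x. c)" for c
    unfolding R_def by (rule exI[of _ "[:of_real c:]"]) simp
  have add: "R (\<lambda>x. g x + h x)" if gh: "R g" "R h" for g h
  proof -
    obtain P P' where "\<forall>x\<in>sphere 0 1. g x = Re (poly P x)" "\<forall>x\<in>sphere 0 1. h x = Re (poly P' x)"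
      using gh by (auto simp: R_def)
    then show ?thesis unfolding R_def by (intro exI[of _ "P + P'"]) simp
  qed
  have sum: "R (\<lambda>x. \<Sum>i\<in>I. g i x)" if "finite I" "\<And>i. R (g i)" for I :: "nat set" and g
    using that by (induction I rule: finite_induct) (auto intro: const add)
  have mono: "R (\<lambda>x. Re (c * x ^ k * cnj (x ^ l)))" for c k l
  proof (cases "l \<le> k")
    case True
    have "Re (c * x ^ k * cnj (x ^ l)) = Re (poly (monom c (k - l)) x)" if "x \<in> sphere 0 1" for x
    proof -
      have "x ^ k * cnj (x ^ l) = x ^ (k - l) * (x ^ l * cnj (x ^ l))"
        using True by (simp flip: power_add mult.assoc)
      also have "x ^ l * cnj (x ^ l) = 1"
        using that by (simp add: complex_norm_square[symmetric] norm_power del: complex_cnj_power)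
      finally show ?thesis by (simp add: poly_monom mult.assoc)
    qed
    then show ?thesis unfolding R_def by blast
  next
    case False
    have "Re (c * x ^ k * cnj (x ^ l)) = Re (poly (monom (cnj c) (l - k)) x)" if "x \<in> sphere 0 1" for x
    proof -
      have "Re (c * x ^ k * cnj (x ^ l)) = Re (cnj (c * x ^ k * cnj (x ^ l)))" by (simp only: cnj.simps)
      also have "cnj (c * x ^ k * cnj (x ^ l)) = cnj c * (x ^ l * cnj (x ^ k))" by simp
      also have "x ^ l * cnj (x ^ k) = x ^ (l - k) * (x ^ k * cnj (x ^ k))"
        using False by (simp flip: power_add mult.assoc)
      also have "x ^ k * cnj (x ^ k) = 1"
        using that by (simp add: complex_norm_square[symmetric] norm_power del: complex_cnj_power)
      finally show ?thesis by (simp add: poly_monom)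
    qed
    then show ?thesis unfolding R_def by blast
  qed
  have mult: "R (\<lambda>x. g x * h x)" if gh: "R g" "R h" for g h
  proof -
    obtain P P' where P: "\<forall>x\<in>sphere 0 1. g x = Re (poly P x)" "\<forall>x\<in>sphere 0 1. h x = Re (poly P' x)"
      using gh by (auto simp: R_def)
    have 1: "R (\<lambda>x. Re (poly (smult (1/2) (P * P')) x))" unfolding R_def by blast
    have 2: "R (\<lambda>x. \<Sum>i\<le>degree P. \<Sum>j\<le>degree P'. Re ((coeff P i * cnj (coeff P' j) / 2) * x ^ i * cnj (x ^ j)))"
      by (intro sum mono) auto
    \<comment> \<open>Re A Re B = (Re(A B) + Re(A conj B))/2; the second term is expanded into the
      monomials covered by \<open>mono\<close>.\<close>
    have "g x * h x = Re (poly (smult (1/2) (P * P')) x) +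
       (\<Sum>i\<le>degree P. \<Sum>j\<le>degree P'. Re ((coeff P i * cnj (coeff P' j) / 2) * x ^ i * cnj (x ^ j)))"
      if "x \<in> sphere 0 1" for x
    proof -
      have "(\<Sum>i\<le>degree P. \<Sum>j\<le>degree P'. Re ((coeff P i * cnj (coeff P' j) / 2) * x ^ i * cnj (x ^ j))) =
         Re (\<Sum>i\<le>degree P. \<Sum>j\<le>degree P'. (coeff P i * x ^ i) * cnj (coeff P' j * x ^ j) / 2)"
        by (simp add: Re_sum algebra_simps)
      also have "(\<Sum>i\<le>degree P. \<Sum>j\<le>degree P'. (coeff P i * x ^ i) * cnj (coeff P' j * x ^ j) / 2) =
         poly P x * cnj (poly P' x) / 2"
        by (simp add: poly_altdef[of P] poly_altdef[of P'] sum_product sum_divide_distrib)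
      finally show ?thesis using P that by (simp add: field_simps)
    qed
    then have "(\<forall>x\<in>sphere 0 1. g x * h x = Re (poly (smult (1/2) (P * P')) x) +
       (\<Sum>i\<le>degree P. \<Sum>j\<le>degree P'. Re ((coeff P i * cnj (coeff P' j) / 2) * x ^ i * cnj (x ^ j))))" by blast
    with add[OF 1 2] show ?thesis unfolding R_def by (metis (no_types, lifting))
  qed
  have cont: "continuous_on (sphere 0 1) g" if g: "R g" for g
  proof -
    obtain P where "\<forall>x\<in>sphere 0 1. g x = Re (poly P x)" using g by (auto simp: R_def)
    moreover have "continuous_on (sphere 0 1) (\<lambda>x. Re (poly P x))" by (intro continuous_intros)
    ultimately show ?thesis by (metis (no_types, lifting) continuous_on_cong)
  qed
  have sep: "\<exists>g. R g \<and> g x \<noteq> g y" if "x \<noteq> y" for x y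
  proof (cases "Re x = Re y")
    case False
    have "R Re" unfolding R_def by (rule exI[of _ "[:0, 1:]"]) simp
    with False show ?thesis by blast
  next
    case True
    have "R (\<lambda>x. - Im x)" unfolding R_def by (rule exI[of _ "[:0, \<i>:]"]) simp
    with True that show ?thesis by (metis complex_eqI minus_equation_iff)
  qed
  have "\<exists>g. R g \<and> (\<forall>x\<in>sphere 0 1. \<bar>f x - g x\<bar> < e)"
    by (rule Stone_Weierstrass_HOL) (use const add mult cont sep f e in auto)
  then obtain g where g: "R g" "\<forall>x\<in>sphere 0 1. \<bar>f x - g x\<bar> < e" by blast
  then obtain P where "\<forall>x\<in>sphere 0 1. g x = Re (poly P x)" by (auto simp: R_def)
  with g(2) show ?thesis by (intro exI[of _ P]) auto
qed

text \<open>A polynomial P with u \<le> Re P \<le> u + e on the unit circle, where u = |k|^p,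
  satisfies u \<le> Re P in the disc by the maximum principle. The mean of Re P is the same on every
  circle about 0, so it carries the bound from radius s to radius 1.\<close>

lemma powr_mean_mono:
  assumes k: "k holomorphic_on U" and U: "open U" "cball 0 1 \<subseteq> U" and p: "p > 0" and s: "0 \<le> s" "s \<le> 1"
  shows "integral {0..1} (\<lambda>t. cmod (k (circlepath 0 s t)) powr p) \<le>
         integral {0..1} (\<lambda>t. cmod (k (circlepath 0 1 t)) powr p)"
proof (rule field_le_epsilon)
  fix e :: real assume e: "e > 0"
  define u where "u x = cmod (k x) powr p" for x
  have ucont: "continuous_on U u"
    unfolding u_def using holomorphic_on_imp_continuous_on[OF k] p
    by (intro continuous_on_powr' continuous_intros) auto
  have ccont: "continuous_on (cball 0 1) u" using ucont U(2) continuous_on_subset by blast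
  have "continuous_on (sphere 0 1) (\<lambda>x. u x + e / 2)"
    by (intro continuous_intros continuous_on_subset[OF ccont]) auto
  \<comment> \<open>The shift by e/2 turns a two-sided approximation into the one-sided bounds u <
    Re P < u + e on the circle.\<close>
  then obtain P where P: "\<And>x. x \<in> sphere 0 1 \<Longrightarrow> \<bar>u x + e / 2 - Re (poly P x)\<bar> < e / 2"
    using real_trig_poly_approximation[of "\<lambda>x. u x + e / 2" "e / 2"] e by (metis half_gt_zero)
  have Pmean: "((\<lambda>t. Re (poly P (circlepath a r t))) has_integral Re (poly P a)) {0..1}" if "r \<ge> 0" for a r
  proof -
    have "poly P holomorphic_on cball a r"
      unfolding holomorphic_on_def field_differentiable_def
      using poly_DERIV has_field_derivative_at_within by blast
    from has_integral_Re[OF circlepath_mean_value[OF this that]] show ?thesis .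
  qed
  have ball: "circlepath a r t \<in> cball 0 1" if "0 \<le> r" "r \<le> 1 - cmod a" for a r t
    using norm_circlepath_diff[of r a t] that norm_triangle_sub[of "circlepath a r t" a] by simp
  have iu: "(\<lambda>t. u (circlepath a r t)) integrable_on {0..1}" if "0 \<le> r" "r \<le> 1 - cmod a" for a r
    using ball[OF that] by (intro integrable_continuous_real continuous_on_circlepath_compose[OF ccont]) auto
  have le: "u x \<le> Re (poly P x)" if "cmod x \<le> 1" for x
  proof -
    have "u x - Re (poly P x) \<le> 0"
    proof (rule local_submean_max_principle[OF _ _ _ that])
      show "continuous_on (cball 0 1) (\<lambda>x. u x - Re (poly P x))"
        by (intro continuous_intros ccont)
      show "u x - Re (poly P x) \<le> 0" if "cmod x = 1" for x
      proof -
        have "\<bar>u x + e / 2 - Re (poly P x)\<bar> < e / 2" using P[of x] that by simp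
        then show ?thesis by linarith
      qed
      fix a :: complex assume a: "cmod a < 1"
      obtain \<epsilon> where \<epsilon>: "\<epsilon> > 0" "\<And>r. 0 < r \<and> r < \<epsilon> \<Longrightarrow> u a \<le> integral {0..1} (\<lambda>t. u (circlepath a r t))"
        using powr_cmod_local_submean[OF k U(1) _ p, of a] a U(2) unfolding u_def by (force simp: subset_iff)
      show "\<exists>\<epsilon>>0. \<forall>r. 0 < r \<and> r < \<epsilon> \<longrightarrow> u a - Re (poly P a) \<le> integral {0..1} (\<lambda>t. u (circlepath a r t) - Re (poly P (circlepath a r t)))"
      proof (intro exI[of _ "min \<epsilon> (1 - cmod a)"] conjI allI impI)
        show "0 < min \<epsilon> (1 - cmod a)" using \<epsilon> a by simp
        fix r assume r: "0 < r \<and> r < min \<epsilon> (1 - cmod a)"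
        have "integral {0..1} (\<lambda>t. u (circlepath a r t) - Re (poly P (circlepath a r t))) =
          integral {0..1} (\<lambda>t. u (circlepath a r t)) - Re (poly P a)"
          using r iu[of r a] Pmean[of r a]
          by (subst Henstock_Kurzweil_Integration.integral_diff) (auto simp: integral_unique)
        then show "u a - Re (poly P a) \<le> integral {0..1} (\<lambda>t. u (circlepath a r t) - Re (poly P (circlepath a r t)))"
          using \<epsilon>(2)[of r] r by simp
      qed
    qed
    then show ?thesis by simp
  qed
  have "integral {0..1} (\<lambda>t. u (circlepath 0 s t)) \<le> integral {0..1} (\<lambda>t. Re (poly P (circlepath 0 s t)))"
    using ball[of s 0] s iu[of s 0] Pmean[of s 0] by (intro integral_le le) auto
  also have "\<dots> = integral {0..1} (\<lambda>t. Re (poly P (circlepath 0 1 t)))"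
    using Pmean[of s 0] Pmean[of 1 0] s by (simp add: integral_unique)
  also have "\<dots> \<le> integral {0..1} (\<lambda>t. u (circlepath 0 1 t) + e)"
  proof (rule integral_le)
    show "(\<lambda>t. u (circlepath 0 1 t) + e) integrable_on {0..1}"
      using iu[of 1 0] by (intro integrable_add) auto
    show "Re (poly P (circlepath 0 1 t)) \<le> u (circlepath 0 1 t) + e" for t
    proof -
      have "circlepath 0 1 t \<in> sphere 0 1" using norm_circlepath_diff[of 1 0 t] by simp
      from P[OF this] show ?thesis by linarith
    qed
  qed (use Pmean[of 1 0] in auto)
  also have "\<dots> = integral {0..1} (\<lambda>t. u (circlepath 0 1 t)) + e"
    using iu[of 1 0] by (subst Henstock_Kurzweil_Integration.integral_add) auto
  finally show "integral {0..1} (\<lambda>t. cmod (k (circlepath 0 s t)) powr p) \<le>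
         integral {0..1} (\<lambda>t. cmod (k (circlepath 0 1 t)) powr p) + e"
    by (simp add: u_def)
qed

lemma nn_integral_continuous_interval:
  fixes f :: "real \<Rightarrow> real"
  assumes "continuous_on {a..b} f" "\<And>x. x \<in> {a..b} \<Longrightarrow> 0 \<le> f x"
  shows "(\<integral>\<^sup>+x. ennreal (f x) * indicator {a..b} x \<partial>lborel) = ennreal (integral {a..b} f)"
proof -
  have si: "set_integrable lborel {a..b} f" by (rule borel_integrable_atLeastAtMost'[OF assms(1)])
  have "(\<integral>\<^sup>+x. ennreal (f x) * indicator {a..b} x \<partial>lborel) = (\<integral>\<^sup>+x. ennreal (indicator {a..b} x *\<^sub>R f x) \<partial>lborel)"
    by (intro nn_integral_cong) (auto simp: indicator_def)
  also have "\<dots> = ennreal (LINT x:{a..b}|lborel. f x)"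
    using si assms(2) unfolding set_integrable_def set_lebesgue_integral_def
    by (intro nn_integral_eq_integral) (auto simp: indicator_def)
  also have "(LINT x:{a..b}|lborel. f x) = integral {a..b} f"
    by (rule set_borel_integral_eq_integral(2)[OF si])
  finally show ?thesis .
qed

section \<open>Complex scalar multiplication and averaging over circles in complex lines\<close>

lemma linear_complex_smult: "linear (\<lambda>y::complex^'n. c *s y)"
  by (rule linearI) (simp_all add: vec_eq_iff algebra_simps)

lemma norm_complex_smult: "norm (c *s (y::complex^'n)) = cmod c * norm y"
  by (simp add: norm_vec_def norm_mult L2_set_right_distrib)

lemma continuous_on_smult [continuous_intros]:
  fixes f :: "'a::topological_space \<Rightarrow> complex" and g :: "'a \<Rightarrow> complex^'n"
  assumes "continuous_on S f" "continuous_on S g"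
  shows "continuous_on S (\<lambda>x. f x *s g x)"
  unfolding vector_scalar_mult_def using assms
  by (intro continuous_intros)

text \<open>With \<open>s = 0\<close> this is the sub-mean value property over circular sets.\<close>
lemma nn_integral_powr_dilate_le:
  fixes g :: "complex^'n \<Rightarrow> complex" and h :: "complex^'n \<Rightarrow> ennreal"
  assumes [measurable]: "g \<in> borel_measurable borel" "h \<in> borel_measurable borel"
    and p: "p > 0" and s: "0 \<le> s" "s \<le> 1"
    and rot: "\<And>c y. cmod c = 1 \<Longrightarrow> h (c *s y) = h y"
    and hol: "\<And>y. h y \<noteq> 0 \<Longrightarrow> \<exists>U. open U \<and> cball 0 1 \<subseteq> U \<and> (\<lambda>l. g (l *s y)) holomorphic_on U"
  shows "(\<integral>\<^sup>+y. ennreal (cmod (g (of_real s *s y)) powr p) * h y \<partial>lborel) \<le>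
         (\<integral>\<^sup>+y. ennreal (cmod (g y) powr p) * h y \<partial>lborel)"
proof -
  \<comment> \<open>Rotations preserve both Lebesgue measure and h, so g(s y) may be averaged over
    the circle of radius s in the complex line through y.\<close>
  have eq: "(\<integral>\<^sup>+y. ennreal (cmod (g (of_real s *s y)) powr p) * h y \<partial>lborel) =
    (\<integral>\<^sup>+y. (\<integral>\<^sup>+t. ennreal (cmod (g (circlepath 0 s t *s y)) powr p) * indicator {0..1} t \<partial>lborel) * h y \<partial>lborel)"
    if s: "0 \<le> s" for s
  proof -
    have "continuous_on UNIV (\<lambda>x::real \<times> (complex^'n). circlepath 0 s (fst x) *s snd x)"
      by (auto simp: circlepath intro!: continuous_intros)
    then have [measurable]: "(\<lambda>x::real \<times> (complex^'n). circlepath 0 s (fst x) *s snd x) \<in> borel_measurable (borel \<Otimes>\<^sub>M borel)"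
      by (simp add: borel_prod borel_measurable_continuous_onI)
    have [measurable]: "(\<lambda>y::complex^'n. c *s y) \<in> borel_measurable borel" for c
      by (intro borel_measurable_continuous_onI continuous_intros)
    have "continuous_on UNIV (\<lambda>t. circlepath 0 s t *s y)" for y :: "complex^'n"
      by (auto simp: circlepath intro!: continuous_intros)
    then have [measurable]: "(\<lambda>t. circlepath 0 s t *s y) \<in> borel_measurable borel" for y :: "complex^'n"
      by (rule borel_measurable_continuous_onI)
    have rot_inv: "(\<integral>\<^sup>+y. ennreal (cmod (g (circlepath 0 s t *s y)) powr p) * h y \<partial>lborel) =
       (\<integral>\<^sup>+y. ennreal (cmod (g (of_real s *s y)) powr p) * h y \<partial>lborel)" for t
    proof -
      let ?c = "exp (2 * of_real pi * \<i> * of_real t)"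
      have c: "cmod ?c = 1" by simp
      have cs: "circlepath 0 s t *s y = of_real s *s (?c *s y)" for y :: "complex^'n"
        by (simp add: circlepath vector_smult_assoc)
      have "(\<integral>\<^sup>+y. ennreal (cmod (g (of_real s *s (?c *s y))) powr p) * h (?c *s y) \<partial>lborel) =
         (\<integral>\<^sup>+y. ennreal (cmod (g (of_real s *s y)) powr p) * h y \<partial>lborel)"
        by (rule nn_integral_lborel_isometry[of "(*s) ?c"])
           (simp_all add: linear_complex_smult norm_complex_smult)
      then show ?thesis by (simp add: rot[OF c] cs)
    qed
    have "(\<integral>\<^sup>+y. ennreal (cmod (g (of_real s *s y)) powr p) * h y \<partial>lborel) =
      (\<integral>\<^sup>+t. (\<integral>\<^sup>+y. ennreal (cmod (g (circlepath 0 s t *s y)) powr p) * h y \<partial>lborel) * indicator {0..1} t \<partial>lborel)"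
      unfolding rot_inv by (subst nn_integral_cmult_indicator) auto
    also have "\<dots> = (\<integral>\<^sup>+t. (\<integral>\<^sup>+y. ennreal (cmod (g (circlepath 0 s t *s y)) powr p) * indicator {0..1} t * h y \<partial>lborel) \<partial>lborel)"
      by (subst nn_integral_multc[symmetric]) (auto intro!: nn_integral_cong simp: mult_ac)
    also have "\<dots> = (\<integral>\<^sup>+y. (\<integral>\<^sup>+t. ennreal (cmod (g (circlepath 0 s t *s y)) powr p) * indicator {0..1} t * h y \<partial>lborel) \<partial>lborel)"
      by (rule lborel_pair.Fubini'[symmetric]) measurable
    also have "\<dots> = (\<integral>\<^sup>+y. (\<integral>\<^sup>+t. ennreal (cmod (g (circlepath 0 s t *s y)) powr p) * indicator {0..1} t \<partial>lborel) * h y \<partial>lborel)"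
      by (subst nn_integral_multc) auto
    finally show ?thesis .
  qed
  have "(\<integral>\<^sup>+y. ennreal (cmod (g (of_real s *s y)) powr p) * h y \<partial>lborel) \<le>
        (\<integral>\<^sup>+y. ennreal (cmod (g (of_real 1 *s y)) powr p) * h y \<partial>lborel)"
    unfolding eq[OF s(1)] eq[OF zero_le_one]
  proof (rule nn_integral_mono)
    fix y :: "complex^'n"
    show "(\<integral>\<^sup>+t. ennreal (cmod (g (circlepath 0 s t *s y)) powr p) * indicator {0..1} t \<partial>lborel) * h y \<le>
          (\<integral>\<^sup>+t. ennreal (cmod (g (circlepath 0 1 t *s y)) powr p) * indicator {0..1} t \<partial>lborel) * h y"
    proof (cases "h y = 0")
      case False
      then obtain U where U: "open U" "cball 0 1 \<subseteq> U" "(\<lambda>l. g (l *s y)) holomorphic_on U"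
        using hol by blast
      have "continuous_on (cball 0 1) (\<lambda>l. cmod (g (l *s y)) powr p)"
        using continuous_on_subset[OF holomorphic_on_imp_continuous_on[OF U(3)] U(2)] p
        by (intro continuous_on_powr' continuous_intros) auto
      then have "continuous_on {0..1} (\<lambda>t. cmod (g (circlepath 0 r t *s y)) powr p)" if "0 \<le> r" "r \<le> 1" for r
        using norm_circlepath_diff[of r 0] that
        by (intro continuous_on_circlepath_compose[of "cball 0 1" "\<lambda>l. cmod (g (l *s y)) powr p"]) auto
      then show ?thesis
        using s powr_mean_mono[OF U(3,1,2) p s]
        by (intro mult_right_mono) (simp_all add: nn_integral_continuous_interval ennreal_leI)
    qed simp
  qed
  then show ?thesis by simp
qed

section \<open>Pseudohyperbolic geometry of the ball\<close>

lemma in_unit_ball_iff [simp]: "z \<in> unit_ball \<longleftrightarrow> norm z < 1"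
  by (simp add: unit_ball_def)

lemma herm_add_left: "herm (x + y) z = herm x z + herm y z"
  and herm_diff_left: "herm (x - y) z = herm x z - herm y z"
  and herm_smult_left: "herm (c *s x) z = c * herm x z"
  and herm_add_right: "herm z (x + y) = herm z x + herm z y"
  and herm_diff_right: "herm z (x - y) = herm z x - herm z y"
  and herm_smult_right: "herm z (c *s x) = cnj c * herm z x"
  and herm_zero_left [simp]: "herm 0 z = 0"
  and herm_zero_right [simp]: "herm z 0 = 0"
  by (simp_all add: herm_def algebra_simps sum.distrib sum_subtractf sum_distrib_left)

lemmas herm_linear = herm_add_left herm_diff_left herm_smult_left
  herm_add_right herm_diff_right herm_smult_right

lemma herm_commute: "herm w z = cnj (herm z w)"
  by (simp add: herm_def mult.commute)

lemma herm_self: "herm z z = of_real ((norm z)\<^sup>2)"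
  by (simp add: herm_def norm_vec_def L2_set_def sum_nonneg complex_norm_square[symmetric])

lemma inner_eq_Re_herm: "inner z w = Re (herm z w)"
  by (simp add: herm_def inner_vec_def inner_complex_def)

text \<open>Rotating z by a unimodular factor makes the Hermitian product real and nonnegative,
  which reduces the claim to the real Cauchy-Schwarz inequality.\<close>

lemma cmod_herm_le: "cmod (herm z w) \<le> norm z * norm w"
proof (cases "herm z w = 0")
  case False
  let ?c = "cnj (sgn (herm z w))"
  have "?c * herm z w = of_real (cmod (herm z w))"
    using False by (simp add: sgn_eq complex_norm_square[symmetric] power2_eq_square mult.commute[of "cnj _"])
  then have "cmod (herm z w) = inner (?c *s z) w"
    by (simp add: inner_eq_Re_herm herm_smult_left)
  also have "\<dots> \<le> norm (?c *s z) * norm w"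
    by (rule norm_cauchy_schwarz)
  also have "norm (?c *s z) = norm z"
    using False by (simp add: norm_complex_smult norm_sgn)
  finally show ?thesis .
qed simp

lemma norm_one_minus_herm_ge: "cmod (1 - herm z w) \<ge> 1 - norm z * norm w"
  using norm_triangle_ineq2[of 1 "herm z w"] cmod_herm_le[of z w] by simp

lemma norm_one_minus_herm_ge': "norm z < 1 \<Longrightarrow> cmod (1 - herm z w) \<ge> 1 - norm w"
  using norm_one_minus_herm_ge[of z w] mult_right_mono[of "norm z" 1 "norm w"] by simp

lemma one_minus_herm_nonzero: 
  assumes "norm z < 1" "norm w < 1" shows "1 - herm z w \<noteq> 0"
  using norm_one_minus_herm_ge'[OF assms(1), of w] assms(2) by auto

lemma norm_one_minus_herm_le: 
  assumes "norm z < 1" "norm w < 1" shows "cmod (1 - herm z w) \<le> 2"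
proof -
  have "norm z * norm w \<le> 1" using assms by (simp add: mult_le_one)
  then show ?thesis
    using norm_triangle_ineq4[of 1 "herm z w"] cmod_herm_le[of z w] by simp
qed

lemma ball_aut_alt:
  fixes a z :: "complex^'n"
  assumes "a \<noteq> 0"
  defines "s \<equiv> of_real (sqrt (1 - (norm a)\<^sup>2))"
  shows "ball_aut a z = (1 / (1 - herm z a)) *s
    ((1 - (1 - s) * herm z a / of_real ((norm a)\<^sup>2)) *s a - s *s z)"
  using assms(1) unfolding ball_aut_def Let_def s_def
  by (simp add: vec_eq_iff algebra_simps diff_divide_distrib)

lemma ball_aut_zero_left: "ball_aut 0 z = - z"
  by (simp add: ball_aut_def Let_def)

lemma ball_aut_zero_right [simp]: "ball_aut a 0 = a"
  by (simp add: ball_aut_def Let_def)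

lemma herm_minus_left: "herm (-x) y = - herm x y"
  and herm_minus_right: "herm x (-y) = - herm x y"
  by (simp_all add: herm_def sum_negf)

text \<open>Source of the invariances below: w = z gives 1 - |\<open>ball_aut a z\<close>|^2, w = 0
  gives \<open>one_minus_herm_ball_aut\<close>, and combining instances gives the invariance of
  \<open>hyp_kernel\<close>. The mixed terms collapse because s^2 = 1 - |a|^2.\<close>

lemma herm_ball_aut:
  fixes a z w :: "complex^'n"
  assumes a: "norm a < 1" and z: "norm z < 1" and w: "norm w < 1"
  shows "1 - herm (ball_aut a z) (ball_aut a w) =
    (1 - of_real ((norm a)\<^sup>2)) * (1 - herm z w) / ((1 - herm z a) * (1 - herm a w))"
proof (cases "a = 0")
  case True
  then show ?thesis by (simp add: ball_aut_zero_left herm_minus_left herm_minus_right)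
next
  case False
  define s :: complex where "s = of_real (sqrt (1 - (norm a)\<^sup>2))"
  define A :: complex where "A = of_real ((norm a)\<^sup>2)"
  define \<alpha> where "\<alpha> = herm z a"
  define \<beta> where "\<beta> = herm a w"
  define g where "g = (1 - s) * \<alpha> / A"
  \<comment> \<open>Built from <a, w> rather than <w, a>, so that the conjugation in the second slot
    of \<open>herm\<close> returns h itself.\<close>
  define h where "h = (1 - s) * \<beta> / A"
  have A: "A \<noteq> 0" using False by (simp add: A_def)
  have "(norm a)\<^sup>2 \<le> 1" using a by (simp add: power_le_one)
  then have ss: "s * s = 1 - A"
    by (simp add: s_def A_def flip: of_real_mult)
  have nz: "1 - \<alpha> \<noteq> 0" "1 - \<beta> \<noteq> 0"
    unfolding \<alpha>_def \<beta>_def using one_minus_herm_nonzero a z w by blast+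
  have wa: "herm w a = cnj \<beta>" by (simp add: \<beta>_def herm_commute[of w a])
  have cs: "cnj s = s" "cnj A = A" by (simp_all add: s_def A_def)
  have Aa: "herm a a = A" by (simp add: herm_self A_def)
  have "herm (ball_aut a z) (ball_aut a w) =
    ((1 - g) * (1 - h) * A - s * \<beta> * (1 - g) - s * \<alpha> * (1 - h) + s * s * herm z w) / ((1 - \<alpha>) * (1 - \<beta>))"
  proof -
    have bz: "ball_aut a z = (1 / (1 - \<alpha>)) *s ((1 - g) *s a - s *s z)"
      using False by (simp add: ball_aut_alt s_def A_def \<alpha>_def g_def)
    have "cnj h = (1 - s) * cnj \<beta> / A" by (simp add: h_def cs)
    then have bw: "ball_aut a w = (1 / (1 - cnj \<beta>)) *s ((1 - cnj h) *s a - s *s w)"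
      using False by (simp add: ball_aut_alt s_def A_def wa)
    have N: "herm ((1 - g) *s a - s *s z) ((1 - cnj h) *s a - s *s w) =
      (1 - g) * (1 - h) * A - s * \<beta> * (1 - g) - s * \<alpha> * (1 - h) + s * s * herm z w"
      unfolding herm_linear Aa by (simp add: cs flip: \<alpha>_def \<beta>_def) (simp add: algebra_simps)
    show ?thesis unfolding bz bw herm_smult_left herm_smult_right N by simp
  qed
  also have "(1 - g) * (1 - h) * A - s * \<beta> * (1 - g) - s * \<alpha> * (1 - h) + s * s * herm z w =
     A - \<alpha> - \<beta> + \<alpha> * \<beta> + (1 - A) * herm z w"
  proof -
    have gA: "g * A = (1 - s) * \<alpha>" and hA: "h * A = (1 - s) * \<beta>" using A by (simp_all add: g_def h_def)
    have "A * (\<alpha> * h + s * \<beta> * g) = A * (\<alpha> * \<beta>)"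
      using gA hA ss by algebra
    then have "\<alpha> * h + s * \<beta> * g = \<alpha> * \<beta>" using A by simp
    then show ?thesis using gA hA ss by algebra
  qed
  finally have eq: "herm (ball_aut a z) (ball_aut a w) =
     (A - \<alpha> - \<beta> + \<alpha> * \<beta> + (1 - A) * herm z w) / ((1 - \<alpha>) * (1 - \<beta>))" .
  have "1 - herm (ball_aut a z) (ball_aut a w) =
     ((1 - \<alpha>) * (1 - \<beta>) - (A - \<alpha> - \<beta> + \<alpha> * \<beta> + (1 - A) * herm z w)) / ((1 - \<alpha>) * (1 - \<beta>))"
    unfolding eq using nz by (simp add: diff_divide_distrib)
  also have "(1 - \<alpha>) * (1 - \<beta>) - (A - \<alpha> - \<beta> + \<alpha> * \<beta> + (1 - A) * herm z w) = (1 - A) * (1 - herm z w)"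
    by (simp add: algebra_simps)
  finally show ?thesis unfolding \<alpha>_def \<beta>_def A_def .
qed

text \<open>This is \<open>1 - \<rho>(a, z)\<^sup>2\<close>, which unlike \<open>\<rho>\<close> needs no square root and is quasi-multiplicative along chains of points.\<close>
definition hyp_kernel :: "complex^'n \<Rightarrow> complex^'n \<Rightarrow> real" where
  "hyp_kernel a z = (1 - (norm a)\<^sup>2) * (1 - (norm z)\<^sup>2) / (cmod (1 - herm a z))\<^sup>2"

lemma hyp_kernel_commute: "hyp_kernel a z = hyp_kernel z a"
proof -
  have "cmod (1 - herm a z) = cmod (1 - herm z a)"
    by (metis complex_cnj_diff complex_cnj_one complex_mod_cnj herm_commute)
  then show ?thesis by (simp add: hyp_kernel_def mult.commute)
qed

lemma one_minus_norm_sq_pos: "norm (z::'a::real_normed_vector) < 1 \<Longrightarrow> 1 - (norm z)\<^sup>2 > 0"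
  by (simp add: power_less_one_iff abs_square_less_1)

lemma hyp_kernel_pos: "norm a < 1 \<Longrightarrow> norm z < 1 \<Longrightarrow> hyp_kernel a z > 0"
  using one_minus_herm_nonzero[of a z] unfolding hyp_kernel_def
  by (intro divide_pos_pos mult_pos_pos one_minus_norm_sq_pos) auto

lemma norm_ball_aut_sq:
  assumes a: "norm a < 1" and z: "norm z < 1"
  shows "1 - (norm (ball_aut a z))\<^sup>2 = hyp_kernel a z"
proof -
  have c: "herm a z = cnj (herm z a)" by (rule herm_commute)
  have "(1 - herm z a) * (1 - herm a z) = of_real ((cmod (1 - herm z a))\<^sup>2)"
    unfolding c complex_norm_square by simp
  then have "complex_of_real (1 - (norm (ball_aut a z))\<^sup>2) =
     of_real ((1 - (norm a)\<^sup>2) * (1 - (norm z)\<^sup>2) / (cmod (1 - herm z a))\<^sup>2)"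
    using herm_ball_aut[OF a z z] by (simp add: herm_self)
  then have "1 - (norm (ball_aut a z))\<^sup>2 = (1 - (norm a)\<^sup>2) * (1 - (norm z)\<^sup>2) / (cmod (1 - herm z a))\<^sup>2"
    using of_real_eq_iff by blast
  then show ?thesis
    by (simp add: hyp_kernel_commute[of a z]) (simp add: hyp_kernel_def mult.commute)
qed

lemma norm_ball_aut_less:
  assumes "norm a < 1" "norm z < 1" shows "norm (ball_aut a z) < 1"
proof -
  have "(norm (ball_aut a z))\<^sup>2 < 1"
    using norm_ball_aut_sq[OF assms] hyp_kernel_pos[OF assms] by linarith
  then show ?thesis by (simp add: abs_square_less_1)
qed

lemma hyp_kernel_le_1: "norm a < 1 \<Longrightarrow> norm z < 1 \<Longrightarrow> hyp_kernel a z \<le> 1"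
  by (simp flip: norm_ball_aut_sq)

lemma pseudohyp_eq: 
  assumes "norm a < 1" "norm z < 1" shows "pseudohyp a z = sqrt (1 - hyp_kernel a z)"
  using norm_ball_aut_sq[OF assms] by (simp add: pseudohyp_def real_sqrt_unique algebra_simps)

lemma one_minus_herm_ball_aut:
  assumes a: "norm a < 1" and z: "norm z < 1"
  shows "1 - herm (ball_aut a z) a = (1 - of_real ((norm a)\<^sup>2)) / (1 - herm z a)"
  using herm_ball_aut[OF a z, of 0] by simp

lemma ball_aut_involution:
  assumes a: "norm a < 1" and z: "norm z < 1"
  shows "ball_aut a (ball_aut a z) = z"
proof (cases "a = 0")
  case True
  then show ?thesis by (simp add: ball_aut_zero_left)
next
  case False
  define s :: complex where "s = of_real (sqrt (1 - (norm a)\<^sup>2))"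
  define A :: complex where "A = of_real ((norm a)\<^sup>2)"
  define \<alpha> where "\<alpha> = herm z a"
  have A: "A \<noteq> 0" using False by (simp add: A_def)
  have "(norm a)\<^sup>2 \<noteq> 1" using one_minus_norm_sq_pos[OF a] by simp
  then have A1: "1 - A \<noteq> 0"
    unfolding A_def by (metis eq_iff_diff_eq_0 of_real_1 of_real_eq_iff)
  have "(norm a)\<^sup>2 \<le> 1" using a by (simp add: power_le_one)
  then have ss: "s * s = 1 - A"
    by (simp add: s_def A_def flip: of_real_mult)
  have nz: "1 - \<alpha> \<noteq> 0"
    unfolding \<alpha>_def using one_minus_herm_nonzero a z by blast
  define b where "b = ball_aut a z"
  \<comment> \<open>\<open>ball_aut a b\<close> depends on b only through b and
    \<open>herm b a\<close>; the latter comes from \<open>herm_ball_aut\<close> with second point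
    0.\<close>
  have b1: "1 - herm b a = (1 - A) / (1 - \<alpha>)"
    using one_minus_herm_ball_aut[OF a z] by (simp add: b_def A_def \<alpha>_def)
  have "herm b a = 1 - (1 - herm b a)" by simp
  also have "\<dots> = (A - \<alpha>) / (1 - \<alpha>)" unfolding b1 using nz by (simp add: field_simps)
  finally have b2: "herm b a = (A - \<alpha>) / (1 - \<alpha>)" .
  have bi: "b $ i = ((1 - (1 - s) * \<alpha> / A) * (a $ i) - s * (z $ i)) / (1 - \<alpha>)" for i
    
    unfolding b_def ball_aut_alt[OF False] s_def[symmetric] A_def[symmetric] \<alpha>_def[symmetric]
    by (simp only: vector_smult_component vector_minus_component times_divide_eq_left mult_1)
  have "ball_aut a b $ i = z $ i" for i
  proof -
    have "ball_aut a b $ i = ((1 - (1 - s) * herm b a / A) * a $ i - s * b $ i) / (1 - herm b a)"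
      unfolding ball_aut_alt[OF False] s_def[symmetric] A_def[symmetric]
      by (simp only: vector_smult_component vector_minus_component times_divide_eq_left mult_1)
    also have "\<dots> = ((1 - (1 - s) * ((A - \<alpha>) / (1 - \<alpha>)) / A) * a $ i -
        s * (((1 - (1 - s) * \<alpha> / A) * (a $ i) - s * (z $ i)) / (1 - \<alpha>))) * (1 - \<alpha>) / (1 - A)"
    proof -
      have "X / (1 - herm b a) = X * (1 - \<alpha>) / (1 - A)" for X unfolding b1 by simp
      then show ?thesis unfolding b2[symmetric] bi[symmetric] .
    qed
    also have "\<dots> = z $ i"
    proof -
      have "((1 - (1 - s) * ((A - \<alpha>) / (1 - \<alpha>)) / A) * a $ i -
        s * (((1 - (1 - s) * \<alpha> / A) * (a $ i) - s * (z $ i)) / (1 - \<alpha>))) * (1 - \<alpha>) * A =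
        (A * (1 - \<alpha>) - (1 - s) * (A - \<alpha>) - s * A + s * (1 - s) * \<alpha>) * a $ i + s * s * A * z $ i"
        using nz A by (simp add: divide_simps) (simp add: algebra_simps)
      also have "\<dots> = (1 - A) * z $ i * A" using ss by algebra
      finally have "((1 - (1 - s) * ((A - \<alpha>) / (1 - \<alpha>)) / A) * a $ i -
        s * (((1 - (1 - s) * \<alpha> / A) * (a $ i) - s * (z $ i)) / (1 - \<alpha>))) * (1 - \<alpha>) = z $ i * (1 - A)"
        unfolding mult_right_cancel[OF A] by (simp only: mult.commute)
      then show ?thesis unfolding nonzero_divide_eq_eq[OF A1] .
    qed
    finally show ?thesis .
  qed
  then show ?thesis by (simp add: b_def vec_eq_iff)
qed

lemma hyp_kernel_ball_aut:
  assumes a: "norm a < 1" and x: "norm x < 1" and y: "norm y < 1"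
  shows "hyp_kernel (ball_aut a x) (ball_aut a y) = hyp_kernel x y"
proof -
  have p: "1 - (norm a)\<^sup>2 > 0" by (rule one_minus_norm_sq_pos[OF a])
  have c: "cmod (1 - herm y a) = cmod (1 - herm a y)"
    by (metis complex_cnj_diff complex_cnj_one complex_mod_cnj herm_commute)
  have c': "cmod (1 - herm x a) = cmod (1 - herm a x)"
    by (metis complex_cnj_diff complex_cnj_one complex_mod_cnj herm_commute)
  have "cmod (1 - of_real ((norm a)\<^sup>2)) = 1 - (norm a)\<^sup>2"
    using p by (metis abs_of_pos norm_of_real of_real_1 of_real_diff)
  then have n: "cmod (1 - herm (ball_aut a x) (ball_aut a y)) =
     (1 - (norm a)\<^sup>2) * cmod (1 - herm x y) / (cmod (1 - herm a x) * cmod (1 - herm a y))"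
    by (simp add: herm_ball_aut[OF a x y] norm_mult norm_divide c c')
  have "hyp_kernel (ball_aut a x) (ball_aut a y) =
    hyp_kernel a x * hyp_kernel a y / (cmod (1 - herm (ball_aut a x) (ball_aut a y)))\<^sup>2"
    by (simp add: hyp_kernel_def[of "ball_aut a x"] norm_ball_aut_sq a x y)
  also have "\<dots> = hyp_kernel x y"
  proof -
    have "cmod (1 - herm a x) \<noteq> 0" "cmod (1 - herm a y) \<noteq> 0" "cmod (1 - herm x y) \<noteq> 0"
      using one_minus_herm_nonzero a x y by auto
    moreover have "(p * X / e\<^sup>2) * (p * Y / f\<^sup>2) / (p * c / (e * f))\<^sup>2 = X * Y / c\<^sup>2"
      if "p \<noteq> 0" "c \<noteq> 0" "e \<noteq> 0" "f \<noteq> 0" for p X Y c e f :: real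
      using that by (simp add: field_simps power2_eq_square)
    ultimately show ?thesis using p unfolding n hyp_kernel_def by simp
  qed
  finally show ?thesis .
qed

lemma hyp_kernel_ge_quarter:
  assumes "norm x < 1" "norm y < 1"
  shows "(1 - (norm x)\<^sup>2) * (1 - (norm y)\<^sup>2) / 4 \<le> hyp_kernel x y"
proof -
  have "(cmod (1 - herm x y))\<^sup>2 \<le> 2\<^sup>2"
    using norm_one_minus_herm_le[OF assms] by (intro power_mono) auto
  then show ?thesis unfolding hyp_kernel_def
    using one_minus_norm_sq_pos[OF assms(1)] one_minus_norm_sq_pos[OF assms(2)] one_minus_herm_nonzero[OF assms]
    by (intro divide_left_mono mult_nonneg_nonneg) (auto simp: less_imp_le)
qed

text \<open>Stands in for the triangle inequality for \<rho>. The automorphism at z sends z to 0, so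
  the two kernels on the left become 1 - |x|^2 and 1 - |x'|^2 for the images x, x' of a and y, and
  \<open>hyp_kernel_ge_quarter\<close> compares their product with the kernel of the images.\<close>

lemma hyp_kernel_triangle:
  assumes a: "norm a < 1" and z: "norm z < 1" and y: "norm y < 1"
  shows "hyp_kernel a z * hyp_kernel z y / 4 \<le> hyp_kernel a y"
  using hyp_kernel_ge_quarter[OF norm_ball_aut_less[OF z a] norm_ball_aut_less[OF z y]]
  by (simp add: hyp_kernel_ball_aut norm_ball_aut_sq assms hyp_kernel_commute[of z a])

text \<open>One factor 1 - |a| cancels because |1 - <a, z>| \<ge> 1 - |a|; the remaining factors 1 +
  |a| and 1 + |z| account for the 4. With \<open>hyp_kernel_commute\<close> it shows that distances
  to the sphere are comparable throughout a Bergman ball.\<close>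

lemma hyp_kernel_norm_compare:
  assumes a: "norm a < 1" and z: "norm z < 1" and k: "\<kappa> \<le> hyp_kernel a z" "0 \<le> \<kappa>"
  shows "\<kappa> * (1 - norm a) / 4 \<le> 1 - norm z"
proof -
  have p: "1 - (norm a)\<^sup>2 > 0" by (rule one_minus_norm_sq_pos[OF a])
  have "1 - norm a \<le> cmod (1 - herm a z)"
    using norm_one_minus_herm_ge'[OF z, of a] by (metis complex_cnj_diff complex_cnj_one complex_mod_cnj herm_commute)
  then have c: "(1 - norm a)\<^sup>2 \<le> (cmod (1 - herm a z))\<^sup>2" using a by (intro power_mono) auto
  have "\<kappa> * (cmod (1 - herm a z))\<^sup>2 \<le> (1 - (norm a)\<^sup>2) * (1 - (norm z)\<^sup>2)"
    using k(1) one_minus_herm_nonzero[OF a z] unfolding hyp_kernel_def by (simp add: field_simps)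
  then have "\<kappa> * (1 - norm a)\<^sup>2 \<le> (1 - (norm a)\<^sup>2) * (1 - (norm z)\<^sup>2)"
    using mult_left_mono[OF c k(2)] by linarith
  also have "\<dots> = (1 - norm a) * ((1 + norm a) * ((1 + norm z) * (1 - norm z)))"
    by (simp add: power2_eq_square algebra_simps)
  finally have "\<kappa> * (1 - norm a) \<le> (1 + norm a) * ((1 + norm z) * (1 - norm z))"
    using a by (simp add: power2_eq_square)
  also have "\<dots> \<le> 2 * (2 * (1 - norm z))"
    using a z by (intro mult_mono mult_right_mono) auto
  finally show ?thesis by simp
qed

lemma cmod_one_minus_herm_sq:
  "(cmod (1 - herm x y))\<^sup>2 - (1 - (norm x)\<^sup>2) * (1 - (norm y)\<^sup>2) =
   (norm (x - y))\<^sup>2 - ((norm x)\<^sup>2 * (norm y)\<^sup>2 - (cmod (herm x y))\<^sup>2)"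
proof -
  have "(cmod (1 - herm x y))\<^sup>2 = 1 - 2 * Re (herm x y) + (cmod (herm x y))\<^sup>2"
    by (simp add: cmod_power2) (simp add: power2_eq_square algebra_simps)
  moreover have "(norm (x - y))\<^sup>2 = (norm x)\<^sup>2 + (norm y)\<^sup>2 - 2 * Re (herm x y)"
    by (simp add: power2_norm_eq_inner inner_diff inner_commute[of y x] flip: inner_eq_Re_herm)
  ultimately show ?thesis by (simp add: algebra_simps)
qed

text \<open>The Gram determinant of x, y equals that of x, y - x, from which the subtracted square
  is dropped.\<close>

lemma gram_det_le:
  "(norm x)\<^sup>2 * (norm y)\<^sup>2 - (cmod (herm x y))\<^sup>2 \<le> (norm x)\<^sup>2 * (norm (x - y))\<^sup>2"
proof -
  define d where "d = y - x"
  have y: "y = x + d" by (simp add: d_def)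
  have "(norm y)\<^sup>2 = (norm x)\<^sup>2 + 2 * Re (herm x d) + (norm d)\<^sup>2"
    unfolding y by (simp add: power2_norm_eq_inner inner_add inner_commute[of d x] flip: inner_eq_Re_herm)
  moreover have "herm x y = of_real ((norm x)\<^sup>2) + herm x d"
    unfolding y by (simp add: herm_add_right herm_self)
  then have "(cmod (herm x y))\<^sup>2 = ((norm x)\<^sup>2 + Re (herm x d))\<^sup>2 + (Im (herm x d))\<^sup>2"
    by (simp add: cmod_power2)
  ultimately have "(norm x)\<^sup>2 * (norm y)\<^sup>2 - (cmod (herm x y))\<^sup>2 = (norm x)\<^sup>2 * (norm d)\<^sup>2 - (cmod (herm x d))\<^sup>2"
    by (simp add: cmod_power2) (simp add: algebra_simps power2_eq_square)
  then show ?thesis by (simp add: d_def norm_minus_commute)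
qed

lemma one_minus_hyp_kernel:
  assumes "norm x < 1" "norm y < 1"
  shows "1 - hyp_kernel x y = ((norm (x - y))\<^sup>2 - ((norm x)\<^sup>2 * (norm y)\<^sup>2 - (cmod (herm x y))\<^sup>2)) / (cmod (1 - herm x y))\<^sup>2"
  using one_minus_herm_nonzero[OF assms]
  by (simp add: cmod_one_minus_herm_sq[symmetric] hyp_kernel_def diff_divide_distrib)

lemma pseudohyp_ball_aut:
  assumes "norm a < 1" "norm x < 1" "norm y < 1"
  shows "pseudohyp (ball_aut a x) (ball_aut a y) = pseudohyp x y"
  using assms by (simp add: pseudohyp_eq norm_ball_aut_less hyp_kernel_ball_aut)

lemma one_minus_norm_ge:
  assumes "norm x < 1" shows "(1 - (norm x)\<^sup>2) / 2 \<le> 1 - norm x"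
proof -
  have "(1 - (norm x)\<^sup>2) = (1 + norm x) * (1 - norm x)" by (simp add: power2_eq_square algebra_simps)
  also have "\<dots> \<le> 2 * (1 - norm x)" using assms by (intro mult_right_mono) auto
  finally show ?thesis by simp
qed

text \<open>The Gram determinant in the numerator of \<rho>^2 is nonnegative by Cauchy-Schwarz and
  is dropped. Together with \<open>norm_diff_le_pseudohyp\<close> this compares \<rho> with
  Euclidean distance while one point stays in a fixed compact part of the ball.\<close>

lemma pseudohyp_le_norm_diff:
  assumes x: "norm x < 1" and y: "norm y < 1" and k: "\<kappa> \<le> 1 - (norm x)\<^sup>2" "0 < \<kappa>"
  shows "pseudohyp x y \<le> 2 / \<kappa> * norm (x - y)"
proof -
  have "\<kappa> / 2 \<le> (1 - (norm x)\<^sup>2) / 2" using k by simp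
  also have "\<dots> \<le> 1 - norm x" by (rule one_minus_norm_ge[OF x])
  also have "\<dots> \<le> cmod (1 - herm x y)"
    using norm_one_minus_herm_ge'[OF y, of x] by (metis complex_cnj_diff complex_cnj_one complex_mod_cnj herm_commute)
  finally have c: "(\<kappa> / 2)\<^sup>2 \<le> (cmod (1 - herm x y))\<^sup>2" using k by (intro power_mono) auto
  have "(cmod (herm x y))\<^sup>2 \<le> (norm x * norm y)\<^sup>2" by (intro power_mono cmod_herm_le) auto
  then have "1 - hyp_kernel x y \<le> (norm (x - y))\<^sup>2 / (cmod (1 - herm x y))\<^sup>2"
    unfolding one_minus_hyp_kernel[OF x y] by (intro divide_right_mono) (auto simp: power_mult_distrib)
  also have "\<dots> \<le> (norm (x - y))\<^sup>2 / (\<kappa> / 2)\<^sup>2"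
    using c k one_minus_herm_nonzero[OF x y] by (intro divide_left_mono) auto
  also have "\<dots> = (2 / \<kappa> * norm (x - y))\<^sup>2"
    by (simp add: power_divide power_mult_distrib)
  finally have "sqrt (1 - hyp_kernel x y) \<le> 2 / \<kappa> * norm (x - y)"
    using k by (intro real_le_lsqrt) auto
  then show ?thesis using pseudohyp_eq[OF x y] by simp
qed

text \<open>\<open>gram_det_le\<close> leaves at least (1 - |x|^2) |x - y|^2 of the numerator of
  \<rho>^2, and the denominator is at most 4.\<close>

lemma norm_diff_le_pseudohyp:
  assumes x: "norm x < 1" and y: "norm y < 1" and k: "\<kappa> \<le> 1 - (norm x)\<^sup>2" "0 < \<kappa>"
  shows "norm (x - y) \<le> 2 / sqrt \<kappa> * pseudohyp x y"
proof -
  have "\<kappa> * (norm (x - y))\<^sup>2 \<le> (1 - (norm x)\<^sup>2) * (norm (x - y))\<^sup>2"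
    using k by (intro mult_right_mono) auto
  also have "\<dots> \<le> (norm (x - y))\<^sup>2 - ((norm x)\<^sup>2 * (norm y)\<^sup>2 - (cmod (herm x y))\<^sup>2)"
    using gram_det_le[of x y] by (simp add: algebra_simps)
  also have "\<dots> = (1 - hyp_kernel x y) * (cmod (1 - herm x y))\<^sup>2"
    using one_minus_herm_nonzero[OF x y] by (simp add: one_minus_hyp_kernel[OF x y])
  also have "\<dots> \<le> (1 - hyp_kernel x y) * 2\<^sup>2"
    using hyp_kernel_le_1[OF x y] norm_one_minus_herm_le[OF x y] by (intro mult_left_mono power_mono) auto
  also have "\<dots> = (2 * pseudohyp x y)\<^sup>2"
    using hyp_kernel_le_1[OF x y] by (simp add: pseudohyp_eq[OF x y] power_mult_distrib)
  finally have "(sqrt \<kappa> * norm (x - y))\<^sup>2 \<le> (2 * pseudohyp x y)\<^sup>2"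
    using k by (simp add: power_mult_distrib)
  then have "sqrt \<kappa> * norm (x - y) \<le> 2 * pseudohyp x y"
    by (rule power2_le_imp_le) (simp add: pseudohyp_def)
  then show ?thesis using k by (simp add: field_simps)
qed

section \<open>Holomorphic functions on the ball\<close>

lemma bounded_linear_smult_right: "bounded_linear (\<lambda>c::complex. c *s (v::complex^'n))"
  by (rule bounded_linear_intro[of _ "norm v"])
     (simp_all add: vec_eq_iff algebra_simps norm_complex_smult)

lemma holo_onD:
  assumes "holo_on S f" "z \<in> S"
  obtains f' where "(f has_derivative f') (at z)" "\<And>c v. f' (c *s v) = c * f' v"
  using assms unfolding holo_on_def by blast

lemma holo_on_open: "holo_on S f \<Longrightarrow> open S"
  by (simp add: holo_on_def)

lemma holo_on_imp_continuous_on: 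
  assumes "holo_on S f" shows "continuous_on S f"
  by (rule continuous_at_imp_continuous_on) (metis assms has_derivative_continuous holo_onD)

lemma holo_on_const: "open S \<Longrightarrow> holo_on S (\<lambda>z. c)"
  unfolding holo_on_def by (auto intro!: exI[of _ "\<lambda>v. 0"])

lemma holo_on_nth: "open S \<Longrightarrow> holo_on S (\<lambda>z. z $ i)"
  unfolding holo_on_def
  by (auto intro!: exI[of _ "\<lambda>v. v $ i"] bounded_linear_imp_has_derivative)

lemma holo_on_add:
  assumes "holo_on S f" "holo_on S g" shows "holo_on S (\<lambda>z. f z + g z)"
  unfolding holo_on_def
proof (intro conjI ballI)
  show "open S" using assms holo_on_open by blast
  fix z assume z: "z \<in> S"
  obtain f' g' where "(f has_derivative f') (at z)" "\<And>c v. f' (c *s v) = c * f' v"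
    "(g has_derivative g') (at z)" "\<And>c v. g' (c *s v) = c * g' v"
    using holo_onD[OF assms(1) z] holo_onD[OF assms(2) z] by metis
  then show "\<exists>f'. ((\<lambda>z. f z + g z) has_derivative f') (at z) \<and> (\<forall>c v. f' (c *s v) = c * f' v)"
    by (intro exI[of _ "\<lambda>v. f' v + g' v"]) (auto intro!: derivative_intros simp: algebra_simps)
qed

lemma holo_on_mult:
  assumes "holo_on S f" "holo_on S g" shows "holo_on S (\<lambda>z. f z * g z)"
  unfolding holo_on_def
proof (intro conjI ballI)
  show "open S" using assms holo_on_open by blast
  fix z assume z: "z \<in> S"
  obtain f' g' where "(f has_derivative f') (at z)" "\<And>c v. f' (c *s v) = c * f' v"
    "(g has_derivative g') (at z)" "\<And>c v. g' (c *s v) = c * g' v"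
    using holo_onD[OF assms(1) z] holo_onD[OF assms(2) z] by metis
  then show "\<exists>f'. ((\<lambda>z. f z * g z) has_derivative f') (at z) \<and> (\<forall>c v. f' (c *s v) = c * f' v)"
    by (intro exI[of _ "\<lambda>v. f z * g' v + f' v * g z"]) (auto intro!: derivative_intros simp: algebra_simps)
qed

lemma holo_on_inverse:
  assumes "holo_on S f" "\<And>z. z \<in> S \<Longrightarrow> f z \<noteq> 0" shows "holo_on S (\<lambda>z. inverse (f z))"
  unfolding holo_on_def
proof (intro conjI ballI)
  show "open S" using assms holo_on_open by blast
  fix z assume z: "z \<in> S"
  obtain f' where "(f has_derivative f') (at z)" "\<And>c v. f' (c *s v) = c * f' v"
    using holo_onD[OF assms(1) z] by metis
  then show "\<exists>f'. ((\<lambda>z. inverse (f z)) has_derivative f') (at z) \<and> (\<forall>c v. f' (c *s v) = c * f' v)"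
    using assms(2)[OF z]
    by (intro exI[of _ "\<lambda>v. - (inverse (f z) * f' v * inverse (f z))"] conjI allI
        Deriv.has_derivative_inverse) (simp_all only: mult_ac mult_minus_left minus_mult_right simp_thms not_False_eq_True)
qed

lemma holo_on_diff:
  assumes "holo_on S f" "holo_on S g" shows "holo_on S (\<lambda>z. f z - g z)"
  using holo_on_add[OF assms(1) holo_on_mult[OF holo_on_const[OF holo_on_open[OF assms(1)], of "-1"] assms(2)]]
  by simp

lemma holo_on_divide:
  assumes "holo_on S f" "holo_on S g" "\<And>z. z \<in> S \<Longrightarrow> g z \<noteq> 0" shows "holo_on S (\<lambda>z. f z / g z)"
  using holo_on_mult[OF assms(1) holo_on_inverse[OF assms(2,3)]] by (simp add: divide_inverse)

lemma holo_on_power: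
  assumes "holo_on S f" shows "holo_on S (\<lambda>z. f z ^ k)"
  by (induction k) (auto intro: holo_on_mult holo_on_const holo_on_open assms)

lemma holo_on_sum:
  assumes "open S" "\<And>i. i \<in> I \<Longrightarrow> holo_on S (f i)" shows "holo_on S (\<lambda>z. \<Sum>i\<in>I. f i z)"
  using assms(2) by (induction I rule: infinite_finite_induct) (auto intro: holo_on_const holo_on_add assms(1))

lemma holo_on_herm: "open S \<Longrightarrow> holo_on S (\<lambda>z. herm z a)"
  unfolding herm_def by (intro holo_on_sum holo_on_mult holo_on_nth holo_on_const)

lemma open_unit_ball: "open (unit_ball :: (complex^'n) set)"
  by (simp add: unit_ball_def)

lemma holo_on_ball_aut_nth:
  assumes a: "norm a < 1"
  shows "holo_on unit_ball (\<lambda>z. ball_aut a z $ i)"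
proof -
  define P where "P z = (if a = 0 then 0 else herm z a / of_real ((norm a)\<^sup>2)) * a $ i" for z
  have "ball_aut a z $ i = (a $ i - P z - of_real (sqrt (1 - (norm a)\<^sup>2)) * (z $ i - P z)) / (1 - herm z a)" for z
    unfolding ball_aut_def Let_def P_def
    by (cases "a = 0") (simp_all only: if_True if_False simp_thms vector_smult_component vector_minus_component
      times_divide_eq_left mult_1 zero_index mult_zero_left)
  moreover have "holo_on unit_ball P"
    unfolding P_def
    by (cases "a = 0") (simp_all add: holo_on_const holo_on_mult holo_on_divide holo_on_herm open_unit_ball)
  moreover have "1 - herm z a \<noteq> 0" if "z \<in> unit_ball" for z
    using one_minus_herm_nonzero[OF _ a] that by simp
  ultimately show ?thesis
    by (simp only:) (intro holo_on_divide holo_on_diff holo_on_mult holo_on_const holo_on_herm holo_on_nth open_unit_ball)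
qed

text \<open>Complex linearity of the derivative of f turns the real chain rule along \<gamma> into a
  complex derivative. This is how one-variable facts on discs are brought to the ball.\<close>

lemma holo_on_compose_curve:
  fixes \<gamma> :: "complex \<Rightarrow> complex^'n"
  assumes f: "holo_on S f" and \<gamma>: "\<And>i. (\<lambda>l. \<gamma> l $ i) holomorphic_on U" and U: "open U" and im: "\<And>l. l \<in> U \<Longrightarrow> \<gamma> l \<in> S"
  shows "(\<lambda>l. f (\<gamma> l)) holomorphic_on U"
proof (rule holomorphic_onI)
  fix l assume l: "l \<in> U"
  have "\<exists>D. \<forall>i. ((\<lambda>l. \<gamma> l $ i) has_field_derivative D i) (at l)"
    using holomorphic_derivI[OF \<gamma> U l] by (intro exI[of _ "\<lambda>i. deriv (\<lambda>l. \<gamma> l $ i) l"]) blast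
  then obtain D where D: "\<And>i. ((\<lambda>l. \<gamma> l $ i) has_field_derivative D i) (at l)" by blast
  have "((\<lambda>l. \<Sum>i\<in>UNIV. \<gamma> l $ i *s axis i 1) has_derivative (\<lambda>h. \<Sum>i\<in>UNIV. (D i * h) *s axis i 1)) (at l)"
    using D by (intro has_derivative_sum bounded_linear.has_derivative[OF bounded_linear_smult_right])
       (simp add: has_field_derivative_def)
  then have d\<gamma>: "(\<gamma> has_derivative (\<lambda>h. h *s (\<Sum>i\<in>UNIV. D i *s axis i 1))) (at l)"
    by (simp add: basis_expansion[of "\<gamma> _"] vec.scale_sum_right mult.commute)
  obtain f' where f': "(f has_derivative f') (at (\<gamma> l))" "\<And>c v. f' (c *s v) = c * f' v"
    using holo_onD[OF f im[OF l]] by blast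
  have "((\<lambda>l. f (\<gamma> l)) has_derivative (\<lambda>h. f' (h *s (\<Sum>i\<in>UNIV. D i *s axis i 1)))) (at l)"
    by (rule has_derivative_compose[OF d\<gamma> f'(1)])
  then have "((\<lambda>l. f (\<gamma> l)) has_field_derivative f' (\<Sum>i\<in>UNIV. D i *s axis i 1)) (at l)"
    by (simp add: has_field_derivative_def f'(2) mult.commute[of _ "f' _"])
  then show "(\<lambda>l. f (\<gamma> l)) field_differentiable at l within U"
    using field_differentiable_at_within field_differentiable_def by blast
qed

lemma holo_on_borel_measurable:
  assumes "holo_on unit_ball f"
  shows "(\<lambda>z. indicator unit_ball z * f z) \<in> borel_measurable borel"
proof -
  have "(\<lambda>z. indicator unit_ball z *\<^sub>R f z) \<in> borel_measurable borel"
    using holo_on_imp_continuous_on[OF assms] borel_open[OF open_unit_ball]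
    by (intro borel_measurable_continuous_on_indicator) auto
  moreover have "(\<lambda>z. indicator unit_ball z *\<^sub>R f z) = (\<lambda>z. indicator unit_ball z * f z)"
    by (auto simp: indicator_def)
  ultimately show ?thesis by simp
qed

lemma emeasure_unit_ball:
  "0 < emeasure lborel (unit_ball :: (complex^'n) set)" "emeasure lborel (unit_ball :: (complex^'n) set) < \<infinity>"
  using emeasure_bounded_finite[of "ball (0::complex^'n) 1"] unit_ball_vol_pos[of "real DIM(complex^'n)"]
  by (auto simp: unit_ball_def emeasure_ball)

lemma unit_ball_borel [measurable]: "(unit_ball :: (complex^'n) set) \<in> sets borel"
  by (rule borel_open[OF open_unit_ball])

text \<open>The integrand is arbitrary outside the ball, so measurability is asked of its
  cut-off.\<close>

lemma nn_integral_dV: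
  fixes f :: "complex^'n \<Rightarrow> ennreal"
  assumes "(\<lambda>z. f z * indicator unit_ball z) \<in> borel_measurable borel"
  shows "(\<integral>\<^sup>+z\<in>unit_ball. f z \<partial>dV) =
    (1 / emeasure lborel (unit_ball :: (complex^'n) set)) * (\<integral>\<^sup>+z. f z * indicator unit_ball z \<partial>lborel)"
proof -
  have "(\<lambda>z. f z * indicator unit_ball z) \<in> borel_measurable (restrict_space lborel unit_ball)"
    using assms by (intro measurable_restrict_space1) simp
  then have "(\<integral>\<^sup>+z\<in>unit_ball. f z \<partial>dV) = (1 / emeasure lborel (unit_ball :: (complex^'n) set)) *
     (\<integral>\<^sup>+z. f z * indicator unit_ball z \<partial>restrict_space lborel unit_ball)"
    unfolding dV_def by (rule nn_integral_scale_measure)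
  also have "(\<integral>\<^sup>+z. f z * indicator unit_ball z \<partial>restrict_space lborel unit_ball) =
     (\<integral>\<^sup>+z. f z * indicator unit_ball z * indicator unit_ball z \<partial>lborel)"
    by (rule nn_integral_restrict_space) simp
  also have "\<dots> = (\<integral>\<^sup>+z. f z * indicator unit_ball z \<partial>lborel)"
    by (intro nn_integral_cong) (auto simp: indicator_def)
  finally show ?thesis .
qed

section \<open>Doubling radial weights\<close>

locale doubling_weight =
  fixes w :: "real \<Rightarrow> real" and ty :: "'n::finite itself"
  assumes class_D: "class_D ty w"
begin

definition wt :: "real \<Rightarrow> ennreal" where
  "wt s = ennreal (w s) * indicator {0..<1} s"

definition what :: "real \<Rightarrow> real" where
  "what r = enn2real (omega_hat w r)"

lemma w_pos: "0 \<le> s \<Longrightarrow> s < 1 \<Longrightarrow> w s > 0"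
  using class_D by (auto simp: class_D_def radial_weight_def)

lemma wt_measurable [measurable]: "wt \<in> borel_measurable borel"
proof -
  have "(\<lambda>s. indicator {0..<1} s *\<^sub>R w s) \<in> borel_measurable borel"
    using class_D by (auto simp: class_D_def radial_weight_def set_borel_measurable_def)
  then have "(\<lambda>s. ennreal (indicator {0..<1} s *\<^sub>R w s)) \<in> borel_measurable borel" by measurable
  moreover have "wt = (\<lambda>s. ennreal (indicator {0..<1} s *\<^sub>R w s))"
    by (auto simp: wt_def indicator_def fun_eq_iff)
  ultimately show ?thesis by simp
qed

lemma omega_hat_eq: "0 \<le> r \<Longrightarrow> omega_hat w r = (\<integral>\<^sup>+s. wt s * indicator {r..} s \<partial>lborel)"
  unfolding omega_hat_def wt_def by (intro nn_integral_cong) (auto simp: indicator_def)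

lemma wt_norm_ball: "wt (norm (z::complex^'n)) = ennreal (w (norm z)) * indicator unit_ball z"
  by (auto simp: wt_def indicator_def)

lemma wt_norm_finite: "(\<integral>\<^sup>+(z::complex^'n). wt (norm z) \<partial>lborel) < \<infinity>"
proof -
  have "(\<integral>\<^sup>+z\<in>(unit_ball :: (complex^'n) set). ennreal (w (norm z)) \<partial>dV) < \<infinity>"
    using class_D by (auto simp: class_D_def radial_weight_def)
  also have "(\<integral>\<^sup>+z\<in>(unit_ball :: (complex^'n) set). ennreal (w (norm z)) \<partial>dV) =
     (1 / emeasure lborel (unit_ball :: (complex^'n) set)) * (\<integral>\<^sup>+(z::complex^'n). wt (norm z) \<partial>lborel)"
    unfolding wt_norm_ball by (rule nn_integral_dV) (simp flip: wt_norm_ball)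
  finally show ?thesis
    using emeasure_unit_ball[where 'n='n]
    by (auto simp: ennreal_mult_less_top ennreal_divide_eq_0_iff less_top)
qed

lemma omega_hat_antimono: "0 \<le> r \<Longrightarrow> r \<le> r' \<Longrightarrow> omega_hat w r' \<le> omega_hat w r"
  by (simp add: omega_hat_eq) (intro nn_integral_mono, auto simp: indicator_def)

text \<open>Integrability over the ball controls \<omega> only against s^(D-1), hence away from s =
  0; this gives finiteness at 1/2. The inequality of \<open>D_hat\<close> at r = 0 bounds the full
  tail by the one from 1/2.\<close>

lemma omega_hat_finite: 
  assumes "0 \<le> r" shows "omega_hat w r < \<infinity>"
proof -
  let ?D = "DIM(complex^'n)"
  let ?A = "{y::complex^'n. 1/2 \<le> norm y \<and> norm y < 1}"
  define K where "K = (\<integral>\<^sup>+(y::complex^'n). ennreal (1 / norm y ^ (?D + 1)) * indicator ?A y \<partial>lborel)"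
  define H where "H = (\<integral>\<^sup>+s. wt s * ennreal (s ^ (?D - 1)) * indicator {0<..} s \<partial>lborel)"
  have meas: "?A \<in> sets borel" by measurable
  have eq: "(\<integral>\<^sup>+(z::complex^'n). wt (norm z) \<partial>lborel) = H * K"
    using nn_integral_homogeneous_norm[of "\<lambda>_::complex^'n. 1" wt] by (simp add: H_def K_def)
  \<comment> \<open>The angular factor must be positive for finiteness of the product H K to bound
    H; the annulus contains a ball.\<close>
  have "K \<noteq> 0"
  proof
    assume "K = 0"
    define y0 :: "complex^'n" where "y0 = (SOME b. b \<in> Basis)"
    have "norm y0 = 1" by (simp add: y0_def SOME_Basis)
    have bA: "ball ((3/4) *\<^sub>R y0) (1/4) \<subseteq> ?A"
    proof
      fix y assume "y \<in> ball ((3/4) *\<^sub>R y0) (1/4)"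
      then have d: "norm ((3/4) *\<^sub>R y0 - y) < 1/4" by (simp add: dist_norm)
      have n: "norm ((3/4) *\<^sub>R y0) = 3/4" using \<open>norm y0 = 1\<close> by simp
      have "\<bar>norm ((3/4) *\<^sub>R y0) - norm y\<bar> \<le> norm ((3/4) *\<^sub>R y0 - y)" by (rule norm_triangle_ineq3)
      with d n show "y \<in> ?A" by auto
    qed
    have "emeasure lborel (ball ((3/4) *\<^sub>R y0) (1/4)) \<le> (\<integral>\<^sup>+y. indicator (ball ((3/4) *\<^sub>R y0) (1/4)) y \<partial>lborel)"
      by simp
    also have "\<dots> \<le> K" unfolding K_def
    proof (intro nn_integral_mono)
      fix y :: "complex^'n"
      have "1 \<le> 1 / norm y ^ (?D + 1)" if "y \<in> ?A"
      proof -
        have y: "0 < norm y" "norm y \<le> 1" using that by auto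
        have "norm y ^ (?D + 1) \<le> 1" by (rule power_le_one) (use y in auto)
        moreover have "0 < norm y ^ (?D + 1)" by (rule zero_less_power) (use y in auto)
        ultimately show ?thesis by simp
      qed
      then show "indicator (ball ((3/4) *\<^sub>R y0) (1/4)) y \<le> ennreal (1 / norm y ^ (?D + 1)) * indicator ?A y"
        using bA by (auto simp: indicator_def)
    qed
    finally have "emeasure lborel (ball ((3/4) *\<^sub>R y0) (1/4)) = 0" using \<open>K = 0\<close> by simp
    then show False using unit_ball_vol_pos[of "real ?D"] by (simp add: emeasure_ball)
  qed
  with eq wt_norm_finite have "H < \<infinity>"
    by (metis ennreal_mult_eq_top_iff infinity_ennreal_def less_top)
  have "omega_hat w (1/2) \<le> ennreal (2 ^ (?D - 1)) * H"
    unfolding omega_hat_eq[of "1/2", simplified] H_def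
  proof (subst nn_integral_cmult[symmetric], simp, intro nn_integral_mono)
    fix s :: real
    show "wt s * indicator {1/2..} s \<le> ennreal (2 ^ (?D - 1)) * (wt s * ennreal (s ^ (?D - 1)) * indicator {0<..} s)"
    proof (cases "s \<ge> 1/2")
      case True
      then have "1 \<le> (2 * s) ^ (?D - 1)" by (intro one_le_power) auto
      then have "1 \<le> ennreal (2 ^ (?D - 1)) * ennreal (s ^ (?D - 1))"
        using True by (simp add: power_mult_distrib flip: ennreal_mult)
      then have "wt s * 1 \<le> wt s * (ennreal (2 ^ (?D - 1)) * ennreal (s ^ (?D - 1)))"
        by (intro mult_left_mono) auto
      with True show ?thesis by (simp add: mult_ac)
    qed (simp add: indicator_def)
  qed
  also have "\<dots> < \<infinity>" using \<open>H < \<infinity>\<close> by (simp add: ennreal_mult_less_top)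
  finally have half: "omega_hat w (1/2) < \<infinity>" .
  obtain C where "\<forall>r\<in>{0..<1}. omega_hat w r \<le> ennreal C * omega_hat w ((1 + r) / 2)"
    using class_D by (auto simp: class_D_def D_hat_def)
  then have "omega_hat w 0 \<le> ennreal C * omega_hat w ((1 + 0) / 2)" by (rule bspec) simp
  also have "\<dots> < \<infinity>" using half by (simp add: ennreal_mult_less_top)
  finally show ?thesis using omega_hat_antimono[of 0 r] assms by (metis order_le_less_trans order_refl)
qed

lemma what_nonneg [simp]: "0 \<le> what r"
  by (simp add: what_def)

lemma ennreal_what: "0 \<le> r \<Longrightarrow> ennreal (what r) = omega_hat w r"
  unfolding what_def using omega_hat_finite by (simp add: less_top)

lemma what_antimono: "0 \<le> r \<Longrightarrow> r \<le> r' \<Longrightarrow> what r' \<le> what r"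
  unfolding what_def using omega_hat_antimono omega_hat_finite by (intro enn2real_mono) auto

lemma what_pos:
  assumes "0 \<le> r" "r < 1" shows "what r > 0"
proof (rule ccontr)
  assume "\<not> what r > 0"
  then have "omega_hat w r = 0" using ennreal_what[OF assms(1)] by (simp add: not_less flip: ennreal_eq_0_iff)
  then have "AE s in lborel. wt s * indicator {r..} s = 0"
    using assms by (subst (asm) omega_hat_eq) (auto simp: nn_integral_0_iff_AE)
  moreover have "wt s * indicator {r..} s \<noteq> 0" if "s \<in> {r..<1}" for s
    using that w_pos[of s] assms by (auto simp: wt_def indicator_def)
  ultimately have "AE s in lborel. s \<notin> {r..<1}" by (auto elim: eventually_mono)
  then have "emeasure lborel {r..<1} = 0"
    by (subst (asm) AE_iff_measurable[where N="{r..<1}"]) auto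
  with assms show False by simp
qed

text \<open>The tail integral as a function of the distance t = 1 - r to the sphere. Clamping at t =
  1 makes doubling hold for all t > 0, so dyadic iterations need no upper limit.\<close>

definition tail_mass :: "real \<Rightarrow> real" where "tail_mass t = what (max 0 (1 - t))"

lemma tail_mass_pos: "t > 0 \<Longrightarrow> tail_mass t > 0" unfolding tail_mass_def by (intro what_pos) auto
lemma tail_mass_mono: "t \<le> t' \<Longrightarrow> tail_mass t \<le> tail_mass t'" unfolding tail_mass_def by (intro what_antimono) auto

lemma tail_mass_doubling: "\<exists>m. \<forall>t>0. tail_mass (2 * t) \<le> 2 ^ m * tail_mass t"
proof -
  obtain C where C: "C \<ge> 1" "\<And>r. 0 \<le> r \<Longrightarrow> r < 1 \<Longrightarrow> omega_hat w r \<le> ennreal C * omega_hat w ((1 + r) / 2)"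
    using class_D by (auto simp: class_D_def D_hat_def)
  have C': "what r \<le> C * what ((1 + r) / 2)" if "0 \<le> r" "r < 1" for r
  proof -
    have "ennreal (what r) \<le> ennreal (C * what ((1 + r) / 2))"
      using C(2)[OF that] C(1) that by (simp add: ennreal_what ennreal_mult)
    then show ?thesis using C(1) by (subst (asm) ennreal_le_iff) auto
  qed
  \<comment> \<open>The constant is enlarged to a power of 2, so that its iterates combine with
    dyadic scales.\<close>
  obtain m where m: "C < 2 ^ m" using real_arch_pow[of 2 C] by auto
  have "tail_mass (2 * t) \<le> 2 ^ m * tail_mass t" if t: "t > 0" for t
  proof -
    have "tail_mass (2 * t) \<le> C * tail_mass t"
    proof (cases "2 * t \<le> 1")
      case True
      then have "(1 + (1 - 2 * t)) / 2 = 1 - t" by (simp add: field_simps)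
      then show ?thesis using C'[of "1 - 2 * t"] True t by (simp only: tail_mass_def) simp
    next
      case False
      then have "tail_mass (2 * t) = what 0" by (simp add: tail_mass_def)
      also have "\<dots> \<le> C * what (1/2)" using C'[of 0] by simp
      also have "\<dots> \<le> C * tail_mass t"
        unfolding tail_mass_def using C(1) False by (intro mult_left_mono what_antimono) (auto simp: max_def)
      finally show ?thesis .
    qed
    also have "\<dots> \<le> 2 ^ m * tail_mass t" using m tail_mass_pos[OF t] by (intro mult_right_mono) auto
    finally show ?thesis .
  qed
  then show ?thesis by blast
qed

definition doubling_exp :: nat where "doubling_exp = (SOME m. \<forall>t>0. tail_mass (2 * t) \<le> 2 ^ m * tail_mass t)"

lemma tail_mass_double: "t > 0 \<Longrightarrow> tail_mass (2 * t) \<le> 2 ^ doubling_exp * tail_mass t"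
  using someI_ex[OF tail_mass_doubling] unfolding doubling_exp_def by blast

lemma tail_mass_iterate: "t > 0 \<Longrightarrow> tail_mass (2 ^ j * t) \<le> 2 ^ (doubling_exp * j) * tail_mass t"
proof (induction j)
  case (Suc j)
  have "tail_mass (2 ^ Suc j * t) \<le> 2 ^ doubling_exp * tail_mass (2 ^ j * t)"
    using tail_mass_double[of "2 ^ j * t"] Suc.prems by (simp add: mult.assoc)
  also have "\<dots> \<le> 2 ^ doubling_exp * (2 ^ (doubling_exp * j) * tail_mass t)" using Suc by (intro mult_left_mono) auto
  finally show ?case by (simp add: power_add)
qed simp

lemma tail_mass_scale: "\<exists>C\<ge>1. \<forall>t>0. tail_mass (L * t) \<le> C * tail_mass t"
proof -
  obtain j where j: "L < 2 ^ j" using real_arch_pow[of 2 L] by auto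
  have "tail_mass (L * t) \<le> 2 ^ (doubling_exp * j) * tail_mass t" if "t > 0" for t
    using tail_mass_iterate[OF that, of j] tail_mass_mono[of "L * t" "2 ^ j * t"] j that by (simp add: mult_right_mono)
  then show ?thesis by (intro exI[of _ "2 ^ (doubling_exp * j)"]) auto
qed

text \<open>Doubling until 2^j t lies between 1 and 2 takes about log(1/t) steps, so the tail decays
  no faster than a power of t. This is what lets a high power of a test function beat
  \<open>ball_mass\<close> near the sphere.\<close>

lemma tail_mass_lower:
  assumes "0 < t" "t \<le> 1" shows "tail_mass 1 * (t / 2) ^ doubling_exp \<le> tail_mass t"
proof -
  define j where "j = (LEAST j::nat. 1 \<le> 2 ^ j * t)"
  obtain j0 where "1 / t < 2 ^ j0" using real_arch_pow[of 2 "1 / t"] by auto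
  then have "1 \<le> 2 ^ j0 * t" using assms by (simp add: field_simps)
  then have j: "1 \<le> 2 ^ j * t" unfolding j_def by (rule LeastI)
  have j2: "2 ^ j * t \<le> 2"
  proof (cases j)
    case (Suc k)
    then have "\<not> 1 \<le> 2 ^ k * t" unfolding j_def using not_less_Least by (metis lessI)
    then show ?thesis using Suc by simp
  qed (use assms in simp)
  have "tail_mass 1 \<le> tail_mass (2 ^ j * t)" using j by (rule tail_mass_mono)
  also have "\<dots> \<le> 2 ^ (doubling_exp * j) * tail_mass t" using assms by (intro tail_mass_iterate)
  finally have 1: "tail_mass 1 \<le> (2 ^ j) ^ doubling_exp * tail_mass t" by (simp add: power_mult[symmetric] mult.commute)
  have "tail_mass 1 * (t / 2) ^ doubling_exp \<le> ((2 ^ j) ^ doubling_exp * tail_mass t) * (t / 2) ^ doubling_exp"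
    using 1 assms by (intro mult_right_mono) auto
  also have "\<dots> = (2 ^ j * t / 2) ^ doubling_exp * tail_mass t" by (simp add: power_mult_distrib power_divide)
  also have "\<dots> \<le> 1 * tail_mass t"
    using j2 assms tail_mass_pos[of t] by (intro mult_right_mono power_le_one) auto
  finally show ?thesis by simp
qed

text \<open>The use of \<open>D_check\<close>: the tail beyond r' = 1 - (1 - r)/K is at most 1/C of
  the tail beyond r, so the annulus between them carries at least the share 1 - 1/C. Hence the
  constant C/(C - 1).\<close>

lemma what_check:
  "\<exists>C K. K > 1 \<and> C \<ge> 0 \<and> (\<forall>r. 0 \<le> r \<and> r < 1 \<longrightarrow>
     omega_hat w r \<le> ennreal C * (\<integral>\<^sup>+s. wt s * indicator {r..<1 - (1 - r) / K} s \<partial>lborel))"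
proof -
  obtain C K where CK: "C > 1" "K > 1" "\<And>r. 0 \<le> r \<Longrightarrow> r < 1 \<Longrightarrow> omega_hat w r \<ge> ennreal C * omega_hat w (1 - (1 - r) / K)"
    using class_D by (auto simp: class_D_def D_check_def)
  have "omega_hat w r \<le> ennreal (C / (C - 1)) * (\<integral>\<^sup>+s. wt s * indicator {r..<1 - (1 - r) / K} s \<partial>lborel)"
    if r: "0 \<le> r" "r < 1" for r
  proof -
    define r' where "r' = 1 - (1 - r) / K"
    have "(1 - r) / K \<le> 1 - r" using divide_left_mono[of 1 K "1 - r"] CK r by simp
    then have r': "r \<le> r'" "0 \<le> r'" using r by (auto simp: r'_def)
    define J where "J = (\<integral>\<^sup>+s. wt s * indicator {r..<r'} s \<partial>lborel)"
    have "omega_hat w r = (\<integral>\<^sup>+s. wt s * indicator {r..<r'} s + wt s * indicator {r'..} s \<partial>lborel)"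
      using r r' by (subst omega_hat_eq) (auto intro!: nn_integral_cong simp: indicator_def)
    also have "\<dots> = J + omega_hat w r'"
      using r' by (subst nn_integral_add) (auto simp: J_def omega_hat_eq)
    finally have eq: "omega_hat w r = J + omega_hat w r'" .
    then have "J \<le> omega_hat w r" by simp
    then have "J < \<infinity>" using omega_hat_finite[OF r(1)] by (metis order_le_less_trans)
    then obtain x where x: "J = ennreal x" "x \<ge> 0" by (metis ennreal_cases less_irrefl infinity_ennreal_def)
    have nn: "what r' \<ge> 0" by (simp add: what_def)
    have e1: "what r = x + what r'"
      using eq x nn r r' by (simp add: ennreal_what[symmetric] what_def[symmetric] flip: ennreal_plus)
    have "ennreal (C * what r') \<le> ennreal (what r)"
      using CK(3)[OF r] CK(1) nn r r' by (simp add: ennreal_what[symmetric] ennreal_mult r'_def[symmetric])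
    then have e2: "C * what r' \<le> what r"
      by (metis e1 add_nonneg_nonneg ennreal_le_iff nn x(2))
    have "C * what r' \<le> x + what r'" using e1 e2 by simp
    then have "what r * (C - 1) \<le> C * x" using e1 by (simp add: algebra_simps)
    then have "what r \<le> C / (C - 1) * x" using CK(1) by (simp add: field_simps)
    then have "ennreal (what r) \<le> ennreal (C / (C - 1)) * ennreal x"
      using CK(1) x(2) by (simp add: ennreal_leI flip: ennreal_mult)
    then show ?thesis using ennreal_what[OF r(1)] x by (simp add: J_def r'_def)
  qed
  then show ?thesis using CK by (intro exI[of _ "C / (C - 1)"] exI[of _ K]) auto
qed

text \<open>Comparable to the \<open>\<omega>\<close>-mass of a regularized Bergman ball centred at \<open>a\<close>.\<close>
definition ball_mass :: "complex^'n \<Rightarrow> real" where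
  "ball_mass a = (1 - norm a) ^ CARD('n) * tail_mass (1 - norm a)"

lemma ball_mass_pos: "norm a < 1 \<Longrightarrow> ball_mass a > 0"
  unfolding ball_mass_def by (simp add: tail_mass_pos)

lemma ball_mass_compare:
  assumes "\<kappa> > 0"
  shows "\<exists>C\<ge>1. \<forall>a z. norm a < 1 \<longrightarrow> norm z < 1 \<longrightarrow> \<kappa> \<le> hyp_kernel a z \<longrightarrow> ball_mass z \<le> C * ball_mass a"
proof -
  obtain C where C: "C \<ge> 1" "\<And>t. t > 0 \<Longrightarrow> tail_mass ((4 / \<kappa>) * t) \<le> C * tail_mass t" using tail_mass_scale by blast
  let ?C = "max 1 ((4 / \<kappa>) ^ CARD('n) * C)"
  have "ball_mass z \<le> ?C * ball_mass a" if az: "norm a < 1" "norm z < 1" "\<kappa> \<le> hyp_kernel a z" for a z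
  proof -
    have "\<kappa> \<le> hyp_kernel z a" using az(3) by (simp add: hyp_kernel_commute)
    then have "\<kappa> * (1 - norm z) / 4 \<le> 1 - norm a"
      using hyp_kernel_norm_compare[of z a \<kappa>] az assms by simp
    then have le: "1 - norm z \<le> (4 / \<kappa>) * (1 - norm a)" using assms by (simp add: field_simps)
    have "ball_mass z \<le> ((4 / \<kappa>) * (1 - norm a)) ^ CARD('n) * tail_mass ((4 / \<kappa>) * (1 - norm a))"
      unfolding ball_mass_def using le az assms tail_mass_pos by (intro mult_mono power_mono tail_mass_mono) (auto simp: less_imp_le)
    also have "\<dots> \<le> ((4 / \<kappa>) * (1 - norm a)) ^ CARD('n) * (C * tail_mass (1 - norm a))"
      using C(2)[of "1 - norm a"] az assms by (intro mult_left_mono) auto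
    also have "\<dots> = (4 / \<kappa>) ^ CARD('n) * C * ball_mass a"
      by (simp only: ball_mass_def power_mult_distrib mult_ac)
    also have "\<dots> \<le> ?C * ball_mass a" using ball_mass_pos[OF az(1)] by (intro mult_right_mono) auto
    finally show ?thesis .
  qed
  then show ?thesis by (intro exI[of _ ?C]) auto
qed

end

section \<open>Volumes of nonisotropic sets\<close>

text \<open>A Householder reflection. A unimodular multiple b of e has real product with the axis
  vector x, and reflecting in the hyperplane orthogonal to b - x then carries b to x.\<close>

lemma unitary_to_axis:
  fixes e :: "complex^'n" and k :: 'n
  assumes e: "norm e = 1"
  shows "\<exists>T. linear T \<and> (\<forall>z. norm (T z) = norm z) \<and> (\<forall>z. T z $ k = herm z e)"
proof -
  define c where "c = (if e $ k = 0 then 1 else cnj (sgn (e $ k)))"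
  have c: "cmod c = 1" by (simp add: c_def norm_sgn)
  have ce: "c * e $ k = of_real (cmod (e $ k))"
    by (auto simp: c_def sgn_eq complex_norm_square[symmetric] power2_eq_square mult.commute[of "cnj _"])
  define b where "b = c *s e"
  define x :: "complex^'n" where "x = axis k 1"
  have hx: "herm z x = z $ k" for z
  proof -
    have "herm z x = (\<Sum>i\<in>UNIV. if i = k then z $ i else 0)"
      unfolding herm_def x_def axis_def by (intro sum.cong) auto
    then show ?thesis by simp
  qed
  define h where "h = b - x"
  define H where "H = herm h h"
  define \<beta> where "\<beta> = complex_of_real (cmod (e $ k))"
  have bx: "herm b x = \<beta>" by (simp add: hx b_def ce \<beta>_def)
  have xb: "herm x b = \<beta>" using herm_commute[of x b] by (simp add: bx \<beta>_def)
  have bb: "herm b b = 1" using e c by (simp add: herm_self b_def norm_complex_smult)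
  have xx: "herm x x = 1" by (simp add: hx) (simp add: x_def)
  have H: "H = 2 - 2 * \<beta>" by (simp add: H_def h_def herm_linear bb xx bx xb)
  have bh: "herm b h = 1 - \<beta>" by (simp add: h_def herm_linear bb bx)
  define U where "U z = (if h = 0 then z else z - (2 * herm z h / H) *s h)" for z
  have H0: "H \<noteq> 0" if "h \<noteq> 0" using that by (simp add: H_def herm_self)
  have Ub: "U b = x"
  proof (cases "h = 0")
    case False
    have "2 * herm b h / H = 1" using H0[OF False] unfolding H bh by (simp add: field_simps)
    then show ?thesis using False by (simp add: U_def h_def)
  qed (simp add: U_def h_def)
  have Uherm: "herm (U z) (U y) = herm z y" for z y
  proof (cases "h = 0")
    case False
    have cH: "cnj H = H" by (simp add: H_def herm_self)
    have hy: "herm h y = cnj (herm y h)" by (rule herm_commute)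
    have hh: "herm h h = H" by (simp add: H_def)
    show ?thesis using False H0[OF False]
      by (simp add: U_def herm_linear hh cH hy field_simps)
  qed (simp add: U_def)
  have Unorm: "norm (U z) = norm z" for z
  proof -
    have "complex_of_real ((norm (U z))\<^sup>2) = of_real ((norm z)\<^sup>2)" using Uherm[of z z] by (simp only: herm_self)
    then have "(norm (U z))\<^sup>2 = (norm z)\<^sup>2" using of_real_eq_iff by blast
    then show ?thesis by simp
  qed
  define T where "T z = U (c *s z)" for z
  have "linear T"
  proof (rule linearI)
    show "T (y + z) = T y + T z" for y z
      by (simp add: T_def U_def herm_linear vec_eq_iff algebra_simps add_divide_distrib)
    show "T (r *\<^sub>R z) = r *\<^sub>R T z" for r z
    proof -
      have r: "r *\<^sub>R z = of_real r *s z" for z :: "complex^'n"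
        by (simp add: vec_eq_iff scaleR_conv_of_real[where 'a=complex])
      show ?thesis unfolding r by (simp add: T_def U_def herm_linear vec_eq_iff algebra_simps)
    qed
  qed
  moreover have "norm (T z) = norm z" for z by (simp add: T_def Unorm norm_complex_smult c)
  moreover have "T z $ k = herm z e" for z
  proof -
    have "T z $ k = herm (U (c *s z)) (U b)" by (simp add: T_def Ub hx)
    also have "\<dots> = c * cnj c * herm z e" by (simp add: Uherm b_def herm_linear)
    also have "c * cnj c = 1" using c by (simp add: complex_norm_square[symmetric])
    finally show ?thesis by simp
  qed
  ultimately show ?thesis by blast
qed

lemma prod_Basis_complex_vec:
  fixes f :: "complex^'n \<Rightarrow> real"
  shows "(\<Prod>b\<in>Basis. f b) = (\<Prod>i\<in>UNIV. f (axis i 1) * f (axis i \<i>))"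
proof -
  have "(\<Prod>b\<in>Basis. f b) = (\<Prod>i\<in>UNIV. prod f (\<Union>u\<in>Basis. {axis i u}))"
    unfolding Basis_vec_def
    by (rule prod.UNION_disjoint) (auto simp: axis_eq_axis)
  also have "\<dots> = (\<Prod>i\<in>UNIV. f (axis i 1) * f (axis i \<i>))"
    by (intro prod.cong refl) (simp add: Basis_complex_def axis_eq_axis complex_eq_iff)
  finally show ?thesis .
qed

lemma mem_cbox_complex_vec:
  fixes v :: "complex^'n"
  shows "z \<in> cbox (-v) v \<longleftrightarrow> (\<forall>i. \<bar>Re (z $ i)\<bar> \<le> Re (v $ i) \<and> \<bar>Im (z $ i)\<bar> \<le> Im (v $ i))"
  unfolding mem_box Basis_vec_def Basis_complex_def
  by (auto simp: inner_axis abs_le_iff inner_complex_def; smt (verit))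

definition axis_box :: "'n \<Rightarrow> real \<Rightarrow> real \<Rightarrow> real \<Rightarrow> complex^'n" where
  "axis_box k A B D = (\<chi> i. if i = k then Complex A B else Complex D D)"

lemma emeasure_axis_box:
  assumes "0 \<le> A" "0 \<le> B" "0 \<le> D"
  shows "emeasure lborel (cbox (- axis_box k A B D) (axis_box k A B D :: complex^'n)) =
    ennreal ((2 * A) * (2 * B) * (4 * D\<^sup>2) ^ (CARD('n) - 1))"
proof -
  let ?v = "axis_box k A B D :: complex^'n"
  have inn: "?v \<bullet> axis i 1 = Re (?v $ i)" "?v \<bullet> axis i \<i> = Im (?v $ i)" for i
    by (simp_all add: inner_axis inner_complex_def)
  have "(\<Prod>b\<in>Basis. (?v - (- ?v)) \<bullet> b) = (\<Prod>i\<in>UNIV. (2 * Re (?v $ i)) * (2 * Im (?v $ i)))"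
  proof -
    have "(?v - (- ?v)) \<bullet> b = 2 * (?v \<bullet> b)" for b
      by (simp only: diff_minus_eq_add inner_add_left mult_2)
    then show ?thesis by (simp only: prod_Basis_complex_vec inn)
  qed
  also have "\<dots> = (2 * Re (?v $ k)) * (2 * Im (?v $ k)) * (\<Prod>i\<in>UNIV - {k}. (2 * Re (?v $ i)) * (2 * Im (?v $ i)))"
    by (subst prod.remove[of UNIV k]) auto
  also have "(\<Prod>i\<in>UNIV - {k}. (2 * Re (?v $ i)) * (2 * Im (?v $ i))) = (\<Prod>i\<in>UNIV - {k}. 4 * D\<^sup>2)"
    by (intro prod.cong refl) (auto simp: axis_box_def power2_eq_square)
  also have "\<dots> = (4 * D\<^sup>2) ^ (CARD('n) - 1)" by (simp add: card_Diff_singleton)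
  finally have eq: "(\<Prod>b\<in>Basis. (?v - (- ?v)) \<bullet> b) = (2 * A) * (2 * B) * (4 * D\<^sup>2) ^ (CARD('n) - 1)"
    by (simp add: axis_box_def)
  have "b \<in> Basis \<Longrightarrow> (- ?v) \<bullet> b \<le> ?v \<bullet> b" for b
  proof -
    have "0 \<le> Re (?v $ i)" "0 \<le> Im (?v $ i)" for i using assms by (simp_all add: axis_box_def)
    then show "b \<in> Basis \<Longrightarrow> (- ?v) \<bullet> b \<le> ?v \<bullet> b"
      by (auto simp: Basis_vec_def Basis_complex_def inn)
  qed
  then show ?thesis
    by (subst emeasure_lborel_cbox) (auto simp only: eq)
qed

lemma emeasure_lborel_isometry_vimage:
  fixes T :: "'a::euclidean_space \<Rightarrow> 'a"
  assumes T: "linear T" "\<And>x. norm (T x) = norm x" and S: "S \<in> sets borel"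
  shows "emeasure lborel (T -` S) = emeasure lborel S"
proof -
  have [measurable]: "T \<in> borel_measurable borel"
    using T(1) by (intro borel_measurable_continuous_onI linear_continuous_on linear_linear[THEN iffD2])
  have m: "T -` S \<in> sets borel" using S measurable_sets[of T borel borel S] by simp
  have "emeasure lborel (T -` S) = (\<integral>\<^sup>+x. indicator S (T x) \<partial>lborel)"
  proof -
    have "(\<lambda>x. indicator S (T x)) = (indicator (T -` S) :: 'a \<Rightarrow> ennreal)"
      by (auto simp: fun_eq_iff indicator_def)
    then show ?thesis using m by simp
  qed
  also have "\<dots> = emeasure lborel S"
    using nn_integral_lborel_isometry[OF T, of "indicator S"] S by simp
  finally show ?thesis .
qed

lemma continuous_on_herm [continuous_intros]:
  "continuous_on S f \<Longrightarrow> continuous_on S g \<Longrightarrow> continuous_on S (\<lambda>x. herm (f x) (g x))"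
  unfolding herm_def by (intro continuous_intros)

lemma borel_measurable_herm [measurable]:
  fixes f g :: "'a \<Rightarrow> complex^'n"
  assumes [measurable]: "f \<in> borel_measurable M" "g \<in> borel_measurable M"
  shows "(\<lambda>x. herm (f x) (g x)) \<in> borel_measurable M"
proof -
  have "(\<lambda>x::(complex^'n)\<times>(complex^'n). herm (fst x) (snd x)) \<in> borel_measurable (borel \<Otimes>\<^sub>M borel)"
    unfolding borel_prod by (intro borel_measurable_continuous_onI continuous_intros)
  from measurable_compose[OF _ this, of "\<lambda>x. (f x, g x)" M] show ?thesis by simp
qed

text \<open>After rotating b to a coordinate axis, the condition makes the imaginary part along b at
  most t and the squared distance of z from the complex line of b at most 2t. The box with
  half-widths 1 and t along b and sqrt(2t) in the other directions has volume of order t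
  t^(n-1).\<close>

lemma emeasure_cone_le:
  fixes b :: "complex^'n"
  assumes b: "norm b = 1" and t: "0 < t"
  shows "emeasure lborel {z. norm z < 1 \<and> cmod (of_real (norm z) - herm z b) < t * norm z}
     \<le> ennreal (8 ^ CARD('n) * t ^ CARD('n))"
proof -
  obtain k :: 'n where True by simp
  obtain T where T: "linear T" "\<And>z. norm (T z) = norm z" "\<And>z. T z $ k = herm z b"
    using unitary_to_axis[OF b, of k] by blast
  let ?v = "axis_box k 1 t (sqrt (2 * t)) :: complex^'n"
  have "{z. norm z < 1 \<and> cmod (of_real (norm z) - herm z b) < t * norm z} \<subseteq> T -` cbox (- ?v) ?v"
  proof safe
    fix z assume z: "norm z < 1" "cmod (of_real (norm z) - herm z b) < t * norm z"
    define y where "y = T z"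
    have ny: "norm y = norm z" by (simp add: y_def T)
    have yk: "y $ k = herm z b" by (simp add: y_def T)
    have lt: "t * norm z \<le> t" using z t by (simp add: mult_left_le)
    have c: "cmod (of_real (norm z) - y $ k) \<le> t" using z lt by (simp add: yk)
    have k1: "\<bar>Re (y $ k)\<bar> \<le> 1"
      using abs_Re_le_cmod[of "y $ k"] Finite_Cartesian_Product.norm_nth_le[of y k] z ny by linarith
    have k2: "\<bar>Im (y $ k)\<bar> \<le> t"
      using abs_Im_le_cmod[of "of_real (norm z) - y $ k"] c by simp
    have "norm z - cmod (y $ k) \<le> t"
      using norm_triangle_ineq2[of "of_real (norm z)" "y $ k"] c by simp
    then have d: "(norm z - cmod (y $ k)) * (norm z + cmod (y $ k)) \<le> t * 2"
      using z Finite_Cartesian_Product.norm_nth_le[of y k] ny t by (intro mult_mono) auto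
    have j: "\<bar>Re (y $ i)\<bar> \<le> sqrt (2 * t) \<and> \<bar>Im (y $ i)\<bar> \<le> sqrt (2 * t)" if "i \<noteq> k" for i
    proof -
      have "(cmod (y $ i))\<^sup>2 + (cmod (y $ k))\<^sup>2 = (\<Sum>l\<in>{i,k}. (cmod (y $ l))\<^sup>2)" using that by simp
      also have "\<dots> \<le> (\<Sum>l\<in>UNIV. (cmod (y $ l))\<^sup>2)" by (intro sum_mono2) auto
      also have "\<dots> = (norm y)\<^sup>2" by (simp add: norm_vec_def L2_set_def sum_nonneg)
      finally have "(cmod (y $ i))\<^sup>2 \<le> 2 * t" using d ny by (simp add: power2_eq_square algebra_simps)
      then have "cmod (y $ i) \<le> sqrt (2 * t)" using real_le_rsqrt by blast
      then show ?thesis using abs_Re_le_cmod[of "y $ i"] abs_Im_le_cmod[of "y $ i"] by linarith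
    qed
    have "y \<in> cbox (- ?v) ?v"
      unfolding mem_cbox_complex_vec using k1 k2 j by (auto simp: axis_box_def)
    then show "z \<in> T -` cbox (- ?v) ?v" by (simp add: y_def)
  qed
  then have "emeasure lborel {z. norm z < 1 \<and> cmod (of_real (norm z) - herm z b) < t * norm z}
     \<le> emeasure lborel (T -` cbox (- ?v) ?v)"
  proof (rule emeasure_mono)
    have "T \<in> borel_measurable borel"
      using T(1) by (intro borel_measurable_continuous_onI linear_continuous_on linear_linear[THEN iffD2])
    then show "T -` cbox (- ?v) ?v \<in> sets lborel"
      using measurable_sets[of T borel borel "cbox (- ?v) ?v"] by simp
  qed
  also have "\<dots> = ennreal ((2 * 1) * (2 * t) * (4 * (sqrt (2 * t))\<^sup>2) ^ (CARD('n) - 1))"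
    using t by (subst emeasure_lborel_isometry_vimage[OF T(1,2)], simp) (rule emeasure_axis_box, auto)
  also have "\<dots> \<le> ennreal (8 ^ CARD('n) * t ^ CARD('n))"
  proof (rule ennreal_leI)
    obtain m where m: "CARD('n) = Suc m" using zero_less_card_finite[where 'a='n] gr0_implies_Suc by blast
    have "(2 * 1) * (2 * t) * (4 * (sqrt (2 * t))\<^sup>2) ^ (CARD('n) - 1) = 4 * (t * (8 ^ m * t ^ m))"
      using t m by (simp add: power_mult_distrib)
    also have "\<dots> \<le> 8 * (t * (8 ^ m * t ^ m))" using t by (intro mult_right_mono) auto
    finally show "(2 * 1) * (2 * t) * (4 * (sqrt (2 * t))\<^sup>2) ^ (CARD('n) - 1) \<le> 8 ^ CARD('n) * t ^ CARD('n)"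
      using m by (simp add: mult_ac)
  qed
  finally show ?thesis .
qed

text \<open>A circular neighbourhood of \<open>0\<close> whose translate to \<open>z\<close> is comparable to a Bergman ball:
  of size \<open>1 - |z|\<close> in the direction of \<open>z\<close> and of size \<open>(1 - |z|)\<^sup>1\<^sup>/\<^sup>2\<close> in the orthogonal ones.\<close>
definition ellipsoid :: "complex^'n \<Rightarrow> (complex^'n) set" where
  "ellipsoid z = {y. cmod (herm y z) < (1 - norm z) / 6 \<and> (norm y)\<^sup>2 < (1 - norm z) / 6}"

lemma ellipsoid_borel [measurable]: "ellipsoid z \<in> sets borel"
  unfolding ellipsoid_def by measurable

lemma ellipsoid_balanced: "y \<in> ellipsoid z \<Longrightarrow> cmod c \<le> 1 \<Longrightarrow> c *s y \<in> ellipsoid z"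
proof -
  assume y: "y \<in> ellipsoid z" and c: "cmod c \<le> 1"
  have "cmod (herm (c *s y) z) \<le> 1 * cmod (herm y z)"
    unfolding herm_smult_left norm_mult using c by (intro mult_right_mono) auto
  also have "\<dots> < (1 - norm z) / 6" using y by (simp add: ellipsoid_def)
  finally have 1: "cmod (herm (c *s y) z) < (1 - norm z) / 6" .
  have "(norm (c *s y))\<^sup>2 \<le> (1 * norm y)\<^sup>2"
    unfolding norm_complex_smult using c by (intro power_mono mult_right_mono) auto
  also have "\<dots> < (1 - norm z) / 6" using y by (simp add: ellipsoid_def)
  finally show ?thesis using 1 by (simp add: ellipsoid_def)
qed

lemma ellipsoid_translate:
  assumes z: "norm z < 1" and y: "y \<in> ellipsoid z"
  shows "norm (z + y) < 1" "1/10 \<le> hyp_kernel z (z + y)"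
proof -
  define d where "d = 1 - norm z"
  have d: "d > 0" using z by (simp add: d_def)
  have h: "cmod (herm y z) < d / 6" "(norm y)\<^sup>2 < d / 6" using y by (auto simp: ellipsoid_def d_def)
  have dz: "d \<le> 1 - (norm z)\<^sup>2" "1 - (norm z)\<^sup>2 \<le> 2 * d"
    using z mult_left_le[of "norm z" "norm z"] one_minus_norm_ge[OF z] by (auto simp: d_def power2_eq_square)
  have "(norm (z + y))\<^sup>2 = (norm z)\<^sup>2 + 2 * Re (herm y z) + (norm y)\<^sup>2"
    by (simp add: power2_norm_eq_inner inner_add inner_commute[of z y] flip: inner_eq_Re_herm)
  also have "\<dots> \<le> (norm z)\<^sup>2 + 2 * (d / 6) + d / 6"
    using h abs_Re_le_cmod[of "herm y z"] by linarith
  finally have n: "d / 2 \<le> 1 - (norm (z + y))\<^sup>2" using dz by simp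
  then have "(norm (z + y))\<^sup>2 < 1" using d by linarith
  then show n1: "norm (z + y) < 1" by (simp add: abs_square_less_1)
  have "1 - herm z (z + y) = of_real (1 - (norm z)\<^sup>2) - cnj (herm y z)"
    using herm_commute[of z y] by (simp add: herm_add_right herm_self)
  then have "cmod (1 - herm z (z + y)) \<le> cmod (of_real (1 - (norm z)\<^sup>2)) + cmod (herm y z)"
    by (metis complex_mod_cnj norm_triangle_ineq4)
  also have "cmod (of_real (1 - (norm z)\<^sup>2)) = 1 - (norm z)\<^sup>2"
    using dz d by (simp only: norm_of_real)
  finally have "cmod (1 - herm z (z + y)) \<le> 13 / 6 * d" using dz h by simp
  then have c: "(cmod (1 - herm z (z + y)))\<^sup>2 \<le> (13 / 6 * d)\<^sup>2" by (intro power_mono) auto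
  \<comment> \<open>The choice of 1/10: (13/6)^2 / 10 = 169/360 < 1/2.\<close>
  have "1 / 10 * (cmod (1 - herm z (z + y)))\<^sup>2 \<le> 1 / 10 * (13 / 6 * d)\<^sup>2" using c by simp
  also have "\<dots> \<le> d * (d / 2)" by (simp add: power2_eq_square)
  also have "\<dots> \<le> (1 - (norm z)\<^sup>2) * (1 - (norm (z + y))\<^sup>2)" using dz n d by (intro mult_mono) auto
  finally show "1/10 \<le> hyp_kernel z (z + y)"
    unfolding hyp_kernel_def using one_minus_herm_nonzero[OF z n1] by (subst le_divide_eq) auto
qed

text \<open>With d = 1 - |z|, a rotated box with half-width d/24 in the complex direction of z and
  sqrt(d/(24 n)) in the others fits inside; its volume is of order d^2 d^(n-1).\<close>

lemma emeasure_ellipsoid_ge: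
  fixes z :: "complex^'n"
  assumes z: "norm z < 1"
  shows "ennreal ((1 - norm z) ^ (CARD('n) + 1) / (144 * (6 * real CARD('n)) ^ CARD('n))) \<le> emeasure lborel (ellipsoid z)"
proof -
  obtain k :: 'n where True by simp
  define d where "d = 1 - norm z"
  have d: "0 < d" "d \<le> 1" using z by (auto simp: d_def)
  define e where "e = (if z = 0 then axis k 1 else (1 / norm z) *\<^sub>R z)"
  have e: "norm e = 1" 
    using norm_Basis[of "axis k 1 :: complex^'n"] by (auto simp: e_def Basis_complex_def)
  have zr: "z = of_real (norm z) *s e"
    by (auto simp: e_def vec_eq_iff scaleR_conv_of_real[where 'a=complex])
  have hz: "cmod (herm y z) \<le> cmod (herm y e)" for y
  proof -
    have "herm y z = of_real (norm z) * herm y e" by (subst zr) (simp add: herm_smult_right)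
    then show ?thesis using z by (simp add: norm_mult mult_left_le_one_le)
  qed
  obtain T where T: "linear T" "\<And>z. norm (T z) = norm z" "\<And>z. T z $ k = herm z e"
    using unitary_to_axis[OF e, of k] by blast
  let ?D = "sqrt (d / (24 * CARD('n)))"
  let ?v = "axis_box k (d / 24) (d / 24) ?D :: complex^'n"
  have "T -` cbox (- ?v) ?v \<subseteq> ellipsoid z"
  proof
    fix y assume "y \<in> T -` cbox (- ?v) ?v"
    then have b: "\<bar>Re (T y $ i)\<bar> \<le> Re (?v $ i)" "\<bar>Im (T y $ i)\<bar> \<le> Im (?v $ i)" for i
      by (auto simp: mem_cbox_complex_vec)
    have k: "cmod (T y $ k) \<le> d / 12"
      using cmod_le[of "T y $ k"] b[of k] by (simp add: axis_box_def)
    then have 1: "cmod (herm y z) < (1 - norm z) / 6" using hz[of y] T(3)[of y] d by (simp add: d_def)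
    have i: "(cmod (T y $ i))\<^sup>2 \<le> d / (12 * CARD('n))" if "i \<noteq> k" for i
    proof -
      have "(Re (T y $ i))\<^sup>2 \<le> ?D\<^sup>2" "(Im (T y $ i))\<^sup>2 \<le> ?D\<^sup>2"
        using b[of i] that by (auto simp: axis_box_def abs_le_square_iff[symmetric] simp del: real_sqrt_pow2)
      moreover have "?D\<^sup>2 = d / (24 * CARD('n))" using d by simp
      ultimately show ?thesis by (simp add: cmod_power2)
    qed
    have "(norm (T y))\<^sup>2 = (\<Sum>i\<in>UNIV. (cmod (T y $ i))\<^sup>2)"
      by (simp add: norm_vec_def L2_set_def sum_nonneg)
    also have "\<dots> = (cmod (T y $ k))\<^sup>2 + (\<Sum>i\<in>UNIV - {k}. (cmod (T y $ i))\<^sup>2)"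
      by (simp add: sum.remove)
    also have "\<dots> \<le> (d / 12)\<^sup>2 + (\<Sum>i\<in>UNIV - {k}. d / (12 * CARD('n)))"
      using k i by (intro add_mono power_mono sum_mono) auto
    also have "\<dots> \<le> d / 144 + (\<Sum>i\<in>(UNIV::'n set). d / (12 * CARD('n)))"
      using d by (intro add_mono sum_mono2) (auto simp: power2_eq_square mult_left_le)
    also have "\<dots> < d / 6" using d by simp
    finally have "(norm y)\<^sup>2 < (1 - norm z) / 6" by (simp add: T(2) d_def)
    with 1 show "y \<in> ellipsoid z" by (simp add: ellipsoid_def)
  qed
  then have "emeasure lborel (T -` cbox (- ?v) ?v) \<le> emeasure lborel (ellipsoid z)"
    by (rule emeasure_mono) simp
  also have "emeasure lborel (T -` cbox (- ?v) ?v) = ennreal ((2 * (d / 24)) * (2 * (d / 24)) * (4 * ?D\<^sup>2) ^ (CARD('n) - 1))"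
    using d by (subst emeasure_lborel_isometry_vimage[OF T(1,2)], simp) (rule emeasure_axis_box, auto)
  finally have 1: "ennreal ((2 * (d / 24)) * (2 * (d / 24)) * (4 * ?D\<^sup>2) ^ (CARD('n) - 1)) \<le> emeasure lborel (ellipsoid z)" .
  obtain m where m: "CARD('n) = Suc m" using zero_less_card_finite[where 'a='n] gr0_implies_Suc by blast
  define q where "q = 6 * real CARD('n)"
  have q: "q \<ge> 1" using m by (simp add: q_def)
  have "4 * ?D\<^sup>2 = d / q" using d by (simp add: q_def)
  then have "(2 * (d / 24)) * (2 * (d / 24)) * (4 * ?D\<^sup>2) ^ (CARD('n) - 1) = d ^ (CARD('n) + 1) / (144 * q ^ m)"
    using m by (simp add: power_divide)
  moreover have "d ^ (CARD('n) + 1) / (144 * q ^ CARD('n)) \<le> d ^ (CARD('n) + 1) / (144 * q ^ m)"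
    using d q m by (intro divide_left_mono mult_left_mono power_increasing mult_pos_pos) auto
  ultimately have "ennreal (d ^ (CARD('n) + 1) / (144 * q ^ CARD('n))) \<le> ennreal ((2 * (d / 24)) * (2 * (d / 24)) * (4 * ?D\<^sup>2) ^ (CARD('n) - 1))"
    by (intro ennreal_leI) simp
  from order_trans[OF this 1] show ?thesis by (simp add: d_def q_def)
qed

section \<open>Local means over Bergman balls\<close>

text \<open>The Bergman ball with centre \<open>a\<close> and pseudohyperbolic radius \<open>(1 - \<kappa>)\<^sup>1\<^sup>/\<^sup>2\<close>.\<close>
definition hball :: "real \<Rightarrow> complex^'n \<Rightarrow> (complex^'n) set" where
  "hball \<kappa> a = {z. norm z < 1 \<and> \<kappa> \<le> hyp_kernel a z}"

lemma borel_measurable_hyp_kernel [measurable]: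
  fixes f g :: "'a \<Rightarrow> complex^'n"
  assumes [measurable]: "f \<in> borel_measurable M" "g \<in> borel_measurable M"
  shows "(\<lambda>x. hyp_kernel (f x) (g x)) \<in> borel_measurable M"
  unfolding hyp_kernel_def by measurable

lemma hball_borel [measurable]: "hball \<kappa> a \<in> sets borel"
  unfolding hball_def by measurable

lemma hball_mono: "\<kappa>' \<le> \<kappa> \<Longrightarrow> hball \<kappa> a \<subseteq> hball \<kappa>' a"
  by (auto simp: hball_def)

definition locint :: "real \<Rightarrow> real \<Rightarrow> (complex^'n \<Rightarrow> complex) \<Rightarrow> complex^'n \<Rightarrow> ennreal" where
  "locint p \<kappa> f z = (\<integral>\<^sup>+y. ennreal (cmod (f y) powr p) * indicator (hball \<kappa> z) y \<partial>lborel)"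

text \<open>The volume of a Bergman ball centred at \<open>z\<close> is comparable to \<open>(1 - |z|)\<^sup>n\<^sup>+\<^sup>1\<close>.\<close>
definition locmean :: "real \<Rightarrow> real \<Rightarrow> (complex^'n \<Rightarrow> complex) \<Rightarrow> complex^'n \<Rightarrow> real" where
  "locmean p \<kappa> f z = enn2real (locint p \<kappa> f z) / (1 - norm z) ^ (CARD('n) + 1)"

lemma holo_bounded_on_cball:
  fixes f :: "complex^'n \<Rightarrow> complex"
  assumes f: "holo_on unit_ball f" and s: "s < 1"
  shows "\<exists>B>0. \<forall>y. norm y \<le> s \<longrightarrow> cmod (f y) \<le> B"
proof -
  have "continuous_on (cball 0 s) f"
    using holo_on_imp_continuous_on[OF f] s by (rule_tac continuous_on_subset) auto
  then have "bounded (f ` cball 0 s)" by (intro compact_imp_bounded compact_continuous_image) auto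
  then show ?thesis unfolding bounded_pos by fastforce
qed

lemma hball_subset_cball:
  assumes "norm z < 1" "0 < \<kappa>" "y \<in> hball \<kappa> z" shows "norm y \<le> 1 - \<kappa> * (1 - norm z) / 4"
  using hyp_kernel_norm_compare[of z y \<kappa>] assms by (simp add: hball_def)

lemma locint_le:
  fixes f :: "complex^'n \<Rightarrow> complex"
  assumes "\<And>y. y \<in> hball \<kappa> z \<Longrightarrow> cmod (f y) \<le> B" "p > 0" "B \<ge> 0"
  shows "locint p \<kappa> f z \<le> ennreal (B powr p) * emeasure lborel (unit_ball :: (complex^'n) set)"
proof -
  have "locint p \<kappa> f z \<le> (\<integral>\<^sup>+y. ennreal (B powr p) * indicator (unit_ball :: (complex^'n) set) y \<partial>lborel)"
    unfolding locint_def
  proof (rule nn_integral_mono)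
    fix y :: "complex^'n"
    show "ennreal (cmod (f y) powr p) * indicator (hball \<kappa> z) y \<le> ennreal (B powr p) * indicator unit_ball y"
    proof (cases "y \<in> hball \<kappa> z")
      case True
      then have "cmod (f y) powr p \<le> B powr p" using assms by (intro powr_mono2) auto
      with True show ?thesis by (simp add: hball_def ennreal_leI)
    qed simp
  qed
  also have "\<dots> = ennreal (B powr p) * emeasure lborel (unit_ball :: (complex^'n) set)"
    by (rule nn_integral_cmult_indicator) simp
  finally show ?thesis .
qed

lemma locint_finite:
  fixes f :: "complex^'n \<Rightarrow> complex"
  assumes f: "holo_on unit_ball f" and z: "norm z < 1" and k: "0 < \<kappa>" and p: "p > 0"
  shows "locint p \<kappa> f z < \<infinity>"
proof -
  obtain B where "B > 0" "\<And>y. norm y \<le> 1 - \<kappa> * (1 - norm z) / 4 \<Longrightarrow> cmod (f y) \<le> B"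
    using holo_bounded_on_cball[OF f, of "1 - \<kappa> * (1 - norm z) / 4"] z k by auto
  then have "locint p \<kappa> f z \<le> ennreal (B powr p) * emeasure lborel (unit_ball :: (complex^'n) set)"
    using hball_subset_cball[OF z k] p by (intro locint_le) auto
  also have "\<dots> < \<infinity>"
    using emeasure_unit_ball(2)[where 'n='n] by (simp add: ennreal_mult_less_top)
  finally show ?thesis .
qed

lemma locmean_nonneg: "norm z < 1 \<Longrightarrow> locmean p \<kappa> f z \<ge> 0"
  by (simp add: locmean_def)

lemma ennreal_locmean:
  fixes z :: "complex^'n"
  assumes "holo_on unit_ball f" "norm z < 1" "0 < \<kappa>" "p > 0"
  shows "ennreal (locmean p \<kappa> f z * (1 - norm z) ^ (CARD('n) + 1)) = locint p \<kappa> f z"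
  using locint_finite[OF assms] assms(2) by (simp add: locmean_def)

text \<open>\<open>ellipsoid z\<close> is circular and its complex discs about 0 translate into the
  ball, so \<open>nn_integral_powr_dilate_le\<close> with s = 0 compares |f(z)|^p with the integral
  of |f|^p over the translate by z.\<close>

lemma submean_point:
  fixes f :: "complex^'n \<Rightarrow> complex"
  assumes f: "holo_on unit_ball f" and z: "norm z < 1" and p: "p > 0"
    and A [measurable]: "A \<in> sets borel" and sub: "\<And>y. y \<in> ellipsoid z \<Longrightarrow> z + y \<in> A"
    and AB: "A \<subseteq> unit_ball"
  shows "ennreal (cmod (f z) powr p) * ennreal ((1 - norm z) ^ (CARD('n) + 1) / (144 * (6 * real CARD('n)) ^ CARD('n)))
     \<le> (\<integral>\<^sup>+y. ennreal (cmod (f y) powr p) * indicator A y \<partial>lborel)"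
proof -
  \<comment> \<open>f is unconstrained outside the ball; cutting it off by zero yields a Borel
    function on the whole space. The same cut-off recurs below.\<close>
  define f0 where "f0 y = indicator unit_ball y * f y" for y
  have [measurable]: "f0 \<in> borel_measurable borel" unfolding f0_def by (rule holo_on_borel_measurable[OF f])
  define g where "g y = f0 (z + y)" for y
  have [measurable]: "g \<in> borel_measurable borel" unfolding g_def by measurable
  have "(\<integral>\<^sup>+y. ennreal (cmod (g (of_real 0 *s y)) powr p) * indicator (ellipsoid z) y \<partial>lborel) \<le>
        (\<integral>\<^sup>+y. ennreal (cmod (g y) powr p) * indicator (ellipsoid z) y \<partial>lborel)"
  proof (rule nn_integral_powr_dilate_le[OF _ _ p])
    show "indicator (ellipsoid z) (c *s y) = (indicator (ellipsoid z) y :: ennreal)" if "cmod c = 1" for c y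
    proof -
      have "y \<in> ellipsoid z" if "c *s y \<in> ellipsoid z"
      proof -
        have "cnj c *s (c *s y) \<in> ellipsoid z" 
          by (rule ellipsoid_balanced[OF that]) (use \<open>cmod c = 1\<close> in simp)
        moreover have "cnj c * c = 1" using \<open>cmod c = 1\<close> by (simp add: complex_norm_square[symmetric] mult.commute)
        ultimately show ?thesis by (simp add: vector_smult_assoc)
      qed
      then show ?thesis using ellipsoid_balanced[of y z c] that by (auto simp: indicator_def)
    qed
    fix y :: "complex^'n" assume "indicator (ellipsoid z) y \<noteq> (0::ennreal)"
    then have y: "y \<in> ellipsoid z" by (auto simp: indicator_def split: if_splits)
    define U where "U = {l::complex. norm (z + l *s y) < 1}"
    have "open U" unfolding U_def by (intro open_Collect_less continuous_intros)
    moreover have "cball 0 1 \<subseteq> U"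
      using ellipsoid_translate(1)[OF z ellipsoid_balanced[OF y]] by (auto simp: U_def)
    moreover have "(\<lambda>l. g (l *s y)) holomorphic_on U"
    proof -
      have "(\<lambda>l. f (z + l *s y)) holomorphic_on U"
        using \<open>open U\<close> by (intro holo_on_compose_curve[OF f]) (auto simp: U_def intro!: holomorphic_intros)
      then show ?thesis
        by (rule holomorphic_transform) (auto simp: g_def f0_def U_def)
    qed
    ultimately show "\<exists>U. open U \<and> cball 0 1 \<subseteq> U \<and> (\<lambda>l. g (l *s y)) holomorphic_on U" by blast
  qed auto
  also have "(\<integral>\<^sup>+y. ennreal (cmod (g (of_real 0 *s y)) powr p) * indicator (ellipsoid z) y \<partial>lborel) =
     ennreal (cmod (f z) powr p) * emeasure lborel (ellipsoid z)"
    using z by (simp add: g_def f0_def nn_integral_cmult_indicator)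
  also have "(\<integral>\<^sup>+y. ennreal (cmod (g y) powr p) * indicator (ellipsoid z) y \<partial>lborel) \<le>
     (\<integral>\<^sup>+y. ennreal (cmod (f0 (z + y)) powr p) * indicator A (z + y) \<partial>lborel)"
    using sub by (intro nn_integral_mono) (auto simp: g_def indicator_def)
  also have "\<dots> = (\<integral>\<^sup>+y. ennreal (cmod (f0 y) powr p) * indicator A y \<partial>lborel)"
    by (rule nn_integral_lborel_translate[of "\<lambda>y. ennreal (cmod (f0 y) powr p) * indicator A y"]) measurable
  also have "\<dots> = (\<integral>\<^sup>+y. ennreal (cmod (f y) powr p) * indicator A y \<partial>lborel)"
    using AB by (intro nn_integral_cong) (auto simp: f0_def indicator_def)
  finally have 1: "ennreal (cmod (f z) powr p) * emeasure lborel (ellipsoid z) \<le>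
    (\<integral>\<^sup>+y. ennreal (cmod (f y) powr p) * indicator A y \<partial>lborel)" .
  show ?thesis
    by (rule order_trans[OF mult_left_mono[OF emeasure_ellipsoid_ge[OF z]] 1]) simp
qed

text \<open>The ellipsoid at y stays in a larger ball about z: chaining the kernels \<kappa> and
  1/10 through \<open>hyp_kernel_triangle\<close> gives \<kappa>/40. The factor (4/\<kappa>)^(n+1)
  adjusts the volume normalization from y to z.\<close>

lemma locmean_bound:
  fixes f :: "complex^'n \<Rightarrow> complex"
  assumes k: "0 < \<kappa>" and p: "p > 0"
  shows "\<exists>C>0. \<forall>(f::complex^'n \<Rightarrow> complex) z y. holo_on unit_ball f \<longrightarrow> norm z < 1 \<longrightarrow> y \<in> hball \<kappa> z \<longrightarrow>
     cmod (f y) powr p \<le> C * locmean p (\<kappa> / 40) f z"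
proof -
  define c where "c = 144 * (6 * real CARD('n)) ^ CARD('n)"
  have c: "c > 0" by (simp add: c_def)
  define C where "C = c * (4 / \<kappa>) ^ (CARD('n) + 1)"
  have "cmod (f y) powr p \<le> C * locmean p (\<kappa> / 40) f z"
    if f: "holo_on unit_ball f" and z: "norm z < 1" and y: "y \<in> hball \<kappa> z" for f :: "complex^'n \<Rightarrow> complex" and z y
  proof -
    have y1: "norm y < 1" "\<kappa> \<le> hyp_kernel z y" using y by (auto simp: hball_def)
    have sub: "y + x \<in> hball (\<kappa> / 40) z" if x: "x \<in> ellipsoid y" for x
    proof -
      have "\<kappa> * (1 / 10) / 4 \<le> hyp_kernel z y * hyp_kernel y (y + x) / 4"
        using y1 k ellipsoid_translate[OF y1(1) x] by (intro divide_right_mono mult_mono) auto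
      also have "\<dots> \<le> hyp_kernel z (y + x)"
        using z y1 ellipsoid_translate[OF y1(1) x] by (intro hyp_kernel_triangle) auto
      finally show ?thesis using ellipsoid_translate[OF y1(1) x] by (simp add: hball_def)
    qed
    have "ennreal (cmod (f y) powr p) * ennreal ((1 - norm y) ^ (CARD('n) + 1) / c) \<le> locint p (\<kappa> / 40) f z"
      unfolding locint_def c_def by (rule submean_point[OF f y1(1) p _ sub]) (auto simp: hball_def)
    also have "\<dots> = ennreal (locmean p (\<kappa> / 40) f z * (1 - norm z) ^ (CARD('n) + 1))"
      using f z k p by (intro ennreal_locmean[symmetric]) auto
    finally have 1: "cmod (f y) powr p * ((1 - norm y) ^ (CARD('n) + 1) / c) \<le> locmean p (\<kappa> / 40) f z * (1 - norm z) ^ (CARD('n) + 1)"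
      using y1 c z locmean_nonneg[OF z] by (simp add: ennreal_mult[symmetric] del: power_Suc)
    have "\<kappa> * (1 - norm z) / 4 \<le> 1 - norm y" using hyp_kernel_norm_compare[OF z y1] k by simp
    then have "(\<kappa> * (1 - norm z) / 4) ^ (CARD('n) + 1) \<le> (1 - norm y) ^ (CARD('n) + 1)"
      using z k by (intro power_mono) auto
    then have "cmod (f y) powr p * ((\<kappa> * (1 - norm z) / 4) ^ (CARD('n) + 1) / c) \<le> cmod (f y) powr p * ((1 - norm y) ^ (CARD('n) + 1) / c)"
      using c by (intro mult_left_mono divide_right_mono) auto
    with 1 have "cmod (f y) powr p * ((\<kappa> * (1 - norm z) / 4) ^ (CARD('n) + 1) / c) \<le> locmean p (\<kappa> / 40) f z * (1 - norm z) ^ (CARD('n) + 1)"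
      by linarith
    moreover have "(\<kappa> * (1 - norm z) / 4) ^ (CARD('n) + 1) / c = (1 - norm z) ^ (CARD('n) + 1) * (1 / C)"
      using k by (simp only: C_def power_divide power_mult_distrib) (simp add: field_simps)
    ultimately have "(cmod (f y) powr p * (1 / C)) * (1 - norm z) ^ (CARD('n) + 1) \<le> locmean p (\<kappa> / 40) f z * (1 - norm z) ^ (CARD('n) + 1)"
      by (simp only: mult_ac)
    then have "cmod (f y) powr p * (1 / C) \<le> locmean p (\<kappa> / 40) f z"
      by (rule mult_right_le_imp_le) (use z in simp)
    then show ?thesis using c k by (simp add: C_def field_simps)
  qed
  moreover have "C > 0" using c k by (simp add: C_def)
  ultimately show ?thesis by blast
qed

lemma hyp_kernel_self:
  assumes "norm z < 1" shows "hyp_kernel z z = 1"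
proof -
  have "ball_aut z z = 0"
    using ball_aut_involution[OF assms, of 0] by simp
  then show ?thesis using norm_ball_aut_sq[OF assms assms] by simp
qed

text \<open>The Schwarz lemma on the disc about 0 of radius s = (1 + r)/2 in the direction of the
  image of y under the automorphism at z. There f differs from f(z) by at most 2S, so dividing by 3S
  gives a map into the open unit disc; 6 comes from 3/s with s > 1/2.\<close>

lemma diff_le_pseudohyp_of_bound:
  fixes f :: "complex^'n \<Rightarrow> complex"
  assumes f: "holo_on unit_ball f" and z: "norm z < 1" and y: "norm y < 1"
    and r: "0 < r" "r < 1" "pseudohyp z y < r"
    and S: "\<And>x. x \<in> hball (1 - ((1 + r) / 2)\<^sup>2) z \<Longrightarrow> cmod (f x) \<le> S" and S0: "S > 0"
  shows "cmod (f z - f y) \<le> 6 * S * pseudohyp z y"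
proof (cases "z = y")
  case False
  define s where "s = (1 + r) / 2"
  have s: "1/2 < s" "r < s" "s < 1" using r by (auto simp: s_def)
  define x where "x = ball_aut z y"
  define \<rho> where "\<rho> = pseudohyp z y"
  have \<rho>: "\<rho> = norm x" by (simp add: \<rho>_def pseudohyp_def x_def)
  have yx: "ball_aut z x = y" unfolding x_def by (rule ball_aut_involution[OF z y])
  have "x \<noteq> 0" using False yx by auto
  then have \<rho>0: "\<rho> > 0" by (simp add: \<rho>)
  define e where "e = (1 / of_real \<rho>) *s x"
  have e: "norm e = 1" using \<rho>0 by (simp add: e_def norm_complex_smult norm_divide \<rho>)
  have xe: "x = of_real \<rho> *s e" using \<rho>0 by (simp add: e_def vector_smult_assoc)
  have holk: "(\<lambda>l. f (ball_aut z ((of_real s * l) *s e))) holomorphic_on ball 0 1"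
  proof (rule holo_on_compose_curve[OF f])
    have n: "norm ((of_real s * l) *s e) < 1" if "l \<in> ball 0 1" for l
    proof -
      have "s * cmod l \<le> 1 * cmod l" using s by (intro mult_right_mono) auto
      then show ?thesis using that s by (simp add: norm_complex_smult e norm_mult)
    qed
    show "ball_aut z ((of_real s * l) *s e) \<in> unit_ball" if "l \<in> ball 0 1" for l
      using norm_ball_aut_less[OF z n[OF that]] by simp
    show "(\<lambda>l. ball_aut z ((of_real s * l) *s e) $ i) holomorphic_on ball 0 1" for i
      using n by (intro holo_on_compose_curve[OF holo_on_ball_aut_nth[OF z]]) (auto intro!: holomorphic_intros)
  qed simp
  define K where "K l = (f (ball_aut z ((of_real s * l) *s e)) - f z) / of_real (3 * S)" for l
  have "K holomorphic_on ball 0 1"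
    unfolding K_def using S0 by (intro holomorphic_intros holk) auto
  moreover have "K 0 = 0" by (simp add: K_def)
  moreover have "cmod (K l) < 1" if l: "cmod l < 1" for l
  proof -
    let ?x = "(of_real s * l) *s e"
    have nx: "norm ?x = s * cmod l" using s by (simp add: norm_complex_smult e norm_mult)
    have "s * cmod l \<le> s" using l s by (intro mult_left_le) auto
    then have nx': "norm ?x \<le> s" "norm ?x < 1" using nx s by linarith+
    have "(norm ?x)\<^sup>2 \<le> s\<^sup>2" using nx' by (intro power_mono) auto
    then have "1 - s\<^sup>2 \<le> hyp_kernel z (ball_aut z ?x)"
      using norm_ball_aut_sq[OF z norm_ball_aut_less[OF z nx'(2)]] ball_aut_involution[OF z nx'(2)] by simp
    then have 1: "cmod (f (ball_aut z ?x)) \<le> S"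
      using norm_ball_aut_less[OF z nx'(2)] by (intro S) (simp add: hball_def s_def)
    have "s\<^sup>2 \<le> 1" using s by (simp add: power_le_one)
    then have "z \<in> hball (1 - s\<^sup>2) z"
      using z hyp_kernel_self[OF z] by (simp add: hball_def)
    then have 2: "cmod (f z) \<le> S" by (intro S) (simp add: s_def)
    have "cmod (f (ball_aut z ?x) - f z) < 3 * S"
      using norm_triangle_ineq4[of "f (ball_aut z ?x)" "f z"] 1 2 S0 by linarith
    then show ?thesis using S0 by (simp add: K_def norm_divide)
  qed
  moreover have "cmod (of_real (\<rho> / s) :: complex) < 1" using \<rho>0 s r by (simp add: \<rho>_def norm_divide)
  ultimately have "cmod (K (of_real (\<rho> / s))) \<le> cmod (of_real (\<rho> / s) :: complex)"
    by (rule Schwarz_Lemma(1))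
  moreover have "K (of_real (\<rho> / s)) = (f y - f z) / of_real (3 * S)"
    using s by (simp add: K_def xe[symmetric] yx)
  ultimately have "cmod (f y - f z) / (3 * S) \<le> \<rho> / s"
    using \<rho>0 s S0 by (simp add: norm_divide)
  also have "\<dots> \<le> 2 * \<rho>" using s \<rho>0 by (simp add: field_simps)
  finally show ?thesis using S0 by (simp add: \<rho>_def field_simps norm_minus_commute)
qed (use S0 in \<open>simp add: pseudohyp_def\<close>)

text \<open>The bound S is taken as the p-th root of a local mean that controls |f|^p on the whole
  ball of radius (1 + r)/2 about z; in this way both estimates share one \<kappa>.\<close>

lemma locmean_diff:
  assumes r: "0 < r" "r < 1" and p: "p > 0"
  shows "\<exists>C \<kappa>. C > 0 \<and> 0 < \<kappa> \<and> \<kappa> < 1 \<and> (\<forall>(f::complex^'n \<Rightarrow> complex) z y. holo_on unit_ball f \<longrightarrow> norm z < 1 \<longrightarrow> norm y < 1 \<longrightarrow>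
     cmod (f z) powr p \<le> C * locmean p \<kappa> f z \<and>
     (pseudohyp z y < r \<longrightarrow> cmod (f z - f y) powr p \<le> C * (pseudohyp z y powr p * locmean p \<kappa> f z)))"
proof -
  define \<kappa>' where "\<kappa>' = 1 - ((1 + r) / 2)\<^sup>2"
  have "((1 + r) / 2)\<^sup>2 < 1" "0 < ((1 + r) / 2)\<^sup>2" using r by (auto simp: power_less_one_iff abs_square_less_1)
  then have k': "0 < \<kappa>'" "\<kappa>' < 1" by (auto simp: \<kappa>'_def)
  obtain C where C: "C > 0" "\<And>(f::complex^'n \<Rightarrow> complex) z y. holo_on unit_ball f \<Longrightarrow> norm z < 1 \<Longrightarrow> y \<in> hball \<kappa>' z \<Longrightarrow>
     cmod (f y) powr p \<le> C * locmean p (\<kappa>' / 40) f z"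
    using locmean_bound[OF k'(1) p] by blast
  have self: "z \<in> hball \<kappa>' z" if "norm z < 1" for z :: "complex^'n"
    using that k' hyp_kernel_self[OF that] by (simp add: hball_def)
  let ?C = "max C (6 powr p * C)"
  have 1: "cmod (f z) powr p \<le> ?C * locmean p (\<kappa>' / 40) f z"
    if "holo_on unit_ball f" "norm z < 1" for f and z :: "complex^'n"
  proof -
    have "C * locmean p (\<kappa>' / 40) f z \<le> ?C * locmean p (\<kappa>' / 40) f z"
      using locmean_nonneg[OF that(2)] by (intro mult_right_mono) auto
    then show ?thesis using C(2)[OF that self[OF that(2)]] by linarith
  qed
  have 2: "cmod (f z - f y) powr p \<le> ?C * (pseudohyp z y powr p * locmean p (\<kappa>' / 40) f z)"
    if f: "holo_on unit_ball f" and z: "norm z < 1" and y: "norm y < 1" and \<rho>: "pseudohyp z y < r"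
    for f and z y :: "complex^'n"
  proof -
    define S where "S = (C * locmean p (\<kappa>' / 40) f z) powr (1 / p)"
    have L: "C * locmean p (\<kappa>' / 40) f z \<ge> 0" using C(1) locmean_nonneg[OF z] by simp
    have S: "cmod (f x) \<le> S" if "x \<in> hball (1 - ((1 + r) / 2)\<^sup>2) z" for x
    proof -
      have "(cmod (f x) powr p) powr (1 / p) \<le> S"
        unfolding S_def using C(2)[OF f z, of x] that p by (intro powr_mono2) (auto simp: \<kappa>'_def)
      then show ?thesis using p by (simp add: powr_powr)
    qed
    have "cmod (f z - f y) \<le> 6 * S * pseudohyp z y"
    proof (rule field_le_epsilon)
      \<comment> \<open>S can be 0, while the Schwarz estimate wants a positive bound; hence S + e/6
        and a limit in e.\<close>
      fix e :: real assume e: "e > 0"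
      have "cmod (f z - f y) \<le> 6 * (S + e / 6) * pseudohyp z y"
      proof (rule diff_le_pseudohyp_of_bound[OF f z y r \<rho>])
        show "0 < S + e / 6" using e by (intro add_nonneg_pos) (auto simp: S_def)
        show "cmod (f x) \<le> S + e / 6" if "x \<in> hball (1 - ((1 + r) / 2)\<^sup>2) z" for x
          using S[OF that] e by linarith
      qed
      also have "\<dots> = 6 * S * pseudohyp z y + e * pseudohyp z y" by (simp add: algebra_simps)
      also have "\<dots> \<le> 6 * S * pseudohyp z y + e * 1"
        using \<rho> r e by (intro add_left_mono mult_left_mono) auto
      finally show "cmod (f z - f y) \<le> 6 * S * pseudohyp z y + e" by simp
    qed
    then have "cmod (f z - f y) powr p \<le> (6 * S * pseudohyp z y) powr p"
      using p by (intro powr_mono2) auto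
    also have "\<dots> = 6 powr p * C * (pseudohyp z y powr p * locmean p (\<kappa>' / 40) f z)"
    proof -
      have "S powr p = C * locmean p (\<kappa>' / 40) f z"
        using p L by (simp add: S_def powr_powr)
      then show ?thesis
        by (simp add: powr_mult pseudohyp_def S_def)
    qed
    also have "\<dots> \<le> ?C * (pseudohyp z y powr p * locmean p (\<kappa>' / 40) f z)"
      using locmean_nonneg[OF z] by (intro mult_right_mono) auto
    finally show ?thesis .
  qed
  show ?thesis
    using 1 2 C(1) k' by (intro exI[of _ ?C] exI[of _ "\<kappa>' / 40"]) auto
qed

section \<open>Regularization of the weight\<close>

context doubling_weight
begin

definition wint :: "real \<Rightarrow> (complex^'n \<Rightarrow> complex) \<Rightarrow> ennreal" where
  "wint p f = (\<integral>\<^sup>+z. ennreal (cmod (f z) powr p) * wt (norm z) \<partial>lborel)"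

text \<open>Unlike \<omega>, this weight is bounded below on a Bergman ball by a multiple of its
  value at the centre.\<close>

definition reg_weight :: "real \<Rightarrow> ennreal" where
  "reg_weight r = omega_hat w r * ennreal (1 / (1 - r)) * indicator {0..<1} r"

lemma omega_hat_measurable [measurable]: "(\<lambda>r. omega_hat w r * indicator {0..<1} r) \<in> borel_measurable borel"
proof -
  have "(\<lambda>r. (\<integral>\<^sup>+s. wt s * indicator {x. fst x \<le> snd x} (r, s) \<partial>lborel) * indicator {0..<1} r) \<in> borel_measurable borel"
    by measurable
  moreover have "(\<lambda>r. (\<integral>\<^sup>+s. wt s * indicator {x. fst x \<le> snd x} (r, s) \<partial>lborel) * indicator {0..<1} r) =
     (\<lambda>r. omega_hat w r * indicator {0..<1} r)"
  proof
    fix r :: real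
    show "(\<integral>\<^sup>+s. wt s * indicator {x. fst x \<le> snd x} (r, s) \<partial>lborel) * indicator {0..<1} r = omega_hat w r * indicator {0..<1} r"
    proof (cases "r \<in> {0..<1}")
      case True
      then have "omega_hat w r = (\<integral>\<^sup>+s. wt s * indicator {x. fst x \<le> snd x} (r, s) \<partial>lborel)"
        by (subst omega_hat_eq) (auto intro!: nn_integral_cong simp: indicator_def)
      then show ?thesis by simp
    qed simp
  qed
  ultimately show ?thesis by simp
qed

lemma reg_weight_measurable [measurable]: "reg_weight \<in> borel_measurable borel"
proof -
  have "(\<lambda>r. (omega_hat w r * indicator {0..<1} r) * ennreal (1 / (1 - r))) \<in> borel_measurable borel"
    by measurable
  moreover have "(\<lambda>r. (omega_hat w r * indicator {0..<1} r) * ennreal (1 / (1 - r))) = reg_weight"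
    by (auto simp: reg_weight_def fun_eq_iff mult_ac)
  ultimately show ?thesis by simp
qed

text \<open>The total weight collected at radius t when mass is moved outward by factors \<sigma>.
  The condition on \<sigma> amounts to t/\<sigma> > \<beta> = 1 - K (1 - t). If \<beta> \<le> 0,
  integrating over all \<sigma> \<ge> 1 gives t/(1 - t) \<le> K; otherwise the range ends at
  t/\<beta> and the bound evaluates to K - 1.\<close>

lemma nn_integral_inverse_square_le:
  fixes t K :: real
  assumes t: "0 < t" "t < 1" and K: "K > 1"
  shows "(\<integral>\<^sup>+\<sigma>. ennreal (t / (1 - t) * (1 / \<sigma>\<^sup>2)) * indicator {\<sigma>. 1 \<le> \<sigma> \<and> t < 1 - (1 - t / \<sigma>) / K} \<sigma> \<partial>lborel) \<le> ennreal K"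
proof -
  define \<beta> where "\<beta> = 1 - K * (1 - t)"
  define c where "c = t / (1 - t)"
  have c: "c > 0" using t by (simp add: c_def)
  have set: "t / \<sigma> > \<beta>" if "1 \<le> \<sigma>" "t < 1 - (1 - t / \<sigma>) / K" for \<sigma>
  proof -
    have "(1 - t / \<sigma>) / K < 1 - t" using that by simp
    then have "1 - t / \<sigma> < (1 - t) * K" using K by (simp add: pos_divide_less_eq)
    then show ?thesis by (simp add: \<beta>_def mult.commute)
  qed
  have der: "((\<lambda>x. - c / x) has_real_derivative c * (1 / x\<^sup>2)) (at x)" if "1 \<le> x" for x
    using that by (auto intro!: derivative_eq_intros simp: power2_eq_square)
  show ?thesis
  proof (cases "\<beta> \<le> 0")
    case True
    have "(\<integral>\<^sup>+\<sigma>. ennreal (t / (1 - t) * (1 / \<sigma>\<^sup>2)) * indicator {\<sigma>. 1 \<le> \<sigma> \<and> t < 1 - (1 - t / \<sigma>) / K} \<sigma> \<partial>lborel) \<le>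
       (\<integral>\<^sup>+\<sigma>. ennreal (c * (1 / \<sigma>\<^sup>2)) * indicator {1..} \<sigma> \<partial>lborel)"
      unfolding c_def by (intro nn_integral_mono) (auto simp: indicator_def)
    also have "\<dots> = ennreal (0 - (- c / 1))"
    proof (rule nn_integral_FTC_atLeast)
      show "((\<lambda>x. - c / x) \<longlongrightarrow> 0) at_top"
        by (intro tendsto_divide_0[OF tendsto_const] filterlim_at_top_imp_at_infinity filterlim_ident)
    qed (use der c in auto)
    also have "\<dots> \<le> ennreal K"
    proof (rule ennreal_leI)
      have "1 \<le> K * (1 - t)" using True by (simp add: \<beta>_def)
      then have "t \<le> K * (1 - t)" using t by linarith
      then show "0 - (- c / 1) \<le> K" using t by (simp add: c_def pos_divide_le_eq)
    qed
    finally show ?thesis .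
  next
    case False
    have tb: "\<beta> \<le> t"
    proof -
      have "1 * (1 - t) \<le> K * (1 - t)" using K t by (intro mult_right_mono) auto
      then show ?thesis by (simp add: \<beta>_def)
    qed
    have "(\<integral>\<^sup>+\<sigma>. ennreal (t / (1 - t) * (1 / \<sigma>\<^sup>2)) * indicator {\<sigma>. 1 \<le> \<sigma> \<and> t < 1 - (1 - t / \<sigma>) / K} \<sigma> \<partial>lborel) \<le>
       (\<integral>\<^sup>+\<sigma>. ennreal (c * (1 / \<sigma>\<^sup>2)) * indicator {1..t / \<beta>} \<sigma> \<partial>lborel)"
    proof (rule nn_integral_mono)
      fix \<sigma> :: real
      have "\<sigma> \<le> t / \<beta>" if "1 \<le> \<sigma>" "t < 1 - (1 - t / \<sigma>) / K"
        using set[OF that] that False by (simp add: field_simps)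
      then show "ennreal (t / (1 - t) * (1 / \<sigma>\<^sup>2)) * indicator {\<sigma>. 1 \<le> \<sigma> \<and> t < 1 - (1 - t / \<sigma>) / K} \<sigma> \<le>
         ennreal (c * (1 / \<sigma>\<^sup>2)) * indicator {1..t / \<beta>} \<sigma>"
        by (auto simp: indicator_def c_def)
    qed
    also have "\<dots> = ennreal (- c / (t / \<beta>) - (- c / 1))"
      using der c tb False t by (intro nn_integral_FTC_Icc) (auto intro: DERIV_subset)
    also have "\<dots> \<le> ennreal K"
    proof (rule ennreal_leI)
      have "- c / (t / \<beta>) - (- c / 1) = c * (t - \<beta>) / t" using t False by (simp add: field_simps)
      also have "t - \<beta> = (K - 1) * (1 - t)" by (simp add: \<beta>_def algebra_simps)
      also have "c * ((K - 1) * (1 - t)) / t = K - 1" using t by (simp add: c_def)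
      finally show "- c / (t / \<beta>) - (- c / 1) \<le> K" by simp
    qed
    finally show ?thesis .
  qed
qed

text \<open>The mass of \<open>\<omega>\<close> on the annulus \<open>r \<le> |z| < 1 - (1 - r)/K\<close> controls \<open>reg_weight\<close> at radius \<open>r\<close>, and
  integral means grow with the radius, so mass may be transported outwards.\<close>
lemma regularized_integral_le:
  fixes p :: real
  assumes p: "p > 0"
  shows "\<exists>C>0. \<forall>f. holo_on unit_ball f \<longrightarrow>
    (\<integral>\<^sup>+z. ennreal (cmod (f z) powr p) * reg_weight (norm z) \<partial>lborel) \<le> ennreal C * wint p f"
proof -
  let ?D = "DIM(complex^'n)"
  obtain C K where CK: "K > 1" "C \<ge> 0" "\<And>r. 0 \<le> r \<Longrightarrow> r < 1 \<Longrightarrow>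
     omega_hat w r \<le> ennreal C * (\<integral>\<^sup>+s. wt s * indicator {r..<1 - (1 - r) / K} s \<partial>lborel)"
    using what_check by blast
  have "(\<integral>\<^sup>+z. ennreal (cmod (f z) powr p) * reg_weight (norm z) \<partial>lborel) \<le> ennreal (C * K) * wint p f"
    if f: "holo_on unit_ball f" for f :: "complex^'n \<Rightarrow> complex"
  proof -
    define f0 where "f0 y = indicator unit_ball y * f y" for y
    have [measurable]: "f0 \<in> borel_measurable borel" unfolding f0_def by (rule holo_on_borel_measurable[OF f])
    define F where "F z = ennreal (cmod (f0 z) powr p)" for z
    have [measurable]: "F \<in> borel_measurable borel" unfolding F_def by measurable
    \<comment> \<open>\<open>G \<sigma> r\<close> is the portion of \<omega> at radius \<sigma> r
      that is charged to radius r, after the substitution s = \<sigma> r in the annulus integral of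
      \<open>what_check\<close>.\<close>
    define G where "G \<sigma> r = ennreal (C * (r / (1 - r))) * wt (\<sigma> * r) * indicator {x. snd x < 1 - (1 - fst x) / K} (r, \<sigma> * r) * indicator {0<..<1} r" for \<sigma> r
    have G_meas: "(\<lambda>x. G (a x) (b x)) \<in> borel_measurable M" if [measurable]: "a \<in> borel_measurable M" "b \<in> borel_measurable M" for a b and M :: "'z measure"
    proof -
      have "(\<lambda>x. G (fst x) (snd x)) \<in> borel_measurable (borel \<Otimes>\<^sub>M borel)"
        unfolding G_def by measurable
      from measurable_compose[OF _ this, of "\<lambda>x. (a x, b x)" M] show ?thesis by simp
    qed
    note G_meas [measurable]
    have "(\<integral>\<^sup>+z. ennreal (cmod (f z) powr p) * reg_weight (norm z) \<partial>lborel) = (\<integral>\<^sup>+z. F z * reg_weight (norm z) \<partial>lborel)"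
      by (intro nn_integral_cong) (auto simp: F_def f0_def reg_weight_def indicator_def)
    also have "\<dots> \<le> (\<integral>\<^sup>+z. (\<integral>\<^sup>+\<sigma>. F z * G \<sigma> (norm z) * indicator {1..} \<sigma> \<partial>lborel) \<partial>lborel)"
    proof (rule nn_integral_mono_AE)
      have "F z * reg_weight (norm z) \<le> (\<integral>\<^sup>+\<sigma>. F z * G \<sigma> (norm z) * indicator {1..} \<sigma> \<partial>lborel)" if z0: "z \<noteq> 0" for z
      proof (cases "norm z < 1")
        case True
        define t where "t = norm z"
        have t: "0 < t" "t < 1" using True z0 by (auto simp: t_def)
        have "omega_hat w t \<le> ennreal C * (\<integral>\<^sup>+s. wt s * indicator {t..<1 - (1 - t) / K} s \<partial>lborel)"
          using CK t by auto
        also have "(\<integral>\<^sup>+s. wt s * indicator {t..<1 - (1 - t) / K} s \<partial>lborel) =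
            ennreal t * (\<integral>\<^sup>+\<sigma>. wt (t * \<sigma>) * indicator {t..<1 - (1 - t) / K} (t * \<sigma>) \<partial>lborel)"
          using t by (subst nn_integral_lborel_affine[of _ t 0]) auto
        finally have "omega_hat w t * ennreal (1 / (1 - t)) \<le>
          ennreal C * (ennreal t * (\<integral>\<^sup>+\<sigma>. wt (t * \<sigma>) * indicator {t..<1 - (1 - t) / K} (t * \<sigma>) \<partial>lborel)) * ennreal (1 / (1 - t))"
          by (intro mult_right_mono) auto
        also have "\<dots> = ennreal (C * (t / (1 - t))) * (\<integral>\<^sup>+\<sigma>. wt (t * \<sigma>) * indicator {t..<1 - (1 - t) / K} (t * \<sigma>) \<partial>lborel)"
        proof -
          have "ennreal (C * (t / (1 - t))) = ennreal C * ennreal t * ennreal (1 / (1 - t))"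
            using CK(2) t by (simp add: ennreal_mult[symmetric])
          then show ?thesis by (simp only: mult_ac)
        qed
        also have "\<dots> = (\<integral>\<^sup>+\<sigma>. G \<sigma> t * indicator {1..} \<sigma> \<partial>lborel)"
          using t by (subst nn_integral_cmult[symmetric])
            (auto intro!: nn_integral_cong simp: G_def indicator_def mult.commute[of t])
        finally have "reg_weight t \<le> (\<integral>\<^sup>+\<sigma>. G \<sigma> t * indicator {1..} \<sigma> \<partial>lborel)" using t by (simp add: reg_weight_def)
        then have "F z * reg_weight t \<le> F z * (\<integral>\<^sup>+\<sigma>. G \<sigma> t * indicator {1..} \<sigma> \<partial>lborel)" by (intro mult_left_mono) auto
        also have "\<dots> = (\<integral>\<^sup>+\<sigma>. F z * G \<sigma> t * indicator {1..} \<sigma> \<partial>lborel)"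
          by (subst nn_integral_cmult[symmetric]) (auto simp: mult.assoc)
        finally show ?thesis by (simp add: t_def)
      qed (simp add: reg_weight_def)
      then show "AE z in lborel. F z * reg_weight (norm z) \<le> (\<integral>\<^sup>+\<sigma>. F z * G \<sigma> (norm z) * indicator {1..} \<sigma> \<partial>lborel)"
        using AE_lborel_singleton[of "0::complex^'n"] by auto
    qed
    also have "\<dots> = (\<integral>\<^sup>+\<sigma>. (\<integral>\<^sup>+z. F z * G \<sigma> (norm z) * indicator {1..} \<sigma> \<partial>lborel) \<partial>lborel)"
      by (rule lborel_pair.Fubini'[symmetric]) measurable
    \<comment> \<open>For fixed \<sigma> the scaling z = y/\<sigma> puts \<omega> at |y| and f at
      y/\<sigma>; passing from f(y/\<sigma>) to f(y) does not decrease the integral since 1/\<sigma>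
      \<le> 1.\<close>
    also have "\<dots> \<le> (\<integral>\<^sup>+\<sigma>. (\<integral>\<^sup>+y. F y * wt (norm y) * (ennreal (C * (norm y / (1 - norm y) * (1 / \<sigma>\<^sup>2))) *
        indicator {x. 1 \<le> snd x \<and> fst x < 1 - (1 - fst x / snd x) / K} (norm y, \<sigma>)) \<partial>lborel) \<partial>lborel)"
    proof (rule nn_integral_mono)
      fix \<sigma> :: real
      show "(\<integral>\<^sup>+z. F z * G \<sigma> (norm z) * indicator {1..} \<sigma> \<partial>lborel) \<le>
        (\<integral>\<^sup>+y. F y * wt (norm y) * (ennreal (C * (norm y / (1 - norm y) * (1 / \<sigma>\<^sup>2))) *
          indicator {x. 1 \<le> snd x \<and> fst x < 1 - (1 - fst x / snd x) / K} (norm y, \<sigma>)) \<partial>lborel)"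
      proof (cases "\<sigma> \<ge> 1")
        case True
        define h where "h y = G \<sigma> (norm y / \<sigma>)" for y :: "complex^'n"
        have [measurable]: "h \<in> borel_measurable borel" unfolding h_def by measurable
        have "(\<integral>\<^sup>+z. F z * G \<sigma> (norm z) \<partial>lborel) =
           ennreal (\<bar>1 / \<sigma>\<bar> ^ ?D) * (\<integral>\<^sup>+y. F (0 + (1 / \<sigma>) *\<^sub>R y) * G \<sigma> (norm (0 + (1 / \<sigma>) *\<^sub>R y)) \<partial>lborel)"
          using True by (intro nn_integral_lborel_affine) auto
        also have "(\<integral>\<^sup>+y. F (0 + (1 / \<sigma>) *\<^sub>R y) * G \<sigma> (norm (0 + (1 / \<sigma>) *\<^sub>R y)) \<partial>lborel) =
           (\<integral>\<^sup>+y. ennreal (cmod (f0 (of_real (1 / \<sigma>) *s y)) powr p) * h y \<partial>lborel)"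
        proof (rule nn_integral_cong)
          fix y :: "complex^'n"
          have "(1 / \<sigma>) *\<^sub>R y = of_real (1 / \<sigma>) *s y"
            by (simp add: vec_eq_iff scaleR_conv_of_real[where 'a=complex])
          then show "F (0 + (1 / \<sigma>) *\<^sub>R y) * G \<sigma> (norm (0 + (1 / \<sigma>) *\<^sub>R y)) = ennreal (cmod (f0 (of_real (1 / \<sigma>) *s y)) powr p) * h y"
            using True by (simp add: F_def h_def norm_complex_smult norm_divide)
        qed
        also have "\<dots> \<le> (\<integral>\<^sup>+y. ennreal (cmod (f0 y) powr p) * h y \<partial>lborel)"
        proof (rule nn_integral_powr_dilate_le[OF _ _ p])
          show "h (c *s y) = h y" if "cmod c = 1" for c y using that by (simp add: h_def norm_complex_smult)
          fix y assume "h y \<noteq> 0"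
          then have y: "norm y < 1" using True by (auto simp: h_def G_def wt_def indicator_def split: if_splits)
          define U where "U = {l::complex. norm (l *s y) < 1}"
          have "open U" unfolding U_def by (intro open_Collect_less continuous_intros)
          moreover have "cball 0 1 \<subseteq> U"
          proof
            fix l :: complex assume "l \<in> cball 0 1"
            then have "cmod l * norm y \<le> 1 * norm y" by (intro mult_right_mono) auto
            then show "l \<in> U" using y by (simp add: U_def norm_complex_smult)
          qed
          moreover have "(\<lambda>l. f0 (l *s y)) holomorphic_on U"
          proof -
            have "(\<lambda>l. f (l *s y)) holomorphic_on U"
              using \<open>open U\<close> by (intro holo_on_compose_curve[OF f]) (auto simp: U_def intro!: holomorphic_intros)
            then show ?thesis
              by (rule holomorphic_transform) (auto simp: f0_def U_def)
          qed
          ultimately show "\<exists>U. open U \<and> cball 0 1 \<subseteq> U \<and> (\<lambda>l. f0 (l *s y)) holomorphic_on U" by blast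
        qed (use True in auto)
        finally have "(\<integral>\<^sup>+z. F z * G \<sigma> (norm z) \<partial>lborel) \<le> ennreal (\<bar>1 / \<sigma>\<bar> ^ ?D) * (\<integral>\<^sup>+y. F y * h y \<partial>lborel)"
          by (simp add: F_def mult_left_mono)
        also have "\<dots> = (\<integral>\<^sup>+y. ennreal (\<bar>1 / \<sigma>\<bar> ^ ?D) * (F y * h y) \<partial>lborel)"
          by (rule nn_integral_cmult[symmetric]) measurable
        also have "\<dots> \<le> (\<integral>\<^sup>+y. F y * wt (norm y) * (ennreal (C * (norm y / (1 - norm y) * (1 / \<sigma>\<^sup>2))) *
          indicator {x. 1 \<le> snd x \<and> fst x < 1 - (1 - fst x / snd x) / K} (norm y, \<sigma>)) \<partial>lborel)"
        proof (rule nn_integral_mono)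
          fix y :: "complex^'n"
          define t where "t = norm y"
          show "ennreal (\<bar>1 / \<sigma>\<bar> ^ ?D) * (F y * h y) \<le> F y * wt (norm y) * (ennreal (C * (norm y / (1 - norm y) * (1 / \<sigma>\<^sup>2))) *
            indicator {x. 1 \<le> snd x \<and> fst x < 1 - (1 - fst x / snd x) / K} (norm y, \<sigma>))"
          proof (cases "t < 1 \<and> t < 1 - (1 - t / \<sigma>) / K")
            case False
            then have "h y = 0" using True by (auto simp: h_def G_def t_def wt_def indicator_def)
            then show ?thesis by simp
          next
            case t: True
            have ts: "t / \<sigma> \<le> t" using True by (simp add: t_def divide_le_eq mult_le_cancel_left1)
            \<comment> \<open>One power of 1/\<sigma> is kept from the Jacobian, another comes from
              the numerator t/\<sigma>, and 1 - t/\<sigma> \<ge> 1 - t bounds the denominator.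
              Together they give the integrable 1/\<sigma>^2.\<close>
            have "\<bar>1 / \<sigma>\<bar> ^ ?D \<le> \<bar>1 / \<sigma>\<bar> ^ 1" using True by (intro power_decreasing) (auto simp: Suc_leI)
            then have "\<bar>1 / \<sigma>\<bar> ^ ?D * (C * ((t / \<sigma>) / (1 - t / \<sigma>))) \<le> (1 / \<sigma>) * (C * ((t / \<sigma>) / (1 - t)))"
              using True CK(2) t ts by (intro mult_mono mult_left_mono divide_left_mono mult_pos_pos) (auto simp: t_def)
            also have "\<dots> = C * (t / (1 - t) * (1 / \<sigma>\<^sup>2))" by (simp add: power2_eq_square)
            finally have le: "\<bar>1 / \<sigma>\<bar> ^ ?D * (C * ((t / \<sigma>) / (1 - t / \<sigma>))) \<le> C * (t / (1 - t) * (1 / \<sigma>\<^sup>2))" .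
            have "h y \<le> ennreal (C * ((t / \<sigma>) / (1 - t / \<sigma>))) * wt t"
              using True by (auto simp: h_def G_def t_def indicator_def)
            then have "ennreal (\<bar>1 / \<sigma>\<bar> ^ ?D) * (F y * h y) \<le> ennreal (\<bar>1 / \<sigma>\<bar> ^ ?D) * (F y * (ennreal (C * ((t / \<sigma>) / (1 - t / \<sigma>))) * wt t))"
              by (intro mult_left_mono) auto
            also have "\<dots> = F y * wt t * ennreal (\<bar>1 / \<sigma>\<bar> ^ ?D * (C * ((t / \<sigma>) / (1 - t / \<sigma>))))"
            proof -
              have "0 \<le> C * ((t / \<sigma>) / (1 - t / \<sigma>))" using CK(2) True t ts by (auto simp: t_def)
              then have "ennreal (\<bar>1 / \<sigma>\<bar> ^ ?D * (C * ((t / \<sigma>) / (1 - t / \<sigma>)))) = ennreal (\<bar>1 / \<sigma>\<bar> ^ ?D) * ennreal (C * ((t / \<sigma>) / (1 - t / \<sigma>)))"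
                by (intro ennreal_mult) auto
              then show ?thesis by (simp only: mult_ac)
            qed
            also have "\<dots> \<le> F y * wt t * ennreal (C * (t / (1 - t) * (1 / \<sigma>\<^sup>2)))"
              using le by (intro mult_left_mono ennreal_leI) auto
            finally show ?thesis using t True by (simp add: t_def)
          qed
        qed
        finally show ?thesis using True by simp
      qed simp
    qed
    also have "\<dots> = (\<integral>\<^sup>+y. (\<integral>\<^sup>+\<sigma>. F y * wt (norm y) * (ennreal (C * (norm y / (1 - norm y) * (1 / \<sigma>\<^sup>2))) *
        indicator {x. 1 \<le> snd x \<and> fst x < 1 - (1 - fst x / snd x) / K} (norm y, \<sigma>)) \<partial>lborel) \<partial>lborel)"
      by (rule lborel_pair.Fubini') measurable
    also have "\<dots> \<le> (\<integral>\<^sup>+y. F y * wt (norm y) * ennreal (C * K) \<partial>lborel)"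
    proof (rule nn_integral_mono)
      fix y :: "complex^'n"
      define t where "t = norm y"
      have "{\<sigma>. 1 \<le> \<sigma> \<and> t < 1 - (1 - t / \<sigma>) / K} \<in> sets borel" by measurable
      moreover have "(\<lambda>\<sigma>. indicator {x. 1 \<le> snd x \<and> fst x < 1 - (1 - fst x / snd x) / K} (t, \<sigma>) :: ennreal) =
        indicator {\<sigma>. 1 \<le> \<sigma> \<and> t < 1 - (1 - t / \<sigma>) / K}"
        by (auto simp: fun_eq_iff indicator_def)
      ultimately have [measurable]: "(\<lambda>\<sigma>. indicator {x. 1 \<le> snd x \<and> fst x < 1 - (1 - fst x / snd x) / K} (t, \<sigma>) :: ennreal) \<in> borel_measurable borel"
        by simp
      have "(\<integral>\<^sup>+\<sigma>. F y * wt t * (ennreal (C * (t / (1 - t) * (1 / \<sigma>\<^sup>2))) *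
        indicator {x. 1 \<le> snd x \<and> fst x < 1 - (1 - fst x / snd x) / K} (t, \<sigma>)) \<partial>lborel) =
        F y * wt t * (\<integral>\<^sup>+\<sigma>. (ennreal (C * (t / (1 - t) * (1 / \<sigma>\<^sup>2))) *
        indicator {x. 1 \<le> snd x \<and> fst x < 1 - (1 - fst x / snd x) / K} (t, \<sigma>)) \<partial>lborel)"
        by (rule nn_integral_cmult) measurable
      also have "\<dots> \<le> F y * wt t * ennreal (C * K)"
      proof (cases "0 < t \<and> t < 1")
        case True
        have "(\<integral>\<^sup>+\<sigma>. (ennreal (C * (t / (1 - t) * (1 / \<sigma>\<^sup>2))) *
          indicator {x. 1 \<le> snd x \<and> fst x < 1 - (1 - fst x / snd x) / K} (t, \<sigma>)) \<partial>lborel) =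
          (\<integral>\<^sup>+\<sigma>. ennreal C * (ennreal (t / (1 - t) * (1 / \<sigma>\<^sup>2)) * indicator {\<sigma>. 1 \<le> \<sigma> \<and> t < 1 - (1 - t / \<sigma>) / K} \<sigma>) \<partial>lborel)"
        proof (rule nn_integral_cong)
          fix \<sigma> :: real
          have "ennreal (C * (t / (1 - t) * (1 / \<sigma>\<^sup>2))) = ennreal C * ennreal (t / (1 - t) * (1 / \<sigma>\<^sup>2))"
            using CK(2) True by (intro ennreal_mult mult_nonneg_nonneg) auto
          then show "ennreal (C * (t / (1 - t) * (1 / \<sigma>\<^sup>2))) *
            indicator {x. 1 \<le> snd x \<and> fst x < 1 - (1 - fst x / snd x) / K} (t, \<sigma>) =
            ennreal C * (ennreal (t / (1 - t) * (1 / \<sigma>\<^sup>2)) * indicator {\<sigma>. 1 \<le> \<sigma> \<and> t < 1 - (1 - t / \<sigma>) / K} \<sigma>)"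
            by (auto simp: indicator_def)
        qed
        also have "\<dots> = ennreal C * (\<integral>\<^sup>+\<sigma>. (ennreal (t / (1 - t) * (1 / \<sigma>\<^sup>2)) * indicator {\<sigma>. 1 \<le> \<sigma> \<and> t < 1 - (1 - t / \<sigma>) / K} \<sigma>) \<partial>lborel)"
          by (rule nn_integral_cmult) measurable
        also have "\<dots> \<le> ennreal C * ennreal K"
          using True CK(1) by (intro mult_left_mono nn_integral_inverse_square_le) auto
        also have "\<dots> = ennreal (C * K)" using CK(1,2) by (simp add: ennreal_mult)
        finally show ?thesis by (intro mult_left_mono) auto
      next
        case False
        then have "t = 0 \<or> wt t = 0" by (auto simp: t_def wt_def indicator_def)
        then show ?thesis by auto
      qed
      finally show "(\<integral>\<^sup>+\<sigma>. F y * wt (norm y) * (ennreal (C * (norm y / (1 - norm y) * (1 / \<sigma>\<^sup>2))) *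
        indicator {x. 1 \<le> snd x \<and> fst x < 1 - (1 - fst x / snd x) / K} (norm y, \<sigma>)) \<partial>lborel) \<le> F y * wt (norm y) * ennreal (C * K)"
        by (simp add: t_def)
    qed
    also have "\<dots> = (\<integral>\<^sup>+y. F y * wt (norm y) \<partial>lborel) * ennreal (C * K)"
      by (rule nn_integral_multc) measurable
    also have "(\<integral>\<^sup>+y. F y * wt (norm y) \<partial>lborel) = wint p f"
      unfolding wint_def by (intro nn_integral_cong) (auto simp: F_def f0_def wt_def indicator_def)
    finally show ?thesis by (simp add: mult.commute)
  qed
  \<comment> \<open>C may be 0, whereas a positive constant is claimed.\<close>
  moreover have "ennreal (C * K) * wint p f \<le> ennreal (C * K + 1) * wint p f" for f
    by (intro mult_right_mono ennreal_leI) auto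
  ultimately have "\<forall>f. holo_on unit_ball f \<longrightarrow>
    (\<integral>\<^sup>+z. ennreal (cmod (f z) powr p) * reg_weight (norm z) \<partial>lborel) \<le> ennreal (C * K + 1) * wint p f"
    using order_trans by blast
  moreover have "C * K + 1 > 0" using CK by (simp add: add_nonneg_pos)
  ultimately show ?thesis by blast
qed

end

section \<open>Test functions\<close>

context doubling_weight
begin

text \<open>In the main case the region lies in |z| \<ge> 1 - t and in a cone around a of aperture
  4t, and polar integration separates the tail of \<omega> from the volume of the cone. For t \<ge>
  1/4 the total mass is a sufficient bound, and for |a| \<le> 1 - t the region contains no point of
  the ball.\<close>

lemma nn_integral_wt_nonisotropic_le:
  "\<exists>C>0. \<forall>(a::complex^'n) t. norm a < 1 \<longrightarrow> t > 0 \<longrightarrow>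
     (\<integral>\<^sup>+z. wt (norm z) * indicator {z. cmod (1 - herm z a) < t} z \<partial>lborel) \<le> ennreal (C * (t ^ CARD('n) * tail_mass t))"
proof -
  let ?D = "DIM(complex^'n)" and ?n = "CARD('n)"
  define W0 where "W0 = enn2real (\<integral>\<^sup>+(z::complex^'n). wt (norm z) \<partial>lborel)"
  have W0: "(\<integral>\<^sup>+(z::complex^'n). wt (norm z) \<partial>lborel) = ennreal W0"
    using wt_norm_finite by (simp add: W0_def less_top)
  have "W0 \<ge> 0" by (simp add: W0_def)
  define C1 where "C1 = W0 / ((1/4) ^ ?n * tail_mass (1/4))"
  define C2 :: real where "C2 = 2 ^ (?D + 1) * (8 ^ ?n * 4 ^ ?n)"
  have C1: "C1 \<ge> 0" using \<open>W0 \<ge> 0\<close> tail_mass_pos[of "1/4"] by (simp add: C1_def)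
  have C2: "C2 > 0" by (simp add: C2_def)
  have "(\<integral>\<^sup>+z. wt (norm z) * indicator {z. cmod (1 - herm z a) < t} z \<partial>lborel) \<le> ennreal ((C1 + C2) * (t ^ ?n * tail_mass t))"
    if a: "norm a < 1" and t: "t > 0" for a :: "complex^'n" and t
  proof (cases "t < 1/4")
    case False
    have le1: "(1/4) ^ ?n * tail_mass (1/4) \<le> t ^ ?n * tail_mass t"
      using False tail_mass_pos[of "1/4"] by (intro mult_mono power_mono tail_mass_mono) auto
    have "C1 * ((1/4) ^ ?n * tail_mass (1/4)) \<le> (C1 + C2) * (t ^ ?n * tail_mass t)"
      by (rule mult_mono[OF _ le1]) (use C1 C2 tail_mass_pos[of "1/4"] in auto)
    moreover have "C1 * ((1/4) ^ ?n * tail_mass (1/4)) = W0" using tail_mass_pos[of "1/4"] by (simp add: C1_def)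
    ultimately have le: "ennreal W0 \<le> ennreal ((C1 + C2) * (t ^ ?n * tail_mass t))" by (intro ennreal_leI) simp
    have "(\<integral>\<^sup>+z. wt (norm z) * indicator {z. cmod (1 - herm z a) < t} z \<partial>lborel) \<le> ennreal W0"
      unfolding W0[symmetric] by (intro nn_integral_mono) (auto simp: indicator_def)
    then show ?thesis using le by (rule order_trans)
  next
    case True
    define \<Gamma> where "\<Gamma> b = {z::complex^'n. cmod (of_real (norm z) - herm z b) < (4 * t) * norm z}" for b
    have [measurable]: "\<Gamma> b \<in> sets borel" for b unfolding \<Gamma>_def by measurable
    show ?thesis
    proof (cases "norm a \<le> 1 - t")
      case True
      have "wt (norm z) * indicator {z. cmod (1 - herm z a) < t} z = 0" for z
      proof (cases "norm z < 1")
        case z: True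
        have "t \<le> cmod (1 - herm z a)" using norm_one_minus_herm_ge'[OF z, of a] True by linarith
        then show ?thesis by simp
      qed (simp add: wt_def)
      then show ?thesis by (simp only: nn_integral_const mult_zero_left zero_le)
    next
      case na: False
      define b where "b = (1 / norm a) *\<^sub>R a"
      have a0: "norm a > 0" using na True t by linarith
      have b: "norm b = 1" using a0 by (simp add: b_def)
      have hab: "herm z a = of_real (norm a) * herm z b" for z
      proof -
        have "a = of_real (norm a) *s b"
          using a0 by (simp add: b_def vec_eq_iff scaleR_conv_of_real[where 'a=complex])
        then have "herm z a = herm z (of_real (norm a) *s b)" by simp
        then show ?thesis by (simp add: herm_smult_right)
      qed
      have incl: "z \<in> \<Gamma> b \<and> 1 - t \<le> norm z" if z: "norm z < 1" "cmod (1 - herm z a) < t" for z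
      proof -
        have "1 - cmod (herm z a) < t" using norm_triangle_ineq2[of 1 "herm z a"] z by simp
        moreover have "cmod (herm z a) \<le> norm z * norm a" by (rule cmod_herm_le)
        moreover have "norm z * norm a \<le> norm z" using a by (simp add: mult_left_le)
        ultimately have nz: "1 - t < norm z" by linarith
        have hb: "cmod (herm z b) \<le> norm z" using cmod_herm_le[of z b] b by simp
        \<comment> \<open>The first two terms are below t and the third is at most t |z|; since |z|
          > 3/4, the sum stays below 4t |z|.\<close>
        have "of_real (norm z) - herm z b = (of_real (norm z) - 1) + (1 - herm z a) - of_real (1 - norm a) * herm z b"
          by (simp add: hab algebra_simps)
        then have "cmod (of_real (norm z) - herm z b) \<le> cmod (of_real (norm z) - 1) + cmod (1 - herm z a) + cmod (of_real (1 - norm a) * herm z b)"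
          by (metis add_mono_thms_linordered_semiring(3) norm_triangle_ineq norm_triangle_ineq4 order_trans)
        also have "cmod (of_real (norm z) - 1) = 1 - norm z"
          using z by (metis abs_minus_commute abs_of_pos diff_gt_0_iff_gt norm_of_real of_real_1 of_real_diff)
        also have "cmod (of_real (1 - norm a) * herm z b) \<le> t * norm z"
          using na a hb by (simp add: norm_mult del: of_real_diff) (intro mult_mono, auto)
        finally have "cmod (of_real (norm z) - herm z b) < t + t + t * norm z" using z nz by linarith
        also have "t + t \<le> 3 * t * norm z" using nz True t by simp
        finally show ?thesis using nz by (simp add: \<Gamma>_def)
      qed
      define h where "h s = wt s * indicator {1 - t..} s" for s
      have [measurable]: "h \<in> borel_measurable borel" unfolding h_def by measurable
      have "(\<integral>\<^sup>+z. wt (norm z) * indicator {z. cmod (1 - herm z a) < t} z \<partial>lborel) \<le> (\<integral>\<^sup>+z. indicator (\<Gamma> b) z * h (norm z) \<partial>lborel)"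
      proof (rule nn_integral_mono)
        fix z :: "complex^'n"
        show "wt (norm z) * indicator {z. cmod (1 - herm z a) < t} z \<le> indicator (\<Gamma> b) z * h (norm z)"
          using incl[of z] by (cases "norm z < 1") (auto simp: h_def wt_def indicator_def)
      qed
      also have "\<dots> = (\<integral>\<^sup>+s. h s * ennreal (s ^ (?D - 1)) * indicator {0<..} s \<partial>lborel) *
        (\<integral>\<^sup>+y. indicator (\<Gamma> b) y * ennreal (1 / norm y ^ (?D + 1)) * indicator {y. 1/2 \<le> norm y \<and> norm y < 1} y \<partial>lborel)"
      proof (rule nn_integral_homogeneous_norm)
        fix c :: real and y :: "complex^'n" assume c: "c > 0"
        have r: "c *\<^sub>R y = of_real c *s y"
          by (simp add: vec_eq_iff scaleR_conv_of_real[where 'a=complex])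
        have "of_real (norm (c *\<^sub>R y)) - herm (c *\<^sub>R y) b = of_real c * (of_real (norm y) - herm y b)"
          using c unfolding r herm_smult_left by (simp add: norm_complex_smult right_diff_distrib)
        then have "cmod (of_real (norm (c *\<^sub>R y)) - herm (c *\<^sub>R y) b) = c * cmod (of_real (norm y) - herm y b)"
          using c by (simp only: norm_mult norm_of_real)
        then have "c *\<^sub>R y \<in> \<Gamma> b \<longleftrightarrow> c * cmod (of_real (norm y) - herm y b) < c * (4 * t * norm y)"
          using c by (simp add: \<Gamma>_def mult_ac)
        also have "\<dots> \<longleftrightarrow> y \<in> \<Gamma> b" using c by (simp add: \<Gamma>_def mult.assoc)
        finally show "indicator (\<Gamma> b) (c *\<^sub>R y) = (indicator (\<Gamma> b) y :: ennreal)" by (simp add: indicator_def)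
      qed measurable
      also have "\<dots> \<le> ennreal (tail_mass t) * ennreal (2 ^ (?D + 1) * (8 ^ ?n * (4 * t) ^ ?n))"
      proof (intro mult_mono)
        have "(\<integral>\<^sup>+s. h s * ennreal (s ^ (?D - 1)) * indicator {0<..} s \<partial>lborel) \<le> (\<integral>\<^sup>+s. wt s * indicator {1 - t..} s \<partial>lborel)"
        proof (rule nn_integral_mono)
          fix s :: real
          show "h s * ennreal (s ^ (?D - 1)) * indicator {0<..} s \<le> wt s * indicator {1 - t..} s"
          proof (cases "0 < s \<and> s < 1")
            case True
            then have "s ^ (?D - 1) \<le> 1" by (intro power_le_one) auto
            then have "h s * ennreal (s ^ (?D - 1)) \<le> h s * 1" by (intro mult_left_mono) auto
            then show ?thesis using True by (simp add: h_def)
          qed (auto simp: h_def wt_def indicator_def)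
        qed
        also have "\<dots> = ennreal (tail_mass t)"
          using True t by (simp add: tail_mass_def ennreal_what omega_hat_eq)
        finally show "(\<integral>\<^sup>+s. h s * ennreal (s ^ (?D - 1)) * indicator {0<..} s \<partial>lborel) \<le> ennreal (tail_mass t)" .
        have "(\<integral>\<^sup>+y. indicator (\<Gamma> b) y * ennreal (1 / norm y ^ (?D + 1)) * indicator {y. 1/2 \<le> norm y \<and> norm y < 1} y \<partial>lborel)
          \<le> (\<integral>\<^sup>+y. ennreal (2 ^ (?D + 1)) * indicator {z. norm z < 1 \<and> cmod (of_real (norm z) - herm z b) < (4 * t) * norm z} y \<partial>lborel)"
        proof (rule nn_integral_mono)
          fix y :: "complex^'n"
          have "1 / norm y ^ (?D + 1) \<le> 2 ^ (?D + 1)" if "1/2 \<le> norm y"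
          proof -
            have "0 < norm y" using that by linarith
            then have "1 / norm y \<le> 2" using that by (subst pos_divide_le_eq) auto
            then have "(1 / norm y) ^ (?D + 1) \<le> 2 ^ (?D + 1)"
              by (intro power_mono) auto
            then show ?thesis by (simp only: power_one_over)
          qed
          then show "indicator (\<Gamma> b) y * ennreal (1 / norm y ^ (?D + 1)) * indicator {y. 1/2 \<le> norm y \<and> norm y < 1} y \<le>
             ennreal (2 ^ (?D + 1)) * indicator {z. norm z < 1 \<and> cmod (of_real (norm z) - herm z b) < (4 * t) * norm z} y"
            by (auto simp: indicator_def \<Gamma>_def simp del: power_Suc intro!: ennreal_leI)
        qed
        also have "\<dots> = ennreal (2 ^ (?D + 1)) * emeasure lborel {z. norm z < 1 \<and> cmod (of_real (norm z) - herm z b) < (4 * t) * norm z}"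
          by (rule nn_integral_cmult_indicator) measurable
        also have "\<dots> \<le> ennreal (2 ^ (?D + 1)) * ennreal (8 ^ ?n * (4 * t) ^ ?n)"
          using b t by (intro mult_left_mono emeasure_cone_le) auto
        also have "\<dots> = ennreal (2 ^ (?D + 1) * (8 ^ ?n * (4 * t) ^ ?n))" using t by (simp add: ennreal_mult)
        finally show "(\<integral>\<^sup>+y. indicator (\<Gamma> b) y * ennreal (1 / norm y ^ (?D + 1)) * indicator {y. 1/2 \<le> norm y \<and> norm y < 1} y \<partial>lborel)
          \<le> ennreal (2 ^ (?D + 1) * (8 ^ ?n * (4 * t) ^ ?n))" .
      qed auto
      also have "\<dots> = ennreal (C2 * (t ^ ?n * tail_mass t))"
      proof -
        have "tail_mass t * (2 ^ (?D + 1) * (8 ^ ?n * (4 * t) ^ ?n)) = C2 * (t ^ ?n * tail_mass t)"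
          by (simp only: C2_def power_mult_distrib mult_ac)
        then show ?thesis using tail_mass_pos[OF t] t by (simp only: ennreal_mult'[symmetric] less_imp_le)
      qed
      also have "\<dots> \<le> ennreal ((C1 + C2) * (t ^ ?n * tail_mass t))"
        using C1 t tail_mass_pos[OF t] by (intro ennreal_leI mult_right_mono) auto
      finally show ?thesis .
    qed
  qed
  then show ?thesis using C1 C2 by (intro exI[of _ "C1 + C2"]) auto
qed

section \<open>Size and normalization of the test functions\<close>

definition test_fun :: "nat \<Rightarrow> complex^'n \<Rightarrow> complex^'n \<Rightarrow> complex" where
  "test_fun N a z = ((1 - of_real ((norm a)\<^sup>2)) / (1 - herm z a)) ^ N"

lemma holo_on_test_fun: "norm a < 1 \<Longrightarrow> holo_on unit_ball (test_fun N a)"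
  unfolding test_fun_def
  by (intro holo_on_power holo_on_divide holo_on_const holo_on_diff holo_on_herm open_unit_ball)
     (use one_minus_herm_nonzero in auto)

lemma cmod_test_fun:
  assumes "norm a < 1" shows "cmod (test_fun N a z) = ((1 - (norm a)\<^sup>2) / cmod (1 - herm z a)) ^ N"
proof -
  have "cmod (1 - of_real ((norm a)\<^sup>2)) = 1 - (norm a)\<^sup>2"
    using one_minus_norm_sq_pos[OF assms] by (metis abs_of_pos norm_of_real of_real_1 of_real_diff)
  then show ?thesis by (simp add: test_fun_def norm_power norm_divide)
qed

lemma cmod_test_fun_le:
  assumes a: "norm a < 1" and z: "0 < x" "x * (1 - norm a) \<le> cmod (1 - herm z a)"
  shows "cmod (test_fun N a z) \<le> (2 / x) ^ N"
proof -
  have "1 - (norm a)\<^sup>2 \<le> 2 * (1 - norm a)" using one_minus_norm_ge[OF a] by simp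
  then have "(1 - (norm a)\<^sup>2) / cmod (1 - herm z a) \<le> (2 * (1 - norm a)) / (x * (1 - norm a))"
    using a z by (intro frac_le) auto
  also have "\<dots> = 2 / x" by (rule nonzero_mult_divide_mult_cancel_right) (use a in simp)
  finally show ?thesis unfolding cmod_test_fun[OF a]
    using one_minus_norm_sq_pos[OF a] by (intro power_mono) auto
qed

text \<open>In terms of the image x of z under the automorphism at a, the test function is (1 - <x,
  a>)^N, and on the Bergman ball |x| stays away from 1.\<close>

lemma cmod_test_fun_ge:
  assumes a: "norm a < 1" and z: "z \<in> hball \<kappa> a" and k: "\<kappa> > 0"
  shows "(\<kappa> / 2) ^ N \<le> cmod (test_fun N a z)"
proof -
  have z1: "norm z < 1" "\<kappa> \<le> hyp_kernel a z" using z by (auto simp: hball_def)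
  define x where "x = ball_aut a z"
  have x1: "norm x < 1" unfolding x_def by (rule norm_ball_aut_less[OF a z1(1)])
  have "test_fun N a z = (1 - herm x a) ^ N"
    unfolding test_fun_def x_def one_minus_herm_ball_aut[OF a z1(1)] ..
  moreover have "\<kappa> / 2 \<le> cmod (1 - herm x a)"
  proof -
    have "\<kappa> / 2 \<le> (1 - (norm x)\<^sup>2) / 2" using z1(2) norm_ball_aut_sq[OF a z1(1)] by (simp add: x_def)
    also have "\<dots> \<le> 1 - norm x" by (rule one_minus_norm_ge[OF x1])
    also have "\<dots> \<le> cmod (1 - herm x a)"
      using norm_one_minus_herm_ge'[OF a, of x] by (metis complex_cnj_diff complex_cnj_one complex_mod_cnj herm_commute)
    finally show ?thesis .
  qed
  ultimately show ?thesis using k by (simp add: norm_power power_mono)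
qed

text \<open>Dyadic decomposition by |1 - <z, a>| / (1 - |a|). At scale 2^j the p-th power of the
  test function is at most a constant times 2^(-jNp), and the \<omega>-mass grows at most like
  2^(j(n + \<open>doubling_exp\<close>)) times \<open>ball_mass a\<close>; the hypothesis on N
  leaves a series with ratio 1/2.\<close>

lemma wint_test_fun_le:
  assumes p: "p > 0" and N: "real N * p \<ge> real (CARD('n) + doubling_exp + 1)"
  shows "\<exists>C>0. \<forall>a::complex^'n. norm a < 1 \<longrightarrow> wint p (test_fun N a) \<le> ennreal (C * ball_mass a)"
proof -
  let ?n = "CARD('n)"
  obtain C where C: "C > 0" "\<And>(a::complex^'n) t. norm a < 1 \<Longrightarrow> t > 0 \<Longrightarrow>
     (\<integral>\<^sup>+z. wt (norm z) * indicator {z. cmod (1 - herm z a) < t} z \<partial>lborel) \<le> ennreal (C * (t ^ CARD('n) * tail_mass t))"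
    using nn_integral_wt_nonisotropic_le by blast
  define B where "B = 2 powr (N * p) * (C * 2 ^ (?n + doubling_exp))"
  have B: "B > 0" using C by (simp add: B_def)
  have "wint p (test_fun N a) \<le> ennreal (2 * B * ball_mass a)" if a: "norm a < 1" for a
  proof -
    define d where "d = 1 - norm a"
    have d: "d > 0" using a by (simp add: d_def)
    define S where "S j = {z::complex^'n. cmod (1 - herm z a) < 2 ^ (j + 1) * d}" for j :: nat
    have [measurable]: "S j \<in> sets borel" for j unfolding S_def by measurable
    define c where "c j = 2 powr (N * p) * 2 powr (- (N * p) * j)" for j :: nat
    have pt: "ennreal (cmod (test_fun N a z) powr p) * wt (norm z) \<le> (\<Sum>j. ennreal (c j) * (wt (norm z) * indicator (S j) z))" for z
    proof (cases "norm z < 1")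
      case False
      then show ?thesis by (simp add: wt_def)
    next
      case True
      define x where "x = cmod (1 - herm z a) / d"
      have x1: "x \<ge> 1" using norm_one_minus_herm_ge'[OF True, of a] d by (simp add: x_def d_def field_simps)
      obtain j where j: "2 ^ j \<le> x" "x < 2 ^ (j + 1)"
      proof -
        obtain m where m: "x < 2 ^ m" using real_arch_pow[of 2 x] by auto
        define k where "k = (LEAST m. x < 2 ^ m)"
        have k: "x < 2 ^ k" unfolding k_def using m by (rule LeastI)
        with x1 have "k \<noteq> 0" by (intro notI) auto
        then obtain j where kj: "k = Suc j" by (metis not0_implies_Suc)
        then have "\<not> x < 2 ^ j" unfolding k_def using not_less_Least by (metis lessI)
        then show ?thesis using k kj that[of j] by simp
      qed
      have zS: "z \<in> S j" using j(2) d by (simp add: S_def x_def field_simps)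
      have "cmod (test_fun N a z) \<le> (2 / 2 ^ j) ^ N"
        using j(1) d by (intro cmod_test_fun_le[OF a]) (auto simp: x_def d_def[symmetric] field_simps)
      then have "cmod (test_fun N a z) powr p \<le> ((2 / 2 ^ j) ^ N) powr p" using p by (intro powr_mono2) auto
      also have "\<dots> = c j"
        by (simp add: c_def powr_realpow[symmetric] powr_powr powr_divide powr_minus_divide power_divide mult_ac)
      finally have "ennreal (cmod (test_fun N a z) powr p) * wt (norm z) \<le> ennreal (c j) * (wt (norm z) * indicator (S j) z)"
        using zS by (simp add: mult_right_mono ennreal_leI)
      also have "\<dots> \<le> (\<Sum>j. ennreal (c j) * (wt (norm z) * indicator (S j) z))"
        using sum_le_suminf[of "\<lambda>j. ennreal (c j) * (wt (norm z) * indicator (S j) z)" "{j}"] by simp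
      finally show ?thesis .
    qed
    have "wint p (test_fun N a) \<le> (\<integral>\<^sup>+z. (\<Sum>j. ennreal (c j) * (wt (norm z) * indicator (S j) z)) \<partial>lborel)"
      unfolding wint_def by (intro nn_integral_mono pt)
    also have "\<dots> = (\<Sum>j. \<integral>\<^sup>+z. ennreal (c j) * (wt (norm z) * indicator (S j) z) \<partial>lborel)"
      by (rule nn_integral_suminf) measurable
    also have "\<dots> \<le> (\<Sum>j. ennreal (B * ball_mass a * (1/2) ^ j))"
    proof (intro suminf_le summableI)
      fix j
      have t: "2 ^ (j + 1) * d > 0" using d by simp
      have "(\<integral>\<^sup>+z. ennreal (c j) * (wt (norm z) * indicator (S j) z) \<partial>lborel) = ennreal (c j) * (\<integral>\<^sup>+z. wt (norm z) * indicator (S j) z \<partial>lborel)"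
        by (rule nn_integral_cmult) measurable
      also have "\<dots> \<le> ennreal (c j) * ennreal (C * ((2 ^ (j + 1) * d) ^ ?n * tail_mass (2 ^ (j + 1) * d)))"
        unfolding S_def using C(2)[OF a t] by (intro mult_left_mono) auto
      also have "\<dots> = ennreal (c j * (C * ((2 ^ (j + 1) * d) ^ ?n * tail_mass (2 ^ (j + 1) * d))))"
        by (rule ennreal_mult'[symmetric]) (simp add: c_def)
      also have "\<dots> \<le> ennreal (B * ball_mass a * (1/2) ^ j)"
      proof (rule ennreal_leI)
        have "tail_mass (2 ^ (j + 1) * d) \<le> 2 ^ (doubling_exp * (j + 1)) * tail_mass d" using d by (rule tail_mass_iterate)
        then have "c j * (C * ((2 ^ (j + 1) * d) ^ ?n * tail_mass (2 ^ (j + 1) * d))) \<le> c j * (C * ((2 ^ (j + 1) * d) ^ ?n * (2 ^ (doubling_exp * (j + 1)) * tail_mass d)))"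
          using C(1) d by (intro mult_left_mono) (auto simp: c_def)
        also have "\<dots> = c j * (C * 2 ^ ((?n + doubling_exp) * (j + 1))) * ball_mass a"
        proof -
          have "(2 ^ (j + 1) * d) ^ ?n * 2 ^ (doubling_exp * (j + 1)) = 2 ^ ((?n + doubling_exp) * (j + 1)) * d ^ ?n"
          proof -
            have e: "(2::real) ^ (k * (j + 1)) = (2 ^ (j + 1)) ^ k" for k
              by (metis power_mult mult.commute)
            show ?thesis unfolding e power_mult_distrib power_add[of _ ?n doubling_exp] by (simp only: mult_ac)
          qed
          then show ?thesis by (simp only: ball_mass_def d_def[symmetric] mult_ac)
        qed
        also have "\<dots> \<le> (B * (1/2) ^ j) * ball_mass a"
        proof (rule mult_right_mono)
          have e: "2 powr (- (N * p) * j) * 2 ^ ((?n + doubling_exp) * j) \<le> (1/2) ^ j"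
          proof -
            have "2 powr (- (N * p) * j) * 2 ^ ((?n + doubling_exp) * j) = 2 powr (- (N * p) * j + real ((?n + doubling_exp) * j))"
              by (simp only: powr_add powr_realpow zero_less_numeral)
            also have "\<dots> \<le> 2 powr (- real j)"
            proof (rule powr_mono)
              have "real (?n + doubling_exp + 1) * real j \<le> (N * p) * real j" using N by (intro mult_right_mono) auto
              then show "- (N * p) * j + real ((?n + doubling_exp) * j) \<le> - real j" by (simp add: algebra_simps)
            qed simp
            also have "\<dots> = (1/2) ^ j" by (simp add: powr_minus powr_realpow power_one_over inverse_eq_divide)
            finally show ?thesis .
          qed
          have "c j * (C * 2 ^ ((?n + doubling_exp) * (j + 1))) = B * (2 powr (- (N * p) * j) * 2 ^ ((?n + doubling_exp) * j))"
            by (simp add: c_def B_def power_add distrib_left mult_ac)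
          also have "\<dots> \<le> B * (1/2) ^ j" using e B by (intro mult_left_mono) auto
          finally show "c j * (C * 2 ^ ((?n + doubling_exp) * (j + 1))) \<le> B * (1/2) ^ j" .
        qed (use ball_mass_pos[OF a] in simp)
        finally show "c j * (C * ((2 ^ (j + 1) * d) ^ ?n * tail_mass (2 ^ (j + 1) * d))) \<le> B * ball_mass a * (1/2) ^ j" by (simp add: mult_ac)
      qed
      finally show "(\<integral>\<^sup>+z. ennreal (c j) * (wt (norm z) * indicator (S j) z) \<partial>lborel) \<le> ennreal (B * ball_mass a * (1/2) ^ j)" .
    qed
    also have "\<dots> = ennreal (B * ball_mass a * 2)"
    proof -
      have "(\<lambda>j. B * ball_mass a * (1/2) ^ j) sums (B * ball_mass a * 2)"
        using geometric_sums[of "1/2::real"] by (intro sums_mult) simp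
      then show ?thesis using B ball_mass_pos[OF a] by (intro suminf_ennreal_eq) auto
    qed
    finally show ?thesis by (simp add: mult_ac)
  qed
  then show ?thesis using B by (intro exI[of _ "2 * B"]) auto
qed

text \<open>For fixed z the numerator is O((1 - |a|)^(Np)), and \<open>tail_mass_lower\<close>
  bounds \<open>ball_mass a\<close> below by a multiple of (1 - |a|)^(n +
  \<open>doubling_exp\<close>); the extra 1 in the hypothesis on N leaves one factor 1 - |a|.
  Normalized test functions thus tend to 0 pointwise as a approaches the sphere.\<close>

lemma test_fun_pointwise_small:
  assumes p: "p > 0" and N: "real N * p \<ge> real (CARD('n) + doubling_exp + 1)" and z: "norm z < 1"
  shows "\<exists>C. \<forall>a::complex^'n. norm a < 1 \<longrightarrow> cmod (test_fun N a z) powr p / ball_mass a \<le> C * (1 - norm a)"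
proof -
  let ?n = "CARD('n)"
  define A where "A = (2 / (1 - norm z)) powr (N * p) * (2 ^ doubling_exp / tail_mass 1)"
  have "cmod (test_fun N a z) powr p / ball_mass a \<le> A * (1 - norm a)" if a: "norm a < 1" for a
  proof -
    define d where "d = 1 - norm a"
    have d: "0 < d" "d \<le> 1" using a by (auto simp: d_def)
    have "1 - norm z \<le> cmod (1 - herm z a)"
      using norm_one_minus_herm_ge'[OF a, of z] by (metis complex_cnj_diff complex_cnj_one complex_mod_cnj herm_commute)
    then have "cmod (test_fun N a z) \<le> (2 / ((1 - norm z) / d)) ^ N"
      using z d by (intro cmod_test_fun_le[OF a]) (auto simp: d_def[symmetric])
    then have "cmod (test_fun N a z) powr p \<le> ((2 / ((1 - norm z) / d)) ^ N) powr p" using p by (intro powr_mono2) auto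
    also have "\<dots> = (2 / (1 - norm z) * d) powr (N * p)"
      using z d by (simp add: powr_realpow[symmetric] powr_powr)
    also have "\<dots> = (2 / (1 - norm z)) powr (N * p) * d powr (N * p)"
      by (subst powr_mult) (use z d in auto)
    also have "\<dots> \<le> (2 / (1 - norm z)) powr (N * p) * d powr real (?n + doubling_exp + 1)"
      using N d by (intro mult_left_mono powr_mono') auto
    also have "d powr real (?n + doubling_exp + 1) = d ^ ?n * d ^ doubling_exp * d" 
      using d by (subst powr_realpow) (auto simp: power_add)
    finally have 1: "cmod (test_fun N a z) powr p \<le> (2 / (1 - norm z)) powr (N * p) * (d ^ ?n * d ^ doubling_exp * d)" .
    have O1: "tail_mass 1 > 0" by (rule tail_mass_pos) simp
    have "tail_mass 1 * (d / 2) ^ doubling_exp \<le> tail_mass d" using d by (rule tail_mass_lower)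
    then have "d ^ doubling_exp \<le> (2 ^ doubling_exp / tail_mass 1) * tail_mass d" using O1 by (simp add: power_divide field_simps)
    then have "d ^ ?n * d ^ doubling_exp * d \<le> d ^ ?n * ((2 ^ doubling_exp / tail_mass 1) * tail_mass d) * d"
      using d by (intro mult_right_mono mult_left_mono) auto
    also have "\<dots> = (2 ^ doubling_exp / tail_mass 1) * d * ball_mass a" by (simp add: ball_mass_def d_def[symmetric])
    finally have "(2 / (1 - norm z)) powr (N * p) * (d ^ ?n * d ^ doubling_exp * d) \<le> (2 / (1 - norm z)) powr (N * p) * ((2 ^ doubling_exp / tail_mass 1) * d * ball_mass a)"
      by (intro mult_left_mono) auto
    with 1 have "cmod (test_fun N a z) powr p \<le> A * d * ball_mass a" by (simp add: A_def mult_ac)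
    then show ?thesis using ball_mass_pos[OF a] by (simp add: d_def pos_divide_le_eq)
  qed
  then show ?thesis by blast
qed

end

section \<open>Carleson measures and Bergman balls\<close>

context doubling_weight
begin

definition cV :: real where "cV = 1 / measure lborel (unit_ball :: (complex^'n) set)"

lemma cV_pos: "cV > 0" and ennreal_cV: "1 / emeasure lborel (unit_ball :: (complex^'n) set) = ennreal cV"
proof -
  have "emeasure lborel (unit_ball :: (complex^'n) set) = ennreal (measure lborel (unit_ball :: (complex^'n) set))"
    using emeasure_unit_ball(2)[where 'n='n] by (intro emeasure_eq_ennreal_measure) auto
  moreover from this have m: "measure lborel (unit_ball :: (complex^'n) set) > 0"
    using emeasure_unit_ball(1)[where 'n='n] by (metis ennreal_eq_0_iff less_irrefl not_le)
  ultimately show "1 / emeasure lborel (unit_ball :: (complex^'n) set) = ennreal cV"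
    by (metis cV_def divide_ennreal ennreal_1 zero_le_one)
  show "cV > 0" using m by (simp add: cV_def)
qed

lemma Apw_int_eq:
  fixes f :: "complex^'n \<Rightarrow> complex"
  assumes f: "holo_on unit_ball f"
  shows "Apw_int p w f = ennreal cV * wint p f"
proof -
  define f0 where "f0 y = indicator unit_ball y * f y" for y
  have [measurable]: "f0 \<in> borel_measurable borel" unfolding f0_def by (rule holo_on_borel_measurable[OF f])
  have eq: "ennreal (cmod (f z) powr p * w (norm z)) * indicator unit_ball z = ennreal (cmod (f0 z) powr p) * wt (norm z)" for z
    by (auto simp: f0_def wt_def indicator_def ennreal_mult')
  have "Apw_int p w f = ennreal cV * (\<integral>\<^sup>+z. ennreal (cmod (f z) powr p * w (norm z)) * indicator unit_ball z \<partial>lborel)"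
    unfolding Apw_int_def ennreal_cV[symmetric] by (rule nn_integral_dV) (simp add: eq)
  also have "(\<integral>\<^sup>+z. ennreal (cmod (f z) powr p * w (norm z)) * indicator unit_ball z \<partial>lborel) = wint p f"
    unfolding eq wint_def by (intro nn_integral_cong) (auto simp: f0_def wt_def indicator_def)
  finally show ?thesis .
qed

lemma in_Apw_iff: "in_Apw p w (f :: complex^'n \<Rightarrow> complex) \<longleftrightarrow> holo_on unit_ball f \<and> wint p f < \<infinity>"
  using cV_pos by (auto simp: in_Apw_def Apw_int_eq ennreal_mult_less_top)

lemma Apw_norm_powr:
  fixes f :: "complex^'n \<Rightarrow> complex"
  assumes "holo_on unit_ball f" "p > 0"
  shows "Apw_norm p w f powr q = (cV * enn2real (wint p f)) powr (q / p)"
  using assms cV_pos by (simp add: Apw_norm_def Apw_int_eq powr_powr enn2real_mult)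

lemma Apw_norm_nonneg: "Apw_norm p w f \<ge> 0"
  by (simp add: Apw_norm_def)

lemma tail_mass_measurable [measurable]: "tail_mass \<in> borel_measurable borel"
  by (intro borel_measurable_mono) (auto simp: mono_def tail_mass_mono)

lemma ball_mass_measurable [measurable]: "ball_mass \<in> borel_measurable borel"
  unfolding ball_mass_def by measurable

text \<open>Up to c the quotient is \<omega>^(|\<zeta>|)/(1 - |\<zeta>|), the regular weight at the
  centre; doubling transports it across the Bergman ball.\<close>

lemma reg_weight_ge:
  assumes k: "\<kappa> > 0"
  shows "\<exists>c>0. \<forall>(\<zeta>::complex^'n) y. norm \<zeta> < 1 \<longrightarrow> y \<in> hball \<kappa> \<zeta> \<longrightarrow>
    ennreal (c * ball_mass \<zeta> / (1 - norm \<zeta>) ^ (CARD('n) + 1)) \<le> reg_weight (norm y)"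
proof -
  obtain C where C: "C \<ge> 1" "\<And>t. t > 0 \<Longrightarrow> tail_mass ((4 / \<kappa>) * t) \<le> C * tail_mass t" using tail_mass_scale by blast
  define c where "c = \<kappa> / (4 * C)"
  have "ennreal (c * ball_mass \<zeta> / (1 - norm \<zeta>) ^ (CARD('n) + 1)) \<le> reg_weight (norm y)"
    if z: "norm \<zeta> < 1" and y: "y \<in> hball \<kappa> \<zeta>" for \<zeta> y :: "complex^'n"
  proof -
    have y1: "norm y < 1" and hk: "\<kappa> \<le> hyp_kernel \<zeta> y" using y by (auto simp: hball_def)
    have "\<kappa> * (1 - norm \<zeta>) / 4 \<le> 1 - norm y" by (rule hyp_kernel_norm_compare[OF z y1 hk]) (use k in simp)
    then have a1: "1 - norm \<zeta> \<le> (4 / \<kappa>) * (1 - norm y)" using k by (simp add: field_simps)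
    have "\<kappa> * (1 - norm y) / 4 \<le> 1 - norm \<zeta>"
      by (rule hyp_kernel_norm_compare[OF y1 z]) (use k hk in \<open>auto simp: hyp_kernel_commute\<close>)
    then have "1 - norm y \<le> (4 / \<kappa>) * (1 - norm \<zeta>)" using k by (simp add: field_simps)
    then have a2: "(\<kappa> / 4) / (1 - norm \<zeta>) \<le> 1 / (1 - norm y)" using k z y1 by (simp add: field_simps)
    have "tail_mass (1 - norm \<zeta>) \<le> C * tail_mass (1 - norm y)"
      using tail_mass_mono[OF a1] C(2)[of "1 - norm y"] y1 by linarith
    then have a3: "tail_mass (1 - norm \<zeta>) / C \<le> tail_mass (1 - norm y)" using C(1) by (simp add: field_simps)
    have "c * ball_mass \<zeta> / (1 - norm \<zeta>) ^ (CARD('n) + 1) = (tail_mass (1 - norm \<zeta>) / C) * ((\<kappa> / 4) / (1 - norm \<zeta>))"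
    proof -
      have "\<kappa> / (4 * C) * (t ^ k * x) / t ^ (k + 1) = (x / C) * ((\<kappa> / 4) / t)" if "t \<noteq> 0" for t x :: real and k
        using that by (simp add: field_simps)
      from this[of "1 - norm \<zeta>"] show ?thesis using z unfolding c_def ball_mass_def by simp
    qed
    also have "\<dots> \<le> tail_mass (1 - norm y) * (1 / (1 - norm y))"
      using a2 a3 tail_mass_pos[of "1 - norm y"] k z y1 by (intro mult_mono) auto
    finally have "ennreal (c * ball_mass \<zeta> / (1 - norm \<zeta>) ^ (CARD('n) + 1)) \<le> ennreal (tail_mass (1 - norm y) * (1 / (1 - norm y)))"
      by (rule ennreal_leI)
    also have "\<dots> = ennreal (tail_mass (1 - norm y)) * ennreal (1 / (1 - norm y))"
      using y1 tail_mass_pos[of "1 - norm y"] by (intro ennreal_mult) auto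
    also have "\<dots> = reg_weight (norm y)"
      using y1 by (simp add: reg_weight_def tail_mass_def ennreal_what)
    finally show ?thesis .
  qed
  moreover have "c > 0" using k C(1) by (simp add: c_def)
  ultimately show ?thesis by blast
qed

lemma ball_mass_locmean_le:
  assumes k: "\<kappa> > 0" and p: "p > 0"
  shows "\<exists>c>0. \<forall>(f::complex^'n \<Rightarrow> complex) \<zeta>. holo_on unit_ball f \<longrightarrow> norm \<zeta> < 1 \<longrightarrow>
    ennreal (c * ball_mass \<zeta> * locmean p \<kappa> f \<zeta>) \<le> (\<integral>\<^sup>+y. ennreal (cmod (f y) powr p) * reg_weight (norm y) * indicator (hball \<kappa> \<zeta>) y \<partial>lborel)"
proof -
  obtain c where c: "c > 0" "\<And>(\<zeta>::complex^'n) y. norm \<zeta> < 1 \<Longrightarrow> y \<in> hball \<kappa> \<zeta> \<Longrightarrow>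
    ennreal (c * ball_mass \<zeta> / (1 - norm \<zeta>) ^ (CARD('n) + 1)) \<le> reg_weight (norm y)"
    using reg_weight_ge[OF k] by blast
  have "ennreal (c * ball_mass \<zeta> * locmean p \<kappa> f \<zeta>) \<le> (\<integral>\<^sup>+y. ennreal (cmod (f y) powr p) * reg_weight (norm y) * indicator (hball \<kappa> \<zeta>) y \<partial>lborel)"
    if f: "holo_on unit_ball f" and z: "norm \<zeta> < 1" for f :: "complex^'n \<Rightarrow> complex" and \<zeta>
  proof -
    define f0 where "f0 y = indicator unit_ball y * f y" for y
    have [measurable]: "f0 \<in> borel_measurable borel" unfolding f0_def by (rule holo_on_borel_measurable[OF f])
    define m where "m = (1 - norm \<zeta>) ^ (CARD('n) + 1)"
    have m: "m > 0" using z by (simp add: m_def)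
    have L: "locint p \<kappa> f \<zeta> = (\<integral>\<^sup>+y. ennreal (cmod (f0 y) powr p) * indicator (hball \<kappa> \<zeta>) y \<partial>lborel)"
      unfolding locint_def by (intro nn_integral_cong) (auto simp: f0_def hball_def indicator_def)
    have "ennreal (c * ball_mass \<zeta> * locmean p \<kappa> f \<zeta>) = ennreal ((c * ball_mass \<zeta> / m) * (locmean p \<kappa> f \<zeta> * m))"
      using m by (simp add: mult.assoc)
    also have "\<dots> = ennreal (c * ball_mass \<zeta> / m) * locint p \<kappa> f \<zeta>"
      unfolding m_def ennreal_locmean[OF f z k p, symmetric] using z c(1) ball_mass_pos[OF z]
      by (intro ennreal_mult mult_nonneg_nonneg locmean_nonneg divide_nonneg_nonneg) auto
    also have "\<dots> = (\<integral>\<^sup>+y. ennreal (c * ball_mass \<zeta> / m) * (ennreal (cmod (f0 y) powr p) * indicator (hball \<kappa> \<zeta>) y) \<partial>lborel)"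
      unfolding L by (rule nn_integral_cmult[symmetric]) measurable
    also have "\<dots> \<le> (\<integral>\<^sup>+y. ennreal (cmod (f y) powr p) * reg_weight (norm y) * indicator (hball \<kappa> \<zeta>) y \<partial>lborel)"
    proof (rule nn_integral_mono)
      fix y :: "complex^'n"
      show "ennreal (c * ball_mass \<zeta> / m) * (ennreal (cmod (f0 y) powr p) * indicator (hball \<kappa> \<zeta>) y) \<le>
        ennreal (cmod (f y) powr p) * reg_weight (norm y) * indicator (hball \<kappa> \<zeta>) y"
      proof (cases "y \<in> hball \<kappa> \<zeta>")
        case True
        then have "ennreal (c * ball_mass \<zeta> / m) * ennreal (cmod (f y) powr p) \<le> reg_weight (norm y) * ennreal (cmod (f y) powr p)"
          using c(2)[OF z True] by (intro mult_right_mono) (auto simp: m_def)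
        then show ?thesis using True by (simp add: f0_def hball_def mult.commute)
      qed simp
    qed
    finally show ?thesis .
  qed
  then show ?thesis using c(1) by blast
qed

text \<open>The integral against the regular weight over one Bergman ball is at most the total one.
  This is the growth estimate behind the normal family argument.\<close>

lemma locmean_le_norm:
  assumes k: "\<kappa> > 0" and p: "p > 0"
  shows "\<exists>C>0. \<forall>(f::complex^'n \<Rightarrow> complex) \<zeta>. in_Apw p w f \<longrightarrow> norm \<zeta> < 1 \<longrightarrow>
    ball_mass \<zeta> * locmean p \<kappa> f \<zeta> \<le> C * Apw_norm p w f powr p"
proof -
  obtain c where c: "c > 0" "\<And>(f::complex^'n \<Rightarrow> complex) \<zeta>. holo_on unit_ball f \<Longrightarrow> norm \<zeta> < 1 \<Longrightarrow>
    ennreal (c * ball_mass \<zeta> * locmean p \<kappa> f \<zeta>) \<le> (\<integral>\<^sup>+y. ennreal (cmod (f y) powr p) * reg_weight (norm y) * indicator (hball \<kappa> \<zeta>) y \<partial>lborel)"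
    using ball_mass_locmean_le[OF k p] by blast
  obtain C where C: "C > 0" "\<And>f. holo_on unit_ball f \<Longrightarrow>
    (\<integral>\<^sup>+z. ennreal (cmod (f z) powr p) * reg_weight (norm z) \<partial>lborel) \<le> ennreal C * wint p f"
    using regularized_integral_le[OF p] by blast
  have "ball_mass \<zeta> * locmean p \<kappa> f \<zeta> \<le> C / (c * cV) * Apw_norm p w f powr p"
    if f: "in_Apw p w f" and z: "norm \<zeta> < 1" for f :: "complex^'n \<Rightarrow> complex" and \<zeta>
  proof -
    have h: "holo_on unit_ball f" and fin: "wint p f < \<infinity>" using f by (auto simp: in_Apw_iff)
    have "ennreal (c * ball_mass \<zeta> * locmean p \<kappa> f \<zeta>) \<le> (\<integral>\<^sup>+y. ennreal (cmod (f y) powr p) * reg_weight (norm y) * indicator (hball \<kappa> \<zeta>) y \<partial>lborel)"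
      by (rule c(2)[OF h z])
    also have "\<dots> \<le> (\<integral>\<^sup>+z. ennreal (cmod (f z) powr p) * reg_weight (norm z) \<partial>lborel)"
      by (intro nn_integral_mono) (auto simp: indicator_def)
    also have "\<dots> \<le> ennreal C * wint p f" by (rule C(2)[OF h])
    also have "\<dots> = ennreal (C * enn2real (wint p f))"
      using fin C(1) by (simp add: ennreal_mult less_top)
    finally have "c * ball_mass \<zeta> * locmean p \<kappa> f \<zeta> \<le> C * enn2real (wint p f)"
      using C(1) by (subst (asm) ennreal_le_iff) auto
    moreover have "Apw_norm p w f powr p = cV * enn2real (wint p f)"
      using Apw_norm_powr[OF h p, of p] p cV_pos by simp
    ultimately show ?thesis using c(1) cV_pos by (simp add: field_simps)
  qed
  moreover have "C / (c * cV) > 0" using C c cV_pos by simp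
  ultimately show ?thesis by blast
qed

text \<open>With s = q/p \<ge> 1, a local integral J and the total Jt satisfy J^s \<le> Jt^(s-1) J,
  which leaves one linear factor for Fubini; this is where p \<le> q enters. The inner integral in
  \<zeta> then runs over a Bergman ball about y, where the condition on \<nu> applies. The set A
  localizes the estimate near the sphere for the compactness proof.\<close>

lemma carleson_integral_le:
  fixes \<nu> :: "(complex^'n) measure"
  assumes sets: "sets \<nu> = sets ball_borel" and sf: "sigma_finite_measure \<nu>"
    and p: "0 < p" "p \<le> q" and k: "\<kappa> > 0"
  shows "\<exists>C>0. \<forall>(f::complex^'n \<Rightarrow> complex) A \<epsilon>. in_Apw p w f \<longrightarrow> A \<in> sets \<nu> \<longrightarrow> 0 \<le> \<epsilon> \<longrightarrow>
     (\<forall>a. norm a < 1 \<longrightarrow> emeasure \<nu> (hball \<kappa> a \<inter> A) \<le> ennreal (\<epsilon> * ball_mass a powr (q / p))) \<longrightarrow>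
     (\<integral>\<^sup>+\<zeta>. ennreal (locmean p \<kappa> f \<zeta> powr (q / p)) * indicator A \<zeta> \<partial>\<nu>) \<le> ennreal (C * \<epsilon> * Apw_norm p w f powr q)"
proof -
  interpret sigma_finite_measure \<nu> by (rule sf)
  interpret pair: pair_sigma_finite \<nu> "lborel :: (complex^'n) measure" ..
  define s where "s = q / p"
  have s: "s \<ge> 1" using p by (simp add: s_def)
  have sp: "space \<nu> = unit_ball" using sets_eq_imp_space_eq[OF sets] by (simp add: ball_borel_def space_restrict_space)
  obtain c where c: "c > 0" "\<And>(f::complex^'n \<Rightarrow> complex) \<zeta>. holo_on unit_ball f \<Longrightarrow> norm \<zeta> < 1 \<Longrightarrow>
    ennreal (c * ball_mass \<zeta> * locmean p \<kappa> f \<zeta>) \<le> (\<integral>\<^sup>+y. ennreal (cmod (f y) powr p) * reg_weight (norm y) * indicator (hball \<kappa> \<zeta>) y \<partial>lborel)"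
    using ball_mass_locmean_le[OF k p(1)] by blast
  obtain C1 where C1: "C1 > 0" "\<And>f. holo_on unit_ball f \<Longrightarrow>
    (\<integral>\<^sup>+z. ennreal (cmod (f z) powr p) * reg_weight (norm z) \<partial>lborel) \<le> ennreal C1 * wint p f"
    using regularized_integral_le[OF p(1)] by blast
  obtain CM where CM: "CM \<ge> 1" "\<And>a z. norm a < 1 \<Longrightarrow> norm z < 1 \<Longrightarrow> \<kappa> \<le> hyp_kernel a z \<Longrightarrow> ball_mass z \<le> CM * ball_mass a"
    using ball_mass_compare[OF k] by blast
  define C where "C = c powr (-s) * CM powr s * (C1 / cV) powr s"
  have idm: "(\<lambda>x. x) \<in> measurable \<nu> borel"
    unfolding measurable_cong_sets[OF sets refl] ball_borel_def by (rule measurable_restrict_space1) simp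
  have pidm: "(\<lambda>x. (fst x, snd x)) \<in> measurable (\<nu> \<Otimes>\<^sub>M lborel) (borel \<Otimes>\<^sub>M borel)"
    by (rule measurable_Pair) (auto intro: measurable_compose[OF measurable_fst idm] measurable_compose[OF measurable_snd])
  have "(\<integral>\<^sup>+\<zeta>. ennreal (locmean p \<kappa> f \<zeta> powr s) * indicator A \<zeta> \<partial>\<nu>) \<le> ennreal (C * \<epsilon> * Apw_norm p w f powr q)"
    if f: "in_Apw p w f" and A [measurable]: "A \<in> sets \<nu>" and e: "0 \<le> \<epsilon>"
      and car: "\<And>a. norm a < 1 \<Longrightarrow> emeasure \<nu> (hball \<kappa> a \<inter> A) \<le> ennreal (\<epsilon> * ball_mass a powr s)"
    for f :: "complex^'n \<Rightarrow> complex" and A \<epsilon>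
  proof -
    have h: "holo_on unit_ball f" and fin: "wint p f < \<infinity>" using f by (auto simp: in_Apw_iff)
    define f0 where "f0 y = indicator unit_ball y * f y" for y
    have [measurable]: "f0 \<in> borel_measurable borel" unfolding f0_def by (rule holo_on_borel_measurable[OF h])
    define F where "F y = ennreal (cmod (f0 y) powr p) * reg_weight (norm y)" for y
    have [measurable]: "F \<in> borel_measurable borel" unfolding F_def by measurable
    define Jt where "Jt = (\<integral>\<^sup>+y. F y \<partial>lborel)"
    define jt where "jt = enn2real Jt"
    have Jt_eq: "Jt = (\<integral>\<^sup>+z. ennreal (cmod (f z) powr p) * reg_weight (norm z) \<partial>lborel)"
      unfolding Jt_def F_def by (intro nn_integral_cong) (auto simp: f0_def reg_weight_def indicator_def)
    have "Jt \<le> ennreal C1 * wint p f" unfolding Jt_eq by (rule C1(2)[OF h])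
    also have "\<dots> = ennreal (C1 * enn2real (wint p f))"
      using fin C1(1) by (simp add: ennreal_mult less_top)
    finally have Jt_le: "Jt \<le> ennreal (C1 * enn2real (wint p f))" .
    then have Jt_fin: "Jt < \<infinity>" using order_le_less_trans by fastforce
    have jt: "Jt = ennreal jt" "jt \<ge> 0" using Jt_fin by (auto simp: jt_def less_top)
    have jt_le: "jt \<le> C1 * enn2real (wint p f)"
      using Jt_le jt C1(1) by (subst (asm) jt(1)) (auto simp: ennreal_le_iff)
    define J where "J \<zeta> = (\<integral>\<^sup>+y. F y * indicator (hball \<kappa> \<zeta>) y \<partial>lborel)" for \<zeta>
    have pt: "ennreal (locmean p \<kappa> f \<zeta> powr s) \<le> ennreal (jt powr (s - 1) * c powr (-s)) * (ennreal (ball_mass \<zeta> powr (-s)) * J \<zeta>)"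
      if z: "norm \<zeta> < 1" for \<zeta>
    proof -
      have JJ: "J \<zeta> \<le> Jt" unfolding J_def Jt_def by (intro nn_integral_mono) (auto simp: indicator_def)
      define j where "j = enn2real (J \<zeta>)"
      have "J \<zeta> < \<infinity>" using JJ Jt_fin by (rule order_le_less_trans)
      then have j: "J \<zeta> = ennreal j" "j \<ge> 0" by (auto simp: j_def less_top)
      have jj: "j \<le> jt" using JJ j jt by simp
      have "ennreal (c * ball_mass \<zeta> * locmean p \<kappa> f \<zeta>) \<le> J \<zeta>"
        using c(2)[OF h z] unfolding J_def F_def
        by (rule order_trans) (intro nn_integral_mono, auto simp: f0_def hball_def indicator_def)
      then have "c * ball_mass \<zeta> * locmean p \<kappa> f \<zeta> \<le> j" using j by (simp add: ennreal_le_iff)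
      then have "locmean p \<kappa> f \<zeta> \<le> j / (c * ball_mass \<zeta>)" using c(1) ball_mass_pos[OF z] by (simp add: field_simps)
      then have "locmean p \<kappa> f \<zeta> powr s \<le> (j / (c * ball_mass \<zeta>)) powr s"
        using s locmean_nonneg[OF z] by (intro powr_mono2) auto
      also have "\<dots> = j powr s * (c powr (-s) * ball_mass \<zeta> powr (-s))"
        using j c(1) ball_mass_pos[OF z] by (simp add: powr_divide powr_mult powr_minus field_simps)
      also have "\<dots> \<le> (jt powr (s - 1) * j) * (c powr (-s) * ball_mass \<zeta> powr (-s))"
      proof (rule mult_right_mono)
        show "j powr s \<le> jt powr (s - 1) * j"
        proof (cases "j = 0")
          case False
          then have "j powr s = j powr (s - 1) * j" using j(2) by (simp add: powr_diff)
          also have "\<dots> \<le> jt powr (s - 1) * j" using jj j s by (intro mult_right_mono powr_mono2) auto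
          finally show ?thesis .
        qed simp
      qed auto
      finally have "locmean p \<kappa> f \<zeta> powr s \<le> (jt powr (s - 1) * c powr (-s)) * (ball_mass \<zeta> powr (-s) * j)"
        by (simp add: mult_ac)
      then have "ennreal (locmean p \<kappa> f \<zeta> powr s) \<le> ennreal ((jt powr (s - 1) * c powr (-s)) * (ball_mass \<zeta> powr (-s) * j))"
        by (rule ennreal_leI)
      also have "\<dots> = ennreal (jt powr (s - 1) * c powr (-s)) * (ennreal (ball_mass \<zeta> powr (-s)) * J \<zeta>)"
        using j by (simp add: ennreal_mult)
      finally show ?thesis .
    qed
    define H where "H x = ennreal (ball_mass (fst x) powr (-s)) * (F (snd x) * indicator {x. norm (snd x) < 1 \<and> \<kappa> \<le> hyp_kernel (fst x) (snd x)} x)" for x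
    have "H \<in> borel_measurable (borel \<Otimes>\<^sub>M borel)" unfolding H_def by measurable
    from measurable_compose[OF pidm this] have H1 [measurable]: "H \<in> borel_measurable (\<nu> \<Otimes>\<^sub>M lborel)" by simp
    have HJ: "(\<integral>\<^sup>+y. H (\<zeta>, y) \<partial>lborel) = ennreal (ball_mass \<zeta> powr (-s)) * J \<zeta>" for \<zeta>
    proof -
      have "(\<integral>\<^sup>+y. H (\<zeta>, y) \<partial>lborel) = (\<integral>\<^sup>+y. ennreal (ball_mass \<zeta> powr (-s)) * (F y * indicator (hball \<kappa> \<zeta>) y) \<partial>lborel)"
        by (intro nn_integral_cong) (auto simp: H_def hball_def indicator_def)
      also have "\<dots> = ennreal (ball_mass \<zeta> powr (-s)) * J \<zeta>" unfolding J_def by (rule nn_integral_cmult) measurable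
      finally show ?thesis .
    qed
    \<comment> \<open>\<open>hyp_kernel\<close> is symmetric, so the admissible \<zeta> fill
      \<open>hball \<kappa> y\<close>, and \<open>ball_mass \<zeta>\<close> is replaced by
      \<open>ball_mass y\<close> at the cost of \<open>CM powr s\<close>; the powers of
      \<open>ball_mass y\<close> then cancel.\<close>
    have inner: "(\<integral>\<^sup>+\<zeta>. H (\<zeta>, y) * indicator A \<zeta> \<partial>\<nu>) \<le> F y * ennreal (CM powr s * \<epsilon>)" for y
    proof (cases "norm y < 1")
      case False
      then show ?thesis by (simp add: H_def)
    next
      case True
      have "hball \<kappa> y \<in> sets \<nu>" unfolding sets ball_borel_def
        by (subst sets_restrict_space_iff) (auto simp: hball_def)
      then have hm: "hball \<kappa> y \<inter> A \<in> sets \<nu>" by simp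
      have "(\<integral>\<^sup>+\<zeta>. H (\<zeta>, y) * indicator A \<zeta> \<partial>\<nu>) \<le> (\<integral>\<^sup>+\<zeta>. (F y * ennreal (CM powr s * ball_mass y powr (-s))) * indicator (hball \<kappa> y \<inter> A) \<zeta> \<partial>\<nu>)"
      proof (rule nn_integral_mono)
        fix \<zeta> assume "\<zeta> \<in> space \<nu>"
        then have z: "norm \<zeta> < 1" by (simp add: sp)
        show "H (\<zeta>, y) * indicator A \<zeta> \<le> (F y * ennreal (CM powr s * ball_mass y powr (-s))) * indicator (hball \<kappa> y \<inter> A) \<zeta>"
        proof (cases "\<kappa> \<le> hyp_kernel \<zeta> y")
          case hk: True
          have "ball_mass y / CM \<le> ball_mass \<zeta>" using CM(2)[OF z True hk] CM(1) by (simp add: field_simps)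
          then have "ball_mass \<zeta> powr (-s) \<le> (ball_mass y / CM) powr (-s)"
            using s ball_mass_pos[OF True] CM(1) by (intro powr_mono2') auto
          also have "\<dots> = CM powr s * ball_mass y powr (-s)"
            using ball_mass_pos[OF True] CM(1) by (simp add: powr_divide powr_minus field_simps)
          finally have "ennreal (ball_mass \<zeta> powr (-s)) \<le> ennreal (CM powr s * ball_mass y powr (-s))" by (rule ennreal_leI)
          then have "ennreal (ball_mass \<zeta> powr (-s)) * F y \<le> ennreal (CM powr s * ball_mass y powr (-s)) * F y"
            by (intro mult_right_mono) auto
          moreover have "\<zeta> \<in> hball \<kappa> y" using hk z by (simp add: hball_def hyp_kernel_commute)
          ultimately show ?thesis using True hk by (auto simp: H_def indicator_def mult.commute)
        qed (simp add: H_def)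
      qed
      also have "\<dots> = (F y * ennreal (CM powr s * ball_mass y powr (-s))) * emeasure \<nu> (hball \<kappa> y \<inter> A)"
        by (rule nn_integral_cmult_indicator[OF hm])
      also have "\<dots> \<le> (F y * ennreal (CM powr s * ball_mass y powr (-s))) * ennreal (\<epsilon> * ball_mass y powr s)"
        by (intro mult_left_mono car[OF True]) auto
      also have "\<dots> = F y * ennreal ((CM powr s * ball_mass y powr (-s)) * (\<epsilon> * ball_mass y powr s))"
        using e by (simp add: ennreal_mult mult.assoc)
      also have "(CM powr s * ball_mass y powr (-s)) * (\<epsilon> * ball_mass y powr s) = CM powr s * \<epsilon>"
        using ball_mass_pos[OF True] by (simp add: powr_minus)
      finally show ?thesis .
    qed
    have "(\<integral>\<^sup>+\<zeta>. ennreal (locmean p \<kappa> f \<zeta> powr s) * indicator A \<zeta> \<partial>\<nu>) \<le>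
       (\<integral>\<^sup>+\<zeta>. ennreal (jt powr (s - 1) * c powr (-s)) * (\<integral>\<^sup>+y. H (\<zeta>, y) * indicator A \<zeta> \<partial>lborel) \<partial>\<nu>)"
    proof (rule nn_integral_mono)
      fix \<zeta> assume "\<zeta> \<in> space \<nu>"
      then have z: "norm \<zeta> < 1" by (simp add: sp)
      show "ennreal (locmean p \<kappa> f \<zeta> powr s) * indicator A \<zeta> \<le> ennreal (jt powr (s - 1) * c powr (-s)) * (\<integral>\<^sup>+y. H (\<zeta>, y) * indicator A \<zeta> \<partial>lborel)"
        using pt[OF z] HJ[of \<zeta>] by (auto simp: indicator_def)
    qed
    also have "\<dots> = ennreal (jt powr (s - 1) * c powr (-s)) * (\<integral>\<^sup>+\<zeta>. (\<integral>\<^sup>+y. H (\<zeta>, y) * indicator A \<zeta> \<partial>lborel) \<partial>\<nu>)"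
      by (rule nn_integral_cmult) measurable
    also have "(\<integral>\<^sup>+\<zeta>. (\<integral>\<^sup>+y. H (\<zeta>, y) * indicator A \<zeta> \<partial>lborel) \<partial>\<nu>) = (\<integral>\<^sup>+y. (\<integral>\<^sup>+\<zeta>. H (\<zeta>, y) * indicator A \<zeta> \<partial>\<nu>) \<partial>lborel)"
      by (rule pair.Fubini'[symmetric]) measurable
    also have "\<dots> \<le> (\<integral>\<^sup>+y. F y * ennreal (CM powr s * \<epsilon>) \<partial>lborel)" by (intro nn_integral_mono inner)
    also have "\<dots> = Jt * ennreal (CM powr s * \<epsilon>)" unfolding Jt_def by (rule nn_integral_multc) measurable
    finally have "(\<integral>\<^sup>+\<zeta>. ennreal (locmean p \<kappa> f \<zeta> powr s) * indicator A \<zeta> \<partial>\<nu>) \<le>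
      ennreal (jt powr (s - 1) * c powr (-s)) * (Jt * ennreal (CM powr s * \<epsilon>))" by (simp add: mult_left_mono)
    also have "\<dots> = ennreal ((jt powr (s - 1) * c powr (-s)) * (jt * (CM powr s * \<epsilon>)))"
      using jt e by (simp add: ennreal_mult)
    also have "\<dots> \<le> ennreal (C * \<epsilon> * Apw_norm p w f powr q)"
    proof (rule ennreal_leI)
      have "jt powr (s - 1) * jt = jt powr s" using jt(2) by (cases "jt = 0") (auto simp: powr_diff)
      then have "(jt powr (s - 1) * c powr (-s)) * (jt * (CM powr s * \<epsilon>)) = jt powr s * (c powr (-s) * CM powr s * \<epsilon>)"
        by (metis mult.assoc mult.left_commute)
      also have "\<dots> \<le> (C1 * enn2real (wint p f)) powr s * (c powr (-s) * CM powr s * \<epsilon>)"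
        using jt_le jt s e by (intro mult_right_mono powr_mono2) auto
      also have "(C1 * enn2real (wint p f)) powr s = (C1 / cV) powr s * Apw_norm p w f powr q"
        using C1(1) cV_pos by (simp add: Apw_norm_powr[OF h p(1)] s_def powr_mult[symmetric])
      finally show "(jt powr (s - 1) * c powr (-s)) * (jt * (CM powr s * \<epsilon>)) \<le> C * \<epsilon> * Apw_norm p w f powr q"
        by (simp add: C_def mult_ac)
    qed
    finally show ?thesis .
  qed
  moreover have "C > 0" using c C1 cV_pos CM by (simp add: C_def)
  ultimately show ?thesis unfolding s_def by blast
qed

end

section \<open>Quasi-triangle inequalities in L^q for every q > 0\<close>

lemma powr_add_le:
  fixes x y q :: real
  assumes "0 \<le> x" "0 \<le> y" "0 < q"
  shows "(x + y) powr q \<le> 2 powr q * (x powr q + y powr q)"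
proof -
  have "(x + y) powr q \<le> (2 * max x y) powr q" using assms by (intro powr_mono2) auto
  also have "\<dots> = 2 powr q * max x y powr q" using assms by (simp add: powr_mult)
  also have "max x y powr q \<le> x powr q + y powr q" by (simp add: max_def)
  finally show ?thesis by (simp add: mult_left_mono)
qed

lemma cmod_add_powr_le:
  assumes "0 < q" shows "cmod (a + b) powr q \<le> 2 powr q * (cmod a powr q + cmod b powr q)"
proof -
  have "cmod (a + b) powr q \<le> (cmod a + cmod b) powr q"
    using assms by (intro powr_mono2 norm_triangle_ineq) auto
  also have "\<dots> \<le> 2 powr q * (cmod a powr q + cmod b powr q)" using assms by (intro powr_add_le) auto
  finally show ?thesis .
qed

lemma cmod_diff_powr_le:
  assumes "0 < q" shows "cmod (a - b) powr q \<le> 2 powr q * (cmod a powr q + cmod b powr q)"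
  using cmod_add_powr_le[OF assms, of a "- b"] by simp

lemma Lq_int_add_le:
  assumes [measurable]: "f \<in> borel_measurable M" "g \<in> borel_measurable M" and q: "q > 0"
  shows "Lq_int M q (\<lambda>z. f z + g z) \<le> ennreal (2 powr q) * (Lq_int M q f + Lq_int M q g)"
proof -
  have "Lq_int M q (\<lambda>z. f z + g z) \<le> (\<integral>\<^sup>+z. ennreal (2 powr q) * (ennreal (cmod (f z) powr q) + ennreal (cmod (g z) powr q)) \<partial>M)"
    unfolding Lq_int_def
    using cmod_add_powr_le[OF q] by (intro nn_integral_mono) (simp add: ennreal_plus[symmetric] ennreal_mult'[symmetric] del: ennreal_plus)
  also have "\<dots> = ennreal (2 powr q) * (Lq_int M q f + Lq_int M q g)"
    unfolding Lq_int_def by (simp add: nn_integral_cmult nn_integral_add)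
  finally show ?thesis .
qed

lemma Lq_int_cmult:
  assumes [measurable]: "g \<in> borel_measurable M"
  shows "Lq_int M q (\<lambda>z. c * g z) = ennreal (cmod c powr q) * Lq_int M q g"
  unfolding Lq_int_def by (simp add: norm_mult powr_mult ennreal_mult nn_integral_cmult)

lemma Lq_int_uminus: "Lq_int M q (\<lambda>z. - g z) = Lq_int M q g"
  by (simp add: Lq_int_def)

lemma Lq_int_eq_norm:
  assumes "Lq_int M q g < \<infinity>" "q > 0" shows "Lq_int M q g = ennreal (Lq_norm M q g powr q)"
  using assms by (simp add: Lq_norm_def powr_powr less_top)

lemma Lq_norm_nonneg: "Lq_norm M q g \<ge> 0"
  by (simp add: Lq_norm_def)

section \<open>The quasi-normed space A^p_\<omega> and normal families\<close>

context doubling_weight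
begin

lemma wint_mono:
  assumes "\<And>z. norm z < 1 \<Longrightarrow> cmod (f z) \<le> cmod (g z)" "p > 0"
  shows "wint p f \<le> wint p g"
  unfolding wint_def
proof (rule nn_integral_mono)
  fix z :: "complex^'n"
  show "ennreal (cmod (f z) powr p) * wt (norm z) \<le> ennreal (cmod (g z) powr p) * wt (norm z)"
  proof (cases "norm z < 1")
    case True
    then show ?thesis using assms by (intro mult_right_mono ennreal_leI powr_mono2) auto
  qed (simp add: wt_def)
qed

lemma wint_indicator: "wint p f = wint p (\<lambda>z. indicator unit_ball z * f z)"
  unfolding wint_def by (intro nn_integral_cong) (auto simp: wt_def indicator_def)

lemma wint_cmult:
  assumes "holo_on unit_ball f" shows "wint p (\<lambda>z. c * f z) = ennreal (cmod c powr p) * wint p f"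
proof -
  define f0 where "f0 y = indicator unit_ball y * f y" for y
  have [measurable]: "f0 \<in> borel_measurable borel" unfolding f0_def by (rule holo_on_borel_measurable[OF assms])
  have "wint p (\<lambda>z. c * f z) = (\<integral>\<^sup>+z. ennreal (cmod c powr p) * (ennreal (cmod (f0 z) powr p) * wt (norm z)) \<partial>lborel)"
    unfolding wint_def
    by (intro nn_integral_cong) (auto simp: f0_def wt_def indicator_def norm_mult powr_mult ennreal_mult mult_ac)
  also have "\<dots> = ennreal (cmod c powr p) * wint p f0"
    unfolding wint_def by (rule nn_integral_cmult) measurable
  also have "wint p f0 = wint p f" unfolding f0_def using wint_indicator by metis
  finally show ?thesis .
qed

lemma in_Apw_cmult:
  fixes f :: "complex^'n \<Rightarrow> complex"
  assumes "in_Apw p w f" shows "in_Apw p w (\<lambda>z. c * f z)"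
  using assms unfolding in_Apw_iff
  by (auto simp: wint_cmult ennreal_mult_less_top intro!: holo_on_mult holo_on_const open_unit_ball)

lemma Apw_norm_cmult:
  fixes f :: "complex^'n \<Rightarrow> complex"
  assumes "in_Apw p w f" "p > 0" shows "Apw_norm p w (\<lambda>z. c * f z) = cmod c * Apw_norm p w f"
proof -
  have h: "holo_on unit_ball f" using assms by (simp add: in_Apw_iff)
  then have "holo_on unit_ball (\<lambda>z. c * f z)" by (intro holo_on_mult holo_on_const open_unit_ball)
  then have "Apw_norm p w (\<lambda>z. c * f z) powr 1 = (cV * enn2real (wint p (\<lambda>z. c * f z))) powr (1 / p)"
    using assms(2) by (rule Apw_norm_powr)
  also have "\<dots> = cmod c * (cV * enn2real (wint p f)) powr (1 / p)"
    using assms(2) cV_pos by (simp add: wint_cmult[OF h] enn2real_mult powr_mult powr_powr mult_ac)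
  also have "(cV * enn2real (wint p f)) powr (1 / p) = Apw_norm p w f powr 1"
    by (rule Apw_norm_powr[symmetric]) (use h assms in auto)
  finally show ?thesis by (simp add: Apw_norm_nonneg)
qed

lemma wint_diff_le:
  assumes f: "holo_on unit_ball f" and g: "holo_on unit_ball g" and p: "p > 0"
  shows "wint p (\<lambda>z. f z - g z) \<le> ennreal (2 powr p) * (wint p f + wint p g)"
proof -
  define f0 where "f0 y = indicator unit_ball y * f y" for y
  define g0 where "g0 y = indicator unit_ball y * g y" for y
  have [measurable]: "f0 \<in> borel_measurable borel" "g0 \<in> borel_measurable borel"
    unfolding f0_def g0_def by (intro holo_on_borel_measurable f g)+
  have "wint p (\<lambda>z. f z - g z) \<le> (\<integral>\<^sup>+z. ennreal (2 powr p) * (ennreal (cmod (f0 z) powr p) * wt (norm z) + ennreal (cmod (g0 z) powr p) * wt (norm z)) \<partial>lborel)"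
    unfolding wint_def
  proof (rule nn_integral_mono)
    fix z :: "complex^'n"
    show "ennreal (cmod (f z - g z) powr p) * wt (norm z) \<le> ennreal (2 powr p) * (ennreal (cmod (f0 z) powr p) * wt (norm z) + ennreal (cmod (g0 z) powr p) * wt (norm z))"
    proof (cases "norm z < 1")
      case True
      have "ennreal (cmod (f z - g z) powr p) \<le> ennreal (2 powr p) * (ennreal (cmod (f z) powr p) + ennreal (cmod (g z) powr p))"
        using cmod_diff_powr_le[OF p] by (simp add: ennreal_plus[symmetric] ennreal_mult'[symmetric] del: ennreal_plus)
      then have "ennreal (cmod (f z - g z) powr p) * wt (norm z) \<le> ennreal (2 powr p) * (ennreal (cmod (f z) powr p) + ennreal (cmod (g z) powr p)) * wt (norm z)"
        by (intro mult_right_mono) auto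
      then show ?thesis using True by (simp add: f0_def g0_def distrib_left distrib_right mult_ac)
    qed (simp add: wt_def)
  qed
  also have "\<dots> = ennreal (2 powr p) * (wint p f0 + wint p g0)"
    unfolding wint_def by (subst nn_integral_cmult, measurable, subst nn_integral_add) auto
  also have "wint p f0 = wint p f" unfolding f0_def using wint_indicator by metis
  also have "wint p g0 = wint p g" unfolding g0_def using wint_indicator by metis
  finally show ?thesis .
qed

lemma in_Apw_diff:
  fixes f g :: "complex^'n \<Rightarrow> complex"
  assumes f: "in_Apw p w f" and g: "in_Apw p w g" and p: "p > 0"
  shows "in_Apw p w (\<lambda>z. f z - g z)"
    and "Apw_norm p w (\<lambda>z. f z - g z) powr p \<le> 2 powr p * (Apw_norm p w f powr p + Apw_norm p w g powr p)"
proof -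
  have h: "holo_on unit_ball f" "holo_on unit_ball g" "wint p f < \<infinity>" "wint p g < \<infinity>"
    using f g by (auto simp: in_Apw_iff)
  have hd: "holo_on unit_ball (\<lambda>z. f z - g z)" using h by (intro holo_on_diff)
  have le: "wint p (\<lambda>z. f z - g z) \<le> ennreal (2 powr p) * (wint p f + wint p g)"
    using wint_diff_le[OF h(1,2) p] .
  also have "\<dots> < \<infinity>" using h by (simp add: ennreal_mult_less_top)
  finally show in_d: "in_Apw p w (\<lambda>z. f z - g z)" using hd by (simp add: in_Apw_iff)
  have "enn2real (wint p (\<lambda>z. f z - g z)) \<le> enn2real (ennreal (2 powr p) * (wint p f + wint p g))"
    using le \<open>ennreal (2 powr p) * (wint p f + wint p g) < \<infinity>\<close> by (intro enn2real_mono) auto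
  also have "\<dots> = 2 powr p * (enn2real (wint p f) + enn2real (wint p g))"
    using h by (simp add: enn2real_mult enn2real_plus less_top)
  finally have "cV * enn2real (wint p (\<lambda>z. f z - g z)) \<le> cV * (2 powr p * (enn2real (wint p f) + enn2real (wint p g)))"
    using cV_pos by (intro mult_left_mono) auto
  moreover have "Apw_norm p w k powr p = cV * enn2real (wint p k)" if "holo_on unit_ball k" for k
    using Apw_norm_powr[OF that p, of p] p cV_pos by simp
  ultimately show "Apw_norm p w (\<lambda>z. f z - g z) powr p \<le> 2 powr p * (Apw_norm p w f powr p + Apw_norm p w g powr p)"
    using h hd by (simp add: algebra_simps)
qed

text \<open>On |z| \<le> s the quantity \<open>ball_mass z\<close> is bounded below by m, so the
  local-mean estimates become uniform in f and z. The radius \<theta>/4 forces \<rho>(z, y) < 1/2,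
  and the Lipschitz bound follows from \<rho>(z, y) \<le> 2|z - y|/\<theta>.\<close>

lemma Apw_local_bounds:
  assumes p: "p > 0" and s: "0 \<le> s" "s < 1"
  shows "\<exists>C>0. \<exists>\<delta>>0. \<forall>(f::complex^'n \<Rightarrow> complex) z. in_Apw p w f \<longrightarrow> norm z \<le> s \<longrightarrow>
     cmod (f z) \<le> C * Apw_norm p w f \<and>
     (\<forall>y. norm y < 1 \<longrightarrow> norm (z - y) < \<delta> \<longrightarrow> cmod (f z - f y) \<le> C * Apw_norm p w f * norm (z - y))"
proof -
  define r :: real where "r = 1/2"
  have r: "0 < r" "r < 1" by (auto simp: r_def)
  obtain C0 \<kappa> where C0: "C0 > 0" "0 < \<kappa>"
    "\<And>(f::complex^'n \<Rightarrow> complex) z y. holo_on unit_ball f \<Longrightarrow> norm z < 1 \<Longrightarrow> norm y < 1 \<Longrightarrow>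
     cmod (f z) powr p \<le> C0 * locmean p \<kappa> f z \<and>
     (pseudohyp z y < r \<longrightarrow> cmod (f z - f y) powr p \<le> C0 * (pseudohyp z y powr p * locmean p \<kappa> f z))"
    using locmean_diff[OF r p] by blast
  obtain C1 where C1: "C1 > 0" "\<And>(f::complex^'n \<Rightarrow> complex) \<zeta>. in_Apw p w f \<Longrightarrow> norm \<zeta> < 1 \<Longrightarrow>
    ball_mass \<zeta> * locmean p \<kappa> f \<zeta> \<le> C1 * Apw_norm p w f powr p"
    using locmean_le_norm[OF C0(2) p] by blast
  define m where "m = (1 - s) ^ CARD('n) * tail_mass (1 - s)"
  have m: "m > 0" using s tail_mass_pos[of "1 - s"] by (simp add: m_def)
  define B where "B = (C0 * (C1 / m)) powr (1 / p)"
  have B: "B > 0" using C0 C1 m by (simp add: B_def)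
  define \<theta> where "\<theta> = 1 - s\<^sup>2"
  have \<theta>: "\<theta> > 0" using s by (simp add: \<theta>_def power_less_one_iff abs_square_less_1)
  define C where "C = B * max 1 (2 / \<theta>)"
  have root: "x \<le> B * (t * n)" if "x powr p \<le> C0 * (t powr p * (C1 / m * n powr p))" "0 \<le> x" "0 \<le> t" "0 \<le> n" for x t n :: real
  proof -
    have "(x powr p) powr (1 / p) \<le> (C0 * (t powr p * (C1 / m * n powr p))) powr (1 / p)"
      using that p by (intro powr_mono2) auto
    also have "C0 * (t powr p * (C1 / m * n powr p)) = (C0 * (C1 / m)) * (t * n) powr p"
      using that by (simp add: powr_mult mult_ac)
    also have "\<dots> powr (1 / p) = B * (t * n)"
    proof -
      have "(X * y powr p) powr (1 / p) = X powr (1 / p) * y" if "X \<ge> 0" "y \<ge> 0" for X y :: real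
        using that p by (simp add: powr_mult powr_powr)
      moreover have "C0 * (C1 / m) \<ge> 0" "t * n \<ge> 0" using that C0(1) C1(1) m by auto
      ultimately show ?thesis unfolding B_def by blast
    qed
    finally show ?thesis using that p by (simp add: powr_powr)
  qed
  have "cmod (f z) \<le> C * Apw_norm p w f \<and>
     (\<forall>y. norm y < 1 \<longrightarrow> norm (z - y) < \<theta> / 4 \<longrightarrow> cmod (f z - f y) \<le> C * Apw_norm p w f * norm (z - y))"
    if f: "in_Apw p w f" and z: "norm z \<le> s" for f :: "complex^'n \<Rightarrow> complex" and z
  proof -
    have h: "holo_on unit_ball f" using f by (simp add: in_Apw_iff)
    have z1: "norm z < 1" using z s by simp
    have "m \<le> ball_mass z"
      unfolding m_def ball_mass_def using z z1 s tail_mass_pos[of "1 - s"] by (intro mult_mono power_mono tail_mass_mono) auto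
    then have "m * locmean p \<kappa> f z \<le> C1 * Apw_norm p w f powr p"
      using C1(2)[OF f z1] mult_right_mono[OF _ locmean_nonneg[OF z1], of m "ball_mass z" p \<kappa> f] by linarith
    then have L: "locmean p \<kappa> f z \<le> C1 / m * Apw_norm p w f powr p" using m by (simp add: field_simps)
    have nn: "Apw_norm p w f \<ge> 0" by (rule Apw_norm_nonneg)
    have "cmod (f z) powr p \<le> C0 * locmean p \<kappa> f z" using C0(3)[OF h z1 z1] by blast
    also have "\<dots> \<le> C0 * (C1 / m * Apw_norm p w f powr p)" by (intro mult_left_mono L) (use C0(1) in simp)
    also have "\<dots> = C0 * (1 powr p * (C1 / m * Apw_norm p w f powr p))" by simp
    finally have 1: "cmod (f z) \<le> B * (1 * Apw_norm p w f)" using nn by (intro root) auto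
    also have "\<dots> \<le> C * Apw_norm p w f" unfolding C_def using B nn by (simp add: mult_right_mono)
    finally have 1: "cmod (f z) \<le> C * Apw_norm p w f" .
    have 2: "cmod (f z - f y) \<le> C * Apw_norm p w f * norm (z - y)" if y: "norm y < 1" "norm (z - y) < \<theta> / 4" for y
    proof -
      have "(norm z)\<^sup>2 \<le> s\<^sup>2" using z by (intro power_mono) auto
      then have "\<theta> \<le> 1 - (norm z)\<^sup>2" by (simp add: \<theta>_def)
      then have \<rho>: "pseudohyp z y \<le> 2 / \<theta> * norm (z - y)" using pseudohyp_le_norm_diff[OF z1 y(1) _ \<theta>] by simp
      also have "\<dots> < r" using y(2) \<theta> by (simp add: field_simps r_def)
      finally have "cmod (f z - f y) powr p \<le> C0 * (pseudohyp z y powr p * locmean p \<kappa> f z)"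
        using C0(3)[OF h z1 y(1)] by blast
      also have "\<dots> \<le> C0 * (pseudohyp z y powr p * (C1 / m * Apw_norm p w f powr p))"
        using L C0(1) by (intro mult_left_mono) auto
      finally have "cmod (f z - f y) \<le> B * (pseudohyp z y * Apw_norm p w f)"
        using nn by (intro root) (auto simp: pseudohyp_def)
      also have "\<dots> \<le> B * ((2 / \<theta> * norm (z - y)) * Apw_norm p w f)"
        using \<rho> B nn by (intro mult_left_mono mult_right_mono) auto
      also have "\<dots> = (B * (2 / \<theta>)) * (Apw_norm p w f * norm (z - y))" by (simp only: mult_ac)
      also have "\<dots> \<le> C * (Apw_norm p w f * norm (z - y))"
        unfolding C_def using B nn by (intro mult_right_mono mult_left_mono) auto
      finally show ?thesis by (simp add: mult.assoc)
    qed
    show ?thesis using 1 2 by blast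
  qed
  moreover have "C > 0" "\<theta> / 4 > 0" using B \<theta> by (auto simp: C_def)
  ultimately show ?thesis by blast
qed

text \<open>\<open>Apw_local_bounds\<close> provides the uniform bound and the equicontinuity for
  Arzela-Ascoli on closed balls exhausting the unit ball; a diagonal subsequence serves all of
  them.\<close>

lemma Apw_montel:
  fixes fs :: "nat \<Rightarrow> complex^'n \<Rightarrow> complex"
  assumes p: "p > 0" and fs: "\<And>k. in_Apw p w (fs k)" "\<And>k. Apw_norm p w (fs k) \<le> B"
  shows "\<exists>(k::nat\<Rightarrow>nat) g. strict_mono k \<and> (\<forall>s<1. \<forall>e>0. \<exists>N. \<forall>n\<ge>N. \<forall>x. norm x \<le> s \<longrightarrow> cmod (fs (k n) x - g x) < e)"
proof -
  define S where "S i = cball (0::complex^'n) (1 - 1 / (real i + 2))" for i :: nat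
  define P where "P i r \<longleftrightarrow> (\<exists>g. \<forall>e>0. \<exists>N. \<forall>n\<ge>N. \<forall>x\<in>S i. cmod (fs (r n) x - g x) < e)" for i and r :: "nat \<Rightarrow> nat"
  have sub: "\<exists>k::nat \<Rightarrow> nat. strict_mono k \<and> P i (r \<circ> k)" for i r
  proof -
    define s where "s = 1 - 1 / (real i + 2)"
    have s: "0 \<le> s" "s < 1" by (auto simp: s_def field_simps)
    obtain C \<delta> where C: "C > 0" "\<delta> > 0" "\<And>(f::complex^'n \<Rightarrow> complex) z. in_Apw p w f \<Longrightarrow> norm z \<le> s \<Longrightarrow>
     cmod (f z) \<le> C * Apw_norm p w f \<and>
     (\<forall>y. norm y < 1 \<longrightarrow> norm (z - y) < \<delta> \<longrightarrow> cmod (f z - f y) \<le> C * Apw_norm p w f * norm (z - y))"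
      using Apw_local_bounds[OF p s] by blast
    define K where "K = C * \<bar>B\<bar> + 1"
    have K: "K > 0" using C(1) by (simp add: K_def add_nonneg_pos)
    have CB: "C * Apw_norm p w (fs k) \<le> K" for k
    proof -
      have "C * Apw_norm p w (fs k) \<le> C * \<bar>B\<bar>" using fs(2)[of k] C(1) by (intro mult_left_mono) auto
      then show ?thesis by (simp add: K_def)
    qed
    have bnd: "norm (fs (r n) x) \<le> K" if "x \<in> S i" for n x
      using C(3)[OF fs(1), of x "r n"] CB[of "r n"] that by (force simp: S_def s_def)
    have equi: "\<exists>d. 0 < d \<and> (\<forall>n y. y \<in> S i \<and> norm (x - y) < d \<longrightarrow> norm (fs (r n) x - fs (r n) y) < e)"
      if x: "x \<in> S i" and e: "0 < e" for x e
    proof (intro exI[of _ "min \<delta> (e / K)"] conjI allI impI)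
      show "0 < min \<delta> (e / K)" using C K e by simp
      fix n y assume y: "y \<in> S i \<and> norm (x - y) < min \<delta> (e / K)"
      have "norm y \<le> s" using y by (simp add: S_def s_def)
      then have "norm y < 1" using s by simp
      then have "cmod (fs (r n) x - fs (r n) y) \<le> C * Apw_norm p w (fs (r n)) * norm (x - y)"
        using C(3)[OF fs(1), of x "r n"] x y by (auto simp: S_def s_def)
      also have "\<dots> \<le> K * norm (x - y)" using CB by (intro mult_right_mono) auto
      also have "\<dots> < e" using y K by (simp add: field_simps)
      finally show "norm (fs (r n) x - fs (r n) y) < e" .
    qed
    obtain g k where "strict_mono (k::nat\<Rightarrow>nat)" "\<And>e. 0 < e \<Longrightarrow> \<exists>N. \<forall>n x. n \<ge> N \<and> x \<in> S i \<longrightarrow> norm ((fs \<circ> r) (k n) x - g x) < e"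
      by (rule Arzela_Ascoli[of "S i" "fs \<circ> r" K]) (use bnd equi in \<open>auto simp: S_def\<close>)
    then show ?thesis unfolding P_def by (intro exI[of _ k]) (auto, metis)
  qed
  \<comment> \<open>The diagonal sequence is a subsequence of each stage only from some index on;
    convergence ignores the initial terms.\<close>
  have P_P: "P i (r \<circ> k2)" if P1: "P i (r \<circ> k1)" and k: "\<And>j. N \<le> j \<Longrightarrow> \<exists>j'. j \<le> j' \<and> k2 j = k1 j'" for i r and k1 k2 :: "nat \<Rightarrow> nat" and N
  proof -
    obtain g where g: "\<And>e. e > 0 \<Longrightarrow> \<exists>N. \<forall>n\<ge>N. \<forall>x\<in>S i. cmod (fs ((r \<circ> k1) n) x - g x) < e"
      using P1 unfolding P_def by blast
    have "\<exists>N'. \<forall>n\<ge>N'. \<forall>x\<in>S i. cmod (fs ((r \<circ> k2) n) x - g x) < e" if e0: "e > 0" for e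
    proof -
      obtain M where M: "\<And>n x. n \<ge> M \<Longrightarrow> x \<in> S i \<Longrightarrow> cmod (fs ((r \<circ> k1) n) x - g x) < e" using g[OF e0] by blast
      have "cmod (fs ((r \<circ> k2) n) x - g x) < e" if n: "n \<ge> max N M" and x: "x \<in> S i" for n x
      proof -
        obtain j' where "n \<le> j'" "k2 n = k1 j'" using k[of n] n by auto
        then show ?thesis using M[of j' x] n x by simp
      qed
      then show ?thesis by blast
    qed
    then show ?thesis unfolding P_def by blast
  qed
  obtain k where k: "strict_mono (k::nat\<Rightarrow>nat)" "\<And>i. P i (id \<circ> k)"
    using subsequence_diagonalization_lemma[of P id] sub P_P by blast
  then obtain g where g: "\<And>i e. e > 0 \<Longrightarrow> \<exists>N. \<forall>n\<ge>N. \<forall>x\<in>S i. cmod (fs (k n) x - g i x) < e"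
    unfolding P_def by (simp add: choice_iff) metis
  \<comment> \<open>The limits on the exhausting balls were chosen separately; the pointwise limit
    glues them.\<close>
  define G where "G x = lim (\<lambda>n. fs (k n) x)" for x
  have gG: "g i x = G x" if "x \<in> S i" for i x
  proof -
    have "(\<lambda>n. fs (k n) x) \<longlonglongrightarrow> g i x"
      unfolding LIMSEQ_iff using g[of _ i] that by blast
    then show ?thesis unfolding G_def by (simp add: limI)
  qed
  have "\<exists>N. \<forall>n\<ge>N. \<forall>x. norm x \<le> s \<longrightarrow> cmod (fs (k n) x - G x) < e" if s: "s < 1" and e: "e > 0" for s e :: real
  proof -
    obtain i :: nat where i: "1 / (1 - s) < real i" using reals_Archimedean2 by blast
    then have "1 / (real i + 2) \<le> 1 - s"
    proof -
      have "1 < real i * (1 - s)" using i s by (simp add: field_simps)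
      then have "1 \<le> (real i + 2) * (1 - s)" using s by (simp add: algebra_simps)
      then show ?thesis using s by (simp add: field_simps)
    qed
    then have "x \<in> S i" if "norm x \<le> s" for x using that by (simp add: S_def)
    then show ?thesis using g[OF e, of i] gG[of _ i] by metis
  qed
  then have "\<forall>s<1. \<forall>e>0. \<exists>N. \<forall>n\<ge>N. \<forall>x. norm x \<le> s \<longrightarrow> cmod (fs (k n) x - G x) < e" by simp
  then show ?thesis using k(1) by (intro exI[of _ k] exI[of _ G] conjI)
qed

text \<open>Stated for every \<kappa>: the sufficiency argument dictates its own radius, and the
  necessity argument yields all of them.\<close>

definition carleson_on_balls :: "real \<Rightarrow> real \<Rightarrow> (complex^'n) measure \<Rightarrow> bool" where
  "carleson_on_balls p q \<nu> \<longleftrightarrow> (\<forall>\<kappa>>0. \<exists>C\<ge>0. \<forall>a. norm a < 1 \<longrightarrow> emeasure \<nu> (hball \<kappa> a) \<le> ennreal (C * ball_mass a powr (q / p)))"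

text \<open>Restricts \<nu> only near the sphere and would admit an infinite atom at 0; it is
  therefore paired with \<open>carleson_on_balls\<close>.\<close>

definition vanishing_on_balls :: "real \<Rightarrow> real \<Rightarrow> (complex^'n) measure \<Rightarrow> bool" where
  "vanishing_on_balls p q \<nu> \<longleftrightarrow> (\<forall>\<kappa>>0. \<forall>\<epsilon>>0. \<exists>s<1. \<forall>a. norm a < 1 \<longrightarrow> s \<le> norm a \<longrightarrow> emeasure \<nu> (hball \<kappa> a) \<le> ennreal (\<epsilon> * ball_mass a powr (q / p)))"

end

lemma hball_in_sets:
  assumes "sets \<nu> = sets ball_borel" shows "hball \<kappa> a \<in> sets \<nu>"
  unfolding assms ball_borel_def by (subst sets_restrict_space_iff) (auto simp: hball_def)

lemma space_eq_unit_ball: "sets \<nu> = sets ball_borel \<Longrightarrow> space \<nu> = unit_ball"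
  using sets_eq_imp_space_eq[of \<nu> ball_borel] by (simp add: ball_borel_def space_restrict_space)

lemma locmean_measurable:
  fixes f :: "complex^'n \<Rightarrow> complex"
  assumes f: "holo_on unit_ball f"
  shows "(\<lambda>\<zeta>. ennreal (locmean p \<kappa> f \<zeta> powr s)) \<in> borel_measurable borel"
proof -
  define f0 where "f0 y = indicator unit_ball y * f y" for y
  have [measurable]: "f0 \<in> borel_measurable borel" unfolding f0_def by (rule holo_on_borel_measurable[OF f])
  have "(\<lambda>\<zeta>. \<integral>\<^sup>+y. ennreal (cmod (f0 y) powr p) * indicator {x. norm (snd x) < 1 \<and> \<kappa> \<le> hyp_kernel (fst x) (snd x)} (\<zeta>, y) \<partial>lborel) \<in> borel_measurable borel"
    by measurable
  moreover have "locint p \<kappa> f = (\<lambda>\<zeta>. \<integral>\<^sup>+y. ennreal (cmod (f0 y) powr p) * indicator {x. norm (snd x) < 1 \<and> \<kappa> \<le> hyp_kernel (fst x) (snd x)} (\<zeta>, y) \<partial>lborel)"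
    unfolding locint_def by (intro ext nn_integral_cong) (auto simp: f0_def hball_def indicator_def)
  ultimately have [measurable]: "locint p \<kappa> f \<in> borel_measurable borel" by (simp only:)
  show ?thesis unfolding locmean_def by measurable
qed

lemma hyp_kernel_zero: "hyp_kernel 0 z = 1 - (norm z)\<^sup>2"
  by (simp add: hyp_kernel_def)

context doubling_weight
begin

lemma carleson_on_balls_cball_finite:
  assumes "carleson_on_balls p q \<nu>" "sets \<nu> = sets ball_borel" "s < 1"
  shows "emeasure \<nu> {\<zeta>. norm \<zeta> \<le> s} < \<infinity>"
proof -
  define s' where "s' = max s 0"
  have s': "0 \<le> s'" "s' < 1" using assms by (auto simp: s'_def)
  then have k: "1 - s'\<^sup>2 > 0" by (simp add: power_less_one_iff abs_square_less_1)
  have "{\<zeta>. norm \<zeta> \<le> s} \<subseteq> hball (1 - s'\<^sup>2) (0::complex^'n)"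
    using s' by (auto simp: hball_def hyp_kernel_zero s'_def intro!: power_mono)
  then have "emeasure \<nu> {\<zeta>. norm \<zeta> \<le> s} \<le> emeasure \<nu> (hball (1 - s'\<^sup>2) 0)"
    by (intro emeasure_mono hball_in_sets assms)
  also obtain C where "emeasure \<nu> (hball (1 - s'\<^sup>2) 0) \<le> ennreal (C * ball_mass 0 powr (q / p))"
    using assms(1) k unfolding carleson_on_balls_def by (metis norm_zero zero_less_one)
  also have "ennreal (C * ball_mass 0 powr (q / p)) < \<infinity>" by simp
  finally show ?thesis .
qed

text \<open>Fubini wants a \<sigma>-finite measure, and \<mu> is arbitrary; the property has to come
  from the ball condition, under which closed balls of radius below 1 have finite measure.\<close>

lemma carleson_on_balls_sigma_finite:
  assumes "carleson_on_balls p q \<nu>" "sets \<nu> = sets ball_borel"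
  shows "sigma_finite_measure \<nu>"
proof
  let ?A = "range (\<lambda>k::nat. {\<zeta>::complex^'n. norm \<zeta> \<le> 1 - 1 / (real k + 1)})"
  show "\<exists>A. countable A \<and> A \<subseteq> sets \<nu> \<and> \<Union> A = space \<nu> \<and> (\<forall>a\<in>A. emeasure \<nu> a \<noteq> \<infinity>)"
  proof (intro exI[of _ ?A] conjI)
    show "?A \<subseteq> sets \<nu>"
    proof safe
      fix k :: nat
      have l: "1 - 1 / (real k + 1) < 1" by simp
      show "{\<zeta>::complex^'n. norm \<zeta> \<le> 1 - 1 / (real k + 1)} \<in> sets \<nu>"
        unfolding assms(2) ball_borel_def using l
        by (subst sets_restrict_space_iff) (auto dest: order_le_less_trans[OF _ l])
    qed
    show "\<Union> ?A = space \<nu>"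
    proof (rule set_eqI)
      fix \<zeta> :: "complex^'n"
      have "\<exists>k::nat. norm \<zeta> \<le> 1 - 1 / (real k + 1)" if "norm \<zeta> < 1"
      proof -
        obtain k :: nat where k: "1 / (1 - norm \<zeta>) < real k" using reals_Archimedean2 by blast
        then have "1 < real k * (1 - norm \<zeta>)" using that by (simp add: field_simps)
        then have "1 \<le> (real k + 1) * (1 - norm \<zeta>)" using that by (simp add: algebra_simps)
        then have "1 / (real k + 1) \<le> 1 - norm \<zeta>" by (simp add: field_simps)
        then show ?thesis by (intro exI[of _ k]) simp
      qed
      moreover have "norm \<zeta> < 1" if "norm \<zeta> \<le> 1 - 1 / (real k + 1)" for k :: nat
        using that by (rule order_le_less_trans) simp
      ultimately show "\<zeta> \<in> \<Union> ?A \<longleftrightarrow> \<zeta> \<in> space \<nu>"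
        by (auto simp: space_eq_unit_ball[OF assms(2)])
    qed
    show "\<forall>a\<in>?A. emeasure \<nu> a \<noteq> \<infinity>"
      using carleson_on_balls_cball_finite[OF assms] by (auto simp: less_top)
  qed simp
qed

end

section \<open>Differences of weighted composition operators\<close>

text \<open>Formulated with measurable data so that it also contains the embedding into L^q_\<nu>,
  as the instance u = 1, v = 0 with identity maps.\<close>

locale weighted_composition = doubling_weight w ty
  for w :: "real \<Rightarrow> real" and ty :: "'n::finite itself" +
  fixes p q :: real and \<mu> :: "(complex^'n) measure"
    and u v :: "complex^'n \<Rightarrow> complex" and \<phi> \<psi> :: "complex^'n \<Rightarrow> complex^'n"
  assumes p_pos: "0 < p" and p_le_q: "p \<le> q"
    and u_meas [measurable]: "u \<in> borel_measurable \<mu>" and v_meas [measurable]: "v \<in> borel_measurable \<mu>"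
    and phi_meas [measurable]: "\<phi> \<in> measurable \<mu> ball_borel" and psi_meas [measurable]: "\<psi> \<in> measurable \<mu> ball_borel"
begin

abbreviation T :: "(complex^'n \<Rightarrow> complex) \<Rightarrow> complex^'n \<Rightarrow> complex" where
  "T \<equiv> wcomp_diff u \<phi> v \<psi>"

lemma q_pos: "0 < q" using p_pos p_le_q by simp

lemma phi_ball: "z \<in> space \<mu> \<Longrightarrow> norm (\<phi> z) < 1" and psi_ball: "z \<in> space \<mu> \<Longrightarrow> norm (\<psi> z) < 1"
  using measurable_space[OF phi_meas] measurable_space[OF psi_meas]
  by (auto simp: ball_borel_def space_restrict_space)

lemma T_measurable [measurable]:
  assumes "holo_on unit_ball f" shows "T f \<in> borel_measurable \<mu>"
proof -
  have [measurable]: "f \<in> borel_measurable ball_borel"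
    unfolding ball_borel_def
    by (rule borel_measurable_continuous_on_restrict[OF holo_on_imp_continuous_on[OF assms]])
  show ?thesis unfolding wcomp_diff_def by measurable
qed

lemma T_diff: "T (\<lambda>z. f z - g z) = (\<lambda>z. T f z - T g z)"
  by (simp add: wcomp_diff_def fun_eq_iff algebra_simps)

lemma T_cmult: "T (\<lambda>z. c * f z) = (\<lambda>z. c * T f z)"
  by (simp add: wcomp_diff_def fun_eq_iff algebra_simps)

lemma T_tendsto:
  assumes "\<And>x. norm x < 1 \<Longrightarrow> (\<lambda>k. fs k x) \<longlonglongrightarrow> g x" "z \<in> space \<mu>"
  shows "(\<lambda>k. T (fs k) z) \<longlonglongrightarrow> T g z"
  unfolding wcomp_diff_def using assms phi_ball[OF assms(2)] psi_ball[OF assms(2)]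
  by (intro tendsto_intros) auto

text \<open>The domination \<open>dom\<close> is an abstract hypothesis because it is supplied
  twice: by \<open>joint_measure\<close> for the difference operator, and by \<nu> itself for the
  embedding.\<close>

lemma bounded_op_if_carleson_on_balls:
  assumes \<nu>: "sets \<nu> = sets ball_borel" and car: "carleson_on_balls p q \<nu>" and k: "\<kappa> > 0" and K: "K \<ge> 0"
    and dom: "\<And>f. holo_on unit_ball f \<Longrightarrow> Lq_int \<mu> q (T f) \<le> ennreal K * (\<integral>\<^sup>+\<zeta>. ennreal (locmean p \<kappa> f \<zeta> powr (q / p)) \<partial>\<nu>)"
  shows "bounded_op p w \<mu> q T"
proof -
  obtain C where C: "C > 0" "\<And>(f::complex^'n \<Rightarrow> complex) A \<epsilon>. in_Apw p w f \<Longrightarrow> A \<in> sets \<nu> \<Longrightarrow> 0 \<le> \<epsilon> \<Longrightarrow>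
     (\<And>a. norm a < 1 \<Longrightarrow> emeasure \<nu> (hball \<kappa> a \<inter> A) \<le> ennreal (\<epsilon> * ball_mass a powr (q / p))) \<Longrightarrow>
     (\<integral>\<^sup>+\<zeta>. ennreal (locmean p \<kappa> f \<zeta> powr (q / p)) * indicator A \<zeta> \<partial>\<nu>) \<le> ennreal (C * \<epsilon> * Apw_norm p w f powr q)"
    using carleson_integral_le[OF \<nu> carleson_on_balls_sigma_finite[OF car \<nu>] p_pos p_le_q k] by blast
  obtain D where D: "D \<ge> 0" "\<And>a. norm a < 1 \<Longrightarrow> emeasure \<nu> (hball \<kappa> a) \<le> ennreal (D * ball_mass a powr (q / p))"
    using car k unfolding carleson_on_balls_def by blast
  have main: "Lq_int \<mu> q (T f) \<le> ennreal (K * C * D * Apw_norm p w f powr q)" if f: "in_Apw p w f" for f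
  proof -
    have h: "holo_on unit_ball f" using f by (simp add: in_Apw_iff)
    have hs: "hball \<kappa> a \<inter> space \<nu> = hball \<kappa> a" for a
      using hball_in_sets[OF \<nu>, of \<kappa> a] sets.sets_into_space by blast
    have "(\<integral>\<^sup>+\<zeta>. ennreal (locmean p \<kappa> f \<zeta> powr (q / p)) \<partial>\<nu>) = (\<integral>\<^sup>+\<zeta>. ennreal (locmean p \<kappa> f \<zeta> powr (q / p)) * indicator (space \<nu>) \<zeta> \<partial>\<nu>)"
      by (intro nn_integral_cong) simp
    also have "\<dots> \<le> ennreal (C * D * Apw_norm p w f powr q)"
      by (rule C(2)[OF f _ D(1)]) (use D(2) hs in auto)
    finally have "ennreal K * (\<integral>\<^sup>+\<zeta>. ennreal (locmean p \<kappa> f \<zeta> powr (q / p)) \<partial>\<nu>) \<le> ennreal K * ennreal (C * D * Apw_norm p w f powr q)"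
      by (intro mult_left_mono) auto
    then have "Lq_int \<mu> q (T f) \<le> ennreal K * ennreal (C * D * Apw_norm p w f powr q)" using dom[OF h] by (rule order_trans[rotated])
    also have "\<dots> = ennreal (K * C * D * Apw_norm p w f powr q)" using K by (simp add: ennreal_mult'[symmetric] mult.assoc)
    finally show ?thesis .
  qed
  have fin: "in_Lq \<mu> q (T f)" if f: "in_Apw p w f" for f
  proof -
    have "Lq_int \<mu> q (T f) < \<infinity>" using main[OF f] order_le_less_trans by fastforce
    then show ?thesis using f by (auto simp: in_Lq_def in_Apw_iff intro: T_measurable)
  qed
  have "Lq_norm \<mu> q (T f) \<le> (K * C * D) powr (1 / q) * Apw_norm p w f" if f: "in_Apw p w f" for f
  proof -
    have "enn2real (Lq_int \<mu> q (T f)) \<le> K * C * D * Apw_norm p w f powr q"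
      using main[OF f] K C(1) D(1) by (intro enn2real_leI) auto
    then have "Lq_norm \<mu> q (T f) \<le> (K * C * D * Apw_norm p w f powr q) powr (1 / q)"
      unfolding Lq_norm_def using q_pos by (intro powr_mono2) auto
    also have "\<dots> = (K * C * D) powr (1 / q) * Apw_norm p w f"
      using q_pos K C(1) D(1) Apw_norm_nonneg[of p f] by (simp add: powr_mult powr_powr)
    finally show ?thesis .
  qed
  then show ?thesis unfolding bounded_op_def using fin by blast
qed

text \<open>A bounded sequence has a locally uniformly convergent subsequence. For differences of
  its members, the integral of local means against \<nu> is small near the sphere by the vanishing
  condition and small elsewhere because the functions are uniformly close. The images are thus
  Cauchy in L^q, and Fatou passes to the limit.\<close>

lemma compact_op_if_vanishing_on_balls:
  assumes \<nu>: "sets \<nu> = sets ball_borel" and car: "carleson_on_balls p q \<nu>" and vcar: "vanishing_on_balls p q \<nu>" and k: "\<kappa> > 0" and K: "K \<ge> 0"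
    and dom: "\<And>f. holo_on unit_ball f \<Longrightarrow> Lq_int \<mu> q (T f) \<le> ennreal K * (\<integral>\<^sup>+\<zeta>. ennreal (locmean p \<kappa> f \<zeta> powr (q / p)) \<partial>\<nu>)"
  shows "compact_op p w \<mu> q T"
proof -
  have bdd: "bounded_op p w \<mu> q T" by (rule bounded_op_if_carleson_on_balls[OF \<nu> car k K dom])
  obtain C where C: "C > 0" "\<And>(f::complex^'n \<Rightarrow> complex) A \<epsilon>. in_Apw p w f \<Longrightarrow> A \<in> sets \<nu> \<Longrightarrow> 0 \<le> \<epsilon> \<Longrightarrow>
     (\<And>a. norm a < 1 \<Longrightarrow> emeasure \<nu> (hball \<kappa> a \<inter> A) \<le> ennreal (\<epsilon> * ball_mass a powr (q / p))) \<Longrightarrow>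
     (\<integral>\<^sup>+\<zeta>. ennreal (locmean p \<kappa> f \<zeta> powr (q / p)) * indicator A \<zeta> \<partial>\<nu>) \<le> ennreal (C * \<epsilon> * Apw_norm p w f powr q)"
    using carleson_integral_le[OF \<nu> carleson_on_balls_sigma_finite[OF car \<nu>] p_pos p_le_q k] by blast
  have sp: "space \<nu> = unit_ball" by (rule space_eq_unit_ball[OF \<nu>])
  show ?thesis unfolding compact_op_def
  proof (intro conjI allI impI)
    show "in_Lq \<mu> q (T f)" if "in_Apw p w f" for f using bdd that unfolding bounded_op_def by blast
    fix fs :: "nat \<Rightarrow> complex^'n \<Rightarrow> complex"
    assume "(\<forall>k. in_Apw p w (fs k)) \<and> (\<exists>B. \<forall>k. Apw_norm p w (fs k) \<le> B)"
    then obtain B where fs: "\<And>k. in_Apw p w (fs k)" "\<And>k. Apw_norm p w (fs k) \<le> B" by blast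
    have B0: "B \<ge> 0" using fs(2)[of 0] Apw_norm_nonneg[of p "fs 0"] by linarith
    obtain r :: "nat \<Rightarrow> nat" and g where r: "strict_mono r" and g: "\<And>s e. s < 1 \<Longrightarrow> e > 0 \<Longrightarrow> \<exists>N. \<forall>n\<ge>N. \<forall>x. norm x \<le> s \<longrightarrow> cmod (fs (r n) x - g x) < e"
      using Apw_montel[of p fs B, OF p_pos fs] by blast
    define B' where "B' = (2 powr p * (B powr p + B powr p)) powr (q / p)"
    have nd: "Apw_norm p w (\<lambda>z. fs m z - fs n z) powr q \<le> B'" for m n
    proof -
      have "Apw_norm p w (\<lambda>z. fs m z - fs n z) powr p \<le> 2 powr p * (Apw_norm p w (fs m) powr p + Apw_norm p w (fs n) powr p)"
        by (rule in_Apw_diff(2)[OF fs(1) fs(1) p_pos])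
      also have "\<dots> \<le> 2 powr p * (B powr p + B powr p)"
        using fs(2) p_pos Apw_norm_nonneg by (intro mult_left_mono add_mono powr_mono2) auto
      finally have "(Apw_norm p w (\<lambda>z. fs m z - fs n z) powr p) powr (q / p) \<le> B'"
        unfolding B'_def using q_pos p_pos by (intro powr_mono2) auto
      then show ?thesis using p_pos by (simp add: powr_powr)
    qed
    have B'0: "B' \<ge> 0" by (simp add: B'_def)
    have cauchy: "\<exists>N. \<forall>m\<ge>N. \<forall>n\<ge>N. Lq_int \<mu> q (T (\<lambda>z. fs (r m) z - fs (r n) z)) \<le> ennreal e" if e: "e > 0" for e
    proof -
      \<comment> \<open>Half of e is reserved for the part near the sphere, the other half, through
        b and \<delta> below, for the compact part; the added 1s keep denominators positive.\<close>
      define \<epsilon> where "\<epsilon> = e / (2 * (K + 1) * C * (B' + 1))"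
      have \<epsilon>: "\<epsilon> > 0" using e K C(1) B'0 by (simp add: \<epsilon>_def add_nonneg_pos)
      obtain s0 where s0: "s0 < 1" "\<And>a. norm a < 1 \<Longrightarrow> s0 \<le> norm a \<Longrightarrow> emeasure \<nu> (hball \<kappa> a) \<le> ennreal (\<epsilon> * ball_mass a powr (q / p))"
        using vcar k \<epsilon> unfolding vanishing_on_balls_def by blast
      \<comment> \<open>Chosen so that a Bergman ball whose centre has |a| < s0 does not reach
        |\<zeta>| > s; on A only centres near the sphere matter.\<close>
      define s where "s = max 0 (1 - \<kappa> / 4 * (1 - s0))"
      have s: "0 \<le> s" "s < 1" using k s0 by (auto simp: s_def)
      define A where "A = {\<zeta>::complex^'n. norm \<zeta> < 1 \<and> s < norm \<zeta>}"
      define A' where "A' = {\<zeta>::complex^'n. norm \<zeta> \<le> s}"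
      have A: "A \<in> sets \<nu>" unfolding \<nu> ball_borel_def
        by (subst sets_restrict_space_iff) (auto simp: A_def)
      have A': "A' \<in> sets \<nu>" unfolding \<nu> ball_borel_def
        using s by (subst sets_restrict_space_iff) (auto simp: A'_def)
      have carA: "emeasure \<nu> (hball \<kappa> a \<inter> A) \<le> ennreal (\<epsilon> * ball_mass a powr (q / p))" if a: "norm a < 1" for a
      proof (cases "s0 \<le> norm a")
        case True
        have "emeasure \<nu> (hball \<kappa> a \<inter> A) \<le> emeasure \<nu> (hball \<kappa> a)" by (intro emeasure_mono hball_in_sets[OF \<nu>]) auto
        then show ?thesis using s0(2)[OF a True] by (rule order_trans)
      next
        case False
        have "hball \<kappa> a \<inter> A = {}"
        proof (rule ccontr)
          assume "hball \<kappa> a \<inter> A \<noteq> {}"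
          then obtain \<zeta> where z: "norm \<zeta> < 1" "\<kappa> \<le> hyp_kernel a \<zeta>" "s < norm \<zeta>" by (auto simp: hball_def A_def)
          have "\<kappa> * (1 - norm a) / 4 \<le> 1 - norm \<zeta>" by (rule hyp_kernel_norm_compare[OF a z(1,2)]) (use k in simp)
          also have "\<dots> < 1 - s" using z by simp
          also have "\<dots> \<le> \<kappa> / 4 * (1 - s0)" unfolding s_def by linarith
          finally have "\<kappa> / 4 * (1 - norm a) < \<kappa> / 4 * (1 - s0)" by simp
          then have "1 - norm a < 1 - s0" using k by (simp add: mult_less_cancel_left_pos)
          then show False using False by simp
        qed
        then show ?thesis by simp
      qed
      \<comment> \<open>A local mean centred in |\<zeta>| \<le> s reads the function only on |y|
        \<le> s'.\<close>
      define s' where "s' = 1 - \<kappa> * (1 - s) / 4"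
      have s': "s' < 1" using k s by (simp add: s'_def)
      define V where "V = measure lborel (unit_ball :: (complex^'n) set) / (1 - s) ^ (CARD('n) + 1)"
      have V: "V \<ge> 0" using s by (simp add: V_def)
      define a where "a = measure \<nu> A'"
      have "emeasure \<nu> A' < \<infinity>" unfolding A'_def by (rule carleson_on_balls_cball_finite[OF car \<nu> s(2)])
      then have a: "emeasure \<nu> A' = ennreal a" "a \<ge> 0" by (auto simp: a_def less_top emeasure_eq_ennreal_measure)
      define b where "b = 2 * (K + 1) * (V powr (q / p) * a + 1)"
      have b: "b > 0" using K a(2) V by (simp add: b_def add_nonneg_pos)
      define \<delta> where "\<delta> = (e / b) powr (1 / q)"
      have \<delta>: "\<delta> > 0" "\<delta> powr q = e / b" using e b q_pos by (auto simp: \<delta>_def powr_powr)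
      obtain N where N: "\<And>n x. n \<ge> N \<Longrightarrow> norm x \<le> s' \<Longrightarrow> cmod (fs (r n) x - g x) < \<delta> / 2"
        using g[OF s', of "\<delta> / 2"] \<delta> by auto
      have "Lq_int \<mu> q (T (\<lambda>z. fs (r m) z - fs (r n) z)) \<le> ennreal e" if mn: "m \<ge> N" "n \<ge> N" for m n
      proof -
        define h where "h = (\<lambda>z. fs (r m) z - fs (r n) z)"
        have hA: "in_Apw p w h" unfolding h_def by (rule in_Apw_diff(1)[OF fs(1) fs(1) p_pos])
        have hh: "holo_on unit_ball h" using hA by (simp add: in_Apw_iff)
        have hN: "Apw_norm p w h powr q \<le> B'" unfolding h_def by (rule nd)
        have hd: "cmod (h x) \<le> \<delta>" if "norm x \<le> s'" for x
        proof -
          have "h x = (fs (r m) x - g x) - (fs (r n) x - g x)" by (simp add: h_def)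
          then have "cmod (h x) \<le> cmod (fs (r m) x - g x) + cmod (fs (r n) x - g x)" by (metis norm_triangle_ineq4)
          then show ?thesis using N[OF mn(1) that] N[OF mn(2) that] by linarith
        qed
        have loc: "locmean p \<kappa> h \<zeta> powr (q / p) \<le> V powr (q / p) * \<delta> powr q" if z: "norm \<zeta> \<le> s" for \<zeta>
        proof -
          have z1: "norm \<zeta> < 1" using z s by simp
          have hb: "cmod (h y) \<le> \<delta>" if y: "y \<in> hball \<kappa> \<zeta>" for y
          proof -
            have "norm y \<le> 1 - \<kappa> * (1 - norm \<zeta>) / 4" by (rule hball_subset_cball[OF z1 k y])
            also have "\<dots> \<le> s'" unfolding s'_def using k z by (simp add: mult_left_mono)
            finally show ?thesis by (rule hd)
          qed
          have "locint p \<kappa> h \<zeta> \<le> ennreal (\<delta> powr p) * emeasure lborel (unit_ball :: (complex^'n) set)"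
            using hb p_pos \<delta> by (intro locint_le) auto
          also have "\<dots> = ennreal (\<delta> powr p * measure lborel (unit_ball :: (complex^'n) set))"
            using emeasure_unit_ball(2)[where 'n='n] by (simp add: ennreal_mult emeasure_eq_ennreal_measure less_top)
          finally have "enn2real (locint p \<kappa> h \<zeta>) \<le> \<delta> powr p * measure lborel (unit_ball :: (complex^'n) set)"
            by (intro enn2real_leI) auto
          then have "locmean p \<kappa> h \<zeta> \<le> \<delta> powr p * measure lborel (unit_ball :: (complex^'n) set) / (1 - s) ^ (CARD('n) + 1)"
            unfolding locmean_def using z z1 s
            by (intro frac_le power_mono) auto
          then have "locmean p \<kappa> h \<zeta> \<le> V * \<delta> powr p" by (simp add: V_def mult.commute)
          then have "locmean p \<kappa> h \<zeta> powr (q / p) \<le> (V * \<delta> powr p) powr (q / p)"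
            using locmean_nonneg[OF z1] q_pos p_pos by (intro powr_mono2) auto
          also have "\<dots> = V powr (q / p) * \<delta> powr q" using V \<delta> p_pos by (simp add: powr_mult powr_powr)
          finally show ?thesis .
        qed
        have 1: "(\<integral>\<^sup>+\<zeta>. ennreal (locmean p \<kappa> h \<zeta> powr (q / p)) * indicator A \<zeta> \<partial>\<nu>) \<le> ennreal (C * \<epsilon> * B')"
        proof -
          have "(\<integral>\<^sup>+\<zeta>. ennreal (locmean p \<kappa> h \<zeta> powr (q / p)) * indicator A \<zeta> \<partial>\<nu>) \<le> ennreal (C * \<epsilon> * Apw_norm p w h powr q)"
            using \<epsilon> carA by (intro C(2)[OF hA A]) auto
          also have "\<dots> \<le> ennreal (C * \<epsilon> * B')" using hN C(1) \<epsilon> by (intro ennreal_leI mult_left_mono) auto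
          finally show ?thesis .
        qed
        have "(\<integral>\<^sup>+\<zeta>. ennreal (locmean p \<kappa> h \<zeta> powr (q / p)) \<partial>\<nu>) \<le>
          (\<integral>\<^sup>+\<zeta>. ennreal (V powr (q / p) * \<delta> powr q) * indicator A' \<zeta> + ennreal (locmean p \<kappa> h \<zeta> powr (q / p)) * indicator A \<zeta> \<partial>\<nu>)"
        proof (rule nn_integral_mono)
          fix \<zeta> assume "\<zeta> \<in> space \<nu>"
          then have z1: "norm \<zeta> < 1" by (simp add: sp)
          show "ennreal (locmean p \<kappa> h \<zeta> powr (q / p)) \<le> ennreal (V powr (q / p) * \<delta> powr q) * indicator A' \<zeta> + ennreal (locmean p \<kappa> h \<zeta> powr (q / p)) * indicator A \<zeta>"
            using loc[of \<zeta>] z1 by (cases "norm \<zeta> \<le> s") (auto simp: A_def A'_def intro!: ennreal_leI)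
        qed
        also have "\<dots> = ennreal (V powr (q / p) * \<delta> powr q) * emeasure \<nu> A' + (\<integral>\<^sup>+\<zeta>. ennreal (locmean p \<kappa> h \<zeta> powr (q / p)) * indicator A \<zeta> \<partial>\<nu>)"
        proof (subst nn_integral_add)
          show "(\<lambda>\<zeta>. ennreal (V powr (q / p) * \<delta> powr q) * indicator A' \<zeta>) \<in> borel_measurable \<nu>"
            using A' by measurable
          have "(\<lambda>x. x) \<in> measurable \<nu> borel"
            unfolding measurable_cong_sets[OF \<nu> refl] ball_borel_def by (rule measurable_restrict_space1) simp
          then have "(\<lambda>\<zeta>. ennreal (locmean p \<kappa> h \<zeta> powr (q / p))) \<in> borel_measurable \<nu>"
            by (rule measurable_compose[OF _ locmean_measurable[OF hh]])
          then show "(\<lambda>\<zeta>. ennreal (locmean p \<kappa> h \<zeta> powr (q / p)) * indicator A \<zeta>) \<in> borel_measurable \<nu>"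
            using A by measurable
        qed (simp add: nn_integral_cmult_indicator[OF A'])
        also have "\<dots> \<le> ennreal (V powr (q / p) * \<delta> powr q) * ennreal a + ennreal (C * \<epsilon> * B')"
          unfolding a(1) by (intro add_mono 1) simp
        also have "\<dots> = ennreal (V powr (q / p) * \<delta> powr q * a + C * \<epsilon> * B')"
          using a(2) C(1) \<epsilon> B'0 by (simp add: ennreal_mult'[symmetric] ennreal_plus[symmetric] del: ennreal_plus)
        finally have "ennreal K * (\<integral>\<^sup>+\<zeta>. ennreal (locmean p \<kappa> h \<zeta> powr (q / p)) \<partial>\<nu>) \<le> ennreal K * ennreal (V powr (q / p) * \<delta> powr q * a + C * \<epsilon> * B')"
          by (intro mult_left_mono) auto
        with dom[OF hh] have "Lq_int \<mu> q (T h) \<le> ennreal K * ennreal (V powr (q / p) * \<delta> powr q * a + C * \<epsilon> * B')"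
          by (rule order_trans)
        also have "\<dots> = ennreal (K * (V powr (q / p) * \<delta> powr q * a + C * \<epsilon> * B'))" using K by (rule ennreal_mult'[symmetric])
        also have "\<dots> \<le> ennreal e"
        proof (rule ennreal_leI)
          have "K * (V powr (q / p) * \<delta> powr q * a) \<le> (K + 1) * ((V powr (q / p) * a + 1) * (e / b))"
          proof -
            have "V powr (q / p) * \<delta> powr q * a = (V powr (q / p) * a) * (e / b)" by (simp add: \<delta>(2))
            also have "\<dots> \<le> (V powr (q / p) * a + 1) * (e / b)" using e b by (intro mult_right_mono) auto
            finally have le: "V powr (q / p) * \<delta> powr q * a \<le> (V powr (q / p) * a + 1) * (e / b)" .
            show ?thesis by (rule mult_mono[OF _ le]) (use K e b a(2) in auto)
          qed
          also have "\<dots> = e / 2"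
          proof -
            have "(K + 1) * (V powr (q / p) * a + 1) > 0" using K a(2) by (simp add: add_nonneg_pos)
            then show ?thesis unfolding b_def by (simp add: field_simps)
          qed
          finally have i: "K * (V powr (q / p) * \<delta> powr q * a) \<le> e / 2" .
          have "K * (C * \<epsilon> * B') \<le> (K + 1) * (C * \<epsilon> * (B' + 1))"
            using K C(1) \<epsilon> B'0 by (intro mult_mono) auto
          also have "\<dots> = e / 2"
          proof -
            have "(K + 1) * C * (B' + 1) > 0" using K C(1) B'0 by (simp add: add_nonneg_pos)
            then show ?thesis unfolding \<epsilon>_def by (simp add: field_simps)
          qed
          finally show "K * (V powr (q / p) * \<delta> powr q * a + C * \<epsilon> * B') \<le> e" using i by (simp add: distrib_left)
        qed
        finally show ?thesis by (simp add: h_def)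
      qed
      then show ?thesis by blast
    qed
    have lim: "(\<lambda>n. fs (r n) x) \<longlonglongrightarrow> g x" if "norm x < 1" for x
      unfolding LIMSEQ_iff using g[OF that] by blast
    have Tlim: "(\<lambda>n. T (fs (r n)) z) \<longlonglongrightarrow> T g z" if "z \<in> space \<mu>" for z
      using T_tendsto[of "\<lambda>n. fs (r n)" g z] lim that by blast
    have hol: "holo_on unit_ball (fs n)" for n using fs(1) by (simp add: in_Apw_iff)
    have [measurable]: "T (fs n) \<in> borel_measurable \<mu>" for n by (rule T_measurable[OF hol])
    \<comment> \<open>g is at hand only as a locally uniform limit; \<open>T g\<close> is measurable
      as a pointwise limit of measurable images.\<close>
    have gm [measurable]: "T g \<in> borel_measurable \<mu>"
      by (rule borel_measurable_LIMSEQ_metric[of "\<lambda>n. T (fs (r n))"]) (use Tlim in auto)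
    have conv: "Lq_int \<mu> q (\<lambda>z. T (fs (r m)) z - T g z) \<le> ennreal e"
      if N: "\<And>n. n \<ge> N \<Longrightarrow> Lq_int \<mu> q (T (\<lambda>z. fs (r m) z - fs (r n) z)) \<le> ennreal e" for m N e
    proof -
      have "Lq_int \<mu> q (\<lambda>z. T (fs (r m)) z - T g z) \<le> (\<integral>\<^sup>+z. liminf (\<lambda>n. ennreal (cmod (T (fs (r m)) z - T (fs (r n)) z) powr q)) \<partial>\<mu>)"
        unfolding Lq_int_def
      proof (rule nn_integral_mono)
        fix z assume z: "z \<in> space \<mu>"
        have "(\<lambda>n. ennreal (cmod (T (fs (r m)) z - T (fs (r n)) z) powr q)) \<longlonglongrightarrow> ennreal (cmod (T (fs (r m)) z - T g z) powr q)"
          using Tlim[OF z] q_pos by (intro tendsto_ennrealI tendsto_powr' tendsto_intros) auto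
        then have "liminf (\<lambda>n. ennreal (cmod (T (fs (r m)) z - T (fs (r n)) z) powr q)) = ennreal (cmod (T (fs (r m)) z - T g z) powr q)"
          by (intro lim_imp_Liminf) auto
        then show "ennreal (cmod (T (fs (r m)) z - T g z) powr q) \<le> liminf (\<lambda>n. ennreal (cmod (T (fs (r m)) z - T (fs (r n)) z) powr q))"
          by (simp only: order_refl)
      qed
      also have "\<dots> \<le> liminf (\<lambda>n. \<integral>\<^sup>+z. ennreal (cmod (T (fs (r m)) z - T (fs (r n)) z) powr q) \<partial>\<mu>)"
        by (rule nn_integral_liminf) measurable
      also have "\<dots> \<le> ennreal e"
      proof (rule Liminf_le)
        show "\<forall>\<^sub>F n in sequentially. (\<integral>\<^sup>+z. ennreal (cmod (T (fs (r m)) z - T (fs (r n)) z) powr q) \<partial>\<mu>) \<le> ennreal e"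
          unfolding eventually_sequentially using N by (intro exI[of _ N]) (auto simp: T_diff Lq_int_def)
      qed simp
      finally show ?thesis .
    qed
    have small: "\<exists>N. \<forall>m\<ge>N. Lq_int \<mu> q (\<lambda>z. T (fs (r m)) z - T g z) \<le> ennreal e" if "e > 0" for e
      using cauchy[OF that] conv by meson
    have gL: "in_Lq \<mu> q (T g)"
    proof -
      obtain N where N: "Lq_int \<mu> q (\<lambda>z. T (fs (r N)) z - T g z) \<le> ennreal 1" using small[of 1] by auto
      have "Lq_int \<mu> q (\<lambda>z. T (fs (r N)) z + - (T (fs (r N)) z - T g z)) \<le>
        ennreal (2 powr q) * (Lq_int \<mu> q (T (fs (r N))) + Lq_int \<mu> q (\<lambda>z. - (T (fs (r N)) z - T g z)))"
        by (rule Lq_int_add_le) (use q_pos in auto)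
      moreover have "(\<lambda>z. T (fs (r N)) z + - (T (fs (r N)) z - T g z)) = T g" by auto
      moreover have "Lq_int \<mu> q (T (fs (r N))) < \<infinity>"
        using bdd fs(1) unfolding bounded_op_def in_Lq_def by blast
      moreover have "Lq_int \<mu> q (\<lambda>z. - (T (fs (r N)) z - T g z)) < \<infinity>"
        unfolding Lq_int_uminus using N order_le_less_trans by fastforce
      ultimately have "Lq_int \<mu> q (T g) < \<infinity>"
        by (auto simp: ennreal_mult_less_top elim!: order_le_less_trans)
      then show ?thesis by (simp add: in_Lq_def)
    qed
    have "(\<lambda>k. Lq_norm \<mu> q (\<lambda>z. T (fs (r k)) z - T g z)) \<longlonglongrightarrow> 0"
    proof (rule LIMSEQ_I)
      fix e :: real assume e: "e > 0"
      obtain N where N: "\<And>m. m \<ge> N \<Longrightarrow> Lq_int \<mu> q (\<lambda>z. T (fs (r m)) z - T g z) \<le> ennreal ((e / 2) powr q)"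
        using small[of "(e / 2) powr q"] e by auto
      have "norm (Lq_norm \<mu> q (\<lambda>z. T (fs (r m)) z - T g z) - 0) < e" if "m \<ge> N" for m
      proof -
        have "enn2real (Lq_int \<mu> q (\<lambda>z. T (fs (r m)) z - T g z)) \<le> (e / 2) powr q"
          using N[OF that] by (intro enn2real_leI) auto
        then have "Lq_norm \<mu> q (\<lambda>z. T (fs (r m)) z - T g z) \<le> ((e / 2) powr q) powr (1 / q)"
          unfolding Lq_norm_def using q_pos by (intro powr_mono2) auto
        also have "\<dots> = e / 2" using q_pos e by (simp add: powr_powr)
        finally show ?thesis using e Lq_norm_nonneg[of \<mu> q "\<lambda>z. T (fs (r m)) z - T g z"] by simp
      qed
      then show "\<exists>no. \<forall>n\<ge>no. norm (Lq_norm \<mu> q (\<lambda>z. T (fs (r n)) z - T g z) - 0) < e" by blast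
    qed
    then show "\<exists>r g. strict_mono r \<and> in_Lq \<mu> q g \<and> (\<lambda>k. Lq_norm \<mu> q (\<lambda>z. T (fs (r k)) z - g z)) \<longlonglongrightarrow> 0"
      using r gL by blast
  qed
qed

end

section \<open>Necessity via test functions\<close>

lemma powr_sum_le:
  fixes c :: "'a::finite \<Rightarrow> real"
  assumes "\<And>i. c i \<ge> 0" "q > 0"
  shows "(\<Sum>i\<in>UNIV. c i) powr q \<le> real CARD('a) powr q * (\<Sum>i\<in>UNIV. c i powr q)"
proof -
  define m where "m = Max (range c)"
  have fin: "finite (range c)" "range c \<noteq> {}" by auto
  have le: "c i \<le> m" for i unfolding m_def using fin by (intro Max_ge) auto
  obtain j where j: "c j = m" using Max_in[OF fin] unfolding m_def by (metis rangeE)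
  have "(\<Sum>i\<in>UNIV. c i) \<le> (\<Sum>i\<in>(UNIV::'a set). m)" by (intro sum_mono le)
  then have "(\<Sum>i\<in>UNIV. c i) powr q \<le> (real CARD('a) * m) powr q"
    using assms by (intro powr_mono2) (auto intro: sum_nonneg)
  also have "\<dots> = real CARD('a) powr q * c j powr q"
    using assms(1)[of j] j by (simp add: powr_mult)
  also have "\<dots> \<le> real CARD('a) powr q * (\<Sum>i\<in>UNIV. c i powr q)"
    by (intro mult_left_mono member_le_sum) auto
  finally show ?thesis .
qed

context weighted_composition
begin

text \<open>One quantity that bounds all four pullback masses of D(a). The products with coordinates
  of the automorphism are included in order to separate \<phi> from \<psi>.\<close>

definition test_sum :: "nat \<Rightarrow> complex^'n \<Rightarrow> ennreal" where
  "test_sum N a = Lq_int \<mu> q (T (test_fun N a)) + (\<Sum>i\<in>UNIV. Lq_int \<mu> q (T (\<lambda>z. test_fun N a z * ball_aut a z $ i)))"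

text \<open>A subsequence of the images converges in L^q to some g, while the images tend to 0
  pointwise, so Fatou makes the L^q integral of g vanish. A single small image is what the
  contradiction arguments below call for.\<close>

lemma compact_null_sequence:
  fixes fs :: "nat \<Rightarrow> complex^'n \<Rightarrow> complex"
  assumes cpt: "compact_op p w \<mu> q T" and fs: "\<And>k. in_Apw p w (fs k)" "\<And>k. Apw_norm p w (fs k) \<le> B"
    and lim: "\<And>z. norm z < 1 \<Longrightarrow> (\<lambda>k. fs k z) \<longlonglongrightarrow> 0" and e: "e > 0"
  shows "\<exists>k. Lq_int \<mu> q (T (fs k)) < ennreal e"
proof -
  have TL: "in_Lq \<mu> q (T (fs k))" for k using cpt fs(1) unfolding compact_op_def by blast
  have "(\<forall>k. in_Apw p w (fs k)) \<and> (\<exists>B. \<forall>k. Apw_norm p w (fs k) \<le> B)" using fs by blast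
  from cpt[unfolded compact_op_def, THEN conjunct2, rule_format, OF this]
  obtain r :: "nat \<Rightarrow> nat" and g where r: "strict_mono r" and g: "in_Lq \<mu> q g"
    and conv: "(\<lambda>k. Lq_norm \<mu> q (\<lambda>z. T (fs (r k)) z - g z)) \<longlonglongrightarrow> 0"
    by blast
  have [measurable]: "T (fs k) \<in> borel_measurable \<mu>" for k using TL by (simp add: in_Lq_def)
  have [measurable]: "g \<in> borel_measurable \<mu>" using g by (simp add: in_Lq_def)
  define D where "D k = Lq_int \<mu> q (\<lambda>z. T (fs (r k)) z - g z)" for k
  have D_fin: "D k < \<infinity>" for k
  proof -
    have "Lq_int \<mu> q (\<lambda>z. T (fs (r k)) z + - g z) \<le> ennreal (2 powr q) * (Lq_int \<mu> q (T (fs (r k))) + Lq_int \<mu> q (\<lambda>z. - g z))"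
      by (rule Lq_int_add_le) (use q_pos in auto)
    also have "\<dots> < \<infinity>" unfolding Lq_int_uminus
      using TL g by (simp add: in_Lq_def ennreal_mult_less_top)
    finally show ?thesis by (simp add: D_def)
  qed
  have "(\<lambda>k. Lq_norm \<mu> q (\<lambda>z. T (fs (r k)) z - g z) powr q) \<longlonglongrightarrow> 0 powr q"
    using conv q_pos by (intro tendsto_powr') (auto intro!: always_eventually simp: Lq_norm_nonneg)
  then have "(\<lambda>k. ennreal (Lq_norm \<mu> q (\<lambda>z. T (fs (r k)) z - g z) powr q)) \<longlonglongrightarrow> ennreal 0"
    by (intro tendsto_ennrealI) simp
  moreover have "D = (\<lambda>k. ennreal (Lq_norm \<mu> q (\<lambda>z. T (fs (r k)) z - g z) powr q))"
    unfolding D_def using D_fin q_pos by (intro ext Lq_int_eq_norm) (auto simp: D_def)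
  ultimately have D0: "D \<longlonglongrightarrow> 0" by (simp only: ennreal_0)
  have sublim: "(\<lambda>k. fs (r k) x) \<longlonglongrightarrow> 0" if "norm x < 1" for x
    using LIMSEQ_subseq_LIMSEQ[OF lim[OF that] r] unfolding o_def .
  have Tlim: "(\<lambda>k. T (fs (r k)) z) \<longlonglongrightarrow> 0" if z: "z \<in> space \<mu>" for z
  proof -
    have "(\<lambda>k. T (fs (r k)) z) \<longlonglongrightarrow> T (\<lambda>_. 0) z"
      by (rule T_tendsto[where fs = "\<lambda>k. fs (r k)" and g = "\<lambda>_. 0" and z = z]) (use sublim z in auto)
    then show ?thesis by (simp add: wcomp_diff_def)
  qed
  have "Lq_int \<mu> q g \<le> (\<integral>\<^sup>+z. liminf (\<lambda>k. ennreal (cmod (T (fs (r k)) z - g z) powr q)) \<partial>\<mu>)"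
    unfolding Lq_int_def
  proof (rule nn_integral_mono)
    fix z assume z: "z \<in> space \<mu>"
    have "(\<lambda>k. ennreal (cmod (T (fs (r k)) z - g z) powr q)) \<longlonglongrightarrow> ennreal (cmod (0 - g z) powr q)"
      using Tlim[OF z] q_pos by (intro tendsto_ennrealI tendsto_powr' tendsto_intros) auto
    then have "liminf (\<lambda>k. ennreal (cmod (T (fs (r k)) z - g z) powr q)) = ennreal (cmod (0 - g z) powr q)"
      by (intro lim_imp_Liminf) auto
    then show "ennreal (cmod (g z) powr q) \<le> liminf (\<lambda>k. ennreal (cmod (T (fs (r k)) z - g z) powr q))"
      by (simp only: diff_0 norm_minus_cancel order_refl)
  qed
  also have "\<dots> \<le> liminf D"
    unfolding D_def Lq_int_def by (rule nn_integral_liminf) measurable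
  also have "\<dots> = 0" using D0 by (simp add: lim_imp_Liminf)
  finally have g0: "Lq_int \<mu> q g = 0" by simp
  have "(\<lambda>k. ennreal (2 powr q) * D k) \<longlonglongrightarrow> ennreal (2 powr q) * 0"
    by (intro tendsto_mult_ennreal D0 tendsto_const) auto
  then have "\<forall>\<^sub>F k in sequentially. ennreal (2 powr q) * D k < ennreal e"
    using e by (intro order_tendstoD(2)) auto
  then obtain k where k: "ennreal (2 powr q) * D k < ennreal e" by (auto simp: eventually_sequentially)
  have "Lq_int \<mu> q (\<lambda>z. (T (fs (r k)) z - g z) + g z) \<le> ennreal (2 powr q) * (D k + Lq_int \<mu> q g)"
    unfolding D_def by (rule Lq_int_add_le) (use q_pos in auto)
  then show ?thesis using k g0 by (intro exI[of _ "r k"]) auto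
qed

text \<open>If no bound holds, there are f_k whose images have norm exceeding (k + 1) times the norm
  of f_k. Divided by the norms of the images, they have norm at most 1/(k + 1) and so tend to 0
  pointwise; but all their images have norm 1, against \<open>compact_null_sequence\<close>.\<close>

lemma compact_imp_bounded:
  assumes cpt: "compact_op p w \<mu> q T" shows "bounded_op p w \<mu> q T"
proof (rule ccontr)
  assume nb: "\<not> bounded_op p w \<mu> q T"
  have TL: "in_Lq \<mu> q (T f)" if "in_Apw p w f" for f using cpt that unfolding compact_op_def by blast
  have "\<exists>f. in_Apw p w f \<and> Lq_norm \<mu> q (T f) > C * Apw_norm p w f" for C
    using nb TL unfolding bounded_op_def by (meson not_le)
  then have "\<forall>k::nat. \<exists>f. in_Apw p w f \<and> Lq_norm \<mu> q (T f) > (real k + 1) * Apw_norm p w f" by blast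
  from choice[OF this] obtain f where f: "\<And>k::nat. in_Apw p w (f k)" "\<And>k. Lq_norm \<mu> q (T (f k)) > (real k + 1) * Apw_norm p w (f k)"
    by blast
  define L where "L k = Lq_norm \<mu> q (T (f k))" for k
  have L: "L k > 0" for k
    using f(2)[of k] Apw_norm_nonneg[of p "f k"] unfolding L_def
    by (smt (verit) mult_nonneg_nonneg of_nat_0_le_iff)
  define F where "F k = (\<lambda>z. of_real (1 / L k) * f k z)" for k
  have FA: "in_Apw p w (F k)" for k unfolding F_def by (rule in_Apw_cmult[OF f(1)])
  have FN: "Apw_norm p w (F k) \<le> 1 / (real k + 1)" for k
  proof -
    have "cmod (of_real (1 / L k)) = 1 / L k" using L[of k] by (simp only: norm_of_real) simp
    then have "Apw_norm p w (F k) = Apw_norm p w (f k) / L k"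
      unfolding F_def Apw_norm_cmult[OF f(1) p_pos] by simp
    moreover have "Apw_norm p w (f k) / L k \<le> 1 / (real k + 1)"
    proof -
      have "(real k + 1) * Apw_norm p w (f k) \<le> L k" using f(2)[of k] by (simp add: L_def)
      then show ?thesis using L[of k] by (simp add: field_simps)
    qed
    ultimately show ?thesis by simp
  qed
  have limF: "(\<lambda>k. F k z) \<longlonglongrightarrow> 0" if z: "norm z < 1" for z
  proof -
    obtain C where C: "C > 0" "\<And>h::complex^'n \<Rightarrow> complex. in_Apw p w h \<Longrightarrow> cmod (h z) \<le> C * Apw_norm p w h"
      using Apw_local_bounds[OF p_pos norm_ge_zero z] by blast
    have b: "cmod (F k z) \<le> C * (1 / real (Suc k))" for k
      using C(2)[OF FA[of k]] mult_left_mono[OF FN[of k], of C] C(1) by (simp add: add.commute)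
    have "(\<lambda>k. C * (1 / real (Suc k))) \<longlonglongrightarrow> C * 0"
      using LIMSEQ_inverse_real_of_nat by (intro tendsto_intros) (simp add: inverse_eq_divide)
    then have lim0: "(\<lambda>k. C * (1 / real (Suc k))) \<longlonglongrightarrow> 0" by simp
    have "\<forall>\<^sub>F k in sequentially. norm (F k z) \<le> C * (1 / real (Suc k))" using b by (intro always_eventually allI)
    from Lim_null_comparison[OF this lim0] show ?thesis .
  qed
  have FN1: "Apw_norm p w (F k) \<le> 1" for k
    using FN[of k] by (rule order_trans) simp
  obtain k where k: "Lq_int \<mu> q (T (F k)) < ennreal 1"
    using compact_null_sequence[OF cpt FA FN1 limF zero_less_one] by blast
  have [measurable]: "T (f k) \<in> borel_measurable \<mu>" using TL[OF f(1)] by (simp add: in_Lq_def)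
  have "Lq_int \<mu> q (T (F k)) = ennreal (cmod (of_real (1 / L k)) powr q) * Lq_int \<mu> q (T (f k))"
    unfolding F_def T_cmult by (rule Lq_int_cmult) measurable
  also have "cmod (of_real (1 / L k)) = 1 / L k" using L[of k] by (simp only: norm_of_real) simp
  also have "Lq_int \<mu> q (T (f k)) = ennreal (L k powr q)"
    unfolding L_def using TL[OF f(1)] q_pos by (intro Lq_int_eq_norm) (auto simp: in_Lq_def)
  also have "ennreal ((1 / L k) powr q) * ennreal (L k powr q) = ennreal 1"
    using L[of k] by (simp add: ennreal_mult[symmetric] powr_mult[symmetric])
  finally show False using k by simp
qed

text \<open>Stated for any holomorphic g dominated by the test function, which also covers its
  products with the coordinates of the automorphism, as these are bounded by 1.\<close>

lemma bounded_test:
  assumes N: "real N * p \<ge> real (CARD('n) + doubling_exp + 1)" and bdd: "bounded_op p w \<mu> q T"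
  shows "\<exists>C\<ge>0. \<forall>a g. norm a < 1 \<longrightarrow> holo_on unit_ball g \<longrightarrow> (\<forall>z. norm z < 1 \<longrightarrow> cmod (g z) \<le> cmod (test_fun N a z)) \<longrightarrow>
     Lq_int \<mu> q (T g) \<le> ennreal (C * ball_mass a powr (q / p))"
proof -
  obtain C1 where C1: "C1 > 0" "\<And>a::complex^'n. norm a < 1 \<Longrightarrow> wint p (test_fun N a) \<le> ennreal (C1 * ball_mass a)"
    using wint_test_fun_le[OF p_pos N] by blast
  obtain C2' where "\<And>f. in_Apw p w f \<Longrightarrow> Lq_norm \<mu> q (T f) \<le> C2' * Apw_norm p w f"
    using bdd unfolding bounded_op_def by blast
  then have C2: "Lq_norm \<mu> q (T f) \<le> \<bar>C2'\<bar> * Apw_norm p w f" if "in_Apw p w f" for f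
    using that Apw_norm_nonneg[of p f] by (meson abs_ge_self mult_right_mono order_trans)
  define C where "C = \<bar>C2'\<bar> powr q * (cV * C1) powr (q / p)"
  have "Lq_int \<mu> q (T g) \<le> ennreal (C * ball_mass a powr (q / p))"
    if a: "norm a < 1" and g: "holo_on unit_ball g" "\<And>z. norm z < 1 \<Longrightarrow> cmod (g z) \<le> cmod (test_fun N a z)" for a g
  proof -
    have "wint p g \<le> wint p (test_fun N a)" using g(2) p_pos by (intro wint_mono) auto
    then have wg: "wint p g \<le> ennreal (C1 * ball_mass a)" using C1(2)[OF a] by (rule order_trans)
    then have "wint p g < \<infinity>" using order_le_less_trans by fastforce
    then have gA: "in_Apw p w g" using g by (simp add: in_Apw_iff)
    have "enn2real (wint p g) \<le> C1 * ball_mass a" using wg C1(1) ball_mass_pos[OF a] by (intro enn2real_leI) auto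
    then have "Apw_norm p w g powr q \<le> (cV * (C1 * ball_mass a)) powr (q / p)"
      unfolding Apw_norm_powr[OF g(1) p_pos] using cV_pos q_pos p_pos by (intro powr_mono2 mult_left_mono) auto
    also have "\<dots> = (cV * C1) powr (q / p) * ball_mass a powr (q / p)"
      using cV_pos C1(1) ball_mass_pos[OF a] by (simp add: powr_mult[symmetric] mult.assoc)
    finally have 1: "Apw_norm p w g powr q \<le> (cV * C1) powr (q / p) * ball_mass a powr (q / p)" .
    have "Lq_norm \<mu> q (T g) powr q \<le> (\<bar>C2'\<bar> * Apw_norm p w g) powr q"
      using C2[OF gA] q_pos by (intro powr_mono2) (auto simp: Lq_norm_nonneg)
    also have "\<dots> = \<bar>C2'\<bar> powr q * Apw_norm p w g powr q" by (simp add: powr_mult Apw_norm_nonneg)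
    also have "\<dots> \<le> \<bar>C2'\<bar> powr q * ((cV * C1) powr (q / p) * ball_mass a powr (q / p))" using 1 by (intro mult_left_mono) auto
    finally have "Lq_norm \<mu> q (T g) powr q \<le> C * ball_mass a powr (q / p)" by (simp add: C_def mult.assoc)
    moreover have "Lq_int \<mu> q (T g) = ennreal (Lq_norm \<mu> q (T g) powr q)"
      using bdd gA q_pos unfolding bounded_op_def in_Lq_def by (intro Lq_int_eq_norm) auto
    ultimately show ?thesis by (simp add: ennreal_leI)
  qed
  moreover have "C \<ge> 0" by (simp add: C_def)
  ultimately show ?thesis by blast
qed

text \<open>Otherwise there are a_k tending to the sphere with large images. Dividing by the 1/p-th
  power of \<open>ball_mass\<close> makes the dominated functions a bounded sequence tending to 0
  pointwise, which contradicts \<open>compact_null_sequence\<close>.\<close>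

lemma compact_test:
  assumes N: "real N * p \<ge> real (CARD('n) + doubling_exp + 1)" and cpt: "compact_op p w \<mu> q T" and e: "\<epsilon> > 0"
  shows "\<exists>s<1. \<forall>a g. norm a < 1 \<longrightarrow> s \<le> norm a \<longrightarrow> holo_on unit_ball g \<longrightarrow> (\<forall>z. norm z < 1 \<longrightarrow> cmod (g z) \<le> cmod (test_fun N a z)) \<longrightarrow>
     Lq_int \<mu> q (T g) \<le> ennreal (\<epsilon> * ball_mass a powr (q / p))"
proof (rule ccontr)
  assume neg: "\<not> ?thesis"
  have "\<exists>a g. norm a < 1 \<and> 1 - 1 / real (Suc k) \<le> norm a \<and> holo_on unit_ball g \<and> (\<forall>z. norm z < 1 \<longrightarrow> cmod (g z) \<le> cmod (test_fun N a z)) \<and>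
     \<not> Lq_int \<mu> q (T g) \<le> ennreal (\<epsilon> * ball_mass a powr (q / p))" for k :: nat
  proof -
    have "1 - 1 / real (Suc k) < 1" by simp
    with neg show ?thesis by blast
  qed
  then obtain a g where ag: "\<And>k::nat. norm (a k :: complex^'n) < 1" "\<And>k. 1 - 1 / real (Suc k) \<le> norm (a k)" "\<And>k. holo_on unit_ball (g k)"
     "\<And>k z. norm z < 1 \<Longrightarrow> cmod (g k z) \<le> cmod (test_fun N (a k) z)" "\<And>k. \<not> Lq_int \<mu> q (T (g k)) \<le> ennreal (\<epsilon> * ball_mass (a k) powr (q / p))"
    by metis
  obtain C1 where C1: "C1 > 0" "\<And>a::complex^'n. norm a < 1 \<Longrightarrow> wint p (test_fun N a) \<le> ennreal (C1 * ball_mass a)"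
    using wint_test_fun_le[OF p_pos N] by blast
  have M: "ball_mass (a k) > 0" for k by (rule ball_mass_pos[OF ag(1)])
  define c where "c k = complex_of_real (ball_mass (a k) powr (- (1 / p)))" for k
  have c: "cmod (c k) powr p = 1 / ball_mass (a k)" "cmod (c k) powr q = ball_mass (a k) powr (- (q / p))" for k
  proof -
    have cm: "cmod (c k) = ball_mass (a k) powr (- (1 / p))" unfolding c_def norm_of_real by simp
    show "cmod (c k) powr p = 1 / ball_mass (a k)" "cmod (c k) powr q = ball_mass (a k) powr (- (q / p))"
      unfolding cm powr_powr using M[of k] p_pos by (simp_all add: powr_minus_divide)
  qed
  define F where "F k = (\<lambda>z. c k * g k z)" for k
  have wF: "wint p (F k) \<le> ennreal C1" for k
  proof -
    have "wint p (F k) = ennreal (1 / ball_mass (a k)) * wint p (g k)"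
      unfolding F_def wint_cmult[OF ag(3)] c ..
    also have "\<dots> \<le> ennreal (1 / ball_mass (a k)) * ennreal (C1 * ball_mass (a k))"
      by (intro mult_left_mono order_trans[OF wint_mono[OF ag(4) p_pos] C1(2)] ag(1)) auto
    also have "\<dots> = ennreal C1" using M[of k] C1(1) by (simp add: ennreal_mult[symmetric])
    finally show ?thesis .
  qed
  have Fh: "holo_on unit_ball (F k)" for k
    unfolding F_def by (intro holo_on_mult holo_on_const open_unit_ball ag(3))
  have FA: "in_Apw p w (F k)" for k
    using wF[of k] Fh[of k] order_le_less_trans by (fastforce simp: in_Apw_iff)
  have FN: "Apw_norm p w (F k) \<le> (cV * C1) powr (1 / p)" for k
  proof -
    have "enn2real (wint p (F k)) \<le> C1" using wF[of k] C1(1) by (intro enn2real_leI) auto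
    then have "(cV * enn2real (wint p (F k))) powr (1 / p) \<le> (cV * C1) powr (1 / p)"
      using cV_pos p_pos by (intro powr_mono2 mult_left_mono) auto
    then show ?thesis using Apw_norm_powr[OF Fh p_pos, of k 1] by (simp add: Apw_norm_nonneg)
  qed
  have lim: "(\<lambda>k. F k z) \<longlonglongrightarrow> 0" if z: "norm z < 1" for z
  proof -
    obtain C where C: "\<And>a::complex^'n. norm a < 1 \<Longrightarrow> cmod (test_fun N a z) powr p / ball_mass a \<le> C * (1 - norm a)"
      using test_fun_pointwise_small[OF p_pos N z] by blast
    have b: "cmod (F k z) powr p \<le> \<bar>C\<bar> * (1 / real (Suc k))" for k
    proof -
      have "cmod (F k z) powr p = (1 / ball_mass (a k)) * cmod (g k z) powr p"
        by (simp add: F_def norm_mult powr_mult c)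
      also have "\<dots> \<le> (1 / ball_mass (a k)) * cmod (test_fun N (a k) z) powr p"
        using M[of k] ag(4)[OF z] p_pos by (intro mult_left_mono powr_mono2) auto
      also have "\<dots> \<le> C * (1 - norm (a k))" using C[OF ag(1)] by simp
      also have "\<dots> \<le> \<bar>C\<bar> * (1 / real (Suc k))"
        using ag(1)[of k] ag(2)[of k] by (intro mult_mono) auto
      finally show ?thesis .
    qed
    have "(\<lambda>k. \<bar>C\<bar> * (1 / real (Suc k))) \<longlonglongrightarrow> \<bar>C\<bar> * 0"
      using LIMSEQ_inverse_real_of_nat by (intro tendsto_intros) (simp add: inverse_eq_divide)
    then have lim0: "(\<lambda>k. \<bar>C\<bar> * (1 / real (Suc k))) \<longlonglongrightarrow> 0" by simp
    have "norm (cmod (F k z) powr p) \<le> \<bar>C\<bar> * (1 / real (Suc k))" for k using b[of k] by simp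
    then have "\<forall>\<^sub>F k in sequentially. norm (cmod (F k z) powr p) \<le> \<bar>C\<bar> * (1 / real (Suc k))" by (intro always_eventually allI)
    from Lim_null_comparison[OF this lim0] have "(\<lambda>k. (cmod (F k z) powr p) powr (1 / p)) \<longlonglongrightarrow> 0 powr (1 / p)"
      using p_pos by (intro tendsto_powr') (auto intro!: always_eventually)
    then have "(\<lambda>k. cmod (F k z)) \<longlonglongrightarrow> 0" using p_pos by (simp add: powr_powr)
    then show ?thesis by (rule tendsto_norm_zero_cancel)
  qed
  obtain k where k: "Lq_int \<mu> q (T (F k)) < ennreal \<epsilon>"
    using compact_null_sequence[OF cpt FA FN lim e] by blast
  have m: "T (g k) \<in> borel_measurable \<mu>" by (rule T_measurable[OF ag(3)])
  have "Lq_int \<mu> q (T (F k)) = ennreal (ball_mass (a k) powr (- (q / p))) * Lq_int \<mu> q (T (g k))"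
    unfolding F_def T_cmult Lq_int_cmult[OF m] c ..
  with k have "ennreal (ball_mass (a k) powr (q / p)) * (ennreal (ball_mass (a k) powr (- (q / p))) * Lq_int \<mu> q (T (g k))) \<le> ennreal (ball_mass (a k) powr (q / p)) * ennreal \<epsilon>"
    by (intro mult_left_mono) auto
  moreover have "ennreal (ball_mass (a k) powr (q / p)) * ennreal (ball_mass (a k) powr (- (q / p))) = 1"
    using M[of k] by (simp add: ennreal_mult[symmetric] powr_add[symmetric])
  ultimately have "Lq_int \<mu> q (T (g k)) \<le> ennreal (\<epsilon> * ball_mass (a k) powr (q / p))"
    using e by (simp add: mult.assoc[symmetric] ennreal_mult mult.commute)
  with ag(5) show False by blast
qed

lemma test_sum_le:
  assumes a: "norm a < 1"
    and b: "\<And>g. holo_on unit_ball g \<Longrightarrow> (\<And>z. norm z < 1 \<Longrightarrow> cmod (g z) \<le> cmod (test_fun N a z)) \<Longrightarrow> Lq_int \<mu> q (T g) \<le> ennreal c"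
    and c: "c \<ge> 0"
  shows "test_sum N a \<le> ennreal ((1 + real CARD('n)) * c)"
proof -
  have "Lq_int \<mu> q (T (test_fun N a)) \<le> ennreal c" by (rule b[OF holo_on_test_fun[OF a]]) simp
  moreover have "Lq_int \<mu> q (T (\<lambda>z. test_fun N a z * ball_aut a z $ i)) \<le> ennreal c" for i
  proof (rule b)
    show "holo_on unit_ball (\<lambda>z. test_fun N a z * ball_aut a z $ i)"
      by (intro holo_on_mult holo_on_test_fun holo_on_ball_aut_nth a)
    show "cmod (test_fun N a z * ball_aut a z $ i) \<le> cmod (test_fun N a z)" if z: "norm z < 1" for z
    proof -
      have "cmod (ball_aut a z $ i) \<le> 1"
        using Finite_Cartesian_Product.norm_nth_le[of "ball_aut a z" i] norm_ball_aut_less[OF a z] by simp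
      then show ?thesis by (simp add: norm_mult mult_left_le)
    qed
  qed
  ultimately have "test_sum N a \<le> ennreal c + (\<Sum>i\<in>(UNIV::'n set). ennreal c)"
    unfolding test_sum_def by (intro add_mono sum_mono)
  also have "\<dots> = ennreal ((1 + real CARD('n)) * c)"
    using c by (simp add: ennreal_of_nat_eq_real_of_nat ennreal_mult[symmetric] ennreal_plus[symmetric] distrib_right del: ennreal_plus)
  finally show ?thesis .
qed

text \<open>Isolates what has to be checked about \<nu>: \<open>dom\<close> at a single \<kappa>
  yields sufficiency, \<open>nec\<close> at every \<kappa> yields necessity. It is instantiated for
  the difference operator and for the embedding.\<close>

lemma bounded_iff_carleson_on_balls_compact_iff_vanishing_on_balls:
  assumes \<nu>: "sets \<nu> = sets ball_borel" and k: "\<kappa> > 0" and K: "K \<ge> 0"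
    and dom: "\<And>f. holo_on unit_ball f \<Longrightarrow> Lq_int \<mu> q (T f) \<le> ennreal K * (\<integral>\<^sup>+\<zeta>. ennreal (locmean p \<kappa> f \<zeta> powr (q / p)) \<partial>\<nu>)"
    and N: "real N * p \<ge> real (CARD('n) + doubling_exp + 1)"
    and nec: "\<And>\<kappa>. \<kappa> > 0 \<Longrightarrow> \<exists>K\<ge>0. \<forall>a. norm a < 1 \<longrightarrow> emeasure \<nu> (hball \<kappa> a) \<le> ennreal K * test_sum N a"
  shows "bounded_op p w \<mu> q T \<longleftrightarrow> carleson_on_balls p q \<nu>" "compact_op p w \<mu> q T \<longleftrightarrow> carleson_on_balls p q \<nu> \<and> vanishing_on_balls p q \<nu>"
proof -
  have 1: "carleson_on_balls p q \<nu>" if bdd: "bounded_op p w \<mu> q T"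
    unfolding carleson_on_balls_def
  proof (intro allI impI)
    fix \<kappa> :: real assume "\<kappa> > 0"
    then obtain K where K: "K \<ge> 0" "\<And>a. norm a < 1 \<Longrightarrow> emeasure \<nu> (hball \<kappa> a) \<le> ennreal K * test_sum N a" using nec by blast
    obtain C where C: "C \<ge> 0" "\<And>a g. norm a < 1 \<Longrightarrow> holo_on unit_ball g \<Longrightarrow> (\<And>z. norm z < 1 \<Longrightarrow> cmod (g z) \<le> cmod (test_fun N a z)) \<Longrightarrow>
     Lq_int \<mu> q (T g) \<le> ennreal (C * ball_mass a powr (q / p))"
      using bounded_test[OF N bdd] by blast
    have "emeasure \<nu> (hball \<kappa> a) \<le> ennreal ((K * ((1 + real CARD('n)) * C)) * ball_mass a powr (q / p))" if a: "norm a < 1" for a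
    proof -
      have "emeasure \<nu> (hball \<kappa> a) \<le> ennreal K * test_sum N a" by (rule K(2)[OF a])
      also have "\<dots> \<le> ennreal K * ennreal ((1 + real CARD('n)) * (C * ball_mass a powr (q / p)))"
        using C a by (intro mult_left_mono test_sum_le) auto
      also have "\<dots> = ennreal ((K * ((1 + real CARD('n)) * C)) * ball_mass a powr (q / p))"
        using K(1) by (simp add: ennreal_mult'[symmetric] mult.assoc)
      finally show ?thesis .
    qed
    then show "\<exists>C\<ge>0. \<forall>a. norm a < 1 \<longrightarrow> emeasure \<nu> (hball \<kappa> a) \<le> ennreal (C * ball_mass a powr (q / p))"
      using K(1) C(1) by (intro exI[of _ "K * ((1 + real CARD('n)) * C)"]) auto
  qed
  have 2: "vanishing_on_balls p q \<nu>" if cpt: "compact_op p w \<mu> q T"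
    unfolding vanishing_on_balls_def
  proof (intro allI impI)
    fix \<kappa> \<epsilon> :: real assume "\<kappa> > 0" and e: "\<epsilon> > 0"
    then obtain K where K: "K \<ge> 0" "\<And>a. norm a < 1 \<Longrightarrow> emeasure \<nu> (hball \<kappa> a) \<le> ennreal K * test_sum N a" using nec by blast
    define \<epsilon>' where "\<epsilon>' = \<epsilon> / ((K + 1) * (1 + real CARD('n)))"
    have e': "\<epsilon>' > 0" using e K(1) by (simp add: \<epsilon>'_def)
    obtain s where s: "s < 1" "\<And>a g. norm a < 1 \<Longrightarrow> s \<le> norm a \<Longrightarrow> holo_on unit_ball g \<Longrightarrow> (\<And>z. norm z < 1 \<Longrightarrow> cmod (g z) \<le> cmod (test_fun N a z)) \<Longrightarrow>
     Lq_int \<mu> q (T g) \<le> ennreal (\<epsilon>' * ball_mass a powr (q / p))"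
      using compact_test[OF N cpt e'] by blast
    have "emeasure \<nu> (hball \<kappa> a) \<le> ennreal (\<epsilon> * ball_mass a powr (q / p))" if a: "norm a < 1" "s \<le> norm a" for a
    proof -
      have "emeasure \<nu> (hball \<kappa> a) \<le> ennreal K * test_sum N a" by (rule K(2)[OF a(1)])
      also have "\<dots> \<le> ennreal K * ennreal ((1 + real CARD('n)) * (\<epsilon>' * ball_mass a powr (q / p)))"
        using s(2)[OF a] e' a by (intro mult_left_mono test_sum_le) auto
      \<comment> \<open>K may be 0, so \<epsilon>' was scaled by K + 1.\<close>
      also have "\<dots> \<le> ennreal (K + 1) * ennreal ((1 + real CARD('n)) * (\<epsilon>' * ball_mass a powr (q / p)))"
        by (intro mult_right_mono ennreal_leI) auto
      also have "\<dots> = ennreal (((K + 1) * (1 + real CARD('n)) * \<epsilon>') * ball_mass a powr (q / p))"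
        using K(1) by (subst ennreal_mult'[symmetric]) (auto simp: mult.assoc)
      also have "(K + 1) * (1 + real CARD('n)) * \<epsilon>' = \<epsilon>"
      proof -
        have "(K + 1) * (1 + real CARD('n)) \<noteq> 0" using K(1) by (simp add: add_nonneg_eq_0_iff)
        then show ?thesis by (simp add: \<epsilon>'_def)
      qed
      finally show ?thesis .
    qed
    then show "\<exists>s<1. \<forall>a. norm a < 1 \<longrightarrow> s \<le> norm a \<longrightarrow> emeasure \<nu> (hball \<kappa> a) \<le> ennreal (\<epsilon> * ball_mass a powr (q / p))"
      using s(1) by blast
  qed
  show "bounded_op p w \<mu> q T \<longleftrightarrow> carleson_on_balls p q \<nu>"
    using 1 bounded_op_if_carleson_on_balls[OF \<nu> _ k K dom] by blast
  show "compact_op p w \<mu> q T \<longleftrightarrow> carleson_on_balls p q \<nu> \<and> vanishing_on_balls p q \<nu>"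
    using 1 2 compact_imp_bounded compact_op_if_vanishing_on_balls[OF \<nu> _ _ k K dom] by blast
qed

end

section \<open>The pullback measures\<close>

lemma sets_measure_add [simp]: "sets (measure_add M N) = sets M"
  and space_measure_add [simp]: "space (measure_add M N) = space M"
  by (simp_all add: measure_add_def sets.sets_measure_of_eq sets.space_measure_of_eq)

lemma emeasure_measure_add:
  assumes s: "sets N = sets M" and A: "A \<in> sets M"
  shows "emeasure (measure_add M N) A = emeasure M A + emeasure N A"
  unfolding measure_add_def
proof (rule emeasure_measure_of_sigma)
  show "sigma_algebra (space M) (sets M)" by (rule sets.sigma_algebra_axioms)
  show "positive (sets M) (\<lambda>A. emeasure M A + emeasure N A)" by (simp add: positive_def)
  show "countably_additive (sets M) (\<lambda>A. emeasure M A + emeasure N A)"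
  proof (rule countably_additiveI)
    fix A :: "nat \<Rightarrow> 'a set" assume A: "range A \<subseteq> sets M" "disjoint_family A"
    have "(\<Sum>i. emeasure M (A i) + emeasure N (A i)) = (\<Sum>i. emeasure M (A i)) + (\<Sum>i. emeasure N (A i))"
      by (intro suminf_add[symmetric] summableI)
    then show "(\<Sum>i. emeasure M (A i) + emeasure N (A i)) = emeasure M (\<Union>i. A i) + emeasure N (\<Union>i. A i)"
      using A s by (simp add: suminf_emeasure)
  qed
qed (rule A)

lemma nn_integral_measure_add:
  assumes s: "sets N = sets M" and f: "f \<in> borel_measurable M"
  shows "(\<integral>\<^sup>+x. f x \<partial>measure_add M N) = (\<integral>\<^sup>+x. f x \<partial>M) + (\<integral>\<^sup>+x. f x \<partial>N)"
  using f
proof (induction rule: borel_measurable_induct)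
  case (cong f g)
  have sp: "space N = space M" using s by (rule sets_eq_imp_space_eq)
  have fg: "f x = g x" if "x \<in> space M" for x using cong(3) that by simp
  have "(\<integral>\<^sup>+x. f x \<partial>M) = (\<integral>\<^sup>+x. g x \<partial>M)" by (intro nn_integral_cong fg)
  moreover have "(\<integral>\<^sup>+x. f x \<partial>N) = (\<integral>\<^sup>+x. g x \<partial>N)" by (intro nn_integral_cong fg) (simp add: sp)
  moreover have "(\<integral>\<^sup>+x. f x \<partial>measure_add M N) = (\<integral>\<^sup>+x. g x \<partial>measure_add M N)"
    by (intro nn_integral_cong fg) simp
  ultimately show ?case using cong.IH by simp
next
  case (set A)
  then show ?case using s by (simp add: emeasure_measure_add)
next
  case (mult u c)
  have "u \<in> borel_measurable N" "u \<in> borel_measurable (measure_add M N)"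
    using mult s by (auto cong: measurable_cong_sets)
  with mult show ?case by (simp add: nn_integral_cmult distrib_left)
next
  case (add u v)
  have "u \<in> borel_measurable N" "u \<in> borel_measurable (measure_add M N)"
    "v \<in> borel_measurable N" "v \<in> borel_measurable (measure_add M N)"
    using add s by (auto cong: measurable_cong_sets)
  with add show ?case by (simp add: nn_integral_add add_ac)
next
  case (seq U)
  have m: "U i \<in> borel_measurable N" "U i \<in> borel_measurable (measure_add M N)" for i
    using seq s by (auto cong: measurable_cong_sets)
  have inc: "incseq U" using seq by simp
  have i1: "incseq (\<lambda>i. \<integral>\<^sup>+x. U i x \<partial>K)" for K :: "'a measure"
    using inc by (auto simp: incseq_def le_fun_def intro!: nn_integral_mono)
  have "(\<integral>\<^sup>+x. (SUP i. U i) x \<partial>measure_add M N) = (SUP i. \<integral>\<^sup>+x. U i x \<partial>measure_add M N)"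
    using m inc by (simp add: nn_integral_monotone_convergence_SUP image_comp)
  also have "\<dots> = (SUP i. (\<integral>\<^sup>+x. U i x \<partial>M) + (\<integral>\<^sup>+x. U i x \<partial>N))"
    using seq by simp
  also have "\<dots> = (SUP i. \<integral>\<^sup>+x. U i x \<partial>M) + (SUP i. \<integral>\<^sup>+x. U i x \<partial>N)"
    by (intro ennreal_SUP_add i1)
  also have "\<dots> = (\<integral>\<^sup>+x. (SUP i. U i) x \<partial>M) + (\<integral>\<^sup>+x. (SUP i. U i) x \<partial>N)"
    using m inc seq by (simp add: nn_integral_monotone_convergence_SUP image_comp)
  finally show ?case .
qed

lemma sets_pushforward [simp]: "sets (pushforward \<mu> g F) = sets ball_borel"
  by (simp add: pushforward_def)

lemma nn_integral_pushforward:
  assumes "F \<in> measurable \<mu> ball_borel" "G \<in> borel_measurable \<mu>" "g \<in> borel_measurable ball_borel"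
  shows "(\<integral>\<^sup>+x. g x \<partial>pushforward \<mu> G F) = (\<integral>\<^sup>+z. ennreal (G z) * g (F z) \<partial>\<mu>)"
proof -
  have "(\<integral>\<^sup>+x. g x \<partial>pushforward \<mu> G F) = (\<integral>\<^sup>+z. g (F z) \<partial>density \<mu> (\<lambda>z. ennreal (G z)))"
    unfolding pushforward_def using assms by (intro nn_integral_distr) auto
  also have "\<dots> = (\<integral>\<^sup>+z. ennreal (G z) * g (F z) \<partial>\<mu>)"
    using assms by (intro nn_integral_density) auto
  finally show ?thesis .
qed

lemma ball_borel_id: "(\<lambda>x. x) \<in> borel_measurable (ball_borel :: (complex^'n) measure)"
  unfolding ball_borel_def by (rule measurable_restrict_space1) simp

lemma holo_self_map_measurable:
  assumes F: "holo_self_map F" and s: "sets \<mu> = sets ball_borel"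
  shows "F \<in> measurable \<mu> (ball_borel :: (complex^'n) measure)"
proof -
  have "continuous_on unit_ball (\<lambda>z. \<chi> i. F z $ i)"
    using F by (intro continuous_on_vec_lambda holo_on_imp_continuous_on) (auto simp: holo_self_map_def)
  then have "F \<in> borel_measurable (restrict_space borel unit_ball)"
    by (intro borel_measurable_continuous_on_restrict) simp
  moreover have "F \<in> space (restrict_space borel unit_ball) \<rightarrow> unit_ball"
    using F by (auto simp: holo_self_map_def space_restrict_space)
  ultimately have "F \<in> measurable (restrict_space borel unit_ball) (restrict_space borel unit_ball)"
    by (intro measurable_restrict_space2)
  then show ?thesis unfolding measurable_cong_sets[OF s refl] by (simp add: ball_borel_def)
qed

context weighted_composition
begin

lemma phi_borel [measurable]: "\<phi> \<in> borel_measurable \<mu>" and psi_borel [measurable]: "\<psi> \<in> borel_measurable \<mu>"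
  using measurable_compose[OF phi_meas ball_borel_id] measurable_compose[OF psi_meas ball_borel_id] by auto

lemma rho_eq: "z \<in> space \<mu> \<Longrightarrow> rho_pair \<phi> \<psi> z = sqrt (1 - hyp_kernel (\<phi> z) (\<psi> z))"
  using phi_ball psi_ball by (simp add: rho_pair_def pseudohyp_eq)

lemma rho_measurable [measurable]: "rho_pair \<phi> \<psi> \<in> borel_measurable \<mu>"
proof -
  have "(\<lambda>z. sqrt (1 - hyp_kernel (\<phi> z) (\<psi> z))) \<in> borel_measurable \<mu>" by measurable
  then show ?thesis by (rule measurable_cong[THEN iffD1, rotated]) (simp add: rho_eq)
qed

lemma rho_pair_nonneg: "0 \<le> rho_pair \<phi> \<psi> z"
  by (simp add: rho_pair_def pseudohyp_def)

text \<open>Subtracting the multiple of \<open>T (test_fun N a)\<close> cancels every term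
  containing v and leaves u alone, multiplied by the difference of the two images under the
  automorphism.\<close>

lemma T_ball_aut:
  "u z * test_fun N a (\<phi> z) * (ball_aut a (\<phi> z) $ i - ball_aut a (\<psi> z) $ i) =
   T (\<lambda>z. test_fun N a z * ball_aut a z $ i) z - ball_aut a (\<psi> z) $ i * T (test_fun N a) z"
  by (simp add: wcomp_diff_def algebra_simps)

lemma test_sum_measurable_parts:
  assumes "norm a < 1"
  shows "T (test_fun N a) \<in> borel_measurable \<mu>" "T (\<lambda>z. test_fun N a z * ball_aut a z $ i) \<in> borel_measurable \<mu>"
  using assms by (auto intro!: T_measurable holo_on_test_fun holo_on_mult holo_on_ball_aut_nth)

lemma test_sum_eq:
  assumes a: "norm a < 1"
  shows "(\<integral>\<^sup>+z. ennreal (cmod (T (test_fun N a) z) powr q + (\<Sum>i\<in>UNIV. cmod (T (\<lambda>z. test_fun N a z * ball_aut a z $ i) z) powr q)) \<partial>\<mu>) = test_sum N a"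
proof -
  note [measurable] = test_sum_measurable_parts[OF a]
  have "(\<integral>\<^sup>+z. ennreal (cmod (T (test_fun N a) z) powr q + (\<Sum>i\<in>UNIV. cmod (T (\<lambda>z. test_fun N a z * ball_aut a z $ i) z) powr q)) \<partial>\<mu>) =
    (\<integral>\<^sup>+z. ennreal (cmod (T (test_fun N a) z) powr q) + (\<Sum>i\<in>UNIV. ennreal (cmod (T (\<lambda>z. test_fun N a z * ball_aut a z $ i) z) powr q)) \<partial>\<mu>)"
    by (intro nn_integral_cong) (simp add: ennreal_plus sum_nonneg)
  also have "\<dots> = test_sum N a"
    unfolding test_sum_def Lq_int_def by (simp add: nn_integral_add nn_integral_sum del: sum_ennreal)
  finally show ?thesis .
qed

text \<open>Invariance moves \<rho> to the images x, y under the automorphism at a; there x stays in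
  a fixed compact ball, so \<rho> is bounded by Euclidean distance and hence by the coordinate
  differences of \<open>T_ball_aut\<close>. The constant c is the factor 2/\<kappa> of that
  comparison divided by the lower bound of the test function.\<close>

lemma rho_u_test_bound:
  assumes k: "\<kappa> > 0"
  shows "\<exists>K\<ge>0. \<forall>a. norm a < 1 \<longrightarrow>
    (\<integral>\<^sup>+z. ennreal ((rho_pair \<phi> \<psi> z * cmod (u z)) powr q) * indicator (hball \<kappa> a) (\<phi> z) \<partial>\<mu>) \<le> ennreal K * test_sum N a"
proof -
  define c where "c = (2 / \<kappa>) / (\<kappa> / 2) ^ N"
  have c: "c > 0" using k by (simp add: c_def)
  let ?n = "real CARD('n)"
  define K where "K = c powr q * (?n powr q * (2 powr q * ?n))"
  have n1: "?n \<ge> 1" by (simp add: Suc_leI)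
  have "(\<integral>\<^sup>+z. ennreal ((rho_pair \<phi> \<psi> z * cmod (u z)) powr q) * indicator (hball \<kappa> a) (\<phi> z) \<partial>\<mu>) \<le> ennreal K * test_sum N a"
    if a: "norm a < 1" for a
  proof -
    define S where "S z = cmod (T (test_fun N a) z) powr q + (\<Sum>i\<in>UNIV. cmod (T (\<lambda>z. test_fun N a z * ball_aut a z $ i) z) powr q)" for z
    note [measurable] = test_sum_measurable_parts[OF a]
    have [measurable]: "S \<in> borel_measurable \<mu>" unfolding S_def by measurable
    have pt: "(rho_pair \<phi> \<psi> z * cmod (u z)) powr q \<le> K * S z" if z: "z \<in> space \<mu>" "\<phi> z \<in> hball \<kappa> a" for z
    proof -
      define x where "x = ball_aut a (\<phi> z)"
      define y where "y = ball_aut a (\<psi> z)"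
      have x1: "norm x < 1" and y1: "norm y < 1"
        unfolding x_def y_def using norm_ball_aut_less[OF a] phi_ball[OF z(1)] psi_ball[OF z(1)] by auto
      have kx: "\<kappa> \<le> 1 - (norm x)\<^sup>2"
        using z(2) norm_ball_aut_sq[OF a phi_ball[OF z(1)]] by (simp add: x_def hball_def)
      have "rho_pair \<phi> \<psi> z = pseudohyp x y"
        unfolding rho_pair_def x_def y_def using a phi_ball[OF z(1)] psi_ball[OF z(1)] by (simp add: pseudohyp_ball_aut)
      also have "\<dots> \<le> 2 / \<kappa> * norm (x - y)" by (rule pseudohyp_le_norm_diff[OF x1 y1 kx k])
      also have "\<dots> \<le> 2 / \<kappa> * (\<Sum>i\<in>UNIV. cmod (x $ i - y $ i))"
      proof -
        have "norm (x - y) \<le> (\<Sum>i\<in>UNIV. cmod ((x - y) $ i))"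
          unfolding norm_vec_def by (rule L2_set_le_sum) auto
        then show ?thesis using k by (intro mult_left_mono) auto
      qed
      finally have r: "rho_pair \<phi> \<psi> z \<le> 2 / \<kappa> * (\<Sum>i\<in>UNIV. cmod (x $ i - y $ i))" .
      define t where "t = test_fun N a (\<phi> z)"
      have t: "(\<kappa> / 2) ^ N \<le> cmod t" unfolding t_def by (rule cmod_test_fun_ge[OF a z(2) k])
      have kp: "(\<kappa> / 2) ^ N > 0" using k by simp
      have "rho_pair \<phi> \<psi> z * cmod (u z) \<le> (2 / \<kappa> * (\<Sum>i\<in>UNIV. cmod (x $ i - y $ i))) * (cmod (u z) * (cmod t / (\<kappa> / 2) ^ N))"
      proof (intro mult_mono r)
        have "1 \<le> cmod t / (\<kappa> / 2) ^ N" using t kp by (simp add: pos_le_divide_eq)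
        then show "cmod (u z) \<le> cmod (u z) * (cmod t / (\<kappa> / 2) ^ N)" by (metis mult_left_mono mult.right_neutral norm_ge_zero)
        have "0 \<le> (\<Sum>i\<in>UNIV. cmod (x $ i - y $ i))" by (intro sum_nonneg) auto
        then show "0 \<le> 2 / \<kappa> * (\<Sum>i\<in>UNIV. cmod (x $ i - y $ i))" using k by (intro mult_nonneg_nonneg) auto
      qed simp
      also have "\<dots> = c * (\<Sum>i\<in>UNIV. cmod (u z * t * (x $ i - y $ i)))"
        by (simp add: c_def norm_mult sum_distrib_left mult_ac)
      also have "\<dots> \<le> c * (\<Sum>i\<in>UNIV. cmod (T (\<lambda>z. test_fun N a z * ball_aut a z $ i) z) + cmod (T (test_fun N a) z))"
      proof (intro mult_left_mono sum_mono)
        fix i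
        have yi: "cmod (y $ i) \<le> 1" using Finite_Cartesian_Product.norm_nth_le[of y i] y1 by simp
        have "u z * t * (x $ i - y $ i) = T (\<lambda>z. test_fun N a z * ball_aut a z $ i) z - y $ i * T (test_fun N a) z"
          unfolding t_def x_def y_def by (rule T_ball_aut)
        then have "cmod (u z * t * (x $ i - y $ i)) \<le> cmod (T (\<lambda>z. test_fun N a z * ball_aut a z $ i) z) + cmod (y $ i * T (test_fun N a) z)"
          by (metis norm_triangle_ineq4)
        also have "cmod (y $ i * T (test_fun N a) z) \<le> 1 * cmod (T (test_fun N a) z)"
          unfolding norm_mult using yi by (intro mult_right_mono) auto
        finally show "cmod (u z * t * (x $ i - y $ i)) \<le> cmod (T (\<lambda>z. test_fun N a z * ball_aut a z $ i) z) + cmod (T (test_fun N a) z)" by simp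
      qed (use c in auto)
      finally have "(rho_pair \<phi> \<psi> z * cmod (u z)) powr q \<le> (c * (\<Sum>i\<in>UNIV. cmod (T (\<lambda>z. test_fun N a z * ball_aut a z $ i) z) + cmod (T (test_fun N a) z))) powr q"
        using q_pos rho_pair_nonneg[of z] by (intro powr_mono2) auto
      also have "\<dots> = c powr q * (\<Sum>i\<in>UNIV. cmod (T (\<lambda>z. test_fun N a z * ball_aut a z $ i) z) + cmod (T (test_fun N a) z)) powr q"
        using c by (simp add: powr_mult sum_nonneg)
      also have "\<dots> \<le> c powr q * (?n powr q * (\<Sum>i\<in>UNIV. (cmod (T (\<lambda>z. test_fun N a z * ball_aut a z $ i) z) + cmod (T (test_fun N a) z)) powr q))"
        using q_pos by (intro mult_left_mono powr_sum_le) auto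
      also have "\<dots> \<le> c powr q * (?n powr q * (2 powr q * (?n * S z)))"
      proof (intro mult_left_mono)
        have "(\<Sum>i\<in>UNIV. (cmod (T (\<lambda>z. test_fun N a z * ball_aut a z $ i) z) + cmod (T (test_fun N a) z)) powr q) \<le>
          (\<Sum>i\<in>UNIV. 2 powr q * (cmod (T (\<lambda>z. test_fun N a z * ball_aut a z $ i) z) powr q + cmod (T (test_fun N a) z) powr q))"
          using q_pos by (intro sum_mono powr_add_le) auto
        also have "\<dots> = 2 powr q * ((\<Sum>i\<in>UNIV. cmod (T (\<lambda>z. test_fun N a z * ball_aut a z $ i) z) powr q) + ?n * cmod (T (test_fun N a) z) powr q)"
          by (simp add: sum_distrib_left[symmetric] sum.distrib)
        also have "\<dots> \<le> 2 powr q * (?n * S z)"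
        proof (intro mult_left_mono)
          have "1 * (\<Sum>i\<in>UNIV. cmod (T (\<lambda>z. test_fun N a z * ball_aut a z $ i) z) powr q) \<le> ?n * (\<Sum>i\<in>UNIV. cmod (T (\<lambda>z. test_fun N a z * ball_aut a z $ i) z) powr q)"
            using n1 by (intro mult_right_mono sum_nonneg) auto
          then show "(\<Sum>i\<in>UNIV. cmod (T (\<lambda>z. test_fun N a z * ball_aut a z $ i) z) powr q) + ?n * cmod (T (test_fun N a) z) powr q \<le> ?n * S z"
            by (simp add: S_def distrib_left)
        qed auto
        finally show "(\<Sum>i\<in>UNIV. (cmod (T (\<lambda>z. test_fun N a z * ball_aut a z $ i) z) + cmod (T (test_fun N a) z)) powr q) \<le> 2 powr q * (?n * S z)" .
      qed auto
      finally show ?thesis by (simp add: K_def mult_ac)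
    qed
    have "(\<integral>\<^sup>+z. ennreal ((rho_pair \<phi> \<psi> z * cmod (u z)) powr q) * indicator (hball \<kappa> a) (\<phi> z) \<partial>\<mu>) \<le> (\<integral>\<^sup>+z. ennreal K * ennreal (S z) \<partial>\<mu>)"
    proof (rule nn_integral_mono)
      fix z assume z: "z \<in> space \<mu>"
      show "ennreal ((rho_pair \<phi> \<psi> z * cmod (u z)) powr q) * indicator (hball \<kappa> a) (\<phi> z) \<le> ennreal K * ennreal (S z)"
      proof (cases "\<phi> z \<in> hball \<kappa> a")
        case True
        have "ennreal ((rho_pair \<phi> \<psi> z * cmod (u z)) powr q) \<le> ennreal (K * S z)" by (rule ennreal_leI[OF pt[OF z True]])
        also have "\<dots> = ennreal K * ennreal (S z)" by (rule ennreal_mult') (simp add: K_def)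
        finally show ?thesis using True by simp
      qed simp
    qed
    also have "\<dots> = ennreal K * (\<integral>\<^sup>+z. ennreal (S z) \<partial>\<mu>)" by (rule nn_integral_cmult) measurable
    also have "(\<integral>\<^sup>+z. ennreal (S z) \<partial>\<mu>) = test_sum N a" unfolding S_def by (rule test_sum_eq[OF a])
    finally show ?thesis .
  qed
  moreover have "K \<ge> 0" by (simp add: K_def)
  ultimately show ?thesis by blast
qed

end

text \<open>Halving brings both numbers into the unit disc, where N-th powers are Lipschitz with
  constant N. The bound 2 is that of |1 - <x, a>| on the ball.\<close>

lemma cmod_power_diff_le:
  fixes x y :: complex
  assumes "cmod x \<le> 2" "cmod y \<le> 2"
  shows "cmod (x ^ N - y ^ N) \<le> real N * 2 ^ N * cmod (x - y)"
proof -
  have d: "(x / 2) ^ N - (y / 2) ^ N = (x ^ N - y ^ N) / 2 ^ N" "x / 2 - y / 2 = (x - y) / 2"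
    by (simp_all only: power_divide diff_divide_distrib)
  have "cmod ((x / 2) ^ N - (y / 2) ^ N) \<le> real N * cmod (x / 2 - y / 2)"
    using assms by (intro norm_power_diff) (auto simp: norm_divide)
  then have "cmod (x ^ N - y ^ N) / 2 ^ N \<le> real N * (cmod (x - y) / 2)"
    unfolding d by (simp only: norm_divide norm_power norm_numeral)
  also have "\<dots> \<le> real N * cmod (x - y)" by (intro mult_left_mono) auto
  finally show ?thesis by (simp add: pos_divide_le_eq mult_ac)
qed

section \<open>Exchanging the two maps, and the region where they are close\<close>

context weighted_composition
begin

text \<open>Exchanging (u, \<phi>) with (v, \<psi>) only changes the sign of the operator, so each
  estimate comes with a mirror image.\<close>

lemma swapped: "weighted_composition w ty p q \<mu> v u \<psi> \<phi>"
  by unfold_locales (use p_pos p_le_q in auto)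

lemma Lq_int_swapped: "Lq_int \<mu> q (wcomp_diff v \<psi> u \<phi> f) = Lq_int \<mu> q (T f)"
proof -
  have "wcomp_diff v \<psi> u \<phi> f = (\<lambda>z. - T f z)" by (auto simp: wcomp_diff_def)
  then show ?thesis by (simp only: Lq_int_uminus)
qed

lemma test_sum_swapped: "weighted_composition.test_sum q \<mu> v u \<psi> \<phi> N a = test_sum N a"
  unfolding weighted_composition.test_sum_def[OF swapped] test_sum_def Lq_int_swapped ..

lemma rho_pair_commute: "z \<in> space \<mu> \<Longrightarrow> rho_pair \<psi> \<phi> z = rho_pair \<phi> \<psi> z"
  unfolding rho_pair_def by (simp add: pseudohyp_eq phi_ball psi_ball hyp_kernel_commute[of "\<psi> z"])

lemma rho_v_test_bound:
  assumes k: "\<kappa> > 0"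
  shows "\<exists>K\<ge>0. \<forall>a. norm a < 1 \<longrightarrow>
    (\<integral>\<^sup>+z. ennreal ((rho_pair \<phi> \<psi> z * cmod (v z)) powr q) * indicator (hball \<kappa> a) (\<psi> z) \<partial>\<mu>) \<le> ennreal K * test_sum N a"
proof -
  obtain K where K: "K \<ge> 0" "\<And>a. norm a < 1 \<Longrightarrow>
    (\<integral>\<^sup>+z. ennreal ((rho_pair \<psi> \<phi> z * cmod (v z)) powr q) * indicator (hball \<kappa> a) (\<psi> z) \<partial>\<mu>) \<le> ennreal K * test_sum N a"
    using weighted_composition.rho_u_test_bound[OF swapped k, of N] unfolding test_sum_swapped by blast
  have "(\<integral>\<^sup>+z. ennreal ((rho_pair \<phi> \<psi> z * cmod (v z)) powr q) * indicator (hball \<kappa> a) (\<psi> z) \<partial>\<mu>) =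
    (\<integral>\<^sup>+z. ennreal ((rho_pair \<psi> \<phi> z * cmod (v z)) powr q) * indicator (hball \<kappa> a) (\<psi> z) \<partial>\<mu>)" for a
    by (intro nn_integral_cong) (simp add: rho_pair_commute)
  then show ?thesis using K by (intro exI[of _ K]) auto
qed

lemma G_set_commute: 
  assumes "space \<mu> = unit_ball" shows "G_set \<psi> \<phi> r = G_set \<phi> \<psi> r"
  unfolding G_set_def assms[symmetric] by (intro Collect_cong conj_cong refl) (simp add: rho_pair_commute)

text \<open>The error term \<rho>|v| arises where \<phi>(z) lies in a Bergman ball about a, whereas
  \<open>rho_v_test_bound\<close> integrates where \<psi>(z) does. On G_r the kernel of \<phi>(z)
  and \<psi>(z) is at least 1 - r^2, so \<open>hyp_kernel_triangle\<close> passes from one to the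
  other with \<kappa>' = \<kappa> (1 - r^2)/4.\<close>

lemma sigma_test_bound:
  assumes k: "\<kappa> > 0" and r: "0 < r" "r < 1" and sp: "space \<mu> = unit_ball"
  shows "\<exists>K\<ge>0. \<forall>a. norm a < 1 \<longrightarrow>
    (\<integral>\<^sup>+z. ennreal (indicator (G_set \<phi> \<psi> r) z * cmod (u z - v z) powr q) * indicator (hball \<kappa> a) (\<phi> z) \<partial>\<mu>) \<le> ennreal K * test_sum N a"
proof -
  define \<kappa>' where "\<kappa>' = \<kappa> * (1 - r\<^sup>2) / 4"
  have r2: "1 - r\<^sup>2 > 0" using r by (simp add: power_less_one_iff abs_square_less_1)
  then have k': "\<kappa>' > 0" using k by (simp add: \<kappa>'_def)
  obtain K' where K': "K' \<ge> 0" "\<And>a. norm a < 1 \<Longrightarrow>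
    (\<integral>\<^sup>+z. ennreal ((rho_pair \<phi> \<psi> z * cmod (v z)) powr q) * indicator (hball \<kappa>' a) (\<psi> z) \<partial>\<mu>) \<le> ennreal K' * test_sum N a"
    using rho_v_test_bound[OF k', of N] by blast
  define D where "D = real N * 2 ^ N * (2 / sqrt \<kappa>)"
  have D: "D \<ge> 0" using k by (simp add: D_def)
  define c where "c = 1 / (\<kappa> / 2) ^ N"
  have c: "c > 0" using k by (simp add: c_def)
  define E where "E = c powr q * 2 powr q"
  have E: "E \<ge> 0" by (simp add: E_def)
  define K where "K = E * (1 + D powr q * K')"
  have "(\<integral>\<^sup>+z. ennreal (indicator (G_set \<phi> \<psi> r) z * cmod (u z - v z) powr q) * indicator (hball \<kappa> a) (\<phi> z) \<partial>\<mu>) \<le> ennreal K * test_sum N a"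
    if a: "norm a < 1" for a
  proof -
    note [measurable] = test_sum_measurable_parts[OF a]
    have pt: "cmod (u z - v z) powr q \<le> E * (cmod (T (test_fun N a) z) powr q + D powr q * (rho_pair \<phi> \<psi> z * cmod (v z)) powr q) \<and> \<psi> z \<in> hball \<kappa>' a"
      if z: "z \<in> space \<mu>" "\<phi> z \<in> hball \<kappa> a" "rho_pair \<phi> \<psi> z < r" for z
    proof -
      note f1 = phi_ball[OF z(1)] and p1 = psi_ball[OF z(1)]
      define \<rho> where "\<rho> = rho_pair \<phi> \<psi> z"
      have \<rho>0: "\<rho> \<ge> 0" unfolding \<rho>_def by (rule rho_pair_nonneg[of z])
      define x where "x = ball_aut a (\<phi> z)"
      define y where "y = ball_aut a (\<psi> z)"
      have x1: "norm x < 1" and y1: "norm y < 1"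
        unfolding x_def y_def using norm_ball_aut_less[OF a] f1 p1 by auto
      have kx: "\<kappa> \<le> 1 - (norm x)\<^sup>2"
        using z(2) norm_ball_aut_sq[OF a f1] by (simp add: x_def hball_def)
      have rxy: "\<rho> = pseudohyp x y"
        unfolding \<rho>_def rho_pair_def x_def y_def using a f1 p1 by (simp add: pseudohyp_ball_aut)
      \<comment> \<open>In terms of x and y the test function is the N-th power of a function that
        is affine with coefficient a, hence Lipschitz uniformly in a.\<close>
      have tx: "test_fun N a (\<phi> z) = (1 - herm x a) ^ N" and ty: "test_fun N a (\<psi> z) = (1 - herm y a) ^ N"
        unfolding test_fun_def x_def y_def one_minus_herm_ball_aut[OF a f1] one_minus_herm_ball_aut[OF a p1] by auto
      have "cmod (test_fun N a (\<phi> z) - test_fun N a (\<psi> z)) \<le> real N * 2 ^ N * cmod ((1 - herm x a) - (1 - herm y a))"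
        unfolding tx ty using norm_one_minus_herm_le[OF x1 a] norm_one_minus_herm_le[OF y1 a] by (rule cmod_power_diff_le)
      also have "cmod ((1 - herm x a) - (1 - herm y a)) = cmod (herm (x - y) a)"
        by (simp add: herm_diff_left norm_minus_commute)
      also have "\<dots> \<le> norm (x - y)"
        using cmod_herm_le[of "x - y" a] a mult_left_le[of "norm a" "norm (x - y)"] by simp
      also have "norm (x - y) \<le> 2 / sqrt \<kappa> * \<rho>" unfolding rxy by (rule norm_diff_le_pseudohyp[OF x1 y1 kx k])
      finally have dt: "cmod (test_fun N a (\<phi> z) - test_fun N a (\<psi> z)) \<le> D * \<rho>"
        by (simp add: D_def mult_left_mono mult.assoc)
      have "(u z - v z) * test_fun N a (\<phi> z) = T (test_fun N a) z - v z * (test_fun N a (\<phi> z) - test_fun N a (\<psi> z))"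
        by (simp add: wcomp_diff_def algebra_simps)
      then have "cmod ((u z - v z) * test_fun N a (\<phi> z)) \<le> cmod (T (test_fun N a) z) + cmod (v z * (test_fun N a (\<phi> z) - test_fun N a (\<psi> z)))"
        by (metis norm_triangle_ineq4)
      also have "cmod (v z * (test_fun N a (\<phi> z) - test_fun N a (\<psi> z))) \<le> cmod (v z) * (D * \<rho>)"
        unfolding norm_mult by (intro mult_left_mono dt) auto
      finally have 1: "cmod (u z - v z) * cmod (test_fun N a (\<phi> z)) \<le> cmod (T (test_fun N a) z) + D * (\<rho> * cmod (v z))"
        by (simp add: norm_mult mult_ac)
      have "cmod (u z - v z) * (\<kappa> / 2) ^ N \<le> cmod (u z - v z) * cmod (test_fun N a (\<phi> z))"
        by (intro mult_left_mono cmod_test_fun_ge[OF a z(2) k]) auto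
      with 1 have "cmod (u z - v z) * (\<kappa> / 2) ^ N \<le> cmod (T (test_fun N a) z) + D * (\<rho> * cmod (v z))" by linarith
      then have "cmod (u z - v z) \<le> c * (cmod (T (test_fun N a) z) + D * (\<rho> * cmod (v z)))"
        using k by (simp add: c_def pos_le_divide_eq)
      then have "cmod (u z - v z) powr q \<le> (c * (cmod (T (test_fun N a) z) + D * (\<rho> * cmod (v z)))) powr q"
        using q_pos by (intro powr_mono2) auto
      also have "\<dots> = c powr q * (cmod (T (test_fun N a) z) + D * (\<rho> * cmod (v z))) powr q"
        using c D \<rho>0 by (simp add: powr_mult)
      also have "\<dots> \<le> c powr q * (2 powr q * (cmod (T (test_fun N a) z) powr q + (D * (\<rho> * cmod (v z))) powr q))"
        using D \<rho>0 q_pos by (intro mult_left_mono powr_add_le) auto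
      also have "\<dots> = E * (cmod (T (test_fun N a) z) powr q + D powr q * (\<rho> * cmod (v z)) powr q)"
        using D \<rho>0 by (simp add: E_def powr_mult mult.assoc)
      finally have res: "cmod (u z - v z) powr q \<le> E * (cmod (T (test_fun N a) z) powr q + D powr q * (\<rho> * cmod (v z)) powr q)" .
      have "\<rho>\<^sup>2 \<le> r\<^sup>2" using z(3) \<rho>0 by (intro power_mono) (auto simp: \<rho>_def)
      moreover have "\<rho>\<^sup>2 = 1 - hyp_kernel (\<phi> z) (\<psi> z)"
        unfolding \<rho>_def rho_eq[OF z(1)] using hyp_kernel_le_1[OF f1 p1] by simp
      ultimately have h2: "1 - r\<^sup>2 \<le> hyp_kernel (\<phi> z) (\<psi> z)" by simp
      have "\<kappa>' \<le> hyp_kernel a (\<phi> z) * hyp_kernel (\<phi> z) (\<psi> z) / 4"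
        unfolding \<kappa>'_def using z(2) h2 k r2 by (intro divide_right_mono mult_mono) (auto simp: hball_def)
      also have "\<dots> \<le> hyp_kernel a (\<psi> z)" by (rule hyp_kernel_triangle[OF a f1 p1])
      finally have "\<psi> z \<in> hball \<kappa>' a" using p1 by (simp add: hball_def)
      with res show ?thesis by (simp add: \<rho>_def)
    qed
    have "(\<integral>\<^sup>+z. ennreal (indicator (G_set \<phi> \<psi> r) z * cmod (u z - v z) powr q) * indicator (hball \<kappa> a) (\<phi> z) \<partial>\<mu>) \<le>
      (\<integral>\<^sup>+z. ennreal E * (ennreal (cmod (T (test_fun N a) z) powr q) + ennreal (D powr q) * (ennreal ((rho_pair \<phi> \<psi> z * cmod (v z)) powr q) * indicator (hball \<kappa>' a) (\<psi> z))) \<partial>\<mu>)"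
    proof (rule nn_integral_mono)
      fix z assume z: "z \<in> space \<mu>"
      show "ennreal (indicator (G_set \<phi> \<psi> r) z * cmod (u z - v z) powr q) * indicator (hball \<kappa> a) (\<phi> z) \<le>
        ennreal E * (ennreal (cmod (T (test_fun N a) z) powr q) + ennreal (D powr q) * (ennreal ((rho_pair \<phi> \<psi> z * cmod (v z)) powr q) * indicator (hball \<kappa>' a) (\<psi> z)))"
      proof (cases "z \<in> G_set \<phi> \<psi> r \<and> \<phi> z \<in> hball \<kappa> a")
        case True
        then have b: "cmod (u z - v z) powr q \<le> E * (cmod (T (test_fun N a) z) powr q + D powr q * (rho_pair \<phi> \<psi> z * cmod (v z)) powr q)" "\<psi> z \<in> hball \<kappa>' a"
          using pt[OF z] by (auto simp: G_set_def)
        have "ennreal (cmod (u z - v z) powr q) \<le> ennreal (E * (cmod (T (test_fun N a) z) powr q + D powr q * (rho_pair \<phi> \<psi> z * cmod (v z)) powr q))"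
          by (rule ennreal_leI[OF b(1)])
        also have "\<dots> = ennreal E * (ennreal (cmod (T (test_fun N a) z) powr q) + ennreal (D powr q) * ennreal ((rho_pair \<phi> \<psi> z * cmod (v z)) powr q))"
          using E by (simp add: ennreal_mult ennreal_plus)
        finally show ?thesis using True b(2) by simp
      qed (auto simp: indicator_def)
    qed
    also have "\<dots> = ennreal E * (Lq_int \<mu> q (T (test_fun N a)) + ennreal (D powr q) * (\<integral>\<^sup>+z. ennreal ((rho_pair \<phi> \<psi> z * cmod (v z)) powr q) * indicator (hball \<kappa>' a) (\<psi> z) \<partial>\<mu>))"
    proof -
      have [measurable]: "(\<lambda>z. indicator (hball \<kappa>' a) (\<psi> z) :: ennreal) \<in> borel_measurable \<mu>"
        by (rule measurable_compose[OF psi_borel borel_measurable_indicator[OF hball_borel]])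
      show ?thesis unfolding Lq_int_def by (simp add: nn_integral_cmult nn_integral_add)
    qed
    also have "\<dots> \<le> ennreal E * (test_sum N a + ennreal (D powr q) * (ennreal K' * test_sum N a))"
      using K'(2)[OF a] by (intro mult_left_mono add_mono) (auto simp: test_sum_def)
    also have "\<dots> = ennreal K * test_sum N a"
      using E K'(1) by (simp add: K_def ennreal_mult ennreal_plus distrib_left distrib_right mult_ac)
    finally show ?thesis .
  qed
  moreover have "K \<ge> 0" using E K'(1) by (simp add: K_def)
  ultimately show ?thesis by blast
qed

section \<open>The sum of the four pullback measures\<close>

definition joint_measure :: "real \<Rightarrow> (complex^'n) measure" where
  "joint_measure r = measure_add
     (measure_add (pushforward \<mu> (\<lambda>z. (rho_pair \<phi> \<psi> z * cmod (u z)) powr q) \<phi>)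
                  (pushforward \<mu> (\<lambda>z. (rho_pair \<phi> \<psi> z * cmod (v z)) powr q) \<psi>))
     (measure_add (pushforward \<mu> (\<lambda>z. indicator (G_set \<phi> \<psi> r) z * cmod (u z - v z) powr q) \<phi>)
                  (pushforward \<mu> (\<lambda>z. indicator (G_set \<phi> \<psi> r) z * cmod (u z - v z) powr q) \<psi>))"

lemma sets_joint_measure [simp]: "sets (joint_measure r) = sets ball_borel"
  by (simp add: joint_measure_def)

lemma G_set_measurable [measurable]:
  assumes "space \<mu> = unit_ball" shows "(\<lambda>z. indicator (G_set \<phi> \<psi> r) z :: real) \<in> borel_measurable \<mu>"
proof -
  have "{z \<in> space \<mu>. rho_pair \<phi> \<psi> z < r} \<in> sets \<mu>" by measurable
  then have "G_set \<phi> \<psi> r \<in> sets \<mu>" using assms by (simp add: G_set_def)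
  then show ?thesis by measurable
qed

lemma nn_integral_joint_measure:
  assumes sp: "space \<mu> = unit_ball" and g: "g \<in> borel_measurable ball_borel"
  shows "(\<integral>\<^sup>+x. g x \<partial>joint_measure r) =
    (\<integral>\<^sup>+z. ennreal ((rho_pair \<phi> \<psi> z * cmod (u z)) powr q) * g (\<phi> z) \<partial>\<mu>) +
    (\<integral>\<^sup>+z. ennreal ((rho_pair \<phi> \<psi> z * cmod (v z)) powr q) * g (\<psi> z) \<partial>\<mu>) +
    ((\<integral>\<^sup>+z. ennreal (indicator (G_set \<phi> \<psi> r) z * cmod (u z - v z) powr q) * g (\<phi> z) \<partial>\<mu>) +
     (\<integral>\<^sup>+z. ennreal (indicator (G_set \<phi> \<psi> r) z * cmod (u z - v z) powr q) * g (\<psi> z) \<partial>\<mu>))"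
proof -
  note [measurable] = G_set_measurable[OF sp]
  have g': "g \<in> borel_measurable (pushforward \<mu> h F)" for h F
    unfolding measurable_cong_sets[OF sets_pushforward refl] by (rule g)
  show ?thesis
    unfolding joint_measure_def
    by (simp add: nn_integral_measure_add g' g nn_integral_pushforward cong: measurable_cong_sets)
qed

text \<open>Where \<rho> \<ge> r no cancellation is sought: |u| and |v| are at most \<rho>|u|/r and
  \<rho>|v|/r, which puts both terms into the \<eta> part at the cost of (1/r)^q. That factor is at
  least 1, so one constant K also serves where \<rho> < r.\<close>

lemma joint_measure_dominates:
  assumes r: "0 < r" "r < 1" and sp: "space \<mu> = unit_ball"
  shows "\<exists>\<kappa>>0. \<exists>K\<ge>0. \<forall>f. holo_on unit_ball f \<longrightarrow>
    Lq_int \<mu> q (T f) \<le> ennreal K * (\<integral>\<^sup>+\<zeta>. ennreal (locmean p \<kappa> f \<zeta> powr (q / p)) \<partial>joint_measure r)"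
proof -
  obtain C \<kappa> where C: "C > 0" "0 < \<kappa>"
    "\<And>(f::complex^'n \<Rightarrow> complex) z y. holo_on unit_ball f \<Longrightarrow> norm z < 1 \<Longrightarrow> norm y < 1 \<Longrightarrow>
     cmod (f z) powr p \<le> C * locmean p \<kappa> f z \<and>
     (pseudohyp z y < r \<longrightarrow> cmod (f z - f y) powr p \<le> C * (pseudohyp z y powr p * locmean p \<kappa> f z))"
    using locmean_diff[OF r p_pos] by blast
  define s where "s = q / p"
  have s: "s > 0" "p * s = q" using p_pos q_pos by (auto simp: s_def)
  define C1 where "C1 = C powr s"
  have C1: "C1 > 0" using C by (simp add: C1_def)
  define K where "K = 2 powr q * C1 * (1 / r) powr q"
  have K: "K \<ge> 0" using C1 by (simp add: K_def)
  have "1 \<le> 1 / r" using r by simp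
  then have r1: "1 \<le> (1 / r) powr q" using q_pos by (intro ge_one_powr_ge_zero) auto
  have "Lq_int \<mu> q (T f) \<le> ennreal K * (\<integral>\<^sup>+\<zeta>. ennreal (locmean p \<kappa> f \<zeta> powr (q / p)) \<partial>joint_measure r)"
    if f: "holo_on unit_ball f" for f
  proof -
    note [measurable] = G_set_measurable[OF sp]
    define L where "L \<zeta> = locmean p \<kappa> f \<zeta> powr s" for \<zeta>
    have Lm: "(\<lambda>\<zeta>. ennreal (L \<zeta>)) \<in> borel_measurable ball_borel"
      unfolding L_def by (rule measurable_compose[OF ball_borel_id locmean_measurable[OF f]])
    note [measurable] = measurable_compose[OF phi_meas Lm] measurable_compose[OF psi_meas Lm]
    have L0: "L \<zeta> \<ge> 0" for \<zeta> by (simp add: L_def)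
    have fL: "cmod (f \<zeta>) powr q \<le> C1 * L \<zeta>" if z: "norm \<zeta> < 1" for \<zeta>
    proof -
      have "(cmod (f \<zeta>) powr p) powr s \<le> (C * locmean p \<kappa> f \<zeta>) powr s"
        using C(3)[OF f z z] s by (intro powr_mono2) auto
      then show ?thesis using s C(1) locmean_nonneg[OF z] by (simp add: powr_powr powr_mult C1_def L_def)
    qed
    have fd: "cmod (f \<zeta> - f y) powr q \<le> C1 * (pseudohyp \<zeta> y powr q * L \<zeta>)" if z: "norm \<zeta> < 1" "norm y < 1" "pseudohyp \<zeta> y < r" for \<zeta> y
    proof -
      have "(cmod (f \<zeta> - f y) powr p) powr s \<le> (C * (pseudohyp \<zeta> y powr p * locmean p \<kappa> f \<zeta>)) powr s"
        using C(3)[OF f z(1,2)] z(3) s by (intro powr_mono2) auto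
      then show ?thesis using s C(1) locmean_nonneg[OF z(1)] by (simp add: powr_powr powr_mult C1_def L_def)
    qed
    have pt: "cmod (T f z) powr q \<le> K * ((rho_pair \<phi> \<psi> z * cmod (u z)) powr q * L (\<phi> z) + (rho_pair \<phi> \<psi> z * cmod (v z)) powr q * L (\<psi> z)
       + (indicator (G_set \<phi> \<psi> r) z * cmod (u z - v z) powr q) * L (\<phi> z))" if z: "z \<in> space \<mu>" for z
    proof -
      note f1 = phi_ball[OF z] and p1 = psi_ball[OF z]
      define \<rho> where "\<rho> = rho_pair \<phi> \<psi> z"
      have \<rho>0: "\<rho> \<ge> 0" unfolding \<rho>_def by (rule rho_pair_nonneg[of z])
      have t1: "(\<rho> * cmod (u z)) powr q * L (\<phi> z) \<ge> 0" "(\<rho> * cmod (v z)) powr q * L (\<psi> z) \<ge> 0" "cmod (u z - v z) powr q * L (\<phi> z) \<ge> 0"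
        using L0 by auto
      show ?thesis
      proof (cases "\<rho> < r")
        case True
        then have G: "z \<in> G_set \<phi> \<psi> r" using z sp by (simp add: G_set_def \<rho>_def)
        have ps: "pseudohyp (\<psi> z) (\<phi> z) = \<rho>"
          using rho_pair_commute[OF z] by (simp add: rho_pair_def \<rho>_def)
        \<comment> \<open>The difference of values of f is centred at \<psi>(z), so that its local
          mean is charged to the v-part of \<eta>.\<close>
        have "T f z = (u z - v z) * f (\<phi> z) - v z * (f (\<psi> z) - f (\<phi> z))"
          by (simp add: wcomp_diff_def algebra_simps)
        then have "cmod (T f z) powr q \<le> 2 powr q * (cmod ((u z - v z) * f (\<phi> z)) powr q + cmod (v z * (f (\<psi> z) - f (\<phi> z))) powr q)"
          using cmod_diff_powr_le[OF q_pos] by metis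
        also have "\<dots> \<le> 2 powr q * (cmod (u z - v z) powr q * (C1 * L (\<phi> z)) + cmod (v z) powr q * (C1 * (\<rho> powr q * L (\<psi> z))))"
          using fL[OF f1] fd[OF p1 f1] True
          by (intro mult_left_mono add_mono) (auto simp: norm_mult powr_mult ps intro!: mult_left_mono)
        also have "\<dots> = (2 powr q * C1) * 1 * ((\<rho> * cmod (v z)) powr q * L (\<psi> z) + cmod (u z - v z) powr q * L (\<phi> z))"
          using \<rho>0 by (simp add: powr_mult algebra_simps)
        also have "\<dots> \<le> (2 powr q * C1) * (1 / r) powr q * ((\<rho> * cmod (v z)) powr q * L (\<psi> z) + cmod (u z - v z) powr q * L (\<phi> z))"
          using r1 C1 t1 by (intro mult_right_mono mult_left_mono add_nonneg_nonneg) auto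
        also have "\<dots> \<le> K * ((\<rho> * cmod (u z)) powr q * L (\<phi> z) + (\<rho> * cmod (v z)) powr q * L (\<psi> z) + cmod (u z - v z) powr q * L (\<phi> z))"
          unfolding K_def[symmetric] using K t1 by (intro mult_left_mono) auto
        finally show ?thesis using G by (simp add: \<rho>_def)
      next
        case False
        have up: "cmod x powr q \<le> (1 / r) powr q * (\<rho> * cmod x) powr q" for x :: complex
        proof -
          have "cmod x * r \<le> cmod x * \<rho>" using False by (intro mult_left_mono) auto
          then have "cmod x \<le> (1 / r) * (\<rho> * cmod x)" using r by (simp add: field_simps)
          then have "cmod x powr q \<le> ((1 / r) * (\<rho> * cmod x)) powr q" using q_pos by (intro powr_mono2) auto
          also have "\<dots> = (1 / r) powr q * (\<rho> * cmod x) powr q" using r \<rho>0 by (subst powr_mult) auto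
          finally show ?thesis .
        qed
        have "cmod (T f z) powr q \<le> 2 powr q * (cmod (u z * f (\<phi> z)) powr q + cmod (v z * f (\<psi> z)) powr q)"
          unfolding wcomp_diff_def by (rule cmod_diff_powr_le[OF q_pos])
        also have "\<dots> \<le> 2 powr q * (((1 / r) powr q * (\<rho> * cmod (u z)) powr q) * (C1 * L (\<phi> z)) + ((1 / r) powr q * (\<rho> * cmod (v z)) powr q) * (C1 * L (\<psi> z)))"
          unfolding norm_mult using fL[OF f1] fL[OF p1] up[of "u z"] up[of "v z"]
          by (subst (1 2) powr_mult) (auto intro!: mult_left_mono add_mono mult_mono)
        also have "\<dots> = K * ((\<rho> * cmod (u z)) powr q * L (\<phi> z) + (\<rho> * cmod (v z)) powr q * L (\<psi> z))"
          unfolding K_def by (simp only: distrib_left mult_ac)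
        also have "\<dots> \<le> K * ((\<rho> * cmod (u z)) powr q * L (\<phi> z) + (\<rho> * cmod (v z)) powr q * L (\<psi> z) + (indicator (G_set \<phi> \<psi> r) z * cmod (u z - v z) powr q) * L (\<phi> z))"
          using K L0 by (intro mult_left_mono) auto
        finally show ?thesis by (simp add: \<rho>_def)
      qed
    qed
    have "Lq_int \<mu> q (T f) \<le> (\<integral>\<^sup>+z. ennreal K * (ennreal ((rho_pair \<phi> \<psi> z * cmod (u z)) powr q) * ennreal (L (\<phi> z))
       + ennreal ((rho_pair \<phi> \<psi> z * cmod (v z)) powr q) * ennreal (L (\<psi> z))
       + ennreal (indicator (G_set \<phi> \<psi> r) z * cmod (u z - v z) powr q) * ennreal (L (\<phi> z))) \<partial>\<mu>)"
      unfolding Lq_int_def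
    proof (rule nn_integral_mono)
      fix z assume z: "z \<in> space \<mu>"
      have "ennreal (cmod (T f z) powr q) \<le> ennreal (K * ((rho_pair \<phi> \<psi> z * cmod (u z)) powr q * L (\<phi> z) + (rho_pair \<phi> \<psi> z * cmod (v z)) powr q * L (\<psi> z)
         + (indicator (G_set \<phi> \<psi> r) z * cmod (u z - v z) powr q) * L (\<phi> z)))"
        by (rule ennreal_leI[OF pt[OF z]])
      also have "\<dots> = ennreal K * (ennreal ((rho_pair \<phi> \<psi> z * cmod (u z)) powr q) * ennreal (L (\<phi> z))
         + ennreal ((rho_pair \<phi> \<psi> z * cmod (v z)) powr q) * ennreal (L (\<psi> z))
         + ennreal (indicator (G_set \<phi> \<psi> r) z * cmod (u z - v z) powr q) * ennreal (L (\<phi> z)))"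
        using K L0 by (simp add: ennreal_mult ennreal_plus)
      finally show "ennreal (cmod (T f z) powr q) \<le> ennreal K * (ennreal ((rho_pair \<phi> \<psi> z * cmod (u z)) powr q) * ennreal (L (\<phi> z))
         + ennreal ((rho_pair \<phi> \<psi> z * cmod (v z)) powr q) * ennreal (L (\<psi> z))
         + ennreal (indicator (G_set \<phi> \<psi> r) z * cmod (u z - v z) powr q) * ennreal (L (\<phi> z)))" .
    qed
    also have "\<dots> = ennreal K * ((\<integral>\<^sup>+z. ennreal ((rho_pair \<phi> \<psi> z * cmod (u z)) powr q) * ennreal (L (\<phi> z)) \<partial>\<mu>)
       + (\<integral>\<^sup>+z. ennreal ((rho_pair \<phi> \<psi> z * cmod (v z)) powr q) * ennreal (L (\<psi> z)) \<partial>\<mu>)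
       + (\<integral>\<^sup>+z. ennreal (indicator (G_set \<phi> \<psi> r) z * cmod (u z - v z) powr q) * ennreal (L (\<phi> z)) \<partial>\<mu>))"
      by (simp add: nn_integral_cmult nn_integral_add)
    also have "\<dots> \<le> ennreal K * (\<integral>\<^sup>+\<zeta>. ennreal (L \<zeta>) \<partial>joint_measure r)"
      unfolding nn_integral_joint_measure[OF sp Lm] by (intro mult_left_mono add_mono order_refl) (auto simp: add.assoc)
    finally show ?thesis by (simp add: L_def s_def)
  qed
  then show ?thesis using C(2) K by blast
qed

lemma joint_measure_test_bound:
  assumes k: "\<kappa> > 0" and r: "0 < r" "r < 1" and sp: "space \<mu> = unit_ball"
  shows "\<exists>K\<ge>0. \<forall>a. norm a < 1 \<longrightarrow> emeasure (joint_measure r) (hball \<kappa> a) \<le> ennreal K * test_sum N a"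
proof -
  obtain K1 where K1: "K1 \<ge> 0" "\<And>a. norm a < 1 \<Longrightarrow>
    (\<integral>\<^sup>+z. ennreal ((rho_pair \<phi> \<psi> z * cmod (u z)) powr q) * indicator (hball \<kappa> a) (\<phi> z) \<partial>\<mu>) \<le> ennreal K1 * test_sum N a"
    using rho_u_test_bound[OF k, of N] by blast
  obtain K2 where K2: "K2 \<ge> 0" "\<And>a. norm a < 1 \<Longrightarrow>
    (\<integral>\<^sup>+z. ennreal ((rho_pair \<phi> \<psi> z * cmod (v z)) powr q) * indicator (hball \<kappa> a) (\<psi> z) \<partial>\<mu>) \<le> ennreal K2 * test_sum N a"
    using rho_v_test_bound[OF k, of N] by blast
  obtain K3 where K3: "K3 \<ge> 0" "\<And>a. norm a < 1 \<Longrightarrow>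
    (\<integral>\<^sup>+z. ennreal (indicator (G_set \<phi> \<psi> r) z * cmod (u z - v z) powr q) * indicator (hball \<kappa> a) (\<phi> z) \<partial>\<mu>) \<le> ennreal K3 * test_sum N a"
    using sigma_test_bound[OF k r sp, of N] by blast
  \<comment> \<open>The pullback under \<psi> follows by exchanging the maps, since G_r and |u - v|
    are symmetric.\<close>
  obtain K4 where K4: "K4 \<ge> 0" "\<And>a. norm a < 1 \<Longrightarrow>
    (\<integral>\<^sup>+z. ennreal (indicator (G_set \<phi> \<psi> r) z * cmod (u z - v z) powr q) * indicator (hball \<kappa> a) (\<psi> z) \<partial>\<mu>) \<le> ennreal K4 * test_sum N a"
    using weighted_composition.sigma_test_bound[OF swapped k r sp, of N]
    unfolding test_sum_swapped G_set_commute[OF sp] norm_minus_commute[of "v _" "u _"] by blast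
  have "emeasure (joint_measure r) (hball \<kappa> a) \<le> ennreal (K1 + K2 + (K3 + K4)) * test_sum N a" if a: "norm a < 1" for a
  proof -
    have g: "(indicator (hball \<kappa> a) :: _ \<Rightarrow> ennreal) \<in> borel_measurable ball_borel"
      using hball_in_sets[of ball_borel \<kappa> a] by simp
    have "emeasure (joint_measure r) (hball \<kappa> a) = (\<integral>\<^sup>+x. indicator (hball \<kappa> a) x \<partial>joint_measure r)"
      by (rule nn_integral_indicator[symmetric]) (rule hball_in_sets[OF sets_joint_measure])
    also have "\<dots> \<le> ennreal K1 * test_sum N a + ennreal K2 * test_sum N a + (ennreal K3 * test_sum N a + ennreal K4 * test_sum N a)"
      unfolding nn_integral_joint_measure[OF sp g] using a by (intro add_mono K1 K2 K3 K4)
    also have "\<dots> = ennreal (K1 + K2 + (K3 + K4)) * test_sum N a"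
      using K1(1) K2(1) K3(1) K4(1) by (simp add: ennreal_plus distrib_right)
    finally show ?thesis .
  qed
  then show ?thesis using K1(1) K2(1) K3(1) K4(1) by (intro exI[of _ "K1 + K2 + (K3 + K4)"]) auto
qed

lemma exponent_exists: "\<exists>N. real N * p \<ge> real (CARD('n) + doubling_exp + 1)"
proof -
  obtain N :: nat where "real (CARD('n) + doubling_exp + 1) / p \<le> real N" using real_arch_simple by blast
  then have "real (CARD('n) + doubling_exp + 1) \<le> real N * p" using p_pos by (simp add: pos_divide_le_eq)
  then show ?thesis by blast
qed

end

section \<open>Carleson measures as the special case of an embedding\<close>

context doubling_weight
begin

text \<open>The general criterion applied to u = 1, v = 0 and identity maps, with \<nu> itself as
  the controlling measure: domination is the local mean bound for |f|^p, and the necessary condition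
  is the lower bound of the test function on \<open>hball \<kappa> a\<close>.\<close>

lemma carleson_iff:
  fixes \<nu> :: "(complex^'n) measure"
  assumes \<nu>: "sets \<nu> = sets ball_borel" and pq: "0 < p" "p \<le> q"
  shows "carleson p w q \<nu> \<longleftrightarrow> carleson_on_balls p q \<nu>" "vanishing_carleson p w q \<nu> \<longleftrightarrow> carleson_on_balls p q \<nu> \<and> vanishing_on_balls p q \<nu>"
proof -
  have idm: "(\<lambda>z. z) \<in> measurable \<nu> ball_borel"
    unfolding measurable_cong_sets[OF \<nu> refl] by simp
  interpret I: weighted_composition w ty p q \<nu> "\<lambda>_. 1" "\<lambda>_. 0" "\<lambda>z. z" "\<lambda>z. z"
    by unfold_locales (use pq idm in auto)
  have T: "I.T = (\<lambda>f. f)" by (simp add: wcomp_diff_def fun_eq_iff)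
  have q: "q > 0" using pq by simp
  have half: "0 < (1/2::real)" "1/2 < (1::real)" by simp_all
  obtain C \<kappa> where C: "C > 0" "0 < \<kappa>"
    "\<And>(f::complex^'n \<Rightarrow> complex) z. holo_on unit_ball f \<Longrightarrow> norm z < 1 \<Longrightarrow> cmod (f z) powr p \<le> C * locmean p \<kappa> f z"
    using locmean_diff[OF half pq(1)] by blast
  have sp: "space \<nu> = unit_ball" by (rule space_eq_unit_ball[OF \<nu>])
  have dom: "Lq_int \<nu> q (I.T f) \<le> ennreal (C powr (q / p)) * (\<integral>\<^sup>+\<zeta>. ennreal (locmean p \<kappa> f \<zeta> powr (q / p)) \<partial>\<nu>)"
    if f: "holo_on unit_ball f" for f
  proof -
    have m: "(\<lambda>\<zeta>. ennreal (locmean p \<kappa> f \<zeta> powr (q / p))) \<in> borel_measurable \<nu>"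
      by (rule measurable_compose[OF measurable_compose[OF idm ball_borel_id] locmean_measurable[OF f]])
    have "Lq_int \<nu> q f \<le> (\<integral>\<^sup>+\<zeta>. ennreal (C powr (q / p)) * ennreal (locmean p \<kappa> f \<zeta> powr (q / p)) \<partial>\<nu>)"
      unfolding Lq_int_def
    proof (rule nn_integral_mono)
      fix \<zeta> assume "\<zeta> \<in> space \<nu>"
      then have z: "norm \<zeta> < 1" by (simp add: sp)
      have "(cmod (f \<zeta>) powr p) powr (q / p) \<le> (C * locmean p \<kappa> f \<zeta>) powr (q / p)"
        using C(3)[OF f z] pq by (intro powr_mono2) auto
      then have "cmod (f \<zeta>) powr q \<le> C powr (q / p) * locmean p \<kappa> f \<zeta> powr (q / p)"
        using C(1) locmean_nonneg[OF z] pq by (simp add: powr_powr powr_mult)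
      then show "ennreal (cmod (f \<zeta>) powr q) \<le> ennreal (C powr (q / p)) * ennreal (locmean p \<kappa> f \<zeta> powr (q / p))"
        by (simp add: ennreal_leI ennreal_mult[symmetric])
    qed
    also have "\<dots> = ennreal (C powr (q / p)) * (\<integral>\<^sup>+\<zeta>. ennreal (locmean p \<kappa> f \<zeta> powr (q / p)) \<partial>\<nu>)"
      using m by (rule nn_integral_cmult)
    finally show ?thesis by (simp add: T)
  qed
  obtain N where N: "real N * p \<ge> real (CARD('n) + doubling_exp + 1)" using I.exponent_exists by blast
  have nec: "\<exists>K\<ge>0. \<forall>a. norm a < 1 \<longrightarrow> emeasure \<nu> (hball \<kappa> a) \<le> ennreal K * I.test_sum N a" if k: "\<kappa> > 0" for \<kappa>
  proof -
    define K where "K = 1 / ((\<kappa> / 2) ^ N) powr q"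
    have "emeasure \<nu> (hball \<kappa> a) \<le> ennreal K * I.test_sum N a" if a: "norm a < 1" for a
    proof -
      have m: "(\<lambda>z. ennreal (cmod (test_fun N a z) powr q)) \<in> borel_measurable \<nu>"
        using I.T_measurable[OF holo_on_test_fun[OF a, of N]] by (simp add: T)
      have "emeasure \<nu> (hball \<kappa> a) = (\<integral>\<^sup>+z. indicator (hball \<kappa> a) z \<partial>\<nu>)"
        by (rule nn_integral_indicator[symmetric]) (rule hball_in_sets[OF \<nu>])
      also have "\<dots> \<le> (\<integral>\<^sup>+z. ennreal K * ennreal (cmod (test_fun N a z) powr q) \<partial>\<nu>)"
      proof (rule nn_integral_mono)
        fix z
        show "indicator (hball \<kappa> a) z \<le> ennreal K * ennreal (cmod (test_fun N a z) powr q)"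
        proof (cases "z \<in> hball \<kappa> a")
          case True
          have pos: "((\<kappa> / 2) ^ N) powr q > 0" using k by simp
          have "((\<kappa> / 2) ^ N) powr q \<le> cmod (test_fun N a z) powr q"
            using cmod_test_fun_ge[OF a True k, of N] q k by (intro powr_mono2) auto
          then have "1 \<le> K * cmod (test_fun N a z) powr q" using pos by (simp add: K_def pos_le_divide_eq)
          then have "1 \<le> ennreal (K * cmod (test_fun N a z) powr q)" by (simp add: ennreal_leI flip: ennreal_1)
          also have "\<dots> = ennreal K * ennreal (cmod (test_fun N a z) powr q)" by (rule ennreal_mult) (auto simp: K_def)
          finally show ?thesis using True by simp
        qed simp
      qed
      also have "\<dots> = ennreal K * Lq_int \<nu> q (I.T (test_fun N a))"
        unfolding Lq_int_def T using m by (rule nn_integral_cmult)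
      also have "\<dots> \<le> ennreal K * I.test_sum N a"
        unfolding I.test_sum_def by (intro mult_left_mono) auto
      finally show ?thesis .
    qed
    moreover have "K \<ge> 0" by (simp add: K_def)
    ultimately show ?thesis by blast
  qed
  note iff = I.bounded_iff_carleson_on_balls_compact_iff_vanishing_on_balls[OF \<nu> C(2) _ dom N nec, simplified T]
  show "carleson p w q \<nu> \<longleftrightarrow> carleson_on_balls p q \<nu>" "vanishing_carleson p w q \<nu> \<longleftrightarrow> carleson_on_balls p q \<nu> \<and> vanishing_on_balls p q \<nu>"
    unfolding carleson_def vanishing_carleson_def using iff by auto
qed

end

theorem theorem1p1:
  fixes p q r :: real
    and w :: "real \<Rightarrow> real"
    and \<phi> \<psi> :: "complex ^ 'n \<Rightarrow> complex ^ 'n"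
    and u v :: "complex ^ 'n \<Rightarrow> complex"
    and \<mu> :: "(complex ^ 'n) measure"
  assumes "0 < p" "p \<le> q" "0 < r" "r < 1"
    and "class_D TYPE('n) w"
    and "holo_self_map \<phi>" "holo_self_map \<psi>"
    and "u \<in> borel_measurable ball_borel" "v \<in> borel_measurable ball_borel"
    and "sets \<mu> = sets ball_borel"
  defines "\<eta> \<equiv> measure_add
              (pushforward \<mu> (\<lambda>z. (rho_pair \<phi> \<psi> z * cmod (u z)) powr q) \<phi>)
              (pushforward \<mu> (\<lambda>z. (rho_pair \<phi> \<psi> z * cmod (v z)) powr q) \<psi>)"
    and "\<sigma> \<equiv> measure_add
              (pushforward \<mu> (\<lambda>z. indicator (G_set \<phi> \<psi> r) z * cmod (u z - v z) powr q) \<phi>)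
              (pushforward \<mu> (\<lambda>z. indicator (G_set \<phi> \<psi> r) z * cmod (u z - v z) powr q) \<psi>)"
  shows "(bounded_op p w \<mu> q (wcomp_diff u \<phi> v \<psi>) \<longleftrightarrow> carleson p w q (measure_add \<eta> \<sigma>))
       \<and> (compact_op p w \<mu> q (wcomp_diff u \<phi> v \<psi>) \<longleftrightarrow> vanishing_carleson p w q (measure_add \<eta> \<sigma>))"
proof -
  note s = assms(10)
  have um: "u \<in> borel_measurable \<mu>" "v \<in> borel_measurable \<mu>"
    using assms(8,9) unfolding measurable_cong_sets[OF s refl] by auto
  interpret weighted_composition w "TYPE('n)" p q \<mu> u v \<phi> \<psi>
    by unfold_locales
       (use assms(1,2,5) um holo_self_map_measurable[OF assms(6) s] holo_self_map_measurable[OF assms(7) s] in auto)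
  have sp: "space \<mu> = unit_ball" by (rule space_eq_unit_ball[OF s])
  have \<nu>: "measure_add \<eta> \<sigma> = joint_measure r" by (simp add: joint_measure_def \<eta>_def \<sigma>_def)
  obtain \<kappa> K where dom: "\<kappa> > 0" "K \<ge> 0" "\<And>f. holo_on unit_ball f \<Longrightarrow>
    Lq_int \<mu> q (T f) \<le> ennreal K * (\<integral>\<^sup>+\<zeta>. ennreal (locmean p \<kappa> f \<zeta> powr (q / p)) \<partial>joint_measure r)"
    using joint_measure_dominates[OF assms(3,4) sp] by blast
  obtain N where N: "real N * p \<ge> real (CARD('n) + doubling_exp + 1)" using exponent_exists by blast
  \<comment> \<open>Operator and embedding are compared through the ball conditions on one and the
    same measure.\<close>
  note iff = bounded_iff_carleson_on_balls_compact_iff_vanishing_on_balls[OF sets_joint_measure dom N joint_measure_test_bound[OF _ assms(3,4) sp]]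
  show ?thesis
    unfolding \<nu> using iff carleson_iff[OF sets_joint_measure assms(1,2)] by blast
qed

end
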